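(* Let $d\geq 2$ and let $f:\mathbb{R}\to\mathbb{R}$ satisfy the hypotheses (H1)–(H6) listed in the context. For every sequence $(u_n)\subset \mathcal N_{\mathrm{nod,rad}}$ such that $\lim_{n\to\infty}S(u_n)=m_{\mathcal N_{\mathrm{nod,rad}}}$, there exists $u_\infty\in\mathcal N_{\mathrm{nod,rad}}$ such that, up to a subsequence, $\lim_{n\to\infty}\|u_n-u_\infty\|_{H^1}=0$. Moreover, $u_\infty$ is a solution of $-\Delta\phi+\phi-f(\phi)=0$, $\phi\in H^1(\mathbb{R}^d)\setminus\{0\}$, which changes sign and has exactly two nodal domains.
   Context: Let $2^*=\frac{2d}{d-2}$ if $d\geq 3$ and $2^*=\infty$ if $d=2$. Let $F(s)=\int_0^s f(t)\,dt$. Hypotheses on $f$: (H1) $f$ is continuous and odd; (H2) there exists $1<p<2^*-1$ such that $|f(s)|\leq C|s|^p$ for all large $|s|$; (H3) $\lim_{s\to0}f(s)/s=0$; (H4) there exists $\xi_0>0$ with $F(\xi_0)>\xi_0^2/2$; (H5) $s\mapsto f(s)/s$ is increasing on $(0,\infty)$; (H6) there exists $\theta>2$ such that $\theta F(s)<sf(s)$ for all $s>0$. All functions are real-valued; $\|u\|_{H^1}^2=\|\nabla u\|_{L^2}^2+\|u\|_{L^2}^2$. For $v\in H^1(\mathbb{R}^d)$ define $S(v)=\frac12\|\nabla v\|_{L^2}^2+\frac12\|v\|_{L^2}^2-\int_{\mathbb{R}^d}F(v)\,dx$ and $I(v)=\|\nabla v\|_{L^2}^2+\|v\|_{L^2}^2-\int_{\mathbb{R}^d}f(v)v\,dx$.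 $H^1_{\mathrm{rad}}(\mathbb{R}^d)$ denotes the radial functions in $H^1(\mathbb{R}^d)$. With $u^+=\max(u,0)$, $u^-=\max(-u,0)$, let $\mathcal N_{\mathrm{nod,rad}}=\{u\in H^1_{\mathrm{rad}}(\mathbb{R}^d): I(u^+)=0,\ I(u^-)=0,\ u^+\neq0,\ u^-\neq0\}$ and $m_{\mathcal N_{\mathrm{nod,rad}}}=\inf\{S(v):v\in\mathcal N_{\mathrm{nod,rad}}\}$. *)

theory Defs
  imports "HOL-Analysis.Analysis"
begin

coinductive smooth_fun :: "('a::euclidean_space \<Rightarrow> real) \<Rightarrow> bool" where
  "(\<And>x. (\<phi> has_derivative (\<lambda>h. G x \<bullet> h)) (at x)) \<Longrightarrow>
   (\<And>i. i \<in> Basis \<Longrightarrow> smooth_fun (\<lambda>x. G x \<bullet> i)) \<Longrightarrow> smooth_fun \<phi>"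

definition test_fun :: "('a::euclidean_space \<Rightarrow> real) \<Rightarrow> bool" where
  "test_fun \<phi> \<longleftrightarrow> smooth_fun \<phi> \<and> compact (closure {x. \<phi> x \<noteq> 0})"

definition L2fun :: "('a::euclidean_space \<Rightarrow> real) \<Rightarrow> bool" where
  "L2fun u \<longleftrightarrow> u \<in> borel_measurable lebesgue \<and> integrable lebesgue (\<lambda>x. (u x)\<^sup>2)"

definition weak_grad :: "('a::euclidean_space \<Rightarrow> real) \<Rightarrow> ('a \<Rightarrow> 'a) \<Rightarrow> bool" where
  "weak_grad u G \<longleftrightarrow> G \<in> borel_measurable lebesgue \<and>
     integrable lebesgue (\<lambda>x. (norm (G x))\<^sup>2) \<and>
     (\<forall>\<phi> D. test_fun \<phi> \<longrightarrow> (\<forall>x. (\<phi> has_derivative (\<lambda>h. D x \<bullet> h)) (at x)) \<longrightarrow>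
        (\<forall>i\<in>Basis. (LINT x|lebesgue. u x * (D x \<bullet> i)) = - (LINT x|lebesgue. (G x \<bullet> i) * \<phi> x)))"

definition H1 :: "('a::euclidean_space \<Rightarrow> real) set" where
  "H1 = {u. L2fun u \<and> (\<exists>G. weak_grad u G)}"

definition H1rad :: "('a::euclidean_space \<Rightarrow> real) set" where
  "H1rad = {u \<in> H1. \<exists>g::real \<Rightarrow> real. AE x in lebesgue. u x = g (norm x)}"

definition wgrad :: "('a::euclidean_space \<Rightarrow> real) \<Rightarrow> 'a \<Rightarrow> 'a" where
  "wgrad u = (SOME G. weak_grad u G)"

definition H1_norm :: "('a::euclidean_space \<Rightarrow> real) \<Rightarrow> real" where
  "H1_norm u = sqrt ((LINT x|lebesgue. (norm (wgrad u x))\<^sup>2) + (LINT x|lebesgue. (u x)\<^sup>2))"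

definition Fprim :: "(real \<Rightarrow> real) \<Rightarrow> real \<Rightarrow> real" where
  "Fprim f s = (LBINT t=0..s. f t)"

definition actS :: "(real \<Rightarrow> real) \<Rightarrow> ('a::euclidean_space \<Rightarrow> real) \<Rightarrow> real" where
  "actS f v = (1/2) * (LINT x|lebesgue. (norm (wgrad v x))\<^sup>2) + (1/2) * (LINT x|lebesgue. (v x)\<^sup>2)
              - (LINT x|lebesgue. Fprim f (v x))"

definition nehI :: "(real \<Rightarrow> real) \<Rightarrow> ('a::euclidean_space \<Rightarrow> real) \<Rightarrow> real" where
  "nehI f v = (LINT x|lebesgue. (norm (wgrad v x))\<^sup>2) + (LINT x|lebesgue. (v x)\<^sup>2)
              - (LINT x|lebesgue. f (v x) * v x)"

definition pospart :: "('a \<Rightarrow> real) \<Rightarrow> 'a \<Rightarrow> real" where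
  "pospart u = (\<lambda>x. max (u x) 0)"

definition negpart :: "('a \<Rightarrow> real) \<Rightarrow> 'a \<Rightarrow> real" where
  "negpart u = (\<lambda>x. max (- u x) 0)"

definition nonzero_fun :: "('a::euclidean_space \<Rightarrow> real) \<Rightarrow> bool" where
  "nonzero_fun u \<longleftrightarrow> \<not> (AE x in lebesgue. u x = 0)"

definition Nnodrad :: "(real \<Rightarrow> real) \<Rightarrow> ('a::euclidean_space \<Rightarrow> real) set" where
  "Nnodrad f = {u \<in> H1rad. nehI f (pospart u) = 0 \<and> nehI f (negpart u) = 0 \<and>
                  nonzero_fun (pospart u) \<and> nonzero_fun (negpart u)}"

definition mNnodrad :: "(real \<Rightarrow> real) \<Rightarrow> 'a::euclidean_space itself \<Rightarrow> real" where
  "mNnodrad f _ = Inf (actS f ` (Nnodrad f :: ('a \<Rightarrow> real) set))"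

definition weak_solution :: "(real \<Rightarrow> real) \<Rightarrow> ('a::euclidean_space \<Rightarrow> real) \<Rightarrow> bool" where
  "weak_solution f w \<longleftrightarrow> w \<in> H1 \<and>
     (\<forall>\<phi> D. test_fun \<phi> \<longrightarrow> (\<forall>x. (\<phi> has_derivative (\<lambda>h. D x \<bullet> h)) (at x)) \<longrightarrow>
        (LINT x|lebesgue. wgrad w x \<bullet> D x + w x * \<phi> x - f (w x) * \<phi> x) = 0)"

text \<open>Nodal domains: connected components of the set where the
  (continuous representative of the) function does not vanish.\<close>
definition nodal_domains :: "('a::euclidean_space \<Rightarrow> real) \<Rightarrow> 'a set set" where
  "nodal_domains w = components {x. w x \<noteq> 0}"

end

theory Submission
  imports Defs "HOL-Complex_Analysis.Great_Picard" "HOL-Probability.Conditional_Expectation" "HOL-Computational_Algebra.Polynomial"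
begin

text \<open>
  Radial functions are represented by their profiles on the half line, weighted by \<open>r\<^bsup>d - 1\<^esup>\<close>: a profile is
  a primitive of a locally integrable function, and the radial lemma and the subcritical growth of \<open>f\<close> make the
  nonlinear terms compact. Along a minimizing sequence the profiles are bounded by (H6), so a subsequence
  converges pointwise; both signed parts of the limit survive, and scaling them back onto the Nehari set
  (possible by (H5)) shows that the limit attains the infimum, whence strong convergence. Deforming
  \<open>s u\<^sup>+ - t u\<^sup>-\<close> with the Poincare-Miranda theorem yields the Euler--Lagrange equation for profiles. If one of the
  signed parts split into two pieces, one of them could be discarded; hence there are exactly two nodal domains. A
  bootstrap at the origin makes the minimizer continuous there. The profile calculus is tied to weak
  derivatives in \<open>\<real>\<^bsup>d\<^esup>\<close> by spherical averaging and the divergence theorem on balls.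
\<close>

section \<open>Square-integrable functions\<close>

text \<open>Weak convergence is replaced throughout by pointwise convergence of profiles: bounded
  energy gives Hoelder equicontinuity away from the origin, and one fixed \<open>majorant\<close>
  gives domination. Subcriticality enters through the exponent \<kappa> of its singularity: (p + 1)
  / 2 * \<kappa> < d makes r^(d-1) |g|^(p+1) integrable at 0, and the gap to d drives the bootstrap
  there. As f is merely continuous, the Nehari functional need not be differentiable and no Lagrange
  multiplier is at hand. Hence two scalings s and t are adjusted by a fixed-point argument, one for
  each constraint I(u^+) = 0 and I(u^-) = 0. Transfer to Euclidean space meets three obstacles:
  radiality is given only almost everywhere and through an arbitrary function of the norm, the weak
  gradient is an arbitrary choice, and test functions are not radial. A Borel profile is therefore
  extracted from \<open>H1rad\<close>, and a test function is replaced by its spherical average,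
  which has the same pairings with radial functions. In this way criticality among radial functions
  gives the equation against all test functions.\<close>

lemmas integrable_bound = Bochner_Integration.integrable_bound
  and integral_nonneg = Bochner_Integration.integral_nonneg
  and integral_cong = Bochner_Integration.integral_cong

lemma integrable_mult_squares:
  fixes f g :: "'b \<Rightarrow> real"
  assumes [measurable]: "f \<in> borel_measurable M" "g \<in> borel_measurable M"
    and "integrable M (\<lambda>x. (f x)^2)" "integrable M (\<lambda>x. (g x)^2)"
  shows "integrable M (\<lambda>x. f x * g x)"
proof (rule integrable_bound[of M "\<lambda>x. (f x)^2 + (g x)^2"])
  show "AE x in M. norm (f x * g x) \<le> norm ((f x)^2 + (g x)^2)"
  proof (rule AE_I2)
    fix x
    have "2 * (\<bar>f x\<bar> * \<bar>g x\<bar>) \<le> (f x)^2 + (g x)^2"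
      using sum_squares_bound[of "\<bar>f x\<bar>" "\<bar>g x\<bar>"] by simp
    moreover have "0 \<le> \<bar>f x\<bar> * \<bar>g x\<bar>" by simp
    ultimately have "\<bar>f x\<bar> * \<bar>g x\<bar> \<le> (f x)^2 + (g x)^2" by linarith
    then show "norm (f x * g x) \<le> norm ((f x)^2 + (g x)^2)" by (simp add: abs_mult)
  qed
qed (use assms in auto)

lemma integrable_square_lincomb:
  fixes f g :: "'b \<Rightarrow> real"
  assumes [measurable]: "f \<in> borel_measurable M" "g \<in> borel_measurable M"
    and "integrable M (\<lambda>x. (f x)^2)" "integrable M (\<lambda>x. (g x)^2)"
  shows "integrable M (\<lambda>x. (a * f x + b * g x)^2)"
    and "(LINT x|M. (a * f x + b * g x)^2) =
      a\<^sup>2 * (LINT x|M. (f x)^2) + 2 * a * b * (LINT x|M. f x * g x) + b\<^sup>2 * (LINT x|M. (g x)^2)"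
proof -
  have e: "(a * f x + b * g x)^2 = a\<^sup>2 * (f x)^2 + 2 * a * b * (f x * g x) + b\<^sup>2 * (g x)^2" for x
    by (simp add: power2_eq_square algebra_simps)
  have i: "integrable M (\<lambda>x. f x * g x)" by (rule integrable_mult_squares) (use assms in auto)
  show "integrable M (\<lambda>x. (a * f x + b * g x)^2)"
    unfolding e using i assms by (intro Bochner_Integration.integrable_add integrable_mult_right) auto
  show "(LINT x|M. (a * f x + b * g x)^2) =
      a\<^sup>2 * (LINT x|M. (f x)^2) + 2 * a * b * (LINT x|M. f x * g x) + b\<^sup>2 * (LINT x|M. (g x)^2)"
    unfolding e using i assms by simp
qed

text \<open>Discriminant argument: the quadratic \<open>q\<close> in t is nonnegative and is
  evaluated at its minimizer -B/C. If C = 0 it is affine, and for B nonzero the point -(A + 1)/(2B)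
  would give the value -1.\<close>

lemma Cauchy_Schwarz_integral:
  fixes f g :: "'b \<Rightarrow> real"
  assumes "f \<in> borel_measurable M" "g \<in> borel_measurable M"
    and "integrable M (\<lambda>x. (f x)^2)" "integrable M (\<lambda>x. (g x)^2)"
  shows "(LINT x|M. f x * g x)^2 \<le> (LINT x|M. (f x)^2) * (LINT x|M. (g x)^2)"
proof -
  define A B C where "A = (LINT x|M. (f x)^2)" and "B = (LINT x|M. f x * g x)" and "C = (LINT x|M. (g x)^2)"
  have q: "0 \<le> A + 2 * t * B + t\<^sup>2 * C" for t
  proof -
    have "0 \<le> (LINT x|M. (1 * f x + t * g x)^2)" by (rule integral_nonneg) auto
    also have "\<dots> = A + 2 * t * B + t\<^sup>2 * C"
      using integrable_square_lincomb(2)[OF assms, of 1 t] unfolding A_def B_def C_def by simp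
    finally show ?thesis .
  qed
  have C: "0 \<le> C" unfolding C_def by (rule integral_nonneg) auto
  show ?thesis
  proof (cases "C = 0")
    case True
    have "B = 0"
    proof (rule ccontr)
      assume "B \<noteq> 0"
      then show False using q[of "- (A + 1) / (2 * B)"] True by (simp add: field_simps)
    qed
    then show ?thesis using True unfolding A_def B_def C_def by simp
  next
    case False
    then have "0 < C" using C by simp
    then have "B\<^sup>2 \<le> A * C" using q[of "- B / C"]
      by (simp add: field_simps power2_eq_square)
    then show ?thesis unfolding A_def B_def C_def .
  qed
qed

text \<open>Riesz-Fischer argument. Along a subsequence whose squared increments \<open>D k\<close>
  have integral at most 4^-k, the series of 2^k (D k)^2 is finite almost everywhere; so D k =
  O(2^(-k/2)) pointwise and the subsequence converges. Fatou's lemma then controls the distance of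
  the full sequence to the limit.\<close>

lemma L2_complete:
  fixes f :: "nat \<Rightarrow> 'b \<Rightarrow> real"
  assumes [measurable]: "\<And>n. f n \<in> borel_measurable M"
    and int: "\<And>n. integrable M (\<lambda>x. (f n x)^2)"
    and cauchy: "\<And>e. e > 0 \<Longrightarrow> \<exists>N. \<forall>m\<ge>N. \<forall>n\<ge>N. (LINT x|M. (f m x - f n x)^2) \<le> e"
  obtains g where "g \<in> borel_measurable M" "integrable M (\<lambda>x. (g x)^2)"
    "(\<lambda>n. LINT x|M. (f n x - g x)^2) \<longlonglongrightarrow> 0"
proof -
  have intd: "integrable M (\<lambda>x. (f m x - f n x)^2)" for m n
    using integrable_square_lincomb(1)[OF _ _ int int, of m n 1 "-1"] by simp
  have "\<exists>N. \<forall>m\<ge>N. \<forall>n\<ge>N. (LINT x|M. (f m x - f n x)^2) \<le> (1/4)^k" for k :: nat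
    by (rule cauchy) simp
  then obtain N where N: "\<And>k m n. m \<ge> N k \<Longrightarrow> n \<ge> N k \<Longrightarrow> (LINT x|M. (f m x - f n x)^2) \<le> (1/4)^k"
    by metis
  \<comment> \<open>Summing all earlier thresholds makes \<open>r\<close> monotone, and the added k
    makes it unbounded.\<close>
  define r where "r k = (\<Sum>i\<le>k. N i) + k" for k
  have rN: "r k \<ge> N k" for k unfolding r_def using member_le_sum[of k "{..k}" N] by simp
  have rmono: "r k \<le> r (Suc k)" and rk: "r k \<ge> k" for k unfolding r_def by auto
  define D where "D k x = f (r (Suc k)) x - f (r k) x" for k x
  have [measurable]: "D k \<in> borel_measurable M" for k unfolding D_def by measurable
  have intD: "integrable M (\<lambda>x. (D k x)^2)" for k unfolding D_def by (rule intd)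
  have D4: "(LINT x|M. (D k x)^2) \<le> (1/4)^k" for k
    unfolding D_def using N[of k "r (Suc k)" "r k"] rN[of k] rmono[of k] by linarith
  have "(\<integral>\<^sup>+x. (\<Sum>k. ennreal (2^k * (D k x)^2)) \<partial>M) = (\<Sum>k. \<integral>\<^sup>+x. ennreal (2^k * (D k x)^2) \<partial>M)"
    by (rule nn_integral_suminf) auto
  also have "\<dots> = (\<Sum>k. ennreal (2^k * (LINT x|M. (D k x)^2)))"
    using intD by (intro suminf_cong) (simp add: nn_integral_eq_integral)
  also have "\<dots> \<le> (\<Sum>k. ennreal ((1/2)^k))"
  proof (rule suminf_le)
    fix k :: nat
    have "2^k * (LINT x|M. (D k x)^2) \<le> 2^k * (1/4)^k" using D4 by (intro mult_left_mono) auto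
    also have "\<dots> = (1/2::real)^k" by (simp flip: power_mult_distrib)
    finally show "ennreal (2^k * (LINT x|M. (D k x)^2)) \<le> ennreal ((1/2)^k)" by (rule ennreal_leI)
  qed auto
  also have "\<dots> < \<infinity>"
    by (subst suminf_ennreal2) (auto intro!: summable_geometric)
  finally have "(\<integral>\<^sup>+x. (\<Sum>k. ennreal (2^k * (D k x)^2)) \<partial>M) \<noteq> \<infinity>" by simp
  then have "AE x in M. (\<Sum>k. ennreal (2^k * (D k x)^2)) \<noteq> \<infinity>"
    by (intro nn_integral_PInf_AE) auto
  then have conv: "AE x in M. convergent (\<lambda>k. f (r k) x)"
  proof eventually_elim
    case (elim x)
    have s: "summable (\<lambda>k. 2^k * (D k x)^2)"
      by (rule summable_suminf_not_top) (use elim in auto)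
    then have "(\<lambda>k. 2^k * (D k x)^2) \<longlonglongrightarrow> 0" by (rule summable_LIMSEQ_zero)
    then have "Bseq (\<lambda>k. 2^k * (D k x)^2)" by (meson Bseq_def convergentI convergent_imp_Bseq)
    then obtain C where C: "C > 0" "\<And>k. 2^k * (D k x)^2 \<le> C" by (auto simp: Bseq_def)
    have b: "norm (D k x) \<le> sqrt C * (sqrt (1/2))^k" for k
    proof -
      have "(D k x)^2 \<le> C * (1/2)^k" using C(2)[of k] by (simp add: field_simps)
      then have "sqrt ((D k x)^2) \<le> sqrt (C * (1/2)^k)" by (rule real_sqrt_le_mono)
      also have "sqrt (C * (1/2)^k) = sqrt C * (sqrt (1/2))^k" by (simp only: real_sqrt_mult real_sqrt_power)
      finally show ?thesis by (simp only: real_sqrt_abs real_norm_def)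
    qed
    have "sqrt (1/2) < (1::real)" using real_sqrt_less_mono[of "1/2" 1] by simp
    then have "summable (\<lambda>k. sqrt C * (sqrt (1/2))^k)"
      by (intro summable_mult summable_geometric) auto
    then have "summable (\<lambda>k. D k x)" by (rule summable_comparison_test'[where N=0]) (rule b)
    then have "convergent (\<lambda>n. \<Sum>k<n. D k x)" by (simp add: summable_iff_convergent)
    moreover have "(\<Sum>k<n. D k x) = f (r n) x - f (r 0) x" for n
      unfolding D_def by (rule sum_lessThan_telescope)
    ultimately have "convergent (\<lambda>n. f (r n) x - f (r 0) x)" by simp
    then have "convergent (\<lambda>n. (f (r n) x - f (r 0) x) + f (r 0) x)"
      by (intro convergent_add convergent_const)
    then show ?case by simp
  qed
  define g where "g x = lim (\<lambda>k. f (r k) x)" for x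
  have [measurable]: "g \<in> borel_measurable M" unfolding g_def by measurable
  have lim: "AE x in M. (\<lambda>k. f (r k) x) \<longlonglongrightarrow> g x"
    using conv by eventually_elim (simp add: g_def convergent_LIMSEQ_iff)
  have key: "(\<integral>\<^sup>+x. ennreal ((f n x - g x)^2) \<partial>M) \<le> ennreal ((1/4)^j)" if "n \<ge> N j" for n j
  proof -
    have "(\<integral>\<^sup>+x. ennreal ((f n x - g x)^2) \<partial>M) = (\<integral>\<^sup>+x. liminf (\<lambda>k. ennreal ((f n x - f (r k) x)^2)) \<partial>M)"
    proof (rule nn_integral_cong_AE)
      show "AE x in M. ennreal ((f n x - g x)^2) = liminf (\<lambda>k. ennreal ((f n x - f (r k) x)^2))"
        using lim
      proof eventually_elim
        case (elim x)
        then have "(\<lambda>k. ennreal ((f n x - f (r k) x)^2)) \<longlonglongrightarrow> ennreal ((f n x - g x)^2)"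
          by (intro tendsto_ennrealI tendsto_intros)
        then show ?case by (intro lim_imp_Liminf[symmetric]) auto
      qed
    qed
    also have "\<dots> \<le> liminf (\<lambda>k. \<integral>\<^sup>+x. ennreal ((f n x - f (r k) x)^2) \<partial>M)"
      by (rule nn_integral_liminf) auto
    also have "\<dots> \<le> ennreal ((1/4)^j)"
    proof -
      have "\<forall>\<^sub>F k in sequentially. (\<integral>\<^sup>+x. ennreal ((f n x - f (r k) x)^2) \<partial>M) \<le> ennreal ((1/4)^j)"
      proof (rule eventually_sequentiallyI[of "N j"])
        fix k assume "N j \<le> k"
        then have "N j \<le> r k" using rk[of k] by linarith
        then have "(LINT x|M. (f n x - f (r k) x)^2) \<le> (1/4)^j" using N that by auto
        then show "(\<integral>\<^sup>+x. ennreal ((f n x - f (r k) x)^2) \<partial>M) \<le> ennreal ((1/4)^j)"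
          by (subst nn_integral_eq_integral) (auto intro: intd ennreal_leI)
      qed
      then show ?thesis by (rule Liminf_le[rotated]) simp
    qed
    finally show ?thesis .
  qed
  have intdg: "integrable M (\<lambda>x. (f n x - g x)^2)" if "n \<ge> N j" for n j
    using key[OF that] by (intro integrableI_bounded) (auto simp: less_top[symmetric] top_unique)
  have "integrable M (\<lambda>x. (1 * f (N 0) x + (-1) * (f (N 0) x - g x))^2)"
    by (rule integrable_square_lincomb(1)) (use int intdg[of 0 "N 0"] in auto)
  then have gi: "integrable M (\<lambda>x. (g x)^2)" by simp
  have "(\<lambda>n. LINT x|M. (f n x - g x)^2) \<longlonglongrightarrow> 0"
  proof (rule LIMSEQ_I)
    fix e :: real assume "e > 0"
    then obtain j where j: "(1/4::real)^j < e" using real_arch_pow_inv[of e "1/4"] by auto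
    have "norm ((LINT x|M. (f n x - g x)^2) - 0) < e" if "n \<ge> N j" for n
    proof -
      have "ennreal (LINT x|M. (f n x - g x)^2) \<le> ennreal ((1/4)^j)"
        using key[OF that] nn_integral_eq_integral[OF intdg[OF that]] by simp
      then have "(LINT x|M. (f n x - g x)^2) \<le> (1/4)^j" by (simp add: ennreal_le_iff)
      then show ?thesis using j by simp
    qed
    then show "\<exists>no. \<forall>n\<ge>no. norm ((LINT x|M. (f n x - g x)^2) - 0) < e" by blast
  qed
  then show ?thesis by (intro that[OF _ gi]) auto
qed

text \<open>The positive and the negative part of f are densities of two finite measures that agree
  on boxes, an intersection-stable generator. The measures coincide, so do their densities, and as
  one of f x and -f x is truncated to 0 in \<open>ennreal\<close>, both must vanish.\<close>

lemma AE_zero_if_box_integrals_zero: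
  fixes f :: "'a::euclidean_space \<Rightarrow> real"
  assumes f: "integrable lborel f"
    and z: "\<And>a b. (LINT x|lborel. indicator (box a b) x * f x) = 0"
  shows "AE x in lborel. f x = 0"
proof -
  have [measurable]: "f \<in> borel_measurable borel" using f by auto
  let ?P = "density lborel (\<lambda>x. ennreal (f x))" and ?N = "density lborel (\<lambda>x. ennreal (- f x))"
  let ?E = "range (\<lambda>(a, b). box a b :: 'a set)"
  have fin: "(\<integral>\<^sup>+x. ennreal (f x) * indicator A x \<partial>lborel) \<noteq> \<infinity>" "(\<integral>\<^sup>+x. ennreal (- f x) * indicator A x \<partial>lborel) \<noteq> \<infinity>" for A
  proof -
    have "(\<integral>\<^sup>+x. ennreal (norm (f x)) \<partial>lborel) < \<infinity>" using f by (simp add: integrable_iff_bounded)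
    moreover have "(\<integral>\<^sup>+x. ennreal (f x) * indicator A x \<partial>lborel) \<le> (\<integral>\<^sup>+x. ennreal (norm (f x)) \<partial>lborel)"
      "(\<integral>\<^sup>+x. ennreal (- f x) * indicator A x \<partial>lborel) \<le> (\<integral>\<^sup>+x. ennreal (norm (f x)) \<partial>lborel)"
      by (auto intro!: nn_integral_mono ennreal_leI simp: indicator_def)
    ultimately show "(\<integral>\<^sup>+x. ennreal (f x) * indicator A x \<partial>lborel) \<noteq> \<infinity>" "(\<integral>\<^sup>+x. ennreal (- f x) * indicator A x \<partial>lborel) \<noteq> \<infinity>"
      using leD by auto
  qed
  have "?P = ?N"
  proof (rule measure_eqI_generator_eq[of ?E UNIV])
    show "Int_stable ?E" by (auto simp: Int_stable_def box_Int_box)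
    show "?E \<subseteq> Pow UNIV" by auto
    show "sets ?P = sigma_sets UNIV ?E" "sets ?N = sigma_sets UNIV ?E"
      by (auto simp: borel_eq_box)
    show "range (\<lambda>n::nat. box (- (real n *\<^sub>R One)) (real n *\<^sub>R One) :: 'a set) \<subseteq> ?E" by auto
    show "(\<Union>n::nat. box (- (real n *\<^sub>R One)) (real n *\<^sub>R One) :: 'a set) = UNIV"
      by (rule UN_box_eq_UNIV)
    show "emeasure ?P (box (- (real n *\<^sub>R One)) (real n *\<^sub>R One) :: 'a set) \<noteq> \<infinity>" for n
      using fin(1) by (subst emeasure_density) auto
    fix X assume "X \<in> ?E"
    then obtain a b where X: "X = box a b" by auto
    have i: "integrable lborel (\<lambda>x. indicator X x * f x)"
      using integrable_mult_indicator[OF _ f, of X] X by simp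
    have "0 = enn2real (\<integral>\<^sup>+x. ennreal (indicator X x * f x) \<partial>lborel) - enn2real (\<integral>\<^sup>+x. ennreal (- (indicator X x * f x)) \<partial>lborel)"
      using real_lebesgue_integral_def[OF i] z[of a b] X by simp
    moreover have "(\<integral>\<^sup>+x. ennreal (indicator X x * f x) \<partial>lborel) = (\<integral>\<^sup>+x. ennreal (f x) * indicator X x \<partial>lborel)"
      "(\<integral>\<^sup>+x. ennreal (- (indicator X x * f x)) \<partial>lborel) = (\<integral>\<^sup>+x. ennreal (- f x) * indicator X x \<partial>lborel)"
      by (auto intro!: nn_integral_cong simp: indicator_def)
    ultimately have "(\<integral>\<^sup>+x. ennreal (f x) * indicator X x \<partial>lborel) = (\<integral>\<^sup>+x. ennreal (- f x) * indicator X x \<partial>lborel)"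
    proof -
      assume a: "0 = enn2real (\<integral>\<^sup>+x. ennreal (indicator X x * f x) \<partial>lborel) - enn2real (\<integral>\<^sup>+x. ennreal (- (indicator X x * f x)) \<partial>lborel)"
        and b: "(\<integral>\<^sup>+x. ennreal (indicator X x * f x) \<partial>lborel) = (\<integral>\<^sup>+x. ennreal (f x) * indicator X x \<partial>lborel)"
          "(\<integral>\<^sup>+x. ennreal (- (indicator X x * f x)) \<partial>lborel) = (\<integral>\<^sup>+x. ennreal (- f x) * indicator X x \<partial>lborel)"
      have e: "p = q" if "enn2real p = enn2real q" "p \<noteq> \<infinity>" "q \<noteq> \<infinity>" for p q :: ennreal
        using that by (cases p; cases q) auto
      show ?thesis using a unfolding b by (intro e fin) simp
    qed
    then show "emeasure ?P X = emeasure ?N X"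
      by (subst (1 2) emeasure_density) (auto simp: X)
  qed
  then have "AE x in lborel. ennreal (f x) = ennreal (- f x)"
    by (intro sigma_finite_measure.density_unique[OF lborel.sigma_finite_measure_axioms]) auto
  then show ?thesis
  proof eventually_elim
    case (elim x)
    then show ?case by (cases "f x \<ge> 0") (auto simp: ennreal_eq_0_iff ennreal_neg)
  qed
qed

section \<open>Radial profiles\<close>

text \<open>Up to the factor \<open>sphere_area\<close>, the image of Lebesgue measure under the
  norm (\<open>distr_norm_lborel\<close>). The half line r \<le> 0 is a null set, so the values of
  profiles there are irrelevant.\<close>

definition radial :: "nat \<Rightarrow> real measure" where
  "radial d = density lborel (\<lambda>r. ennreal (indicator {0<..} r * r ^ (d - 1)))"

lemma sets_radial [measurable_cong, simp]: "sets (radial d) = sets borel"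
  and space_radial [simp]: "space (radial d) = UNIV"
  by (simp_all add: radial_def)

lemma radial_weight_nonneg: "0 \<le> indicator {0<..} r * (r::real) ^ n"
  by (simp add: indicator_def)

lemma borel_measurable_radial [simp]:
  "borel_measurable (radial d) = borel_measurable borel"
  by (rule measurable_cong_sets) auto

lemma AE_radial: "(AE r in radial d. P r) \<longleftrightarrow> (AE r in lborel. 0 < r \<longrightarrow> P r)"
  unfolding radial_def by (subst AE_density) (auto simp: indicator_def intro!: AE_cong)

lemma AE_radialI: "(\<And>r. 0 < r \<Longrightarrow> P r) \<Longrightarrow> AE r in radial d. P r"
  by (simp add: AE_radial)

lemma integrable_radial:
  fixes h :: "real \<Rightarrow> real"
  assumes "h \<in> borel_measurable borel"
  shows "integrable (radial d) h \<longleftrightarrow> integrable lborel (\<lambda>r. indicator {0<..} r * r ^ (d - 1) * h r)"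
  unfolding radial_def
  by (subst integrable_density) (use assms in \<open>auto simp: radial_weight_nonneg\<close>)

lemma integral_radial:
  fixes h :: "real \<Rightarrow> real"
  assumes "h \<in> borel_measurable borel"
  shows "integral\<^sup>L (radial d) h = (LINT r|lborel. indicator {0<..} r * r ^ (d - 1) * h r)"
  unfolding radial_def
  by (subst integral_density) (use assms in \<open>auto simp: radial_weight_nonneg\<close>)

text \<open>\<open>c\<close> is the weak derivative of \<open>g\<close>, in integral form. Since the
  identity holds for all positive a and b, not just almost all, \<open>g\<close> is the continuous
  representative. Nothing is demanded at the origin, where \<open>g\<close> may blow up.\<close>

definition profile :: "nat \<Rightarrow> (real \<Rightarrow> real) \<Rightarrow> (real \<Rightarrow> real) \<Rightarrow> bool" where
  "profile d g c \<longleftrightarrow> g \<in> borel_measurable borel \<and> c \<in> borel_measurable borel \<and>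
     integrable (radial d) (\<lambda>r. (g r)^2) \<and> integrable (radial d) (\<lambda>r. (c r)^2) \<and>
     (\<forall>a b. 0 < a \<longrightarrow> a \<le> b \<longrightarrow> g b - g a = (LBINT r:{a..b}. c r))"

lemma profileD:
  assumes "profile d g c"
  shows "g \<in> borel_measurable borel" "c \<in> borel_measurable borel"
    "integrable (radial d) (\<lambda>r. (g r)^2)" "integrable (radial d) (\<lambda>r. (c r)^2)"
    "0 < a \<Longrightarrow> a \<le> b \<Longrightarrow> g b - g a = (LBINT r:{a..b}. c r)"
  using assms unfolding profile_def by auto

section \<open>Pointwise bounds and equicontinuity of profiles\<close>

lemma set_integrable_inverse_power:
  assumes "0 < (a::real)"
  shows "set_integrable lborel {a..b} (\<lambda>r. (1/r) ^ n)"
  unfolding set_integrable_def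
  by (rule borel_integrable_compact) (use assms in \<open>auto intro!: continuous_intros\<close>)

text \<open>Cauchy-Schwarz in the weighted space against \<open>h\<close>, which is r^-(d-1) on
  [a, b]: this factor cancels the weight, so the weighted integral of c h is the plain integral of
  c.\<close>

lemma radial_L2_interval:
  fixes c :: "real \<Rightarrow> real"
  assumes [measurable]: "c \<in> borel_measurable borel"
    and i: "integrable (radial d) (\<lambda>r. (c r)^2)" and a: "0 < a"
  shows "set_integrable lborel {a..b} c"
    and "(LBINT r:{a..b}. c r)^2 \<le> (LINT r|radial d. (c r)^2) * (LBINT r:{a..b}. (1/r) ^ (d - 1))"
proof -
  let ?M = "radial d"
  define h where "h r = indicator {a..b} r * (1/r) ^ (d - 1)" for r :: real
  have [measurable]: "h \<in> borel_measurable borel" unfolding h_def by measurable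
  have eq: "indicator {0<..} r * r ^ (d - 1) * (h r)^2 = indicator {a..b} r *\<^sub>R (1/r) ^ (d - 1)" for r
    using a by (auto simp: h_def indicator_def power2_eq_square field_simps)
  have hi: "integrable ?M (\<lambda>r. (h r)^2)"
    by (subst integrable_radial, measurable)
       (use set_integrable_inverse_power[OF a, of b "d - 1"] in \<open>simp only: eq set_integrable_def\<close>)
  have hv: "(LINT r|?M. (h r)^2) = (LBINT r:{a..b}. (1/r) ^ (d - 1))"
    by (subst integral_radial, measurable) (simp only: eq set_lebesgue_integral_def)
  have eq2: "indicator {0<..} r * r ^ (d - 1) * (c r * h r) = indicator {a..b} r *\<^sub>R c r" for r
    using a by (auto simp: h_def indicator_def field_simps)
  have "integrable ?M (\<lambda>r. c r * h r)"
    by (rule integrable_mult_squares) (use i hi in auto)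
  then show "set_integrable lborel {a..b} c"
    unfolding set_integrable_def by (subst (asm) integrable_radial, measurable) (simp only: eq2)
  have v: "(LINT r|?M. c r * h r) = (LBINT r:{a..b}. c r)"
    by (subst integral_radial, measurable) (simp only: eq2 set_lebesgue_integral_def)
  show "(LBINT r:{a..b}. c r)^2 \<le> (LINT r|?M. (c r)^2) * (LBINT r:{a..b}. (1/r) ^ (d - 1))"
    using Cauchy_Schwarz_integral[of c ?M h] i hi unfolding v hv by simp
qed

lemma LBINT_interval_bound:
  fixes h :: "real \<Rightarrow> real"
  assumes "a \<le> b" "set_integrable lborel {a..b} h" "\<And>r. a \<le> r \<Longrightarrow> r \<le> b \<Longrightarrow> h r \<le> C"
  shows "(LBINT r:{a..b}. h r) \<le> C * (b - a)"
proof -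
  have "(LBINT r:{a..b}. h r) \<le> (LBINT r:{a..b}. C)"
    by (rule set_integral_mono) (use assms in \<open>auto simp: set_integrable_def\<close>)
  also have "\<dots> = C * (b - a)" using assms(1) by (simp add: set_lebesgue_integral_def)
  finally show ?thesis .
qed

lemma profile_diff_bound:
  assumes p: "profile d g c" and a: "0 < a" "a \<le> b"
  shows "(g b - g a)^2 \<le> (LINT r|radial d. (c r)^2) * ((1/a) ^ (d - 1) * (b - a))"
proof -
  have "(g b - g a)^2 \<le> (LINT r|radial d. (c r)^2) * (LBINT r:{a..b}. (1/r) ^ (d - 1))"
    using radial_L2_interval(2)[OF profileD(2,4)[OF p] a(1)] profileD(5)[OF p a] by simp
  also have "\<dots> \<le> (LINT r|radial d. (c r)^2) * ((1/a) ^ (d - 1) * (b - a))"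
    by (intro mult_left_mono LBINT_interval_bound set_integrable_inverse_power integral_nonneg)
       (use a in \<open>auto intro!: power_mono divide_left_mono\<close>)
  finally show ?thesis .
qed

lemma LBINT_powr_bound:
  fixes a \<kappa> :: real
  assumes "0 < a" "a \<le> 1" "0 < \<kappa>"
  shows "set_integrable lborel {a..1} (\<lambda>r. r powr (- \<kappa> - 1))"
    and "(LBINT r:{a..1}. r powr (- \<kappa> - 1)) \<le> a powr (- \<kappa>) / \<kappa>"
proof -
  show "set_integrable lborel {a..1} (\<lambda>r. r powr (- \<kappa> - 1))"
    unfolding set_integrable_def
  proof (rule borel_integrable_compact)
    have "isCont (\<lambda>r. r powr (- \<kappa> - 1)) x" if "x \<in> {a..1}" for x
      using that assms by (intro DERIV_isCont[OF has_real_derivative_powr]) auto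
    then show "continuous_on {a..1} (\<lambda>r. r powr (- \<kappa> - 1))"
      by (simp add: continuous_at_imp_continuous_on)
  qed auto
  have "(\<integral>r. (r powr (- \<kappa> - 1)) * indicator {a..1} r \<partial>lborel) = - (1 powr (- \<kappa>)) / \<kappa> - (- (a powr (- \<kappa>)) / \<kappa>)"
  proof (rule integral_FTC_Icc_real)
    fix x assume x: "a \<le> x" "x \<le> 1"
    show "((\<lambda>r. - (r powr (- \<kappa>)) / \<kappa>) has_field_derivative x powr (- \<kappa> - 1)) (at x)"
      by (rule derivative_eq_intros refl | use x assms in simp)+
    show "isCont (\<lambda>r. r powr (- \<kappa> - 1)) x" using x assms by (intro DERIV_isCont[OF has_real_derivative_powr]) auto
  qed (rule assms)
  then show "(LBINT r:{a..1}. r powr (- \<kappa> - 1)) \<le> a powr (- \<kappa>) / \<kappa>"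
    using assms by (simp add: set_lebesgue_integral_def mult.commute)
qed

text \<open>On (0, 1] the factor r^-(d-1) is at most r^(-\<kappa>-1) because \<kappa> \<ge> d - 2.
  Requiring \<kappa> > 0 trades the logarithm of the planar case for a small power, so that all
  dimensions are treated alike.\<close>

lemma profile_diff_bound_origin:
  assumes p: "profile d g c" and d: "2 \<le> d" and a: "0 < a" "a \<le> 1"
    and \<kappa>: "0 < \<kappa>" "real d - 2 \<le> \<kappa>"
  shows "(g 1 - g a)^2 \<le> (LINT r|radial d. (c r)^2) * (a powr (- \<kappa>) / \<kappa>)"
proof -
  have "(g 1 - g a)^2 \<le> (LINT r|radial d. (c r)^2) * (LBINT r:{a..1}. (1/r) ^ (d - 1))"
    using radial_L2_interval(2)[OF profileD(2,4)[OF p] a(1)] profileD(5)[OF p a] by simp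
  also have "(LBINT r:{a..1}. (1/r) ^ (d - 1)) \<le> (LBINT r:{a..1}. r powr (- \<kappa> - 1))"
  proof (rule set_integral_mono)
    fix r assume r: "r \<in> {a..1}"
    then have "(1/r) ^ (d - 1) = r powr (- real (d - 1))"
      using a by (simp add: powr_minus powr_realpow power_one_over inverse_eq_divide)
    also have "\<dots> \<le> r powr (- \<kappa> - 1)"
      using r a \<kappa> d by (intro powr_mono') (auto simp: of_nat_diff)
    finally show "(1/r) ^ (d - 1) \<le> r powr (- \<kappa> - 1)" .
  qed (use a \<kappa> in \<open>auto intro: set_integrable_inverse_power LBINT_powr_bound\<close>)
  also have "\<dots> \<le> a powr (- \<kappa>) / \<kappa>" by (rule LBINT_powr_bound(2)[OF a \<kappa>(1)])
  finally show ?thesis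
    by (simp add: mult_left_mono integral_nonneg)
qed

text \<open>Hoelder continuity of order 1/2 at x with a constant that depends on the profile only
  through its energy. The restriction y > x/2 keeps the weight r^-(d-1) under control when y lies on
  the side of the origin.\<close>

lemma profile_equicontinuous:
  assumes p: "profile d g c" and x: "0 < x" and y: "x / 2 < y"
  shows "(g y - g x)^2 \<le> (LINT r|radial d. (c r)^2) * (2/x) ^ (d - 1) * \<bar>y - x\<bar>"
proof -
  define A where "A = (LINT r|radial d. (c r)^2)"
  have A: "0 \<le> A" unfolding A_def by (rule integral_nonneg) auto
  have "(g y - g x)^2 \<le> A * (2/x) ^ (d - 1) * \<bar>y - x\<bar>"
  proof (cases "x \<le> y")
    case True
    have "(g y - g x)^2 \<le> A * ((1/x) ^ (d - 1) * (y - x))"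
      using profile_diff_bound[OF p x True] unfolding A_def .
    also have "\<dots> \<le> A * ((2/x) ^ (d - 1) * (y - x))"
      using A x True by (intro mult_left_mono mult_right_mono power_mono) (auto simp: field_simps)
    finally show ?thesis using True by simp
  next
    case False
    then have "(g x - g y)^2 \<le> A * ((1/y) ^ (d - 1) * (x - y))"
      using profile_diff_bound[OF p, of y x] x y unfolding A_def by auto
    also have "\<dots> \<le> A * ((2/x) ^ (d - 1) * (x - y))"
      using A x y False by (intro mult_left_mono mult_right_mono power_mono) (auto simp: field_simps)
    finally show ?thesis using False by (simp add: power2_commute)
  qed
  then show ?thesis unfolding A_def .
qed

lemma profile_continuous:
  assumes p: "profile d g c"
  shows "continuous_on {0<..} g"
proof -
  have "isCont g x" if x: "0 < x" for x
  proof -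
    define K where "K = (LINT r|radial d. (c r)^2) * (2/x) ^ (d - 1)"
    have "((\<lambda>y. (g y - g x)^2) \<longlongrightarrow> 0) (at x)"
    proof (rule tendsto_sandwich[of "\<lambda>_. 0" _ _ "\<lambda>y. K * \<bar>y - x\<bar>"])
      show "\<forall>\<^sub>F y in at x. (g y - g x)^2 \<le> K * \<bar>y - x\<bar>"
      proof -
        have "\<forall>\<^sub>F y in at x. x / 2 < y" by (rule order_tendstoD(1)[OF tendsto_ident_at]) (use x in simp)
        then show ?thesis by eventually_elim (unfold K_def, rule profile_equicontinuous[OF p x])
      qed
      have "((\<lambda>y. K * \<bar>y - x\<bar>) \<longlongrightarrow> K * \<bar>x - x\<bar>) (at x)" by (intro tendsto_intros)
      then show "((\<lambda>y. K * \<bar>y - x\<bar>) \<longlongrightarrow> 0) (at x)" by simp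
    qed auto
    then have "((\<lambda>y. sqrt ((g y - g x)^2)) \<longlongrightarrow> sqrt 0) (at x)" by (rule tendsto_real_sqrt)
    then have "((\<lambda>y. g y - g x) \<longlongrightarrow> 0) (at x)" by (simp add: tendsto_rabs_zero_iff)
    then show "isCont g x" unfolding isCont_def by (simp add: LIM_zero_iff)
  qed
  then show ?thesis by (auto intro!: continuous_at_imp_continuous_on)
qed

abbreviation energy :: "nat \<Rightarrow> (real \<Rightarrow> real) \<Rightarrow> (real \<Rightarrow> real) \<Rightarrow> real" where
  "energy d g c \<equiv> (LINT r|radial d. (c r)^2) + (LINT r|radial d. (g r)^2)"

text \<open>The minimum of g^2 over an interval of length 1 is at most its mean, and r^(d-1) is the
  least value of the weight on [r, r + 1].\<close>

lemma profile_average: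
  assumes p: "profile d g c" and r: "0 < r"
  shows "\<exists>s\<in>{r..r+1}. (g s)^2 * r ^ (d - 1) \<le> (LINT r|radial d. (g r)^2)"
proof -
  note [measurable] = profileD(1)[OF p]
  have "continuous_on {r..r+1} (\<lambda>s. (g s)^2)"
    by (intro continuous_intros continuous_on_subset[OF profile_continuous[OF p]]) (use r in auto)
  then obtain s where s: "s \<in> {r..r+1}" and m: "\<And>t. t \<in> {r..r+1} \<Longrightarrow> (g s)^2 \<le> (g t)^2"
    using continuous_attains_inf[of "{r..r+1}" "\<lambda>s. (g s)^2"] by auto
  have "(g s)^2 * r ^ (d - 1) = (LINT t|lborel. indicator {r..r+1} t * ((g s)^2 * r ^ (d - 1)))" by simp
  also have "\<dots> \<le> (LINT t|lborel. indicator {0<..} t * t ^ (d - 1) * (g t)^2)"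
  proof (rule Bochner_Integration.integral_mono)
    show "integrable lborel (\<lambda>t. indicator {r..r+1} t * ((g s)^2 * r ^ (d - 1)))" by simp
    show "integrable lborel (\<lambda>t. indicator {0<..} t * t ^ (d - 1) * (g t)^2)"
      using profileD(3)[OF p] by (subst (asm) integrable_radial, measurable)
    fix t :: real
    show "indicator {r..r+1} t * ((g s)^2 * r ^ (d - 1)) \<le> indicator {0<..} t * t ^ (d - 1) * (g t)^2"
    proof (cases "t \<in> {r..r+1}")
      case True
      then have "(g s)^2 * r ^ (d - 1) \<le> (g t)^2 * t ^ (d - 1)"
        using m r by (intro mult_mono[OF m] power_mono) auto
      then show ?thesis using True r by (simp add: mult.commute)
    qed (use radial_weight_nonneg[of t] in simp)
  qed
  also have "\<dots> = (LINT r|radial d. (g r)^2)" by (simp add: integral_radial)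
  finally show ?thesis using s by blast
qed

lemma square_add_bound: "(x::real)^2 \<le> 2 * y\<^sup>2 + 2 * (x - y)^2"
  using sum_squares_ge_zero[of "x - 2 * y" 0] by (simp add: power2_eq_square algebra_simps)

text \<open>A form of Strauss's radial lemma: within distance 1 of r there is a point s where g is
  small on average, and the increment from r to s is bounded by the energy of the
  derivative.\<close>

lemma profile_decay:
  assumes p: "profile d g c" and r: "0 < r"
  shows "(g r)^2 \<le> 4 * energy d g c * (1/r) ^ (d - 1)"
proof -
  define A B where "A = (LINT r|radial d. (c r)^2)" and "B = (LINT r|radial d. (g r)^2)"
  have A: "0 \<le> A" and B: "0 \<le> B" unfolding A_def B_def by (auto intro!: integral_nonneg)
  obtain s where s: "r \<le> s" "s \<le> r + 1" and "(g s)^2 * r ^ (d - 1) \<le> B"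
    using profile_average[OF p r] unfolding B_def by auto
  then have 1: "(g s)^2 \<le> B * (1/r) ^ (d - 1)" using r by (simp add: field_simps)
  have "(g s - g r)^2 \<le> A * ((1/r) ^ (d - 1) * (s - r))"
    using profile_diff_bound[OF p r s(1)] unfolding A_def .
  also have "\<dots> \<le> A * ((1/r) ^ (d - 1) * 1)" using A r s by (intro mult_left_mono) auto
  finally have 2: "(g r - g s)^2 \<le> A * (1/r) ^ (d - 1)" by (simp add: power2_commute)
  have "(g r)^2 \<le> 2 * (B * (1/r) ^ (d - 1)) + 2 * (A * (1/r) ^ (d - 1))"
    using square_add_bound[of "g r" "g s"] 1 2 by linarith
  also have "\<dots> \<le> 4 * (A + B) * (1/r) ^ (d - 1)"
    using A B r by (simp add: algebra_simps)
  finally show ?thesis unfolding A_def B_def .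
qed

text \<open>A common majorant of squared profiles of unit energy; \<open>\<kappa>\<close> is \<open>d - 2\<close>, perturbed if \<open>d = 2\<close>.\<close>
definition majorant :: "nat \<Rightarrow> real \<Rightarrow> real \<Rightarrow> real" where
  "majorant d \<kappa> r = (if r \<le> 1 then (8 + 2 / \<kappa>) * r powr (- \<kappa>) else 4 * (1/r) ^ (d - 1))"

text \<open>Beyond 1 this is the decay estimate. Inside, the value at 1 is at most 4 energies
  squared-wise and the increment towards the origin adds r^(-\<kappa>) / \<kappa>; doubling both by
  \<open>square_add_bound\<close>, and absorbing the first term since r^(-\<kappa>) \<ge> 1,
  produces the constant 8 + 2 / \<kappa>.\<close>

lemma profile_le_majorant:
  assumes p: "profile d g c" and d: "2 \<le> d" and r: "0 < r"
    and \<kappa>: "0 < \<kappa>" "real d - 2 \<le> \<kappa>"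
  shows "(g r)^2 \<le> energy d g c * majorant d \<kappa> r"
proof (cases "r \<le> 1")
  case False
  then show ?thesis using profile_decay[OF p r] by (simp add: majorant_def algebra_simps)
next
  case True
  define A B where "A = (LINT r|radial d. (c r)^2)" and "B = (LINT r|radial d. (g r)^2)"
  have A: "0 \<le> A" and B: "0 \<le> B" unfolding A_def B_def by (auto intro!: integral_nonneg)
  have 1: "(g 1)^2 \<le> 4 * (A + B)" using profile_decay[OF p, of 1] unfolding A_def B_def by simp
  have 2: "(g r - g 1)^2 \<le> A * (r powr (- \<kappa>) / \<kappa>)"
    using profile_diff_bound_origin[OF p d r True \<kappa>] unfolding A_def by (simp add: power2_commute)
  have 3: "1 \<le> r powr (- \<kappa>)" using r True \<kappa> powr_mono'[of "- \<kappa>" 0 r] by simp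
  have "(g r)^2 \<le> 8 * (A + B) + 2 * (A * (r powr (- \<kappa>) / \<kappa>))"
    using square_add_bound[of "g r" "g 1"] 1 2 by linarith
  also have "\<dots> \<le> 8 * (A + B) * r powr (- \<kappa>) + 2 * ((A + B) * (r powr (- \<kappa>) / \<kappa>))"
    using A B 3 \<kappa> mult_left_mono[OF 3, of "8 * (A + B)"]
    by (intro add_mono mult_left_mono mult_right_mono) auto
  also have "\<dots> = (A + B) * ((8 + 2 / \<kappa>) * r powr (- \<kappa>))" by (simp add: algebra_simps)
  finally show ?thesis using True unfolding A_def B_def majorant_def by simp
qed

lemma majorant_nonneg: "0 < \<kappa> \<Longrightarrow> 0 < r \<Longrightarrow> 0 \<le> majorant d \<kappa> r"
  by (simp add: majorant_def)

lemma borel_measurable_majorant [measurable]: "majorant d \<kappa> \<in> borel_measurable borel"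
  unfolding majorant_def by measurable

section \<open>Linear combinations of profiles\<close>

lemma profile_lincomb:
  assumes g: "profile d g c" and h: "profile d h e"
  shows "profile d (\<lambda>r. s * g r + t * h r) (\<lambda>r. s * c r + t * e r)"
  unfolding profile_def
proof (intro conjI allI impI)
  note [measurable] = profileD(1,2)[OF g] profileD(1,2)[OF h]
  show "(\<lambda>r. s * g r + t * h r) \<in> borel_measurable borel" "(\<lambda>r. s * c r + t * e r) \<in> borel_measurable borel"
    by measurable
  show "integrable (radial d) (\<lambda>r. (s * g r + t * h r)^2)"
    "integrable (radial d) (\<lambda>r. (s * c r + t * e r)^2)"
    using profileD(3,4)[OF g] profileD(3,4)[OF h] by (intro integrable_square_lincomb(1); simp)+
  fix a b :: real assume ab: "0 < a" "a \<le> b"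
  have i: "set_integrable lborel {a..b} c" "set_integrable lborel {a..b} e"
    using radial_L2_interval(1)[OF profileD(2,4)[OF g] ab(1)] radial_L2_interval(1)[OF profileD(2,4)[OF h] ab(1)] by auto
  have "(LBINT r:{a..b}. s * c r + t * e r) = s * (LBINT r:{a..b}. c r) + t * (LBINT r:{a..b}. e r)"
    using i by simp
  then show "s * g b + t * h b - (s * g a + t * h a) = (LBINT r:{a..b}. s * c r + t * e r)"
    using profileD(5)[OF g ab] profileD(5)[OF h ab] by (simp add: algebra_simps)
qed

lemma profile_scale: "profile d g c \<Longrightarrow> profile d (\<lambda>r. s * g r) (\<lambda>r. s * c r)"
  using profile_lincomb[of d g c g c s 0] by simp

lemma profile_cong:
  assumes p: "profile d g c" and g: "g' \<in> borel_measurable borel" "\<And>r. 0 < r \<Longrightarrow> g' r = g r"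
    and c: "c' \<in> borel_measurable borel" "AE r in radial d. c' r = c r"
  shows "profile d g' c'"
  unfolding profile_def
proof (intro conjI allI impI)
  note [measurable] = g(1) c(1) profileD(1,2)[OF p]
  show "g' \<in> borel_measurable borel" "c' \<in> borel_measurable borel" by measurable
  show "integrable (radial d) (\<lambda>r. (g' r)^2)"
    using profileD(3)[OF p] by (rule integrable_cong_AE_imp) (auto simp: AE_radial g(2))
  show "integrable (radial d) (\<lambda>r. (c' r)^2)"
    using profileD(4)[OF p] by (rule integrable_cong_AE_imp) (use c(2) in auto)
  fix a b :: real assume ab: "0 < a" "a \<le> b"
  have "(LBINT r:{a..b}. c r) = (LBINT r:{a..b}. c' r)"
    by (rule set_lebesgue_integral_cong_AE) (use c(2) ab in \<open>auto simp: AE_radial\<close>)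
  then show "g' b - g' a = (LBINT r:{a..b}. c' r)" using profileD(5)[OF p ab] g(2) ab by simp
qed

section \<open>Chain rule, signed parts and truncation\<close>

lemma LBINT_interval_split:
  fixes c :: "real \<Rightarrow> real"
  assumes "set_integrable lborel {x..z} c" "x \<le> y" "y \<le> z"
  shows "(LBINT r:{x..z}. c r) = (LBINT r:{x..y}. c r) + (LBINT r:{y..z}. c r)"
proof -
  have "{x..z} = {x..y} \<union> {y..z}" using assms by auto
  moreover have "(LBINT r:{x..y} \<union> {y..z}. c r) = (LBINT r:{x..y}. c r) + (LBINT r:{y..z}. c r)"
  proof (rule set_integral_Un_AE)
    show "AE r in lborel. \<not> (r \<in> {x..y} \<and> r \<in> {y..z})"
      using AE_lborel_singleton[of y] by eventually_elim auto
    show "set_integrable lborel {x..y} c" "set_integrable lborel {y..z} c"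
      using assms by (auto intro: set_integrable_subset)
  qed auto
  ultimately show ?thesis by simp
qed

lemma LBINT_abs_bound:
  fixes h k :: "real \<Rightarrow> real"
  assumes "set_integrable lborel S h" "set_integrable lborel S k" "\<And>r. r \<in> S \<Longrightarrow> \<bar>h r\<bar> \<le> k r"
  shows "\<bar>LBINT r:S. h r\<bar> \<le> (LBINT r:S. k r)"
  unfolding set_lebesgue_integral_def
  by (rule integral_abs_bound_integral)
     (use assms in \<open>auto simp: set_integrable_def indicator_def\<close>)

lemma set_integrable_mult_continuous:
  fixes k h :: "real \<Rightarrow> real"
  assumes h: "set_integrable lborel {a..b} h" and k: "continuous_on {a..b} k"
  shows "set_integrable lborel {a..b} (\<lambda>r. k r * h r)"
proof -
  have "compact (k ` {a..b})" by (rule compact_continuous_image[OF k]) simp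
  then obtain B where B: "\<And>r. r \<in> {a..b} \<Longrightarrow> \<bar>k r\<bar> \<le> B"
    using compact_imp_bounded bounded_real by (metis (no_types, lifting) imageI)
  show ?thesis unfolding set_integrable_def
  proof (rule integrable_bound)
    show "integrable lborel (\<lambda>r. B * (indicator {a..b} r *\<^sub>R h r))" using h unfolding set_integrable_def by simp
    have "(\<lambda>r. indicator {a..b} r *\<^sub>R k r) \<in> borel_measurable lborel"
      using borel_measurable_continuous_on_indicator[OF _ k] by simp
    moreover have "(\<lambda>r. indicator {a..b} r *\<^sub>R h r) \<in> borel_measurable lborel" using h unfolding set_integrable_def by auto
    ultimately have "(\<lambda>r. (indicator {a..b} r *\<^sub>R k r) * (indicator {a..b} r *\<^sub>R h r)) \<in> borel_measurable lborel" by measurable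
    then show "(\<lambda>r. indicator {a..b} r *\<^sub>R (k r * h r)) \<in> borel_measurable lborel"
      by (rule measurable_cong[THEN iffD1, rotated]) (auto simp: indicator_def)
    show "AE r in lborel. norm (indicator {a..b} r *\<^sub>R (k r * h r)) \<le> norm (B * (indicator {a..b} r *\<^sub>R h r))"
    proof (rule AE_I2)
      fix r
      show "norm (indicator {a..b} r *\<^sub>R (k r * h r)) \<le> norm (B * (indicator {a..b} r *\<^sub>R h r))"
      proof (cases "r \<in> {a..b}")
        case True
        then have "\<bar>k r\<bar> \<le> \<bar>B\<bar>" using B by fastforce
        then show ?thesis using True by (simp add: abs_mult mult_right_mono)
      qed simp
    qed
  qed
qed

text \<open>The chain rule for the absolutely continuous \<open>g\<close>, by a bisection (Bolzano) argument: on short intervals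
  \<open>\<phi>' \<circ> g\<close> is almost constant.\<close>
lemma integral_chain_rule:
  fixes g c :: "real \<Rightarrow> real"
  assumes ab: "a \<le> b" and g: "continuous_on {a..b} g" and c: "set_integrable lborel {a..b} c"
    and FTC: "\<And>x y. a \<le> x \<Longrightarrow> x \<le> y \<Longrightarrow> y \<le> b \<Longrightarrow> g y - g x = (LBINT r:{x..y}. c r)"
    and \<phi>: "\<And>s. (\<phi> has_real_derivative \<phi>' s) (at s)" "continuous_on UNIV \<phi>'"
  shows "\<phi> (g b) - \<phi> (g a) = (LBINT r:{a..b}. \<phi>' (g r) * c r)"
proof -
  have cont: "continuous_on {a..b} (\<lambda>r. \<phi>' (g r))"
    using continuous_on_compose2[OF \<phi>(2) g] by simp
  have sub: "set_integrable lborel {x..y} (\<lambda>r. c r)" "set_integrable lborel {x..y} (\<lambda>r. \<bar>c r\<bar>)"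
    if "a \<le> x" "y \<le> b" for x y
    using set_integrable_subset[OF c, of "{x..y}"] that by (auto intro: set_integrable_abs)
  note ci = set_integrable_mult_continuous[OF c cont]
  have cis: "set_integrable lborel {x..y} (\<lambda>r. \<phi>' (g r) * c r)" if "a \<le> x" "y \<le> b" for x y
    using set_integrable_subset[OF ci, of "{x..y}"] that by auto
  \<comment> \<open>The defect of the chain rule. It is additive over adjacent intervals, and so is
    the integral of |c|; a bound of the first by \<epsilon> times the second therefore passes from
    short intervals to [a, b].\<close>
  define E where "E x y = \<phi> (g y) - \<phi> (g x) - (LBINT r:{x..y}. \<phi>' (g r) * c r)" for x y
  have main: "\<bar>E a b\<bar> \<le> \<epsilon> * (LBINT r:{a..b}. \<bar>c r\<bar>)" if \<epsilon>: "\<epsilon> > 0" for \<epsilon>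
  proof -
    define P where "P x y \<longleftrightarrow> (a \<le> x \<longrightarrow> x \<le> y \<longrightarrow> y \<le> b \<longrightarrow> \<bar>E x y\<bar> \<le> \<epsilon> * (LBINT r:{x..y}. \<bar>c r\<bar>))" for x y
    have "P a b"
    proof (rule Bolzano[OF ab])
      fix x y z assume P: "P x y" "P y z" and xyz: "x \<le> y" "y \<le> z"
      show "P x z" unfolding P_def
      proof (intro impI)
        assume xz: "a \<le> x" "x \<le> z" "z \<le> b"
        have "E x z = E x y + E y z"
          unfolding E_def using LBINT_interval_split[OF cis[OF xz(1,3)] xyz] by simp
        moreover have "(LBINT r:{x..z}. \<bar>c r\<bar>) = (LBINT r:{x..y}. \<bar>c r\<bar>) + (LBINT r:{y..z}. \<bar>c r\<bar>)"
          using LBINT_interval_split[OF sub(2)[OF xz(1,3)] xyz] .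
        moreover have "\<bar>E x y\<bar> \<le> \<epsilon> * (LBINT r:{x..y}. \<bar>c r\<bar>)" "\<bar>E y z\<bar> \<le> \<epsilon> * (LBINT r:{y..z}. \<bar>c r\<bar>)"
          using P xyz xz unfolding P_def by auto
        ultimately show "\<bar>E x z\<bar> \<le> \<epsilon> * (LBINT r:{x..z}. \<bar>c r\<bar>)"
          by (simp add: distrib_left)
      qed
    next
      fix x assume x: "a \<le> x" "x \<le> b"
      have "isCont \<phi>' (g x)" using \<phi>(2) by (simp add: continuous_on_eq_continuous_at)
      then obtain \<delta>1 where \<delta>1: "\<delta>1 > 0" "\<And>s. \<bar>s - g x\<bar> < \<delta>1 \<Longrightarrow> \<bar>\<phi>' s - \<phi>' (g x)\<bar> < \<epsilon> / 2"
        using \<epsilon> unfolding continuous_at_eps_delta dist_real_def by (metis half_gt_zero)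
      obtain \<delta> where \<delta>: "\<delta> > 0" "\<And>s. s \<in> {a..b} \<Longrightarrow> \<bar>s - x\<bar> < \<delta> \<Longrightarrow> \<bar>g s - g x\<bar> < \<delta>1"
        using g x \<delta>1(1) unfolding continuous_on_iff dist_real_def by (metis atLeastAtMost_iff)
      show "\<exists>\<delta>>0. \<forall>y z. y \<le> x \<and> x \<le> z \<and> z - y < \<delta> \<longrightarrow> P y z"
      proof (intro exI conjI allI impI)
        fix y z assume yz: "y \<le> x \<and> x \<le> z \<and> z - y < \<delta>"
        show "P y z" unfolding P_def
        proof (intro impI)
          assume r: "a \<le> y" "y \<le> z" "z \<le> b"
          have near: "\<bar>g s - g x\<bar> < \<delta>1" if "s \<in> {y..z}" for s
            by (rule \<delta>(2)) (use that yz r in auto)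
          let ?k = "\<phi>' (g x)"
          \<comment> \<open>Subtracting the linear function with slope \<open>?k\<close> leaves a
            function whose derivative is below \<epsilon>/2 near g x. The other half of \<epsilon>
            pays for replacing \<phi>' (g r) by \<open>?k\<close> under the integral.\<close>
          have "norm ((\<phi> (g z) - ?k * g z) - (\<phi> (g y) - ?k * g y)) \<le> \<epsilon> / 2 * norm (g z - g y)"
          proof (rule field_differentiable_bound[of "ball (g x) \<delta>1" _ "\<lambda>s. \<phi>' s - ?k"])
            fix s assume s: "s \<in> ball (g x) \<delta>1"
            have "((\<lambda>s. \<phi> s - ?k * s) has_real_derivative \<phi>' s - ?k) (at s)"
              by (auto intro!: derivative_eq_intros \<phi>(1))
            then show "((\<lambda>s. \<phi> s - ?k * s) has_real_derivative \<phi>' s - ?k) (at s within ball (g x) \<delta>1)"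
              by (rule has_field_derivative_at_within)
            show "norm (\<phi>' s - ?k) \<le> \<epsilon> / 2" using \<delta>1(2)[of s] s by (auto simp: dist_real_def abs_minus_commute)
          qed (use near[of z] near[of y] r in \<open>auto simp: dist_real_def abs_minus_commute\<close>)
          also have "norm (g z - g y) \<le> (LBINT r:{y..z}. \<bar>c r\<bar>)"
            using LBINT_abs_bound[OF sub[OF r(1,3)]] FTC[OF r] by simp
          finally have 1: "\<bar>(\<phi> (g z) - \<phi> (g y)) - ?k * (g z - g y)\<bar> \<le> \<epsilon> / 2 * (LBINT r:{y..z}. \<bar>c r\<bar>)"
            using \<epsilon> by (simp add: algebra_simps)
          have "\<bar>LBINT r:{y..z}. (?k * c r - \<phi>' (g r) * c r)\<bar> \<le> (LBINT r:{y..z}. \<epsilon> / 2 * \<bar>c r\<bar>)"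
          proof (rule LBINT_abs_bound)
            show "set_integrable lborel {y..z} (\<lambda>r. ?k * c r - \<phi>' (g r) * c r)"
              using sub(1)[OF r(1,3)] cis[OF r(1,3)] by auto
            show "set_integrable lborel {y..z} (\<lambda>r. \<epsilon> / 2 * \<bar>c r\<bar>)" using sub(2)[OF r(1,3)] by auto
            fix t assume t: "t \<in> {y..z}"
            have "\<bar>?k * c t - \<phi>' (g t) * c t\<bar> = \<bar>\<phi>' (g t) - ?k\<bar> * \<bar>c t\<bar>"
              by (metis abs_minus_commute abs_mult left_diff_distrib)
            also have "\<dots> \<le> \<epsilon> / 2 * \<bar>c t\<bar>" using \<delta>1(2)[OF near[OF t]] by (intro mult_right_mono) auto
            finally show "\<bar>?k * c t - \<phi>' (g t) * c t\<bar> \<le> \<epsilon> / 2 * \<bar>c t\<bar>" .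
          qed
          then have 2: "\<bar>?k * (g z - g y) - (LBINT r:{y..z}. \<phi>' (g r) * c r)\<bar> \<le> \<epsilon> / 2 * (LBINT r:{y..z}. \<bar>c r\<bar>)"
            using sub(1)[OF r(1,3)] cis[OF r(1,3)] FTC[OF r] by simp
          show "\<bar>E y z\<bar> \<le> \<epsilon> * (LBINT r:{y..z}. \<bar>c r\<bar>)"
          proof -
            have "E y z = ((\<phi> (g z) - \<phi> (g y)) - ?k * (g z - g y)) + (?k * (g z - g y) - (LBINT r:{y..z}. \<phi>' (g r) * c r))"
              unfolding E_def by simp
            then show ?thesis using 1 2 by linarith
          qed
        qed
      qed (rule \<delta>(1))
    qed
    then show ?thesis using ab unfolding P_def by simp
  qed
  have "\<bar>E a b\<bar> \<le> 0"
  proof (rule field_le_epsilon)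
    fix e :: real assume e: "e > 0"
    define V where "V = (LBINT r:{a..b}. \<bar>c r\<bar>)"
    have V: "V \<ge> 0" unfolding V_def set_lebesgue_integral_def by (rule integral_nonneg) simp
    have "\<bar>E a b\<bar> \<le> e / (V + 1) * V" unfolding V_def by (rule main[unfolded V_def]) (use e V in \<open>auto simp: V_def\<close>)
    also have "\<dots> \<le> e" using V e by (simp add: field_simps)
    finally show "\<bar>E a b\<bar> \<le> 0 + e" by simp
  qed
  then show ?thesis unfolding E_def by simp
qed

lemma profile_FTC_set_integrable:
  assumes "profile d g c" "0 < a"
  shows "set_integrable lborel {a..b} c"
  using radial_L2_interval(1)[OF profileD(2,4)[OF assms(1)] assms(2)] .

text \<open>Extends the chain rule to a nonsmooth \<psi> approximated by \<phi> n with derivatives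
  bounded by 1, so that |c| dominates. The limit \<eta> of the derivatives need not be the
  derivative of \<psi> at exceptional points, and this freedom is exploited below.\<close>

lemma profile_compose_limit:
  assumes p: "profile d g c" and ab: "0 < a" "a \<le> b"
    and \<phi>: "\<And>n s. (\<phi> n has_real_derivative \<phi>' n s) (at s)" "\<And>n. continuous_on UNIV (\<phi>' n)"
    and bd: "\<And>n s. \<bar>\<phi>' n s\<bar> \<le> 1"
    and lim: "\<And>s. (\<lambda>n. \<phi> n s) \<longlonglongrightarrow> \<psi> s" "\<And>s. (\<lambda>n. \<phi>' n s) \<longlonglongrightarrow> \<eta> s"
    and \<eta>: "\<eta> \<in> borel_measurable borel"
  shows "\<psi> (g b) - \<psi> (g a) = (LBINT r:{a..b}. \<eta> (g r) * c r)"
proof -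
  note [measurable] = profileD(1,2)[OF p] \<eta>
  have [measurable]: "\<phi>' n \<in> borel_measurable borel" for n
    using \<phi>(2) by (rule borel_measurable_continuous_onI)
  have 1: "(\<lambda>n. LBINT r:{a..b}. \<phi>' n (g r) * c r) \<longlonglongrightarrow> (LBINT r:{a..b}. \<eta> (g r) * c r)"
    unfolding set_lebesgue_integral_def
  proof (rule integral_dominated_convergence)
    show "integrable lborel (\<lambda>r. norm (indicator {a..b} r *\<^sub>R c r))"
      using profile_FTC_set_integrable[OF p ab(1), of b] unfolding set_integrable_def by (rule integrable_norm)
    show "AE r in lborel. (\<lambda>n. indicator {a..b} r *\<^sub>R (\<phi>' n (g r) * c r)) \<longlonglongrightarrow> indicator {a..b} r *\<^sub>R (\<eta> (g r) * c r)"
      by (intro AE_I2 tendsto_intros lim)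
    show "AE r in lborel. norm (indicator {a..b} r *\<^sub>R (\<phi>' n (g r) * c r)) \<le> norm (indicator {a..b} r *\<^sub>R c r)" for n
      using mult_right_mono[OF bd, of "\<bar>c _\<bar>"] by (auto simp: indicator_def abs_mult)
  qed measurable
  have 2: "(LBINT r:{a..b}. \<phi>' n (g r) * c r) = \<phi> n (g b) - \<phi> n (g a)" for n
  proof (rule integral_chain_rule[symmetric, OF ab(2) _ _ _ \<phi>(1) \<phi>(2)])
    show "continuous_on {a..b} g" by (rule continuous_on_subset[OF profile_continuous[OF p]]) (use ab in auto)
    show "set_integrable lborel {a..b} c" by (rule profile_FTC_set_integrable[OF p ab(1)])
    show "g y - g x = (LBINT r:{x..y}. c r)" if "a \<le> x" "x \<le> y" for x y
      using profileD(5)[OF p, of x y] that ab by simp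
  qed
  have "(\<lambda>n. \<phi> n (g b) - \<phi> n (g a)) \<longlonglongrightarrow> \<psi> (g b) - \<psi> (g a)"
    by (intro tendsto_intros lim)
  from LIMSEQ_unique[OF this 1[unfolded 2]] show ?thesis .
qed

lemma AE_radial_zero_if_interval_integrals_zero:
  fixes h :: "real \<Rightarrow> real"
  assumes [measurable]: "h \<in> borel_measurable borel"
    and int: "\<And>a b. 0 < a \<Longrightarrow> a \<le> b \<Longrightarrow> set_integrable lborel {a..b} h"
    and z: "\<And>a b. 0 < a \<Longrightarrow> a \<le> b \<Longrightarrow> (LBINT r:{a..b}. h r) = 0"
  shows "AE r in radial d. h r = 0"
proof -
  define u v where "u n = 1 / (real n + 1)" and "v n = real n + 1" for n :: nat
  have uv: "0 < u n" "u n \<le> v n" for n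
    unfolding u_def v_def by (auto simp: field_simps)
  have "AE r in lborel. indicator {u n..v n} r * h r = 0" for n
  proof (rule AE_zero_if_box_integrals_zero)
    show "integrable lborel (\<lambda>r. indicator {u n..v n} r * h r)"
      using int[OF uv] by (simp add: set_integrable_def)
    fix a b :: real
    show "(LINT r|lborel. indicator (box a b) r * (indicator {u n..v n} r * h r)) = 0"
    proof (cases "max a (u n) \<le> min b (v n)")
      case True
      have "(LINT r|lborel. indicator (box a b) r * (indicator {u n..v n} r * h r)) = (LBINT r:{max a (u n)..min b (v n)}. h r)"
        unfolding set_lebesgue_integral_def
      proof (rule integral_cong_AE)
        show "AE r in lborel. indicator (box a b) r * (indicator {u n..v n} r * h r) = indicator {max a (u n)..min b (v n)} r *\<^sub>R h r"
          using AE_lborel_singleton[of a] AE_lborel_singleton[of b] by eventually_elim (auto simp: indicator_def)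
      qed measurable
      also have "\<dots> = 0" by (rule z) (use True uv[of n] in auto)
      finally show ?thesis .
    next
      case False
      then have "(\<lambda>r. indicator (box a b) r * (indicator {u n..v n} r * h r)) = (\<lambda>_. 0)"
        by (auto simp: indicator_def)
      then show ?thesis by (simp only: Bochner_Integration.integral_zero)
    qed
  qed
  then have "AE r in lborel. \<forall>n. indicator {u n..v n} r * h r = 0" by (simp only: AE_all_countable) auto
  then have "AE r in lborel. 0 < r \<longrightarrow> h r = 0"
  proof eventually_elim
    case (elim r)
    show ?case
    proof
      assume r: "0 < r"
      obtain n :: nat where n: "max r (1 / r) \<le> real n" using real_arch_simple by blast
      then have "u n \<le> r" "r \<le> v n" using r unfolding u_def v_def by (auto simp: field_simps)
      then show "h r = 0" using elim[rule_format, of n] by simp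
    qed
  qed
  then show ?thesis by (simp add: AE_radial)
qed

text \<open>The functions arctan((n+1) s)/(n+1) tend to 0, while their derivatives tend to the
  indicator \<eta> of {0}. In the limit of the chain rule the integral of \<eta> (g r) * c r
  vanishes over every interval.\<close>

lemma profile_deriv_zero_on_zero_set:
  assumes p: "profile d g c"
  shows "AE r in radial d. g r = 0 \<longrightarrow> c r = 0"
proof -
  define \<phi> where "\<phi> n s = arctan ((real n + 1) * s) / (real n + 1)" for n s
  define \<phi>' where "\<phi>' n s = inverse (1 + ((real n + 1) * s)^2)" for n and s :: real
  define \<eta> where "\<eta> s = (if s = 0 then 1 else 0::real)" for s :: real
  note [measurable] = profileD(1,2)[OF p]
  have [measurable]: "\<eta> \<in> borel_measurable borel" unfolding \<eta>_def by measurable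
  have inf: "filterlim (\<lambda>n. real n + 1) at_top sequentially"
    by (rule filterlim_at_top_mono[OF filterlim_real_sequentially]) simp
  have 1: "(\<phi> n has_real_derivative \<phi>' n s) (at s)" for n s
    unfolding \<phi>_def \<phi>'_def by (rule derivative_eq_intros refl | simp add: add_nonneg_eq_0_iff)+
  have pos: "0 < 1 + ((real n + 1) * s)^2" for n s by (simp add: add_pos_nonneg)
  have 2: "continuous_on UNIV (\<phi>' n)" for n
    unfolding \<phi>'_def by (intro continuous_intros ballI) (use pos[of n] in \<open>metis less_irrefl\<close>)
  have 3: "\<bar>\<phi>' n s\<bar> \<le> 1" for n s
    unfolding \<phi>'_def using pos[of n s] by (simp add: inverse_le_1_iff)
  have 4: "(\<lambda>n. \<phi> n s) \<longlonglongrightarrow> 0" for s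
  proof (rule tendsto_rabs_zero_cancel, rule tendsto_sandwich[of "\<lambda>_. 0" _ _ "\<lambda>n. (pi/2) / (real n + 1)"])
    show "\<forall>\<^sub>F n in sequentially. \<bar>\<phi> n s\<bar> \<le> (pi/2) / (real n + 1)"
    proof (intro always_eventually allI)
      fix n
      have "\<bar>arctan ((real n + 1) * s)\<bar> \<le> pi / 2"
        using arctan_bounded[of "(real n + 1) * s"] by linarith
      then have "\<bar>arctan ((real n + 1) * s)\<bar> / (real n + 1) \<le> (pi / 2) / (real n + 1)"
        by (rule divide_right_mono) simp
      then show "\<bar>\<phi> n s\<bar> \<le> (pi/2) / (real n + 1)" by (simp add: \<phi>_def)
    qed
    show "(\<lambda>n. (pi/2) / (real n + 1)) \<longlonglongrightarrow> 0" by (rule tendsto_divide_0[OF tendsto_const filterlim_at_top_imp_at_infinity[OF inf]])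
  qed auto
  have 5: "(\<lambda>n. \<phi>' n s) \<longlonglongrightarrow> \<eta> s" for s
  proof (cases "s = 0")
    case False
    have "filterlim (\<lambda>n. 1 + ((real n + 1) * s)^2) at_top sequentially"
    proof (rule filterlim_at_top_mono)
      show "filterlim (\<lambda>n. s\<^sup>2 * (real n + 1)) at_top sequentially"
        by (rule filterlim_tendsto_pos_mult_at_top[OF tendsto_const _ inf]) (use False in simp)
      have "s\<^sup>2 * (real n + 1) \<le> 1 + ((real n + 1) * s)^2" for n
      proof -
        have "s\<^sup>2 * (real n + 1) * 1 \<le> s\<^sup>2 * (real n + 1) * (real n + 1)" by (intro mult_left_mono) auto
        then show ?thesis by (simp add: power2_eq_square algebra_simps)
      qed
      then show "\<forall>\<^sub>F n in sequentially. s\<^sup>2 * (real n + 1) \<le> 1 + ((real n + 1) * s)^2" by simp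
    qed
    then have "(\<lambda>n. \<phi>' n s) \<longlonglongrightarrow> 0" unfolding \<phi>'_def by (rule tendsto_inverse_0_at_top)
    then show ?thesis using False by (simp add: \<eta>_def)
  qed (simp add: \<phi>'_def \<eta>_def)
  have "AE r in radial d. \<eta> (g r) * c r = 0"
  proof (rule AE_radial_zero_if_interval_integrals_zero)
    fix a b :: real assume ab: "0 < a" "a \<le> b"
    show "(LBINT r:{a..b}. \<eta> (g r) * c r) = 0"
      using profile_compose_limit[OF p ab 1 2 3 4 5] by simp
    show "set_integrable lborel {a..b} (\<lambda>r. \<eta> (g r) * c r)"
      unfolding set_integrable_def
    proof (rule integrable_bound)
      show "integrable lborel (\<lambda>r. indicator {a..b} r *\<^sub>R c r)"
        using profile_FTC_set_integrable[OF p ab(1)] unfolding set_integrable_def .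
    qed (auto simp: \<eta>_def)
  qed measurable
  then show ?thesis by eventually_elim (auto simp: \<eta>_def)
qed

lemma profile_unique:
  assumes p: "profile d g c" and q: "profile d g e"
  shows "AE r in radial d. c r = e r"
proof -
  note [measurable] = profileD(2)[OF p] profileD(2)[OF q]
  have "AE r in radial d. c r - e r = 0"
  proof (rule AE_radial_zero_if_interval_integrals_zero)
    fix a b :: real assume ab: "0 < a" "a \<le> b"
    note i = profile_FTC_set_integrable[OF p ab(1)] profile_FTC_set_integrable[OF q ab(1)]
    show "set_integrable lborel {a..b} (\<lambda>r. c r - e r)" using i by auto
    show "(LBINT r:{a..b}. c r - e r) = 0"
      using i profileD(5)[OF p ab] profileD(5)[OF q ab] by simp
  qed measurable
  then show ?thesis by simp
qed

lemma profile_abs: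
  assumes p: "profile d g c"
  shows "profile d (\<lambda>r. \<bar>g r\<bar>) (\<lambda>r. sgn (g r) * c r)"
  unfolding profile_def
proof (intro conjI allI impI)
  note [measurable] = profileD(1,2)[OF p]
  show "(\<lambda>r. \<bar>g r\<bar>) \<in> borel_measurable borel" "(\<lambda>r. sgn (g r) * c r) \<in> borel_measurable borel" by measurable
  show "integrable (radial d) (\<lambda>r. \<bar>g r\<bar>\<^sup>2)" using profileD(3)[OF p] by simp
  show "integrable (radial d) (\<lambda>r. (sgn (g r) * c r)^2)"
    by (rule integrable_bound[OF profileD(4)[OF p]]) (auto simp: sgn_if)
  fix a b :: real assume ab: "0 < a" "a \<le> b"
  \<comment> \<open>Smooth approximations of |s| whose derivatives have absolute value at most 1 and
    converge to \<open>sgn\<close>, including the value 0 at s = 0.\<close>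
  define \<phi> where "\<phi> n s = sqrt (s\<^sup>2 + 1 / (real n + 1))" for n and s :: real
  define \<phi>' where "\<phi>' n s = s / sqrt (s\<^sup>2 + 1 / (real n + 1))" for n and s :: real
  have pos: "0 < s\<^sup>2 + 1 / (real n + 1)" for n and s :: real by (simp add: add_nonneg_pos)
  have l0: "(\<lambda>n. s\<^sup>2 + 1 / (real n + 1)) \<longlonglongrightarrow> s\<^sup>2 + 0" for s :: real
    by (intro tendsto_add tendsto_const) (use LIMSEQ_inverse_real_of_nat in \<open>simp add: inverse_eq_divide add.commute\<close>)
  have l1: "(\<lambda>n. \<phi> n s) \<longlonglongrightarrow> \<bar>s\<bar>" for s
    using tendsto_real_sqrt[OF l0[of s]] unfolding \<phi>_def by simp
  show "\<bar>g b\<bar> - \<bar>g a\<bar> = (LBINT r:{a..b}. sgn (g r) * c r)"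
  proof (rule profile_compose_limit[OF p ab, of \<phi> \<phi>'])
    show "(\<phi> n has_real_derivative \<phi>' n s) (at s)" for n s
    proof -
      have "((\<lambda>s. s\<^sup>2 + 1 / (real n + 1)) has_real_derivative 2 * s) (at s)"
        by (auto intro!: derivative_eq_intros)
      from DERIV_chain2[where f = sqrt and g = "\<lambda>s. s\<^sup>2 + 1 / (real n + 1)" and x = s, OF DERIV_real_sqrt[OF pos] this]
      have "((\<lambda>s. sqrt (s\<^sup>2 + 1 / (real n + 1))) has_real_derivative
        inverse (sqrt (s\<^sup>2 + 1 / (real n + 1))) / 2 * (2 * s)) (at s)" .
      then show ?thesis unfolding \<phi>_def \<phi>'_def by (rule DERIV_cong) (simp add: inverse_eq_divide)
    qed
    show "continuous_on UNIV (\<phi>' n)" for n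
      unfolding \<phi>'_def by (intro continuous_intros ballI) (use pos[of _ n] in \<open>simp add: less_imp_neq[symmetric]\<close>)
    show "\<bar>\<phi>' n s\<bar> \<le> 1" for n s
    proof -
      have "sqrt (s\<^sup>2) \<le> sqrt (s\<^sup>2 + 1 / (real n + 1))" by (rule real_sqrt_le_mono) simp
      then show ?thesis unfolding \<phi>'_def using pos[of s n] by (simp add: field_simps)
    qed
    show "(\<lambda>n. \<phi>' n s) \<longlonglongrightarrow> sgn s" for s
    proof (cases "s = 0")
      case False
      have "(\<lambda>n. s / \<phi> n s) \<longlonglongrightarrow> s / \<bar>s\<bar>" by (intro tendsto_intros l1) (use False in simp)
      then show ?thesis unfolding \<phi>'_def \<phi>_def by (simp add: real_sgn_eq)
    qed (simp add: \<phi>'_def)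
  qed (rule l1, measurable)
qed

text \<open>Half the sum of g and |g|. Where g = 0 this averages to c/2 instead of the claimed 0,
  which is harmless since c vanishes almost everywhere on the zero set.\<close>

lemma profile_pospart:
  assumes p: "profile d g c"
  shows "profile d (pospart g) (\<lambda>r. if 0 < g r then c r else 0)"
proof (rule profile_cong[OF profile_lincomb[OF p profile_abs[OF p], of "1/2" "1/2"]])
  note [measurable] = profileD(1,2)[OF p]
  show "pospart g \<in> borel_measurable borel" unfolding pospart_def by measurable
  show "(\<lambda>r. if 0 < g r then c r else 0) \<in> borel_measurable borel" by measurable
  show "pospart g r = 1/2 * g r + 1/2 * \<bar>g r\<bar>" for r by (simp add: pospart_def max_def)
  show "AE r in radial d. (if 0 < g r then c r else 0) = 1/2 * c r + 1/2 * (sgn (g r) * c r)"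
    using profile_deriv_zero_on_zero_set[OF p] by eventually_elim (auto simp: sgn_if)
qed

lemma negpart_eq_pospart: "negpart g = pospart (\<lambda>r. - g r)"
  by (simp add: negpart_def pospart_def)

lemma profile_uminus: "profile d g c \<Longrightarrow> profile d (\<lambda>r. - g r) (\<lambda>r. - c r)"
  using profile_scale[of d g c "-1"] by simp

lemma profile_negpart:
  assumes p: "profile d g c"
  shows "profile d (negpart g) (\<lambda>r. if g r < 0 then - c r else 0)"
  using profile_pospart[OF profile_uminus[OF p]] by (simp add: negpart_eq_pospart)

text \<open>Truncation at a zero of g creates no jump, hence no singular part of the
  derivative.\<close>

lemma profile_cut:
  assumes p: "profile d g c" and y: "0 < y" "g y = 0"
  shows "profile d (\<lambda>r. if r < y then g r else 0) (\<lambda>r. if r < y then c r else 0)"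
  unfolding profile_def
proof (intro conjI allI impI)
  note [measurable] = profileD(1,2)[OF p]
  show "(\<lambda>r. if r < y then g r else 0) \<in> borel_measurable borel"
    "(\<lambda>r. if r < y then c r else 0) \<in> borel_measurable borel" by measurable
  show "integrable (radial d) (\<lambda>r. (if r < y then g r else 0)^2)"
    by (rule integrable_bound[OF profileD(3)[OF p]]) auto
  show "integrable (radial d) (\<lambda>r. (if r < y then c r else 0)^2)"
    by (rule integrable_bound[OF profileD(4)[OF p]]) auto
  fix a b :: real assume ab: "0 < a" "a \<le> b"
  have e: "(LBINT r:{a..b}. if r < y then c r else 0) = (LBINT r:{a..min b y}. c r)"
    unfolding set_lebesgue_integral_def
    by (rule integral_cong_AE, measurable)
       (use AE_lborel_singleton[of y] in eventually_elim, auto simp: indicator_def)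
  show "(if b < y then g b else 0) - (if a < y then g a else 0) = (LBINT r:{a..b}. if r < y then c r else 0)"
  proof (cases "a < y")
    case True
    then have "(LBINT r:{a..min b y}. c r) = g (min b y) - g a" using profileD(5)[OF p ab(1), of "min b y"] ab by simp
    then show ?thesis using True y(2) e by (auto simp: min_def)
  next
    case False
    have "AE r in lborel. indicator {a..min b y} r *\<^sub>R c r = 0"
      using AE_lborel_singleton[of y] by eventually_elim (use False in \<open>auto simp: indicator_def\<close>)
    then have "(LBINT r:{a..min b y}. c r) = 0"
      unfolding set_lebesgue_integral_def by (rule integral_eq_zero_AE)
    then show ?thesis using False ab e by simp
  qed
qed

section \<open>The energy form of a profile\<close>

definition profiles :: "nat \<Rightarrow> (real \<Rightarrow> real) set" where
  "profiles d = {g. \<exists>c. profile d g c}"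

text \<open>The squared H^1 norm of the radial function, up to \<open>sphere_area\<close>. The
  choice of derivative is immaterial: by \<open>profile_unique\<close> any two agree almost
  everywhere.\<close>

definition qform :: "nat \<Rightarrow> (real \<Rightarrow> real) \<Rightarrow> real" where
  "qform d g = energy d g (SOME c. profile d g c)"

lemma profilesI: "profile d g c \<Longrightarrow> g \<in> profiles d"
  and profilesE: "g \<in> profiles d \<Longrightarrow> (\<And>c. profile d g c \<Longrightarrow> thesis) \<Longrightarrow> thesis"
  by (auto simp: profiles_def)

lemma qform_eq:
  assumes p: "profile d g c"
  shows "qform d g = energy d g c"
proof -
  have q: "profile d g (SOME c. profile d g c)" using p by (rule someI[of "profile d g"])
  have "(LINT r|radial d. ((SOME c. profile d g c) r)^2) = (LINT r|radial d. (c r)^2)"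
    by (rule integral_cong_AE)
       (use profileD(2)[OF p] profileD(2)[OF q] profile_unique[OF q p] in auto)
  then show ?thesis by (simp add: qform_def)
qed

lemma qform_nonneg: "0 \<le> qform d g"
  unfolding qform_def by (intro add_nonneg_nonneg integral_nonneg) auto

lemma qform_scale:
  assumes "g \<in> profiles d"
  shows "qform d (\<lambda>r. s * g r) = s\<^sup>2 * qform d g" "(\<lambda>r. s * g r) \<in> profiles d"
proof -
  obtain c where c: "profile d g c" using assms by (rule profilesE)
  show "qform d (\<lambda>r. s * g r) = s\<^sup>2 * qform d g"
    by (simp add: qform_eq[OF c] qform_eq[OF profile_scale[OF c]] power_mult_distrib distrib_left)
  show "(\<lambda>r. s * g r) \<in> profiles d" using profile_scale[OF c] by (rule profilesI)
qed

lemma energy_lincomb: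
  assumes g: "profile d g c" and h: "profile d h e"
  shows "energy d (\<lambda>r. s * g r + t * h r) (\<lambda>r. s * c r + t * e r) = s\<^sup>2 * energy d g c
    + 2 * s * t * ((LINT r|radial d. c r * e r) + (LINT r|radial d. g r * h r)) + t\<^sup>2 * energy d h e"
  using integrable_square_lincomb(2)[of g "radial d" h s t] integrable_square_lincomb(2)[of c "radial d" e s t]
    profileD(1-4)[OF g] profileD(1-4)[OF h]
  by (simp add: algebra_simps)

lemma qform_parallelogram:
  assumes "g \<in> profiles d" "h \<in> profiles d"
  shows "qform d (\<lambda>r. g r - h r) + 4 * qform d (\<lambda>r. (g r + h r) / 2) = 2 * qform d g + 2 * qform d h"
proof -
  obtain c e where c: "profile d g c" and e: "profile d h e" using assms by (auto elim!: profilesE)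
  have 1: "qform d (\<lambda>r. g r - h r) = energy d (\<lambda>r. 1 * g r + (-1) * h r) (\<lambda>r. 1 * c r + (-1) * e r)"
    using qform_eq[OF profile_lincomb[OF c e, of 1 "-1"]] by simp
  have 2: "qform d (\<lambda>r. (g r + h r) / 2) = energy d (\<lambda>r. 1/2 * g r + 1/2 * h r) (\<lambda>r. 1/2 * c r + 1/2 * e r)"
    using qform_eq[OF profile_lincomb[OF c e, of "1/2" "1/2"]] by (simp add: add_divide_distrib)
  show ?thesis unfolding 1 2 energy_lincomb[OF c e] qform_eq[OF c] qform_eq[OF e]
    by (simp add: power2_eq_square algebra_simps)
qed

lemma profiles_lincomb:
  assumes "g \<in> profiles d" "h \<in> profiles d"
  shows "(\<lambda>r. s * g r + t * h r) \<in> profiles d"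
  using assms unfolding profiles_def by (blast intro: profile_lincomb)

lemma profiles_parts:
  assumes "g \<in> profiles d"
  shows "pospart g \<in> profiles d" "negpart g \<in> profiles d"
  using assms unfolding profiles_def by (blast intro: profile_pospart profile_negpart)+

text \<open>The signed parts have disjoint supports, and the zero set of g carries no derivative, so
  no energy is lost in the splitting.\<close>

lemma qform_parts:
  assumes "g \<in> profiles d"
  shows "qform d g = qform d (pospart g) + qform d (negpart g)"
proof -
  obtain c where p: "profile d g c" using assms by (rule profilesE)
  note [measurable] = profileD(1,2)[OF p]
  note P = profile_pospart[OF p] and N = profile_negpart[OF p]
  have "(LINT r|radial d. (c r)^2) = (LINT r|radial d. (if 0 < g r then c r else 0)^2 + (if g r < 0 then - c r else 0)^2)"
    by (rule integral_cong_AE, simp, simp) (use profile_deriv_zero_on_zero_set[OF p] in eventually_elim, auto)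
  also have "\<dots> = (LINT r|radial d. (if 0 < g r then c r else 0)^2) + (LINT r|radial d. (if g r < 0 then - c r else 0)^2)"
    by (rule Bochner_Integration.integral_add[OF profileD(4)[OF P] profileD(4)[OF N]])
  moreover have "(LINT r|radial d. (g r)^2) = (LINT r|radial d. (pospart g r)^2 + (negpart g r)^2)"
    by (rule integral_cong) (auto simp: pospart_def negpart_def max_def)
  moreover have "\<dots> = (LINT r|radial d. (pospart g r)^2) + (LINT r|radial d. (negpart g r)^2)"
    by (rule Bochner_Integration.integral_add[OF profileD(3)[OF P] profileD(3)[OF N]])
  ultimately show ?thesis unfolding qform_eq[OF p] qform_eq[OF P] qform_eq[OF N] by simp
qed

lemma integral_Fatou_bound:
  fixes f :: "nat \<Rightarrow> 'b \<Rightarrow> real"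
  assumes [measurable]: "\<And>n. integrable M (f n)" "h \<in> borel_measurable M"
    and nn: "\<And>n x. 0 \<le> f n x" and lim: "AE x in M. (\<lambda>n. f n x) \<longlonglongrightarrow> h x"
    and C: "\<forall>\<^sub>F n in sequentially. integral\<^sup>L M (f n) \<le> C" and h: "\<And>x. 0 \<le> h x"
  shows "integrable M h" "integral\<^sup>L M h \<le> C"
proof -
  have "\<forall>\<^sub>F n in sequentially. 0 \<le> C"
    using C by eventually_elim (meson integral_nonneg nn order_trans)
  then have C0: "0 \<le> C" by simp
  have "(\<integral>\<^sup>+x. ennreal (h x) \<partial>M) = (\<integral>\<^sup>+x. liminf (\<lambda>n. ennreal (f n x)) \<partial>M)"
    by (rule nn_integral_cong_AE) (use lim in eventually_elim, auto intro!: lim_imp_Liminf[symmetric])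
  also have "\<dots> \<le> liminf (\<lambda>n. \<integral>\<^sup>+x. ennreal (f n x) \<partial>M)" by (rule nn_integral_liminf) auto
  also have "\<dots> \<le> ennreal C"
  proof -
    have "\<forall>\<^sub>F n in sequentially. (\<integral>\<^sup>+x. ennreal (f n x) \<partial>M) \<le> ennreal C"
      using C by eventually_elim (simp add: nn_integral_eq_integral nn assms(1) ennreal_leI)
    then show ?thesis by (rule Liminf_le[rotated]) simp
  qed
  finally have b: "(\<integral>\<^sup>+x. ennreal (h x) \<partial>M) \<le> ennreal C" .
  show i: "integrable M h"
    using b by (intro integrableI_nonneg) (auto simp: h less_top[symmetric] top_unique)
  have "ennreal (integral\<^sup>L M h) \<le> ennreal C"
    using b nn_integral_eq_integral[OF i] h by simp
  then show "integral\<^sup>L M h \<le> C" using C0 by (simp add: ennreal_le_iff)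
qed

section \<open>Compactness of profiles\<close>

text \<open>Weak lower semicontinuity without weak topologies: elements of almost minimal derivative norm in
  the midpoint hulls of the tails form an \<open>L\<^sup>2\<close> Cauchy sequence by the parallelogram law.\<close>
inductive midhull :: "(nat \<Rightarrow> real \<Rightarrow> real) \<Rightarrow> (nat \<Rightarrow> real \<Rightarrow> real) \<Rightarrow> nat \<Rightarrow> (real \<Rightarrow> real) \<Rightarrow> (real \<Rightarrow> real) \<Rightarrow> bool"
  for g c N where
  base: "N \<le> n \<Longrightarrow> midhull g c N (g n) (c n)"
| mid: "midhull g c N a b \<Longrightarrow> midhull g c N a' b' \<Longrightarrow>
    midhull g c N (\<lambda>r. 1/2 * a r + 1/2 * a' r) (\<lambda>r. 1/2 * b r + 1/2 * b' r)"

lemma midhull_antimono: "midhull g c M a b \<Longrightarrow> N \<le> M \<Longrightarrow> midhull g c N a b"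
proof (induction rule: midhull.induct)
  case (mid a b a' b')
  then show ?case by (intro midhull.mid) auto
qed (auto intro: midhull.base)

lemma midhull_bounds:
  assumes "midhull g c N a b" and "\<And>n. N \<le> n \<Longrightarrow> lo \<le> g n r \<and> g n r \<le> hi"
  shows "lo \<le> a r \<and> a r \<le> hi"
  using assms(1)
proof (induction rule: midhull.induct)
  case (mid a b a' b')
  then show ?case by (auto simp: field_simps)
qed (use assms(2) in auto)

lemma midhull_profile:
  assumes "midhull g c N a b" and p: "\<And>n. profile d (g n) (c n)" and K: "\<And>n. energy d (g n) (c n) \<le> K"
  shows "profile d a b \<and> energy d a b \<le> K"
  using assms(1)
proof (induction rule: midhull.induct)
  case (mid a b a' b')
  then have A: "profile d a b" and A': "profile d a' b'" and k: "energy d a b \<le> K" "energy d a' b' \<le> K" by auto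
  \<comment> \<open>Convexity: nonnegative energy of the half difference bounds the cross term, so a
    midpoint has at most the mean of the two energies.\<close>
  have "0 \<le> energy d (\<lambda>r. 1/2 * a r + (-1/2) * a' r) (\<lambda>r. 1/2 * b r + (-1/2) * b' r)"
    by (intro add_nonneg_nonneg integral_nonneg) auto
  then have "energy d (\<lambda>r. 1/2 * a r + 1/2 * a' r) (\<lambda>r. 1/2 * b r + 1/2 * b' r) \<le> K"
    using k unfolding energy_lincomb[OF A A'] by (simp add: power2_eq_square field_simps)
  then show ?case using profile_lincomb[OF A A'] by blast
qed (use p K in auto)

text \<open>The selected hull elements \<open>A N\<close> still converge pointwise to h, since they
  lie between the bounds of the tails, and their derivatives \<open>B N\<close> converge in the
  weighted L^2 space. Hence the limit e of the derivatives is the derivative of h, and Fatou's lemma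
  for the functions completes the energy bound.\<close>

lemma profile_lsc:
  assumes p: "\<And>n. profile d (g n) (c n)" and K: "\<And>n. energy d (g n) (c n) \<le> K"
    and lim: "\<And>r. 0 < r \<Longrightarrow> (\<lambda>n. g n r) \<longlonglongrightarrow> h r" and h[measurable]: "h \<in> borel_measurable borel"
  shows "\<exists>e. profile d h e \<and> energy d h e \<le> K"
proof -
  let ?M = "radial d"
  define D where "D b = (LINT r|?M. (b r)^2)" for b :: "real \<Rightarrow> real"
  have Dnn: "0 \<le> D b" for b unfolding D_def by (rule integral_nonneg) auto
  \<comment> \<open>Least derivative norm over the hull of the tail from N on. Tails shrink, so
    \<delta> increases; it is bounded by K and thus converges.\<close>
  define \<delta> where "\<delta> N = (INF ab\<in>{(a, b). midhull g c N a b}. D (snd ab))" for N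
  have bdd: "bdd_below ((\<lambda>ab. D (snd ab)) ` {(a, b). midhull g c N a b})" for N
    by (rule bdd_belowI[of _ 0]) (use Dnn in auto)
  have ne: "{(a, b). midhull g c N a b} \<noteq> {}" for N using midhull.base[of N N g c] by auto
  have \<delta>le: "\<delta> N \<le> D b" if "midhull g c N a b" for N a b
    unfolding \<delta>_def using cINF_lower[OF bdd, of "(a, b)" N] that by simp
  have "\<exists>a b. midhull g c N a b \<and> D b < \<delta> N + 1 / (real N + 1)" for N
  proof -
    have "\<exists>ab\<in>{(a, b). midhull g c N a b}. D (snd ab) < \<delta> N + 1 / (real N + 1)"
      by (subst cINF_less_iff[OF ne bdd, symmetric]) (simp add: \<delta>_def)
    then obtain ab where "ab \<in> {(a, b). midhull g c N a b}" "D (snd ab) < \<delta> N + 1 / (real N + 1)"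
      by (elim bexE)
    then show ?thesis by (cases ab) auto
  qed
  then obtain A B where AB: "\<And>N. midhull g c N (A N) (B N)" "\<And>N. D (B N) < \<delta> N + 1 / (real N + 1)"
    by metis
  have pAB: "profile d (A N) (B N)" and KAB: "energy d (A N) (B N) \<le> K" for N
    using midhull_profile[OF AB(1) p K] by auto
  note [measurable] = profileD(1,2)[OF pAB]
  have \<delta>K: "\<delta> N \<le> K" for N
  proof -
    have "0 \<le> (LINT r|?M. (A N r)^2)" by (rule integral_nonneg) auto
    then show ?thesis using \<delta>le[OF AB(1)[of N]] KAB[of N] unfolding D_def by linarith
  qed
  have inc: "incseq \<delta>"
  proof (rule incseq_SucI)
    fix N
    show "\<delta> N \<le> \<delta> (Suc N)"
      unfolding \<delta>_def[of "Suc N"]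
    proof (rule cINF_greatest[OF ne])
      fix ab assume "ab \<in> {(a, b). midhull g c (Suc N) a b}"
      then have "midhull g c (Suc N) (fst ab) (snd ab)" by (simp add: case_prod_unfold)
      from \<delta>le[OF midhull_antimono[OF this, of N]] show "\<delta> N \<le> D (snd ab)" by simp
    qed
  qed
  obtain L where L: "\<delta> \<longlonglongrightarrow> L" "\<And>N. \<delta> N \<le> L" using incseq_convergent[OF inc] \<delta>K by metis
  \<comment> \<open>The midpoint of two selected elements again lies in the hull of the tail N, so
    its derivative norm is at least \<delta> N; the parallelogram law then leaves only the gap L -
    \<delta> N and the selection error.\<close>
  have cau: "D (\<lambda>r. B m r - B n r) \<le> 4 * (L - \<delta> N) + 4 / (real N + 1)" if "N \<le> m" "N \<le> n" for N m n
  proof -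
    have "midhull g c N (\<lambda>r. 1/2 * A m r + 1/2 * A n r) (\<lambda>r. 1/2 * B m r + 1/2 * B n r)"
      by (rule midhull.mid) (use that AB(1) in \<open>auto intro: midhull_antimono\<close>)
    then have 1: "\<delta> N \<le> D (\<lambda>r. 1/2 * B m r + 1/2 * B n r)" by (rule \<delta>le)
    note i = profileD(4)[OF pAB]
    have 2: "D (\<lambda>r. B m r - B n r) = 2 * D (B m) + 2 * D (B n) - 4 * D (\<lambda>r. 1/2 * B m r + 1/2 * B n r)"
      using integrable_square_lincomb(2)[OF _ _ i i, of m n 1 "-1"] integrable_square_lincomb(2)[OF _ _ i i, of m n "1/2" "1/2"]
      unfolding D_def by (simp add: power2_eq_square)
    have "1 / (real m + 1) \<le> 1 / (real N + 1)" "1 / (real n + 1) \<le> 1 / (real N + 1)"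
      using that by (auto intro!: divide_left_mono)
    moreover have "D (B m) \<le> L + 1 / (real m + 1)" "D (B n) \<le> L + 1 / (real n + 1)"
      using AB(2)[of m] AB(2)[of n] L(2)[of m] L(2)[of n] by linarith+
    ultimately have 3: "D (B m) \<le> L + 1 / (real N + 1)" "D (B n) \<le> L + 1 / (real N + 1)" by linarith+
    have "2 * x + 2 * y - 4 * z \<le> 4 * (L - l) + 4 * q" if "x \<le> L + q" "y \<le> L + q" "l \<le> z" for x y z q l :: real
      using that by (simp add: algebra_simps)
    from this[OF 3 1] show ?thesis unfolding 2 by simp
  qed
  have cauB: "\<exists>N. \<forall>m\<ge>N. \<forall>n\<ge>N. (LINT r|?M. (B m r - B n r)^2) \<le> \<epsilon>" if \<epsilon>: "\<epsilon> > 0" for \<epsilon>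
  proof -
    have "(\<lambda>N. 4 * (L - \<delta> N) + 4 * (1 / (real N + 1))) \<longlonglongrightarrow> 4 * (L - L) + 4 * 0"
      by (intro tendsto_intros L) (use LIMSEQ_inverse_real_of_nat in \<open>simp add: inverse_eq_divide add.commute\<close>)
    then have "\<forall>\<^sub>F N in sequentially. 4 * (L - \<delta> N) + 4 * (1 / (real N + 1)) < \<epsilon>"
      by (intro order_tendstoD(2)) (use \<epsilon> in auto)
    then obtain N where "4 * (L - \<delta> N) + 4 / (real N + 1) < \<epsilon>"
      by (auto dest!: eventually_happens)
    then show ?thesis using cau[of N] unfolding D_def by (meson less_imp_le order_trans)
  qed
  have Bm: "B n \<in> borel_measurable ?M" for n using profileD(2)[OF pAB] by simp
  obtain e where e[measurable]: "e \<in> borel_measurable ?M" and ei: "integrable ?M (\<lambda>r. (e r)^2)"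
    and elim: "(\<lambda>n. LINT r|?M. (B n r - e r)^2) \<longlonglongrightarrow> 0"
    by (rule L2_complete[OF Bm profileD(4)[OF pAB] cauB], assumption) (rule that)
  have eb: "e \<in> borel_measurable borel" using e by simp
  have Ah: "(\<lambda>n. A n r) \<longlonglongrightarrow> h r" if r: "0 < r" for r
  proof (rule LIMSEQ_I)
    fix \<epsilon> :: real assume \<epsilon>: "0 < \<epsilon>"
    then obtain N where N: "\<And>n. N \<le> n \<Longrightarrow> \<bar>g n r - h r\<bar> < \<epsilon> / 2"
      using LIMSEQ_D[OF lim[OF r], of "\<epsilon> / 2"] by auto
    have "\<bar>A n r - h r\<bar> < \<epsilon>" if "N \<le> n" for n
    proof -
      have "h r - \<epsilon> / 2 \<le> A n r \<and> A n r \<le> h r + \<epsilon> / 2"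
      proof (rule midhull_bounds[OF AB(1)])
        fix k assume "n \<le> k"
        then show "h r - \<epsilon> / 2 \<le> g k r \<and> g k r \<le> h r + \<epsilon> / 2" using N[of k] that by linarith
      qed
      then show ?thesis using \<epsilon> by linarith
    qed
    then show "\<exists>no. \<forall>n\<ge>no. norm (A n r - h r) < \<epsilon>" by auto
  qed
  have di: "integrable ?M (\<lambda>r. (B n r - e r)^2)" for n
    using integrable_square_lincomb(1)[OF _ _ profileD(4)[OF pAB] ei, of n 1 "-1"] eb by simp
  have FTC: "h b - h a = (LBINT r:{a..b}. e r)" if ab: "0 < a" "a \<le> b" for a b
  proof -
    define k where "k = (LBINT r:{a..b}. (1/r) ^ (d - 1))"
    note ie = radial_L2_interval(1)[OF eb ei ab(1), of b]
    have sq: "((A n b - A n a) - (LBINT r:{a..b}. e r))^2 \<le> (LINT r|?M. (B n r - e r)^2) * k" for n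
    proof -
      have "(A n b - A n a) - (LBINT r:{a..b}. e r) = (LBINT r:{a..b}. B n r - e r)"
        using profileD(5)[OF pAB[of n] ab] profile_FTC_set_integrable[OF pAB[of n] ab(1), of b] ie by simp
      then show ?thesis using radial_L2_interval(2)[OF _ di[of n] ab(1), of b] eb unfolding k_def by simp
    qed
    have "(\<lambda>n. ((A n b - A n a) - (LBINT r:{a..b}. e r))^2) \<longlonglongrightarrow> 0"
    proof (rule tendsto_sandwich[of "\<lambda>_. 0" _ _ "\<lambda>n. (LINT r|?M. (B n r - e r)^2) * k"])
      show "(\<lambda>n. (LINT r|?M. (B n r - e r)^2) * k) \<longlonglongrightarrow> 0"
        using tendsto_mult_right[OF elim, of k] by simp
    qed (use sq in auto)
    moreover have "(\<lambda>n. ((A n b - A n a) - (LBINT r:{a..b}. e r))^2) \<longlonglongrightarrow> ((h b - h a) - (LBINT r:{a..b}. e r))^2"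
      by (intro tendsto_intros Ah) (use ab in auto)
    ultimately have "((h b - h a) - (LBINT r:{a..b}. e r))^2 = 0" using LIMSEQ_unique by blast
    then show ?thesis by simp
  qed
  have Dlim: "(\<lambda>n. D (B n)) \<longlonglongrightarrow> D e"
  proof -
    have eq: "D (B n) = D e + 2 * (LINT r|?M. e r * (B n r - e r)) + (LINT r|?M. (B n r - e r)^2)" for n
      using integrable_square_lincomb(2)[OF _ _ ei di, of n 1 1] eb unfolding D_def by simp
    have "(\<lambda>n. (LINT r|?M. e r * (B n r - e r))^2) \<longlonglongrightarrow> 0"
    proof (rule tendsto_sandwich[of "\<lambda>_. 0" _ _ "\<lambda>n. D e * (LINT r|?M. (B n r - e r)^2)"])
      show "(\<lambda>n. D e * (LINT r|?M. (B n r - e r)^2)) \<longlonglongrightarrow> 0"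
        using tendsto_mult_left[OF elim, of "D e"] by simp
    qed (use Cauchy_Schwarz_integral[OF _ _ ei di] eb in \<open>auto simp: D_def\<close>)
    from tendsto_real_sqrt[OF this] have "(\<lambda>n. LINT r|?M. e r * (B n r - e r)) \<longlonglongrightarrow> 0"
      by (simp add: tendsto_rabs_zero_iff)
    then have "(\<lambda>n. D e + 2 * (LINT r|?M. e r * (B n r - e r)) + (LINT r|?M. (B n r - e r)^2)) \<longlonglongrightarrow> D e + 2 * 0 + 0"
      by (intro tendsto_intros elim)
    then show ?thesis by (simp add: eq)
  qed
  \<comment> \<open>The energy bound leaves at most K - D (B n) for the norm of A n itself, and D (B
    n) tends to D e. Fatou thus yields the bound for the sum of both terms, not for each
    separately.\<close>
  have F: "integrable ?M (\<lambda>r. (h r)^2)" "(LINT r|?M. (h r)^2) \<le> K - D e + \<epsilon>" if "\<epsilon> > 0" for \<epsilon>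
  proof -
    have "\<forall>\<^sub>F n in sequentially. D e - \<epsilon> < D (B n)" by (rule order_tendstoD(1)[OF Dlim]) (use that in simp)
    then have ev: "\<forall>\<^sub>F n in sequentially. (LINT r|?M. (A n r)^2) \<le> K - D e + \<epsilon>"
    proof eventually_elim
      case (elim n)
      then show ?case using KAB[of n] unfolding D_def by linarith
    qed
    have "AE r in ?M. (\<lambda>n. (A n r)^2) \<longlonglongrightarrow> (h r)^2"
      by (rule AE_radialI) (intro tendsto_intros Ah)
    from integral_Fatou_bound[OF profileD(3)[OF pAB] _ _ this ev]
    show "integrable ?M (\<lambda>r. (h r)^2)" "(LINT r|?M. (h r)^2) \<le> K - D e + \<epsilon>" by auto
  qed
  have "profile d h e"
    unfolding profile_def using F(1)[of 1] FTC eb ei by auto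
  moreover have "(LINT r|?M. (h r)^2) \<le> K - D e" by (rule field_le_epsilon) (rule F(2))
  ultimately show ?thesis unfolding D_def by force
qed

text \<open>A diagonal subsequence converges at all positive rationals; equicontinuity at x, uniform
  in the sequence, carries the Cauchy property from a nearby rational to x.\<close>

lemma profile_pointwise_compact:
  fixes g c :: "nat \<Rightarrow> real \<Rightarrow> real"
  assumes p: "\<And>n. profile d (g n) (c n)" and K: "\<And>n. energy d (g n) (c n) \<le> K"
  shows "\<exists>\<rho> h. strict_mono \<rho> \<and> h \<in> borel_measurable borel \<and> (\<forall>r>0. (\<lambda>n. g (\<rho> n) r) \<longlonglongrightarrow> h r)"
proof -
  have K0: "0 \<le> K"
    by (rule order_trans[OF _ K[of 0]]) (intro add_nonneg_nonneg integral_nonneg, auto)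
  \<comment> \<open>The decay bound depends on r, whereas the diagonal extraction asks for a uniform
    bound, so values are divided by \<open>m r\<close>. The summand 1 keeps the divisor
    positive.\<close>
  define m where "m r = 1 + sqrt (4 * K * (1/r) ^ (d - 1))" for r
  have m: "0 < m r" if "0 < r" for r
    unfolding m_def using that K0 by (intro add_pos_nonneg) auto
  have bd: "\<bar>g n r\<bar> \<le> m r" if r: "0 < r" for n r
  proof -
    have "(g n r)^2 \<le> 4 * energy d (g n) (c n) * (1/r) ^ (d - 1)" by (rule profile_decay[OF p r])
    also have "\<dots> \<le> 4 * K * (1/r) ^ (d - 1)" using K[of n] r by (intro mult_right_mono) auto
    finally have "sqrt ((g n r)^2) \<le> sqrt (4 * K * (1/r) ^ (d - 1))" by (rule real_sqrt_le_mono)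
    then show ?thesis by (simp add: m_def)
  qed
  define S :: "real set" where "S = {0<..} \<inter> \<rat>"
  have "countable S" unfolding S_def by (intro countable_Int2 countable_rat)
  moreover have "norm (g n r / m r) \<le> 1" if "r \<in> S" for n r
    using bd[of r n] m[of r] that by (auto simp: S_def)
  ultimately obtain \<rho> :: "nat \<Rightarrow> nat" where \<rho>: "strict_mono \<rho>" "\<And>r. r \<in> S \<Longrightarrow> \<exists>l. (\<lambda>n. g (\<rho> n) r / m r) \<longlonglongrightarrow> l"
    using function_convergent_subsequence[of S "\<lambda>n r. g n r / m r" 1] by blast
  have S: "convergent (\<lambda>n. g (\<rho> n) r)" if r: "r \<in> S" for r
  proof -
    obtain l where "(\<lambda>n. g (\<rho> n) r / m r) \<longlonglongrightarrow> l" using \<rho>(2)[OF r] by blast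
    then have "(\<lambda>n. m r * (g (\<rho> n) r / m r)) \<longlonglongrightarrow> m r * l" by (rule tendsto_mult_left)
    then show ?thesis using m[of r] r unfolding S_def convergent_def by auto
  qed
  have conv: "convergent (\<lambda>n. g (\<rho> n) x)" if x: "0 < x" for x
  proof -
    have "Cauchy (\<lambda>n. g (\<rho> n) x)"
    proof (rule metric_CauchyI)
      fix \<epsilon> :: real assume \<epsilon>: "0 < \<epsilon>"
      define C where "C = K * (2/x) ^ (d - 1) + 1"
      have C: "0 < C" using K0 x by (simp add: C_def add_nonneg_pos)
      \<comment> \<open>Inverts the Hoelder estimate of order 1/2: points closer than \<eta> have
        values closer than \<epsilon>/3, for all members of the sequence.\<close>
      define \<eta> where "\<eta> = (\<epsilon> / 3)^2 / C"
      have "x < x + \<eta>" using C \<epsilon> by (simp add: \<eta>_def)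
      then obtain y where y: "y \<in> \<rat>" "x < y" "y < x + \<eta>" using Rats_dense_in_real by blast
      have near: "\<bar>g n y - g n x\<bar> < \<epsilon> / 3" for n
      proof -
        have "(g n y - g n x)^2 \<le> (LINT r|radial d. (c n r)^2) * (2/x) ^ (d - 1) * \<bar>y - x\<bar>"
          by (rule profile_equicontinuous[OF p x]) (use x y in auto)
        also have "\<dots> \<le> C * \<bar>y - x\<bar>"
        proof (rule mult_right_mono)
          have "0 \<le> (LINT r|radial d. (g n r)^2)" by (rule integral_nonneg) auto
          then have "(LINT r|radial d. (c n r)^2) \<le> K" using K[of n] by linarith
          then have "(LINT r|radial d. (c n r)^2) * (2/x) ^ (d - 1) \<le> K * (2/x) ^ (d - 1)"
            using x by (intro mult_right_mono) auto
          then show "(LINT r|radial d. (c n r)^2) * (2/x) ^ (d - 1) \<le> C" unfolding C_def by linarith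
        qed simp
        also have "\<dots> < C * \<eta>" using C y by (intro mult_strict_left_mono) auto
        also have "\<dots> = (\<epsilon> / 3)^2" using C by (simp add: \<eta>_def)
        finally show ?thesis using \<epsilon> power2_less_imp_less[of "\<bar>g n y - g n x\<bar>" "\<epsilon>/3"] by simp
      qed
      have "Cauchy (\<lambda>n. g (\<rho> n) y)"
        using S[of y] y x unfolding S_def by (auto intro: convergent_Cauchy)
      then obtain N where N: "\<And>m n. N \<le> m \<Longrightarrow> N \<le> n \<Longrightarrow> \<bar>g (\<rho> m) y - g (\<rho> n) y\<bar> < \<epsilon> / 3"
        using \<epsilon> unfolding Cauchy_def dist_real_def by (metis divide_pos_pos zero_less_numeral)
      show "\<exists>M. \<forall>m\<ge>M. \<forall>n\<ge>M. dist (g (\<rho> m) x) (g (\<rho> n) x) < \<epsilon>"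
      proof (intro exI allI impI)
        fix m n assume "N \<le> m" "N \<le> n"
        then show "dist (g (\<rho> m) x) (g (\<rho> n) x) < \<epsilon>"
          using N[of m n] near[of "\<rho> m"] near[of "\<rho> n"] unfolding dist_real_def by linarith
      qed
    qed
    then show ?thesis by (simp add: Cauchy_convergent_iff)
  qed
  note [measurable] = profileD(1)[OF p]
  define h where "h r = (if 0 < r then lim (\<lambda>n. g (\<rho> n) r) else 0)" for r
  have "h \<in> borel_measurable borel" unfolding h_def by measurable
  moreover have "\<forall>r>0. (\<lambda>n. g (\<rho> n) r) \<longlonglongrightarrow> h r"
    using conv by (simp add: h_def convergent_LIMSEQ_iff)
  ultimately show ?thesis using \<rho>(1) by blast
qed

lemma qform_lsc:
  assumes g: "\<And>n. g n \<in> profiles d" and K: "\<forall>\<^sub>F n in sequentially. qform d (g n) \<le> K"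
    and lim: "\<And>r. 0 < r \<Longrightarrow> (\<lambda>n. g n r) \<longlonglongrightarrow> h r" and h: "h \<in> borel_measurable borel"
  shows "h \<in> profiles d" "qform d h \<le> K"
proof -
  have "\<forall>n. \<exists>c. profile d (g n) c" using g by (simp add: profiles_def)
  from choice[OF this] obtain c where c: "\<And>n. profile d (g n) (c n)" by blast
  obtain N where N: "\<And>n. N \<le> n \<Longrightarrow> qform d (g n) \<le> K" using K unfolding eventually_sequentially by blast
  have "\<exists>e. profile d h e \<and> energy d h e \<le> K"
  proof (rule profile_lsc[of d "\<lambda>n. g (n + N)" "\<lambda>n. c (n + N)"])
    show "energy d (g (n + N)) (c (n + N)) \<le> K" for n using N[of "n + N"] qform_eq[OF c] by simp
    show "(\<lambda>n. g (n + N) r) \<longlonglongrightarrow> h r" if "0 < r" for r using lim[OF that] by (rule LIMSEQ_ignore_initial_segment)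
  qed (use c h in auto)
  then obtain e where e: "profile d h e" "energy d h e \<le> K" by blast
  show "h \<in> profiles d" using e(1) by (rule profilesI)
  show "qform d h \<le> K" using e qform_eq[OF e(1)] by simp
qed

text \<open>Convergence of norms plus lower semicontinuity at the midpoints of g n and h: the
  parallelogram law bounds the energy of the difference by 2 (\<epsilon>/8) + 4 (\<epsilon>/8),
  which is below \<epsilon>.\<close>

lemma qform_tendsto_strong:
  assumes g: "\<And>n. g n \<in> profiles d" and h: "h \<in> profiles d"
    and Q: "(\<lambda>n. qform d (g n)) \<longlonglongrightarrow> qform d h" and lim: "\<And>r. 0 < r \<Longrightarrow> (\<lambda>n. g n r) \<longlonglongrightarrow> h r"
  shows "(\<lambda>n. qform d (\<lambda>r. g n r - h r)) \<longlonglongrightarrow> 0"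
proof (rule LIMSEQ_I)
  fix \<epsilon> :: real assume \<epsilon>: "0 < \<epsilon>"
  have hb: "h \<in> borel_measurable borel" using h profileD(1) by (auto elim: profilesE)
  have mid: "(\<lambda>r. (g n r + h r) / 2) \<in> profiles d" for n
    using profiles_lincomb[OF g[of n] h, of "1/2" "1/2"] by (simp add: add_divide_distrib)
  \<comment> \<open>Otherwise infinitely many midpoints have too little energy; along that
    subsequence they still converge pointwise to h, against lower semicontinuity.\<close>
  have ev: "\<forall>\<^sub>F n in sequentially. qform d h - \<epsilon> / 8 < qform d (\<lambda>r. (g n r + h r) / 2)"
  proof (rule ccontr)
    assume "\<not> ?thesis"
    then have "\<exists>\<^sub>F n in sequentially. qform d (\<lambda>r. (g n r + h r) / 2) \<le> qform d h - \<epsilon> / 8"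
      by (simp add: frequently_def not_le)
    then have "infinite {n. qform d (\<lambda>r. (g n r + h r) / 2) \<le> qform d h - \<epsilon> / 8}"
      by (simp add: frequently_cofinite flip: cofinite_eq_sequentially)
    then obtain \<rho> :: "nat \<Rightarrow> nat" where \<rho>: "strict_mono \<rho>" "\<And>n. qform d (\<lambda>r. (g (\<rho> n) r + h r) / 2) \<le> qform d h - \<epsilon> / 8"
      using infinite_enumerate[of "{n. qform d (\<lambda>r. (g n r + h r) / 2) \<le> qform d h - \<epsilon> / 8}"] by auto
    have "qform d h \<le> qform d h - \<epsilon> / 8"
    proof (rule qform_lsc(2)[of "\<lambda>n r. (g (\<rho> n) r + h r) / 2"])
      show "(\<lambda>n. (g (\<rho> n) r + h r) / 2) \<longlonglongrightarrow> h r" if "0 < r" for r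
      proof -
        have "(\<lambda>n. (g (\<rho> n) r + h r) / 2) \<longlonglongrightarrow> (h r + h r) / 2"
          using LIMSEQ_subseq_LIMSEQ[OF lim[OF that] \<rho>(1)] by (intro tendsto_intros) (auto simp: o_def)
        then show ?thesis by simp
      qed
    qed (use mid \<rho>(2) hb in auto)
    then show False using \<epsilon> by simp
  qed
  have "\<forall>\<^sub>F n in sequentially. qform d (g n) < qform d h + \<epsilon> / 8" by (rule order_tendstoD(2)[OF Q]) (use \<epsilon> in simp)
  with ev have "\<forall>\<^sub>F n in sequentially. norm (qform d (\<lambda>r. g n r - h r) - 0) < \<epsilon>"
  proof eventually_elim
    case (elim n)
    then show ?case using qform_parallelogram[OF g[of n] h] qform_nonneg[of d "\<lambda>r. g n r - h r"] \<epsilon> by simp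
  qed
  then show "\<exists>no. \<forall>n\<ge>no. norm (qform d (\<lambda>r. g n r - h r) - 0) < \<epsilon>" by (simp add: eventually_sequentially)
qed

section \<open>The nonlinearity\<close>

lemma Fprim_DERIV:
  assumes "continuous_on UNIV f"
  shows "(Fprim f has_real_derivative f s) (at s)"
proof -
  define M where "M = \<bar>s\<bar> + 1"
  have "((\<lambda>u. LBINT y=0..u. f y) has_vector_derivative f s) (at s within {-M..M})"
    using interval_integral_FTC2[of "-M" 0 M f s] continuous_on_subset[OF assms]
    by (auto simp: M_def zero_ereal_def)
  moreover have "at s within {-M..M} = at s"
    by (rule at_within_interior) (auto simp: M_def)
  ultimately show ?thesis
    by (simp add: has_real_derivative_iff_has_vector_derivative Fprim_def[abs_def])
qed

text \<open>Profiles of bounded energy are O(r^(-\<kappa>/2)) at the origin. The second condition on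
  \<kappa> makes this bound true, the last one makes the p+1 power integrable against r^(d-1);
  \<open>subcritical_exponent\<close> shows that both can be met.\<close>

locale nonlinearity =
  fixes d :: nat and f :: "real \<Rightarrow> real" and p C\<^sub>0 R\<^sub>0 \<theta> \<kappa> :: real
  assumes d2: "2 \<le> d" and cont_f: "continuous_on UNIV f" and odd_f: "\<And>s. f (- s) = - f s"
    and p1: "1 < p" and growth_f: "\<And>s. R\<^sub>0 \<le> \<bar>s\<bar> \<Longrightarrow> \<bar>f s\<bar> \<le> C\<^sub>0 * \<bar>s\<bar> powr p"
    and lim_f: "((\<lambda>s. f s / s) \<longlongrightarrow> 0) (at 0)"
    and mono_f: "strict_mono_on {0<..} (\<lambda>s. f s / s)"
    and \<theta>2: "2 < \<theta>" and AR: "\<And>s. 0 < s \<Longrightarrow> \<theta> * Fprim f s < s * f s"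
    and \<kappa>: "0 < \<kappa>" "real d - 2 \<le> \<kappa>" "(p + 1) / 2 * \<kappa> < d"
begin

abbreviation "\<mu> \<equiv> radial d"
abbreviation "F \<equiv> Fprim f"

lemma f_zero [simp]: "f 0 = 0"
  using odd_f[of 0] by simp

lemma ratio_less: "0 < s \<Longrightarrow> s < t \<Longrightarrow> f s / s < f t / t"
  using mono_f by (auto simp: strict_mono_on_def)

text \<open>The increasing quotient f(s)/s has limit 0 at 0, so it is nonnegative at s/2 and
  strictly larger at s.\<close>

lemma f_pos:
  assumes s: "0 < s"
  shows "0 < f s"
proof -
  have "\<forall>\<^sub>F t in at_right 0. f t / t \<le> f (s/2) / (s/2)"
    using ratio_less[of _ "s/2"] s
    by (auto simp: eventually_at_right intro!: exI[of _ "s/2"] less_imp_le)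
  then have "0 \<le> f (s/2) / (s/2)"
    by (rule tendsto_upperbound[rotated]) (auto intro: tendsto_within_subset[OF lim_f])
  also have "\<dots> < f s / s" using s by (intro ratio_less) auto
  finally show ?thesis using s by (simp add: zero_less_divide_iff)
qed

lemma f_mult_pos: "s \<noteq> 0 \<Longrightarrow> 0 < f s * s"
  using f_pos[of s] f_pos[of "- s"] odd_f[of s] by (cases "0 < s") (auto simp: mult_neg_neg)

lemma f_mult_nonneg: "0 \<le> f s * s"
  using f_mult_pos[of s] by (cases "s = 0") auto

lemma f_mult_even: "f (- s) * (- s) = f s * s"
  by (simp add: odd_f)

lemma f_mult_abs: "f \<bar>s\<bar> * \<bar>s\<bar> = f s * s"
  by (cases "0 \<le> s") (auto simp: odd_f)

lemma f_abs: "\<bar>f s\<bar> = f \<bar>s\<bar>"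
proof (cases "s = 0")
  case False
  then have "f \<bar>s\<bar> > 0" by (intro f_pos) simp
  then show ?thesis using odd_f[of s] by (cases "0 \<le> s") auto
qed simp

lemma f_mono:
  assumes "0 \<le> s" "s \<le> t"
  shows "f s \<le> f t"
proof (cases "0 < s \<and> s < t")
  case True
  then have "f s / s * s \<le> f t / t * t"
    using ratio_less[of s t] f_pos[of t] by (intro mult_mono) (auto intro: less_imp_le)
  then show ?thesis using True by simp
next
  case False
  then show ?thesis using assms f_pos[of t] by (cases "t = 0"; cases "s = t") auto
qed

lemmas F_deriv = Fprim_DERIV[OF cont_f]

lemma F_zero [simp]: "F 0 = 0"
  by (simp add: Fprim_def zero_ereal_def)

lemma cont_F: "continuous_on UNIV F"
  by (intro continuous_at_imp_continuous_on ballI DERIV_isCont[OF F_deriv])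

lemma F_even: "F (- s) = F s"
proof -
  have "((\<lambda>s. F (- s) - F s) has_real_derivative 0) (at s)" for s
    using DERIV_diff[OF DERIV_chain2[where g = uminus, OF F_deriv DERIV_minus[OF DERIV_ident]] F_deriv, of s]
    by (simp add: odd_f)
  then have "F (- s) - F s = F (- 0) - F 0"
    by (intro DERIV_isconst_all) auto
  then show ?thesis by simp
qed

lemma F_abs: "F \<bar>s\<bar> = F s"
  by (cases "0 \<le> s") (auto simp: F_even)

text \<open>The function G x = q x^2 / 2 - F x with q = f t / t has derivative (q - f x / x) x,
  which is nonnegative before t and nonpositive after. So t maximizes G on the positive axis,
  whichever of s and t is larger. This yields both the monotonicity of \<open>excess\<close> and the
  maximality of the action along rays.\<close>

lemma F_diff_bound:
  assumes st: "0 < s" "0 < t"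
  shows "F t - F s \<le> f t / t * (t\<^sup>2 - s\<^sup>2) / 2"
proof -
  define q where "q = f t / t"
  define G where "G x = q * x\<^sup>2 / 2 - F x" for x
  have G': "(G has_real_derivative (f t / t - f x / x) * x) (at x)" if "0 < x" for x
  proof -
    have "(G has_real_derivative q * (2 * x) / 2 - f x) (at x)"
      unfolding G_def by (auto intro!: derivative_eq_intros F_deriv)
    moreover have "q * (2 * x) / 2 - f x = (q - f x / x) * x"
      using that by (simp add: left_diff_distrib)
    ultimately show ?thesis by (simp add: q_def)
  qed
  have "G s \<le> G t"
  proof (cases "s \<le> t")
    case True
    show ?thesis
    proof (rule DERIV_nonneg_imp_nondecreasing[OF True])
      fix x assume x: "s \<le> x" "x \<le> t"
      then have "f x / x \<le> f t / t" using ratio_less[of x t] st by (cases "x = t") auto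
      then show "\<exists>y. (G has_real_derivative y) (at x) \<and> 0 \<le> y"
        using G'[of x] x st by (intro exI conjI) auto
    qed
  next
    case False
    then have "t \<le> s" by simp
    then show ?thesis
    proof (rule DERIV_nonpos_imp_nonincreasing)
      fix x assume x: "t \<le> x" "x \<le> s"
      then have "f t / t \<le> f x / x" using ratio_less[of t x] st by (cases "x = t") auto
      then show "\<exists>y. (G has_real_derivative y) (at x) \<and> y \<le> 0"
        using G'[of x] x st by (intro exI conjI) (auto intro!: mult_nonpos_nonneg)
    qed
  qed
  then have "F t - F s \<le> q * (t\<^sup>2 - s\<^sup>2) / 2" unfolding G_def by (simp add: field_simps)
  then show ?thesis by (simp add: q_def)
qed

lemma F_nonneg: "0 \<le> F s"
proof -
  have "F 0 \<le> F \<bar>s\<bar>"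
    by (rule DERIV_nonneg_imp_nondecreasing) (auto intro!: exI[of _ "f _"] F_deriv f_mono[of 0, simplified])
  then show ?thesis by (simp add: F_abs)
qed

lemma F_le: "\<theta> * F s \<le> f s * s"
  using AR[of "\<bar>s\<bar>"] f_mult_abs[of s] by (cases "s = 0") (auto simp: F_abs mult.commute)

lemma F_le_f: "\<bar>F s\<bar> \<le> f s * s"
proof -
  have "1 * F s \<le> \<theta> * F s" using \<theta>2 F_nonneg by (intro mult_right_mono) auto
  then show ?thesis using F_le[of s] F_nonneg[of s] by simp
qed

lemma f_small:
  assumes "0 < \<epsilon>"
  obtains \<delta> where "0 < \<delta>" "\<And>s. \<bar>s\<bar> < \<delta> \<Longrightarrow> f s * s \<le> \<epsilon> * s\<^sup>2"
proof -
  obtain \<delta> where \<delta>: "0 < \<delta>" "\<And>s. s \<noteq> 0 \<Longrightarrow> \<bar>s\<bar> < \<delta> \<Longrightarrow> \<bar>f s / s\<bar> < \<epsilon>"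
    using lim_f assms unfolding LIM_def by (auto simp: dist_real_def)
  have "f s * s \<le> \<epsilon> * s\<^sup>2" if s: "\<bar>s\<bar> < \<delta>" for s
  proof (cases "s = 0")
    case False
    have "f s * s = f s / s * s\<^sup>2" using False by (simp add: power2_eq_square)
    also have "\<dots> \<le> \<epsilon> * s\<^sup>2"
    proof (rule mult_right_mono)
      show "f s / s \<le> \<epsilon>" using \<delta>(2)[OF False s] by linarith
    qed simp
    finally show ?thesis .
  qed simp
  then show ?thesis using that \<delta>(1) by blast
qed

lemma f_growth:
  assumes \<epsilon>: "0 < \<epsilon>"
  obtains C where "0 \<le> C" "\<And>s. f s * s \<le> \<epsilon> * s\<^sup>2 + C * \<bar>s\<bar> powr (p + 1)"
proof -
  obtain \<delta> where \<delta>: "0 < \<delta>" "\<And>s. \<bar>s\<bar> < \<delta> \<Longrightarrow> f s * s \<le> \<epsilon> * s\<^sup>2"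
    using f_small[OF \<epsilon>] by blast
  define B where "B = f (max R\<^sub>0 0)"
  \<comment> \<open>\<open>B\<close> bounds |f| below the growth threshold, by monotonicity;
    division by \<delta>^p turns it into a multiple of |s|^p on the range |s| \<ge>
    \<delta>.\<close>
  define C where "C = \<bar>C\<^sub>0\<bar> + \<bar>B\<bar> / \<delta> powr p"
  have C: "0 \<le> C" unfolding C_def by simp
  have "f s * s \<le> \<epsilon> * s\<^sup>2 + C * \<bar>s\<bar> powr (p + 1)" for s
  proof (cases "\<bar>s\<bar> < \<delta>")
    case True
    have "0 \<le> C * \<bar>s\<bar> powr (p + 1)" using C by simp
    then show ?thesis using \<delta>(2)[OF True] by linarith
  next
    case False
    then have s: "\<delta> \<le> \<bar>s\<bar>" by simp
    have "\<bar>f s\<bar> \<le> C * \<bar>s\<bar> powr p"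
    proof (cases "R\<^sub>0 \<le> \<bar>s\<bar>")
      case True
      then have "\<bar>f s\<bar> \<le> C\<^sub>0 * \<bar>s\<bar> powr p" by (rule growth_f)
      also have "\<dots> \<le> C * \<bar>s\<bar> powr p" unfolding C_def by (intro mult_right_mono) (auto intro: add_increasing2)
      finally show ?thesis .
    next
      case False
      then have "\<bar>f s\<bar> \<le> \<bar>B\<bar>" unfolding f_abs B_def using f_mono[of "\<bar>s\<bar>" "max R\<^sub>0 0"] by simp
      also have "\<bar>B\<bar> = \<bar>B\<bar> / \<delta> powr p * \<delta> powr p" using \<delta>(1) by simp
      also have "\<dots> \<le> C * \<bar>s\<bar> powr p" unfolding C_def using s \<delta>(1) p1
        by (intro mult_mono powr_mono2) auto
      finally show ?thesis .
    qed
    then have "f s * s \<le> C * \<bar>s\<bar> powr p * \<bar>s\<bar>"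
      by (metis abs_ge_self abs_ge_zero abs_mult mult_right_mono order_trans)
    also have "\<dots> = C * \<bar>s\<bar> powr (p + 1)" using s \<delta>(1) by (simp add: powr_add)
    finally show ?thesis using \<epsilon> by (simp add: add_increasing)
  qed
  then show ?thesis using that C by blast
qed

text \<open>What the nonlinear terms need from a profile of energy at most K, with no mention of a
  derivative: such bounds survive pointwise limits and pass to functions like 2|g| + |h| that serve
  as dominating functions.\<close>

definition admissible :: "real \<Rightarrow> (real \<Rightarrow> real) \<Rightarrow> bool" where
  "admissible K g \<longleftrightarrow> g \<in> borel_measurable borel \<and> (\<forall>r>0. (g r)^2 \<le> K * majorant d \<kappa> r) \<and>
     integrable \<mu> (\<lambda>r. (g r)^2) \<and> (LINT r|\<mu>. (g r)^2) \<le> K"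

lemma admissibleD:
  assumes "admissible K g"
  shows "g \<in> borel_measurable borel" "0 < r \<Longrightarrow> (g r)^2 \<le> K * majorant d \<kappa> r"
    "integrable \<mu> (\<lambda>r. (g r)^2)" "(LINT r|\<mu>. (g r)^2) \<le> K" "0 \<le> K"
proof -
  show "0 \<le> K"
  proof (rule order_trans)
    show "0 \<le> (LINT r|\<mu>. (g r)^2)" by (rule integral_nonneg) auto
  qed (use assms in \<open>auto simp: admissible_def\<close>)
qed (use assms in \<open>auto simp: admissible_def\<close>)

lemma profile_admissible:
  assumes g: "g \<in> profiles d" and K: "qform d g \<le> K"
  shows "admissible K g"
proof -
  obtain c where p: "profile d g c" using g by (rule profilesE)
  have E: "energy d g c \<le> K" using K qform_eq[OF p] by simp
  have "0 \<le> (LINT r|\<mu>. (c r)^2)" by (rule integral_nonneg) auto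
  then have "(LINT r|\<mu>. (g r)^2) \<le> K" using E by linarith
  moreover have "(g r)^2 \<le> K * majorant d \<kappa> r" if "0 < r" for r
  proof -
    have "(g r)^2 \<le> energy d g c * majorant d \<kappa> r"
      by (rule profile_le_majorant[OF p d2 that \<kappa>(1,2)])
    also have "\<dots> \<le> K * majorant d \<kappa> r" using E majorant_nonneg[OF \<kappa>(1) that] by (rule mult_right_mono)
    finally show ?thesis .
  qed
  ultimately show ?thesis unfolding admissible_def using profileD(1,3)[OF p] by blast
qed

lemma admissible_limit:
  assumes g: "\<And>n. admissible K (g n)" and lim: "\<And>r. 0 < r \<Longrightarrow> (\<lambda>n. g n r) \<longlonglongrightarrow> h r"
    and h: "h \<in> borel_measurable borel"
  shows "admissible K h"
proof -
  have l: "AE r in \<mu>. (\<lambda>n. (g n r)^2) \<longlonglongrightarrow> (h r)^2"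
    by (rule AE_radialI) (intro tendsto_intros lim)
  have ev: "\<forall>\<^sub>F n in sequentially. (LINT r|\<mu>. (g n r)^2) \<le> K"
    using admissibleD(4)[OF g] by simp
  have "(h r)^2 \<le> K * majorant d \<kappa> r" if r: "0 < r" for r
    by (rule tendsto_upperbound[of "\<lambda>n. (g n r)^2"])
       (auto intro!: tendsto_intros lim r always_eventually admissibleD(2)[OF g])
  then show ?thesis
    unfolding admissible_def
    using integral_Fatou_bound[OF admissibleD(3)[OF g] _ _ l ev] h by simp
qed

text \<open>Near 0 the integrand is a multiple of r^(d - 1 - q \<kappa>), and the exponent exceeds
  -1 exactly when q \<kappa> < d.\<close>

lemma majorant_powr_integrable:
  assumes q: "0 < q" "q * \<kappa> < d"
  shows "integrable \<mu> (\<lambda>r. indicator {0<..1} r * majorant d \<kappa> r powr q)"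
proof -
  define a where "a = real d - 1 - q * \<kappa>"
  have a: "-1 < a" unfolding a_def using q by simp
  have "(\<lambda>r. r powr a) integrable_on {0..1}"
    using integrable_on_powr_from_0[OF a, of 1] by simp
  then have "(\<lambda>r. r powr a) absolutely_integrable_on {0..1}"
    by (rule nonnegative_absolutely_integrable_1) simp
  then have "integrable lebesgue (\<lambda>r. indicator {0..1} r *\<^sub>R (r powr a))" by (simp add: set_integrable_def)
  then have i: "integrable lborel (\<lambda>r. indicator {0..1} r *\<^sub>R (r powr a))"
    by (subst (asm) integrable_completion) measurable
  show ?thesis
  proof (subst integrable_radial, measurable)
    show "integrable lborel (\<lambda>r. indicator {0<..} r * r ^ (d - 1) * (indicator {0<..1} r * majorant d \<kappa> r powr q))"
    proof (rule integrable_cong_AE_imp[OF integrable_mult_right[OF i, of "(8 + 2 / \<kappa>) powr q"]], measurable)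
      have "indicator {0<..} r * r ^ (d - 1) * (indicator {0<..1} r * majorant d \<kappa> r powr q) =
        (8 + 2 / \<kappa>) powr q * (indicator {0..1} r *\<^sub>R (r powr a))" if "r \<noteq> 0" for r
      proof (cases "0 < r \<and> r \<le> 1")
        case True
        then have "r ^ (d - 1) = r powr (real d - 1)" using d2 by (simp add: powr_realpow[symmetric] of_nat_diff)
        moreover have "majorant d \<kappa> r powr q = (8 + 2 / \<kappa>) powr q * r powr (- \<kappa> * q)"
          using True \<kappa>(1) by (simp add: majorant_def powr_mult powr_powr)
        moreover have "r powr (real d - 1) * r powr (- \<kappa> * q) = r powr a"
          unfolding a_def by (simp add: powr_add[symmetric] algebra_simps)
        ultimately show ?thesis using True by (simp add: algebra_simps)
      next
        case False
        then show ?thesis using that by (auto simp: indicator_def)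
      qed
      then show "AE r in lborel. (8 + 2 / \<kappa>) powr q * (indicator {0..1} r *\<^sub>R (r powr a)) =
          indicator {0<..} r * r ^ (d - 1) * (indicator {0<..1} r * majorant d \<kappa> r powr q)"
        using AE_lborel_singleton[of "0::real"] by (auto elim: eventually_mono)
    qed
  qed
qed

text \<open>On (0, 1] the square of g is raised to the power (p + 1)/2 and bounded by the majorant.
  Beyond 1 one has g^2 \<le> 4 K, so the surplus power p - 1 costs a constant and the square
  remains.\<close>

lemma admissible_abs_bound:
  assumes g: "admissible K g" and r: "0 < r"
  shows "\<bar>g r\<bar> powr (p + 1) \<le> K powr ((p + 1) / 2) * (indicator {0<..1} r * majorant d \<kappa> r powr ((p + 1) / 2))
    + (4 * K) powr ((p - 1) / 2) * (g r)^2"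
proof -
  note K = admissibleD(5)[OF g]
  have sq: "\<bar>x\<bar> powr q = (x\<^sup>2) powr (q / 2)" for x q :: real
    using powr_powr[of "\<bar>x\<bar>" 2 "q/2"] by (cases "x = 0") (auto simp: powr_realpow[symmetric])
  show ?thesis
  proof (cases "r \<le> 1")
    case True
    have "\<bar>g r\<bar> powr (p + 1) \<le> (K * majorant d \<kappa> r) powr ((p + 1) / 2)"
      unfolding sq by (intro powr_mono2 admissibleD(2)[OF g r]) (use p1 in auto)
    also have "\<dots> = K powr ((p + 1) / 2) * majorant d \<kappa> r powr ((p + 1) / 2)"
      using K majorant_nonneg[OF \<kappa>(1) r] by (simp add: powr_mult)
    finally show ?thesis using True r by (simp add: add_increasing2)
  next
    case False
    have "(1/r) ^ (d - 1) \<le> 1" using False r by (intro power_le_one) auto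
    then have "K * majorant d \<kappa> r \<le> K * 4" using False K by (intro mult_left_mono) (auto simp: majorant_def)
    then have "(g r)^2 \<le> 4 * K" using admissibleD(2)[OF g r] by linarith
    then have "((g r)^2) powr ((p - 1) / 2) \<le> (4 * K) powr ((p - 1) / 2)"
      by (intro powr_mono2) (use p1 in auto)
    then have "((g r)^2) powr ((p - 1) / 2) * (g r)^2 \<le> (4 * K) powr ((p - 1) / 2) * (g r)^2"
      by (rule mult_right_mono) simp
    moreover have "\<bar>g r\<bar> powr (p + 1) = ((g r)^2) powr ((p - 1) / 2) * (g r)^2"
    proof (cases "g r = 0")
      case False
      then have "((g r)^2) powr ((p - 1) / 2) * (g r)^2 = ((g r)^2) powr ((p - 1) / 2) * ((g r)^2) powr 1" by simp
      also have "\<dots> = ((g r)^2) powr ((p - 1) / 2 + 1)" by (rule powr_add[symmetric])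
      also have "(p - 1) / 2 + 1 = (p + 1) / 2" by (simp add: field_simps)
      finally show ?thesis unfolding sq by simp
    qed simp
    ultimately show ?thesis using False by simp
  qed
qed

text \<open>Keeps track of homogeneity in K: the power (p + 1)/2 exceeds 1, and this superlinearity
  is what separates the Nehari set from 0.\<close>

lemma admissible_powr_integral:
  obtains C where "0 \<le> C" "\<And>K g. admissible K g \<Longrightarrow> integrable \<mu> (\<lambda>r. \<bar>g r\<bar> powr (p + 1))"
    "\<And>K g. admissible K g \<Longrightarrow> (LINT r|\<mu>. \<bar>g r\<bar> powr (p + 1)) \<le> C * K powr ((p + 1) / 2)"
proof -
  define w where "w r = indicator {0<..1} r * majorant d \<kappa> r powr ((p + 1) / 2)" for r
  have wi: "integrable \<mu> w" unfolding w_def by (rule majorant_powr_integrable) (use p1 \<kappa> in auto)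
  have w0: "0 \<le> integral\<^sup>L \<mu> w" unfolding w_def by (rule integral_nonneg) simp
  define C where "C = integral\<^sup>L \<mu> w + 4 powr ((p - 1) / 2)"
  show ?thesis
  proof (rule that[of C])
    show "0 \<le> C" unfolding C_def using w0 by simp
    fix K g assume g: "admissible K g"
    note K = admissibleD(5)[OF g]
    note [measurable] = admissibleD(1)[OF g]
    let ?b = "\<lambda>r. K powr ((p + 1) / 2) * w r + (4 * K) powr ((p - 1) / 2) * (g r)^2"
    have bi: "integrable \<mu> ?b" using wi admissibleD(3)[OF g] by auto
    have le: "AE r in \<mu>. \<bar>g r\<bar> powr (p + 1) \<le> ?b r"
      by (rule AE_radialI) (use admissible_abs_bound[OF g] in \<open>simp add: w_def\<close>)
    show i: "integrable \<mu> (\<lambda>r. \<bar>g r\<bar> powr (p + 1))"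
      by (rule integrable_bound[OF bi]) (use le in \<open>auto elim!: eventually_mono\<close>)
    have "(LINT r|\<mu>. \<bar>g r\<bar> powr (p + 1)) \<le> integral\<^sup>L \<mu> ?b" by (rule integral_mono_AE[OF i bi le])
    also have "\<dots> = K powr ((p + 1) / 2) * integral\<^sup>L \<mu> w + (4 * K) powr ((p - 1) / 2) * (LINT r|\<mu>. (g r)^2)"
      using wi admissibleD(3)[OF g] by simp
    also have "\<dots> \<le> K powr ((p + 1) / 2) * integral\<^sup>L \<mu> w + (4 * K) powr ((p - 1) / 2) * K"
      using admissibleD(4)[OF g] by (intro add_left_mono mult_left_mono) auto
    also have "(4 * K) powr ((p - 1) / 2) * K = 4 powr ((p - 1) / 2) * K powr ((p + 1) / 2)"
    proof (cases "K = 0")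
      case False
      then have "K powr ((p - 1) / 2) * K = K powr ((p - 1) / 2) * K powr 1" using K by simp
      also have "\<dots> = K powr ((p - 1) / 2 + 1)" by (rule powr_add[symmetric])
      also have "(p - 1) / 2 + 1 = (p + 1) / 2" by (simp add: field_simps)
      finally show ?thesis using K by (simp add: powr_mult)
    qed simp
    finally show "(LINT r|\<mu>. \<bar>g r\<bar> powr (p + 1)) \<le> C * K powr ((p + 1) / 2)"
      unfolding C_def by (simp add: algebra_simps)
  qed
qed

lemma admissible_f_integrable:
  assumes g: "admissible K g"
  shows "integrable \<mu> (\<lambda>r. f (g r) * g r)"
proof -
  note [measurable] = admissibleD(1)[OF g] borel_measurable_continuous_onI[OF cont_f]
  obtain C where C: "0 \<le> C" "\<And>s. f s * s \<le> 1 * s\<^sup>2 + C * \<bar>s\<bar> powr (p + 1)" using f_growth[of 1] by auto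
  obtain C' where i: "integrable \<mu> (\<lambda>r. \<bar>g r\<bar> powr (p + 1))" using admissible_powr_integral g by metis
  show ?thesis
  proof (rule integrable_bound)
    show "integrable \<mu> (\<lambda>r. 1 * (g r)^2 + C * \<bar>g r\<bar> powr (p + 1))" using i admissibleD(3)[OF g] by auto
    show "AE r in \<mu>. norm (f (g r) * g r) \<le> norm (1 * (g r)^2 + C * \<bar>g r\<bar> powr (p + 1))"
    proof (rule AE_I2)
      fix r
      show "norm (f (g r) * g r) \<le> norm (1 * (g r)^2 + C * \<bar>g r\<bar> powr (p + 1))"
        using C(2)[of "g r"] f_mult_nonneg[of "g r"] by (simp only: real_norm_def)
    qed
  qed measurable
qed

text \<open>The integrands that occur later, namely \<open>F\<close>, \<open>excess\<close> and f s
  * s itself, are all dominated by f s * s.\<close>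

lemma admissible_integrable:
  assumes g: "admissible K g" and \<Psi>: "continuous_on UNIV \<Psi>" "\<And>s. \<bar>\<Psi> s\<bar> \<le> f s * s"
  shows "integrable \<mu> (\<lambda>r. \<Psi> (g r))"
proof -
  note [measurable] = admissibleD(1)[OF g] borel_measurable_continuous_onI[OF \<Psi>(1)]
  show ?thesis
    by (rule integrable_bound[OF admissible_f_integrable[OF g]])
       (use \<Psi>(2) f_mult_nonneg in \<open>auto simp: abs_of_nonneg intro!: AE_I2\<close>)
qed

text \<open>Compactness of the nonlinear terms: dominated convergence on bounded intervals, uniform smallness at infinity.\<close>
lemma admissible_integral_tendsto:
  assumes g: "\<And>n. admissible K (g n)" and lim: "\<And>r. 0 < r \<Longrightarrow> (\<lambda>n. g n r) \<longlonglongrightarrow> h r"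
    and h: "h \<in> borel_measurable borel"
    and \<Psi>: "continuous_on UNIV \<Psi>" "\<And>s. \<bar>\<Psi> s\<bar> \<le> f s * s"
  shows "(\<lambda>n. LINT r|\<mu>. \<Psi> (g n r)) \<longlonglongrightarrow> (LINT r|\<mu>. \<Psi> (h r))"
proof (rule LIMSEQ_I)
  fix \<epsilon> :: real assume \<epsilon>: "0 < \<epsilon>"
  have H: "admissible K h" by (rule admissible_limit[OF g lim h])
  note K = admissibleD(5)[OF H]
  note [measurable] = admissibleD(1)[OF g] h borel_measurable_continuous_onI[OF \<Psi>(1)]
  define e where "e = \<epsilon> / (4 * (K + 1))"
  have e: "0 < e" unfolding e_def using \<epsilon> K by simp
  obtain \<delta> where \<delta>: "0 < \<delta>" "\<And>s. \<bar>s\<bar> < \<delta> \<Longrightarrow> f s * s \<le> e * s\<^sup>2" using f_small[OF e] by blast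
  \<comment> \<open>Beyond R every admissible function lies below \<delta>: its square is at most 4
    K / r there, as d \<ge> 2 provides at least one power of decay. On that range the nonlinear term
    is at most e times the square.\<close>
  define R where "R = max 1 (4 * K / \<delta>\<^sup>2 + 1)"
  have R: "1 \<le> R" "4 * K < \<delta>\<^sup>2 * R"
  proof -
    have "4 * K = \<delta>\<^sup>2 * (4 * K / \<delta>\<^sup>2)" using \<delta>(1) by simp
    also have "\<dots> < \<delta>\<^sup>2 * R" unfolding R_def using \<delta>(1) by (intro mult_strict_left_mono) auto
    finally show "4 * K < \<delta>\<^sup>2 * R" .
  qed (simp add: R_def)
  have tail_pt: "\<bar>\<Psi> (k r)\<bar> \<le> e * (k r)^2" if k: "admissible K k" and r: "R < r" for k r
  proof -
    have r1: "1 < r" using R r by linarith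
    have "(k r)^2 \<le> K * (4 * (1/r) ^ (d - 1))" using admissibleD(2)[OF k, of r] r1 by (simp add: majorant_def)
    also have "\<dots> \<le> K * (4 * (1/r) ^ 1)"
      using r1 d2 K by (intro mult_left_mono power_decreasing) auto
    also have "\<dots> < \<delta>\<^sup>2"
    proof -
      have "\<delta>\<^sup>2 * R < \<delta>\<^sup>2 * r" using \<delta>(1) r by simp
      then show ?thesis using R r1 by (simp add: field_simps)
    qed
    finally have "\<bar>k r\<bar> < \<delta>" using power2_less_imp_less[of "\<bar>k r\<bar>" \<delta>] \<delta>(1) by simp
    then show ?thesis using \<Psi>(2)[of "k r"] \<delta>(2) by force
  qed
  have tail: "\<bar>LINT r|\<mu>. indicator {R<..} r * \<Psi> (k r)\<bar> \<le> e * K" if k: "admissible K k" for k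
  proof -
    note [measurable] = admissibleD(1)[OF k]
    have "integrable \<mu> (\<lambda>r. indicator {R<..} r * \<Psi> (k r))"
      using integrable_mult_indicator[OF _ admissible_integrable[OF k \<Psi>], of "{R<..}"] by simp
    then have "\<bar>LINT r|\<mu>. indicator {R<..} r * \<Psi> (k r)\<bar> \<le> (LINT r|\<mu>. e * (k r)^2)"
      by (rule integral_abs_bound_integral) (use admissibleD(3)[OF k] tail_pt[OF k] e in \<open>auto simp: indicator_def\<close>)
    also have "\<dots> \<le> e * K" using admissibleD(4)[OF k] e by simp
    finally show ?thesis .
  qed
  obtain C where C: "0 \<le> C" "\<And>s. f s * s \<le> 1 * s\<^sup>2 + C * \<bar>s\<bar> powr (p + 1)" using f_growth[of 1] by auto
  define L where "L = sqrt (4 * K)"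
  \<comment> \<open>A dominating function common to all admissible functions: near the origin the
    growth estimate combined with the majorant, on (1, R] the constant value at the uniform bound L,
    and 0 beyond.\<close>
  define V where "V r = (1 + C * (4 * K) powr ((p - 1) / 2)) * K * (indicator {0<..1} r * majorant d \<kappa> r powr 1)
      + C * K powr ((p + 1) / 2) * (indicator {0<..1} r * majorant d \<kappa> r powr ((p + 1) / 2))
      + f L * L * indicator {1<..R} r" for r
  have \<kappa>d: "1 * \<kappa> < d"
  proof -
    have "1 * \<kappa> \<le> (p + 1) / 2 * \<kappa>" using \<kappa>(1) p1 by (intro mult_right_mono) auto
    then show ?thesis using \<kappa>(3) by linarith
  qed
  have Ri: "integrable \<mu> (indicator {1<..R} :: real \<Rightarrow> real)"
  proof (subst integrable_radial, measurable)
    show "integrable lborel (\<lambda>r. indicator {0<..} r * r ^ (d - 1) * indicator {1<..R} r)"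
    proof (rule integrable_bound)
      show "integrable lborel (\<lambda>r. R ^ (d - 1) * indicator {1<..R} r)"
        by (intro integrable_mult_right integrable_real_indicator) (use R(1) in auto)
      show "AE r in lborel. norm (indicator {0<..} r * r ^ (d - 1) * indicator {1<..R} r) \<le> norm (R ^ (d - 1) * indicator {1<..R} r)"
        by (auto simp: indicator_def intro!: AE_I2 power_mono)
    qed measurable
  qed
  have Vi: "integrable \<mu> V"
    unfolding V_def using majorant_powr_integrable[of 1] majorant_powr_integrable[of "(p + 1) / 2"] \<kappa>(3) \<kappa>d p1 Ri
    by (intro Bochner_Integration.integrable_add integrable_mult_right) auto
  have V: "\<bar>indicator {..R} r * \<Psi> (k r)\<bar> \<le> V r" if k: "admissible K k" and r: "0 < r" for k r
  proof (cases "r \<le> 1")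
    case True
    define m where "m = majorant d \<kappa> r"
    define c where "c = C * (4 * K) powr ((p - 1) / 2)"
    have m0: "0 \<le> m" unfolding m_def using majorant_nonneg[OF \<kappa>(1) r] .
    have c0: "0 \<le> c" unfolding c_def using C(1) by simp
    have 1: "(k r)^2 \<le> K * m" unfolding m_def by (rule admissibleD(2)[OF k r])
    have "C * \<bar>k r\<bar> powr (p + 1) \<le> C * (K powr ((p + 1) / 2) * m powr ((p + 1) / 2) + (4 * K) powr ((p - 1) / 2) * (k r)^2)"
      using admissible_abs_bound[OF k r] True r C(1) by (intro mult_left_mono) (auto simp: m_def)
    also have "\<dots> = C * K powr ((p + 1) / 2) * m powr ((p + 1) / 2) + c * (k r)^2"
      by (simp add: c_def algebra_simps)
    finally have "f (k r) * k r \<le> (k r)^2 + (C * K powr ((p + 1) / 2) * m powr ((p + 1) / 2) + c * (k r)^2)"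
      using C(2)[of "k r"] by linarith
    also have "\<dots> \<le> K * m + (C * K powr ((p + 1) / 2) * m powr ((p + 1) / 2) + c * (K * m))"
      using 1 mult_left_mono[OF 1 c0] by linarith
    also have "\<dots> = V r" using True r R(1) m0 by (simp add: V_def m_def c_def algebra_simps)
    finally show ?thesis using \<Psi>(2)[of "k r"] True R(1) by simp
  next
    case False
    show ?thesis
    proof (cases "r \<le> R")
      case True
      have "(1/r) ^ (d - 1) \<le> 1" using False r by (intro power_le_one) auto
      then have "K * majorant d \<kappa> r \<le> K * 4" using False K by (intro mult_left_mono) (auto simp: majorant_def)
      then have "(k r)^2 \<le> 4 * K" using admissibleD(2)[OF k r] by linarith
      then have "\<bar>k r\<bar> \<le> L" unfolding L_def using real_sqrt_le_mono by fastforce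
      moreover have "0 \<le> f \<bar>k r\<bar>" using f_mono[of 0 "\<bar>k r\<bar>"] by simp
      ultimately have "f \<bar>k r\<bar> * \<bar>k r\<bar> \<le> f L * L" by (intro mult_mono' f_mono) auto
      then show ?thesis using \<Psi>(2)[of "k r"] True False r by (simp add: V_def f_mult_abs)
    next
      case False2: False
      then show ?thesis using False R(1) by (simp add: V_def)
    qed
  qed
  have "(\<lambda>n. LINT r|\<mu>. indicator {..R} r * \<Psi> (g n r)) \<longlonglongrightarrow> (LINT r|\<mu>. indicator {..R} r * \<Psi> (h r))"
  proof (rule integral_dominated_convergence[where w = V])
    show "AE r in \<mu>. (\<lambda>n. indicator {..R} r * \<Psi> (g n r)) \<longlonglongrightarrow> indicator {..R} r * \<Psi> (h r)"
    proof (rule AE_radialI)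
      fix r :: real assume r: "0 < r"
      have "isCont \<Psi> (h r)" using \<Psi>(1) by (simp add: continuous_on_eq_continuous_at)
      then have "(\<lambda>n. \<Psi> (g n r)) \<longlonglongrightarrow> \<Psi> (h r)" by (rule isCont_tendsto_compose[OF _ lim[OF r]])
      then show "(\<lambda>n. indicator {..R} r * \<Psi> (g n r)) \<longlonglongrightarrow> indicator {..R} r * \<Psi> (h r)"
        by (rule tendsto_mult_left)
    qed
    show "AE r in \<mu>. norm (indicator {..R} r * \<Psi> (g n r)) \<le> V r" for n
      by (rule AE_radialI) (use V[OF g] in simp)
  qed (use Vi in \<open>auto\<close>)
  then obtain N where N: "\<And>n. N \<le> n \<Longrightarrow> \<bar>(LINT r|\<mu>. indicator {..R} r * \<Psi> (g n r)) - (LINT r|\<mu>. indicator {..R} r * \<Psi> (h r))\<bar> < \<epsilon> / 2"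
    using LIMSEQ_D[of _ _ "\<epsilon> / 2"] \<epsilon> by fastforce
  have split: "(LINT r|\<mu>. \<Psi> (k r)) = (LINT r|\<mu>. indicator {..R} r * \<Psi> (k r)) + (LINT r|\<mu>. indicator {R<..} r * \<Psi> (k r))"
    if k: "admissible K k" for k
  proof -
    note [measurable] = admissibleD(1)[OF k]
    have "(LINT r|\<mu>. \<Psi> (k r)) = (LINT r|\<mu>. indicator {..R} r * \<Psi> (k r) + indicator {R<..} r * \<Psi> (k r))"
      by (rule integral_cong) (auto simp: indicator_def)
    also have "\<dots> = (LINT r|\<mu>. indicator {..R} r * \<Psi> (k r)) + (LINT r|\<mu>. indicator {R<..} r * \<Psi> (k r))"
      using integrable_mult_indicator[OF _ admissible_integrable[OF k \<Psi>], of "{R<..}"]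
        integrable_mult_indicator[OF _ admissible_integrable[OF k \<Psi>], of "{..R}"]
      by (intro Bochner_Integration.integral_add) auto
    finally show ?thesis .
  qed
  have eK: "2 * (e * K) < \<epsilon> / 2"
  proof -
    have "e * K < e * (K + 1)" using e by simp
    also have "\<dots> = \<epsilon> / 4" unfolding e_def using K by (simp add: field_simps)
    finally show ?thesis by simp
  qed
  have "\<bar>(LINT r|\<mu>. \<Psi> (g n r)) - (LINT r|\<mu>. \<Psi> (h r))\<bar> < \<epsilon>" if n: "N \<le> n" for n
    unfolding split[OF g] split[OF H] using N[OF n] tail[OF g[of n]] tail[OF H] eK by linarith
  then show "\<exists>no. \<forall>n\<ge>no. norm ((LINT r|\<mu>. \<Psi> (g n r)) - (LINT r|\<mu>. \<Psi> (h r))) < \<epsilon>" by auto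
qed

end

section \<open>Minimizing sequences\<close>

context nonlinearity
begin

text \<open>Together with \<open>nehari\<close> and \<open>act\<close> below: the nonlinear term and
  the functionals I and S on radial functions, divided by \<open>sphere_area\<close>.\<close>

definition nl :: "(real \<Rightarrow> real) \<Rightarrow> real" where
  "nl g = (LINT r|\<mu>. f (g r) * g r)"

definition nehari :: "(real \<Rightarrow> real) \<Rightarrow> real" where
  "nehari g = qform d g - nl g"

definition act :: "(real \<Rightarrow> real) \<Rightarrow> real" where
  "act g = 1/2 * qform d g - (LINT r|\<mu>. F (g r))"

definition nodal :: "(real \<Rightarrow> real) set" where
  "nodal = {g \<in> profiles d. nehari (pospart g) = 0 \<and> nehari (negpart g) = 0 \<and>
     0 < qform d (pospart g) \<and> 0 < qform d (negpart g)}"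

text \<open>The integrand of S - I/2. On the Nehari set its integral is the action, and since it
  contains no gradient it passes to pointwise limits.\<close>

definition excess :: "real \<Rightarrow> real" where
  "excess s = 1/2 * (f s * s) - F s"

lemma profile_admissible': "g \<in> profiles d \<Longrightarrow> admissible (qform d g) g"
  by (rule profile_admissible) auto

lemma profiles_borel: "g \<in> profiles d \<Longrightarrow> g \<in> borel_measurable borel"
  by (auto elim: profilesE dest: profileD)

text \<open>For s > 0 combine \<open>F_diff_bound\<close> with the strict monotonicity of f(s)/s. At
  s = 0 the quotient is undefined, and (H6) with \<theta> > 2 takes over.\<close>

lemma excess_strict:
  assumes "0 \<le> s" "s < t"
  shows "excess s < excess t"
proof (cases "s = 0")
  case True
  have "\<theta> * F t \<le> f t * t" by (rule F_le)
  moreover have "0 < f t * t" using assms True by (intro f_mult_pos) auto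
  moreover have "2 * F t \<le> \<theta> * F t" using \<theta>2 F_nonneg by (intro mult_right_mono) auto
  moreover have "2 * F t < f t * t"
  proof (cases "F t = 0")
    case False
    then have "2 * F t < \<theta> * F t" using \<theta>2 F_nonneg[of t] by (intro mult_strict_right_mono) auto
    then show ?thesis using \<open>\<theta> * F t \<le> f t * t\<close> by linarith
  qed (use \<open>0 < f t * t\<close> in simp)
  ultimately show ?thesis using True by (simp add: excess_def)
next
  case False
  then have s: "0 < s" "0 < t" using assms by auto
  have "F t - F s \<le> f t / t * (t\<^sup>2 - s\<^sup>2) / 2" using F_diff_bound[OF s] .
  also have "\<dots> = 1/2 * (f t * t) - 1/2 * (f t / t * s\<^sup>2)" using s by (simp add: power2_eq_square field_simps)
  also have "\<dots> < 1/2 * (f t * t) - 1/2 * (f s / s * s\<^sup>2)"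
  proof -
    have "f s / s * s\<^sup>2 < f t / t * s\<^sup>2" using ratio_less[OF s(1) assms(2)] s by (intro mult_strict_right_mono) auto
    then show ?thesis by linarith
  qed
  also have "f s / s * s\<^sup>2 = f s * s" using s by (simp add: power2_eq_square)
  finally show ?thesis by (simp add: excess_def)
qed

lemma excess_even: "excess \<bar>s\<bar> = excess s"
  by (simp add: excess_def F_abs f_mult_abs)

lemma excess_zero [simp]: "excess 0 = 0"
  by (simp add: excess_def)

lemma excess_nonneg: "0 \<le> excess s"
  using excess_strict[of 0 "\<bar>s\<bar>"] excess_even[of s] by (cases "s = 0") auto

lemma excess_pos: "s \<noteq> 0 \<Longrightarrow> 0 < excess s"
  using excess_strict[of 0 "\<bar>s\<bar>"] excess_even[of s] by auto

lemma excess_bound: "\<bar>excess s\<bar> \<le> f s * s"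
  using excess_nonneg[of s] F_nonneg[of s] f_mult_nonneg[of s] unfolding excess_def by linarith

lemma cont_excess: "continuous_on UNIV excess"
  unfolding excess_def[abs_def] by (intro continuous_intros cont_f cont_F)

lemma cont_f_mult: "continuous_on UNIV (\<lambda>s. f s * s)"
  by (intro continuous_intros cont_f)

lemma f_mult_bound: "\<bar>f s * s\<bar> \<le> f s * s"
  using f_mult_nonneg[of s] by simp

lemma excess_scale:
  assumes "0 \<le> t" "t \<le> 1"
  shows "excess (t * s) \<le> excess s" "t < 1 \<Longrightarrow> excess (t * s) = excess s \<Longrightarrow> s = 0"
proof -
  have e: "excess (t * s) = excess (t * \<bar>s\<bar>)" using excess_even[of "t * s"] assms by (simp add: abs_mult)
  have "t * \<bar>s\<bar> \<le> 1 * \<bar>s\<bar>" using assms by (intro mult_right_mono) auto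
  then show "excess (t * s) \<le> excess s"
    unfolding e using excess_strict[of "t * \<bar>s\<bar>" "\<bar>s\<bar>"] assms excess_even[of s]
    by (cases "t * \<bar>s\<bar> = \<bar>s\<bar>") auto
  assume t: "t < 1" and eq: "excess (t * s) = excess s"
  show "s = 0"
  proof (rule ccontr)
    assume "s \<noteq> 0"
    then have "t * \<bar>s\<bar> < 1 * \<bar>s\<bar>" using t by (intro mult_strict_right_mono) auto
    then show False using excess_strict[of "t * \<bar>s\<bar>" "\<bar>s\<bar>"] assms excess_even[of s] e eq by auto
  qed
qed

lemma act_eq_excess:
  assumes g: "g \<in> profiles d" and n: "nehari g = 0"
  shows "act g = (LINT r|\<mu>. excess (g r))"
proof -
  note a = profile_admissible'[OF g]
  have "(LINT r|\<mu>. excess (g r)) = 1/2 * nl g - (LINT r|\<mu>. F (g r))"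
    unfolding excess_def nl_def
    using admissible_f_integrable[OF a] admissible_integrable[OF a cont_F F_le_f] by simp
  then show ?thesis using n unfolding act_def nehari_def by simp
qed

lemma integral_parts:
  assumes g: "g \<in> profiles d" and \<Psi>: "continuous_on UNIV \<Psi>" "\<And>s. \<bar>\<Psi> s\<bar> \<le> f s * s" "\<And>s. \<Psi> (- s) = \<Psi> s"
  shows "(LINT r|\<mu>. \<Psi> (g r)) = (LINT r|\<mu>. \<Psi> (pospart g r)) + (LINT r|\<mu>. \<Psi> (negpart g r))"
proof -
  have z: "\<Psi> 0 = 0" using \<Psi>(2)[of 0] by simp
  have "(LINT r|\<mu>. \<Psi> (g r)) = (LINT r|\<mu>. \<Psi> (pospart g r) + \<Psi> (negpart g r))"
    using z \<Psi>(3) by (intro integral_cong) (auto simp: pospart_def negpart_def max_def)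
  also have "\<dots> = (LINT r|\<mu>. \<Psi> (pospart g r)) + (LINT r|\<mu>. \<Psi> (negpart g r))"
    by (rule Bochner_Integration.integral_add[OF admissible_integrable[OF profile_admissible'[OF profiles_parts(1)[OF g]] \<Psi>(1,2)]
          admissible_integrable[OF profile_admissible'[OF profiles_parts(2)[OF g]] \<Psi>(1,2)]])
  finally show ?thesis .
qed

lemma act_parts: "g \<in> profiles d \<Longrightarrow> act g = act (pospart g) + act (negpart g)"
  using integral_parts[OF _ cont_F F_le_f F_even] qform_parts unfolding act_def by (simp add: distrib_left)

lemma nl_parts: "g \<in> profiles d \<Longrightarrow> nl g = nl (pospart g) + nl (negpart g)"
  using integral_parts[OF _ cont_f_mult f_mult_bound f_mult_even] unfolding nl_def by simp

lemma nehari_parts: "g \<in> profiles d \<Longrightarrow> nehari g = nehari (pospart g) + nehari (negpart g)"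
  using nl_parts qform_parts unfolding nehari_def by simp

text \<open>Evaluates S - I/\<theta>: by (H6) the nonlinear part is nonnegative and the quadratic
  part keeps the factor 1/2 - 1/\<theta>.\<close>

lemma act_coercive:
  assumes g: "g \<in> profiles d" and n: "nehari g = 0"
  shows "(1/2 - 1/\<theta>) * qform d g \<le> act g"
proof -
  note a = profile_admissible'[OF g]
  have "(LINT r|\<mu>. F (g r)) \<le> (LINT r|\<mu>. 1/\<theta> * (f (g r) * g r))"
  proof (rule Bochner_Integration.integral_mono)
    show "integrable \<mu> (\<lambda>r. F (g r))" by (rule admissible_integrable[OF a cont_F F_le_f])
    show "integrable \<mu> (\<lambda>r. 1/\<theta> * (f (g r) * g r))" using admissible_f_integrable[OF a] by simp
    show "F (g r) \<le> 1/\<theta> * (f (g r) * g r)" for r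
      using F_le[of "g r"] \<theta>2 by (simp add: field_simps)
  qed
  also have "\<dots> = 1/\<theta> * qform d g" using n unfolding nehari_def nl_def by simp
  finally show ?thesis unfolding act_def by (simp add: algebra_simps)
qed

lemma qform_zero_imp:
  assumes "g \<in> profiles d" "qform d g = 0" "0 < r"
  shows "g r = 0"
  using admissibleD(2)[OF profile_admissible'[OF assms(1)] assms(3)] assms(2) by simp

lemma qform_eq_zero_AE:
  assumes g: "g \<in> profiles d" and z: "AE r in \<mu>. g r = 0"
  shows "qform d g = 0"
proof -
  obtain c where p: "profile d g c" using g by (rule profilesE)
  have "AE r in \<mu>. (c r)^2 = 0" "AE r in \<mu>. (g r)^2 = 0"
    using z profile_deriv_zero_on_zero_set[OF p] by auto
  then have "(LINT r|\<mu>. (c r)^2) = 0" "(LINT r|\<mu>. (g r)^2) = 0"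
    by (auto intro: integral_eq_zero_AE)
  then show ?thesis by (simp add: qform_eq[OF p])
qed

text \<open>If I \<le> 0, the energy Q satisfies Q \<le> Q/2 + D Q^(1+q) with q = (p - 1)/2 > 0,
  impossible for small positive Q. The threshold solves D c^q = 1/2. This prevents the signed parts
  of a minimizing sequence from vanishing.\<close>

lemma nehari_lower_bound:
  obtains c\<^sub>0 where "0 < c\<^sub>0" "\<And>g. g \<in> profiles d \<Longrightarrow> nehari g \<le> 0 \<Longrightarrow> 0 < qform d g \<Longrightarrow> c\<^sub>0 \<le> qform d g"
proof -
  obtain C where C: "0 \<le> C" "\<And>s. f s * s \<le> 1/2 * s\<^sup>2 + C * \<bar>s\<bar> powr (p + 1)" using f_growth[of "1/2"] by auto
  obtain C' where C': "0 \<le> C'" "\<And>K g. admissible K g \<Longrightarrow> integrable \<mu> (\<lambda>r. \<bar>g r\<bar> powr (p + 1))"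
    "\<And>K g. admissible K g \<Longrightarrow> (LINT r|\<mu>. \<bar>g r\<bar> powr (p + 1)) \<le> C' * K powr ((p + 1) / 2)"
    using admissible_powr_integral by metis
  define D where "D = C * C' + 1"
  have D: "0 < D" unfolding D_def using C C' by (simp add: add_nonneg_pos)
  define q where "q = (p - 1) / 2"
  have q: "0 < q" unfolding q_def using p1 by simp
  define c\<^sub>0 where "c\<^sub>0 = (1 / (2 * D)) powr (1 / q)"
  have c0: "0 < c\<^sub>0" unfolding c\<^sub>0_def using D by simp
  have c0q: "D * c\<^sub>0 powr q = 1/2" unfolding c\<^sub>0_def using D q by (simp add: powr_powr)
  have "c\<^sub>0 \<le> qform d g" if g: "g \<in> profiles d" and n: "nehari g \<le> 0" and Q: "0 < qform d g" for g
  proof (rule ccontr)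
    assume "\<not> c\<^sub>0 \<le> qform d g"
    define Q' where "Q' = qform d g"
    note a = profile_admissible'[OF g, folded Q'_def]
    have "nl g \<le> (LINT r|\<mu>. 1/2 * (g r)^2 + C * \<bar>g r\<bar> powr (p + 1))"
      unfolding nl_def
      by (rule Bochner_Integration.integral_mono)
         (use admissible_f_integrable[OF a] admissibleD(3)[OF a] C'(2)[OF a] C(2) in auto)
    also have "\<dots> = 1/2 * (LINT r|\<mu>. (g r)^2) + C * (LINT r|\<mu>. \<bar>g r\<bar> powr (p + 1))"
      using admissibleD(3)[OF a] C'(2)[OF a] by simp
    also have "\<dots> \<le> 1/2 * Q' + C * (C' * Q' powr ((p + 1) / 2))"
      using admissibleD(4)[OF a] C'(3)[OF a] C(1) by (intro add_mono mult_left_mono) auto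
    also have "\<dots> \<le> 1/2 * Q' + D * Q' powr ((p + 1) / 2)" unfolding D_def by (simp add: algebra_simps)
    also have "Q' powr ((p + 1) / 2) = Q' powr q * Q'"
    proof -
      have "Q' powr q * Q' = Q' powr q * Q' powr 1" using Q by (simp add: Q'_def)
      also have "\<dots> = Q' powr (q + 1)" by (rule powr_add[symmetric])
      also have "q + 1 = (p + 1) / 2" by (simp add: q_def field_simps)
      finally show ?thesis by simp
    qed
    finally have "nl g \<le> 1/2 * Q' + (D * Q' powr q) * Q'" by (simp add: mult.assoc)
    also have "\<dots> < 1/2 * Q' + (1/2) * Q'"
    proof -
      have "Q' powr q < c\<^sub>0 powr q" using \<open>\<not> c\<^sub>0 \<le> qform d g\<close> q Q by (intro powr_less_mono2) (auto simp: Q'_def)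
      then have "D * Q' powr q < 1/2" unfolding c0q[symmetric] using D by (rule mult_strict_left_mono)
      then have "(D * Q' powr q) * Q' < (1/2) * Q'" using Q by (intro mult_strict_right_mono) (auto simp: Q'_def)
      then show ?thesis by simp
    qed
    also have "\<dots> = Q'" by simp
    finally show False using n unfolding nehari_def Q'_def by simp
  qed
  then show ?thesis using that c0 by blast
qed

lemma nl_tendsto:
  assumes g: "\<And>n. g n \<in> profiles d" and K: "\<And>n. qform d (g n) \<le> K"
    and lim: "\<And>r. 0 < r \<Longrightarrow> (\<lambda>n. g n r) \<longlonglongrightarrow> h r" and h: "h \<in> borel_measurable borel"
  shows "(\<lambda>n. nl (g n)) \<longlonglongrightarrow> nl h"
  unfolding nl_def
  by (rule admissible_integral_tendsto[OF profile_admissible[OF g K] lim h cont_f_mult f_mult_bound])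

text \<open>Below a scale whose energy is less than the threshold of
  \<open>nehari_lower_bound\<close> the functional I must be positive; at t = 1 it is nonpositive,
  so the intermediate value theorem applies in between. Continuity in t comes from compactness of
  the nonlinear term.\<close>

lemma nehari_scale_exists:
  assumes g: "g \<in> profiles d" and n: "nehari g \<le> 0" and Q: "0 < qform d g"
  obtains t where "0 < t" "t \<le> 1" "nehari (\<lambda>r. t * g r) = 0"
proof -
  obtain c\<^sub>0 where c0: "0 < c\<^sub>0" "\<And>g. g \<in> profiles d \<Longrightarrow> nehari g \<le> 0 \<Longrightarrow> 0 < qform d g \<Longrightarrow> c\<^sub>0 \<le> qform d g"
    using nehari_lower_bound by metis
  define t\<^sub>0 where "t\<^sub>0 = min 1 (sqrt (c\<^sub>0 / (2 * qform d g)))"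
  have t0: "0 < t\<^sub>0" "t\<^sub>0 \<le> 1" unfolding t\<^sub>0_def using c0(1) Q by auto
  have "t\<^sub>0\<^sup>2 \<le> (sqrt (c\<^sub>0 / (2 * qform d g)))^2"
    using t0 by (intro power_mono) (auto simp: t\<^sub>0_def)
  also have "\<dots> = c\<^sub>0 / (2 * qform d g)" using c0(1) Q by simp
  finally have "t\<^sub>0\<^sup>2 * qform d g \<le> c\<^sub>0 / 2" using Q by (simp add: field_simps)
  then have small: "t\<^sub>0\<^sup>2 * qform d g < c\<^sub>0" using c0(1) by linarith
  define \<phi> where "\<phi> t = nehari (\<lambda>r. t * g r)" for t
  have pos: "0 < \<phi> t\<^sub>0"
  proof (rule ccontr)
    assume "\<not> 0 < \<phi> t\<^sub>0"
    then have "c\<^sub>0 \<le> qform d (\<lambda>r. t\<^sub>0 * g r)"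
      by (intro c0(2) qform_scale(2)[OF g]) (use t0 Q in \<open>auto simp: \<phi>_def qform_scale(1)[OF g]\<close>)
    then show False using small by (simp add: qform_scale(1)[OF g])
  qed
  have "continuous_on {t\<^sub>0..1} \<phi>"
  proof (rule continuous_on_sequentiallyI)
    fix u t assume u: "\<forall>n. u n \<in> {t\<^sub>0..1}" and t: "t \<in> {t\<^sub>0..1}" and lim: "u \<longlonglongrightarrow> t"
    have "(\<lambda>n. nl (\<lambda>r. u n * g r)) \<longlonglongrightarrow> nl (\<lambda>r. t * g r)"
    proof (rule nl_tendsto[where K = "qform d g"])
      fix n
      have "(u n)^2 \<le> 1" using u[rule_format, of n] t0 by (intro power_le_one) auto
      then show "qform d (\<lambda>r. u n * g r) \<le> qform d g"
        using Q mult_right_mono[of "(u n)^2" 1 "qform d g"] by (simp add: qform_scale(1)[OF g])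
    qed (auto intro!: tendsto_intros lim qform_scale(2) g profiles_borel[OF qform_scale(2)[OF g]])
    moreover have "(\<lambda>n. (u n)^2 * qform d g) \<longlonglongrightarrow> t\<^sup>2 * qform d g" by (intro tendsto_intros lim)
    ultimately show "(\<lambda>n. \<phi> (u n)) \<longlonglongrightarrow> \<phi> t"
      unfolding \<phi>_def nehari_def qform_scale(1)[OF g] by (intro tendsto_diff)
  qed
  moreover have "\<phi> 1 \<le> 0" using n by (simp add: \<phi>_def)
  ultimately obtain t where "t\<^sub>0 \<le> t" "t \<le> 1" "\<phi> t = 0"
    using IVT2'[of \<phi> 1 0 t\<^sub>0] pos t0 by auto
  then show ?thesis using that[of t] t0 by (simp add: \<phi>_def)
qed

lemma excess_integral_scale:
  assumes g: "g \<in> profiles d" and t: "0 < t" "t \<le> 1"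
  shows "(LINT r|\<mu>. excess (t * g r)) \<le> (LINT r|\<mu>. excess (g r))"
    and "0 < qform d g \<Longrightarrow> (LINT r|\<mu>. excess (t * g r)) = (LINT r|\<mu>. excess (g r)) \<Longrightarrow> t = 1"
proof -
  have i1: "integrable \<mu> (\<lambda>r. excess (t * g r))"
    using admissible_integrable[OF profile_admissible'[OF qform_scale(2)[OF g, of t]] cont_excess excess_bound] .
  have i2: "integrable \<mu> (\<lambda>r. excess (g r))"
    using admissible_integrable[OF profile_admissible'[OF g] cont_excess excess_bound] .
  show "(LINT r|\<mu>. excess (t * g r)) \<le> (LINT r|\<mu>. excess (g r))"
    by (rule Bochner_Integration.integral_mono[OF i1 i2]) (use excess_scale(1) t in auto)
  assume Q: "0 < qform d g" and eq: "(LINT r|\<mu>. excess (t * g r)) = (LINT r|\<mu>. excess (g r))"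
  show "t = 1"
  proof (rule ccontr)
    assume "t \<noteq> 1"
    have "(LINT r|\<mu>. excess (g r) - excess (t * g r)) = 0" using i1 i2 eq by simp
    then have "AE r in \<mu>. excess (g r) - excess (t * g r) = 0"
      using integral_nonneg_eq_0_iff_AE[of \<mu> "\<lambda>r. excess (g r) - excess (t * g r)"] i1 i2 excess_scale(1)[of t] t by auto
    then have "AE r in \<mu>. g r = 0"
      by eventually_elim (use excess_scale(2)[of t] t \<open>t \<noteq> 1\<close> in auto)
    then show False using qform_eq_zero_AE[OF g] Q by simp
  qed
qed

lemma parts_tendsto:
  assumes "(\<lambda>n. g n r) \<longlonglongrightarrow> (h r :: real)"
  shows "(\<lambda>n. pospart (g n) r) \<longlonglongrightarrow> pospart h r" "(\<lambda>n. negpart (g n) r) \<longlonglongrightarrow> negpart h r"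
  unfolding pospart_def negpart_def by (intro tendsto_intros assms)+

lemma parts_of_combination:
  assumes "0 < s" "0 < t" "\<And>r. 0 \<le> a r" "\<And>r. 0 \<le> b r" "\<And>r. a r = 0 \<or> b r = (0::real)"
  shows "pospart (\<lambda>r. s * a r - t * b r) = (\<lambda>r. s * a r)" "negpart (\<lambda>r. s * a r - t * b r) = (\<lambda>r. t * b r)"
proof -
  have "max (s * a r - t * b r) 0 = s * a r \<and> max (- (s * a r - t * b r)) 0 = t * b r" for r
    using assms(5)[of r] assms(1,2) assms(3)[of r] assms(4)[of r] by auto
  then show "pospart (\<lambda>r. s * a r - t * b r) = (\<lambda>r. s * a r)" "negpart (\<lambda>r. s * a r - t * b r) = (\<lambda>r. t * b r)"
    unfolding pospart_def negpart_def by auto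
qed

lemma pospart_nonneg: "0 \<le> pospart h r" and negpart_nonneg: "0 \<le> negpart h r"
  and parts_disjoint: "pospart h r = 0 \<or> negpart h r = 0"
  by (auto simp: pospart_def negpart_def)

text \<open>Two nonnegative profiles with disjoint supports, each below its Nehari set, can be scaled down into the
  nodal set, which does not increase the excess.\<close>
lemma nodal_by_scaling:
  assumes ab: "a \<in> profiles d" "b \<in> profiles d" "\<And>r. 0 \<le> a r" "\<And>r. 0 \<le> b r" "\<And>r. a r = 0 \<or> b r = 0"
    and n: "nehari a \<le> 0" "nehari b \<le> 0" and Q: "0 < qform d a" "0 < qform d b"
  obtains s t where "0 < s" "s \<le> 1" "0 < t" "t \<le> 1" "nehari (\<lambda>r. s * a r) = 0" "nehari (\<lambda>r. t * b r) = 0"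
    "(\<lambda>r. s * a r - t * b r) \<in> nodal"
    "act (\<lambda>r. s * a r - t * b r) = (LINT r|\<mu>. excess (s * a r)) + (LINT r|\<mu>. excess (t * b r))"
proof -
  obtain s where s: "0 < s" "s \<le> 1" "nehari (\<lambda>r. s * a r) = 0"
    using nehari_scale_exists[OF ab(1) n(1) Q(1)] by metis
  obtain t where t: "0 < t" "t \<le> 1" "nehari (\<lambda>r. t * b r) = 0"
    using nehari_scale_exists[OF ab(2) n(2) Q(2)] by metis
  have w: "(\<lambda>r. s * a r - t * b r) \<in> profiles d"
    using profiles_lincomb[OF ab(1,2), of s "- t"] by simp
  note parts = parts_of_combination[where a = a and b = b, OF s(1) t(1) ab(3-5)]
  show ?thesis
  proof (rule that[OF s(1,2) t(1,2) s(3) t(3)])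
    show "(\<lambda>r. s * a r - t * b r) \<in> nodal"
      unfolding nodal_def using w s t Q by (simp add: parts qform_scale(1)[OF ab(1)] qform_scale(1)[OF ab(2)])
    show "act (\<lambda>r. s * a r - t * b r) = (LINT r|\<mu>. excess (s * a r)) + (LINT r|\<mu>. excess (t * b r))"
      unfolding act_parts[OF w] parts
      by (simp add: act_eq_excess[OF qform_scale(2)[OF ab(1)] s(3)] act_eq_excess[OF qform_scale(2)[OF ab(2)] t(3)])
  qed
qed

lemma nodalD:
  assumes "g \<in> nodal"
  shows "g \<in> profiles d" "nehari (pospart g) = 0" "nehari (negpart g) = 0"
    "0 < qform d (pospart g)" "0 < qform d (negpart g)"
  using assms unfolding nodal_def by auto

lemma act_nodal:
  assumes "g \<in> nodal"
  shows "act g = (LINT r|\<mu>. excess (pospart g r)) + (LINT r|\<mu>. excess (negpart g r))"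
proof -
  note n = nodalD[OF assms]
  show ?thesis
    by (simp only: act_parts[OF n(1)] act_eq_excess[OF profiles_parts(1)[OF n(1)] n(2)]
        act_eq_excess[OF profiles_parts(2)[OF n(1)] n(3)])
qed

text \<open>Under pointwise convergence the nonlinear term is continuous but the energy only lower
  semicontinuous, so the constraint I = 0 weakens to I \<le> 0. The limit is nonzero because the
  energies, hence the nonlinear terms, stay above a fixed positive constant.\<close>

lemma nehari_limit:
  assumes g: "\<And>n. g n \<in> profiles d" and n: "\<And>n. nehari (g n) = 0" and pos: "\<And>n. 0 < qform d (g n)"
    and K: "\<And>n. qform d (g n) \<le> K" and lim: "\<And>r. 0 < r \<Longrightarrow> (\<lambda>n. g n r) \<longlonglongrightarrow> h r"
    and h: "h \<in> borel_measurable borel"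
  shows "h \<in> profiles d" "nehari h \<le> 0" "0 < qform d h" "(\<lambda>n. qform d (g n)) \<longlonglongrightarrow> nl h"
proof -
  obtain c\<^sub>0 where c0: "0 < c\<^sub>0" "\<And>g. g \<in> profiles d \<Longrightarrow> nehari g \<le> 0 \<Longrightarrow> 0 < qform d g \<Longrightarrow> c\<^sub>0 \<le> qform d g"
    using nehari_lower_bound by metis
  have "(\<lambda>n. nl (g n)) \<longlonglongrightarrow> nl h" by (rule nl_tendsto[OF g K lim h])
  moreover have "nl (g k) = qform d (g k)" for k using n[of k] by (simp add: nehari_def)
  ultimately show l: "(\<lambda>n. qform d (g n)) \<longlonglongrightarrow> nl h" by simp
  show hp: "h \<in> profiles d" by (rule qform_lsc(1)[OF g always_eventually lim h]) (use K in auto)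
  have "qform d h \<le> nl h"
  proof (rule field_le_epsilon)
    fix e :: real assume e: "0 < e"
    have "\<forall>\<^sub>F n in sequentially. qform d (g n) < nl h + e" by (rule order_tendstoD(2)[OF l]) (use e in simp)
    then have "\<forall>\<^sub>F n in sequentially. qform d (g n) \<le> nl h + e" by eventually_elim simp
    then show "qform d h \<le> nl h + e" by (rule qform_lsc(2)[OF g _ lim h])
  qed
  then show "nehari h \<le> 0" by (simp add: nehari_def)
  have "c\<^sub>0 \<le> nl h"
    by (rule tendsto_lowerbound[OF l]) (auto intro!: always_eventually c0(2) g pos simp: n)
  have "qform d h \<noteq> 0"
  proof
    assume "qform d h = 0"
    then have "AE r in \<mu>. f (h r) * h r = 0"
      by (intro AE_radialI) (simp add: qform_zero_imp[OF hp])
    then have "nl h = 0" unfolding nl_def by (rule integral_eq_zero_AE)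
    then show False using \<open>c\<^sub>0 \<le> nl h\<close> c0(1) by simp
  qed
  then show "0 < qform d h" using qform_nonneg[of d h] by simp
qed

theorem nodal_minimizing_sequence:
  assumes g: "\<And>n. g n \<in> nodal" and lim: "(\<lambda>n. act (g n)) \<longlonglongrightarrow> m" and min: "\<And>h. h \<in> nodal \<Longrightarrow> m \<le> act h"
  obtains \<rho> h where "strict_mono (\<rho> :: nat \<Rightarrow> nat)" "h \<in> nodal" "act h = m"
    "(\<lambda>n. qform d (\<lambda>r. g (\<rho> n) r - h r)) \<longlonglongrightarrow> 0"
proof -
  note G = nodalD[OF g]
  define \<alpha> where "\<alpha> = 1/2 - 1/\<theta>"
  have \<alpha>: "0 < \<alpha>" unfolding \<alpha>_def using \<theta>2 by (simp add: field_simps)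
  have "Bseq (\<lambda>n. act (g n))" using lim by (meson convergentI convergent_imp_Bseq)
  then obtain B where B: "\<And>n. \<bar>act (g n)\<bar> \<le> B" unfolding Bseq_def by auto
  define K where "K = B / \<alpha>"
  have K: "qform d (g n) \<le> K" for n
  proof -
    have "\<alpha> * qform d (g n) \<le> act (g n)" unfolding \<alpha>_def
      by (rule act_coercive[OF G(1)]) (simp add: nehari_parts[OF G(1)] G)
    also have "\<dots> \<le> B" using B[of n] by linarith
    finally show ?thesis unfolding K_def using \<alpha> by (simp add: field_simps)
  qed
  have "\<forall>n. \<exists>c. profile d (g n) c" using G(1) by (simp add: profiles_def)
  from choice[OF this] obtain c where c: "\<And>n. profile d (g n) (c n)" by blast
  have E: "energy d (g n) (c n) \<le> K" for n using K[of n] qform_eq[OF c] by simp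
  from profile_pointwise_compact[where g = g, OF c E] obtain \<rho> :: "nat \<Rightarrow> nat" and h
    where \<rho>h: "strict_mono \<rho> \<and> h \<in> borel_measurable borel \<and> (\<forall>r>0. (\<lambda>n. g (\<rho> n) r) \<longlonglongrightarrow> h r)"
    by (elim exE)
  then have \<rho>: "strict_mono \<rho>" and h: "h \<in> borel_measurable borel" by simp_all
  have lim_h: "(\<lambda>n. g (\<rho> n) r) \<longlonglongrightarrow> h r" if "0 < r" for r using \<rho>h that by simp
  have hp: "h \<in> profiles d"
    by (rule qform_lsc(1)[of "\<lambda>n. g (\<rho> n)", OF G(1) always_eventually lim_h h]) (use K in auto)
  note hb = profiles_borel[OF profiles_parts(1)[OF hp]] profiles_borel[OF profiles_parts(2)[OF hp]]
  have Kp: "qform d (pospart (g n)) \<le> K" "qform d (negpart (g n)) \<le> K" for n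
    using K[of n] qform_parts[OF G(1)[of n]] qform_nonneg[of d "pospart (g n)"] qform_nonneg[of d "negpart (g n)"] by linarith+
  note limp = parts_tendsto[where g = "\<lambda>n. g (\<rho> n)", OF lim_h]
  note P = nehari_limit[where g = "\<lambda>n. pospart (g (\<rho> n))", OF profiles_parts(1)[OF G(1)] G(2) G(4) Kp(1) limp(1) hb(1)]
  note N = nehari_limit[where g = "\<lambda>n. negpart (g (\<rho> n))", OF profiles_parts(2)[OF G(1)] G(3) G(5) Kp(2) limp(2) hb(2)]
  \<comment> \<open>Pointwise convergence suffices here, since no derivative enters the
    excess.\<close>
  have eP: "(\<lambda>n. LINT r|\<mu>. excess (pospart (g (\<rho> n)) r)) \<longlonglongrightarrow> (LINT r|\<mu>. excess (pospart h r))"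
    by (rule admissible_integral_tendsto[OF profile_admissible[OF profiles_parts(1)[OF G(1)] Kp(1)] limp(1) hb(1) cont_excess excess_bound])
  have eN: "(\<lambda>n. LINT r|\<mu>. excess (negpart (g (\<rho> n)) r)) \<longlonglongrightarrow> (LINT r|\<mu>. excess (negpart h r))"
    by (rule admissible_integral_tendsto[OF profile_admissible[OF profiles_parts(2)[OF G(1)] Kp(2)] limp(2) hb(2) cont_excess excess_bound])
  have "(\<lambda>n. act (g (\<rho> n))) \<longlonglongrightarrow> m" using LIMSEQ_subseq_LIMSEQ[OF lim \<rho>] by (simp add: o_def)
  moreover have "(\<lambda>n. act (g (\<rho> n))) \<longlonglongrightarrow> (LINT r|\<mu>. excess (pospart h r)) + (LINT r|\<mu>. excess (negpart h r))"
    unfolding act_nodal[OF g] by (rule tendsto_add[OF eP eN])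
  ultimately have m: "m = (LINT r|\<mu>. excess (pospart h r)) + (LINT r|\<mu>. excess (negpart h r))"
    by (rule LIMSEQ_unique)
  obtain s t where st: "0 < s" "s \<le> 1" "0 < t" "t \<le> 1" "nehari (\<lambda>r. s * pospart h r) = 0" "nehari (\<lambda>r. t * negpart h r) = 0"
    "(\<lambda>r. s * pospart h r - t * negpart h r) \<in> nodal"
    "act (\<lambda>r. s * pospart h r - t * negpart h r) = (LINT r|\<mu>. excess (s * pospart h r)) + (LINT r|\<mu>. excess (t * negpart h r))"
    by (rule nodal_by_scaling[where a = "pospart h" and b = "negpart h",
          OF profiles_parts[OF hp] pospart_nonneg negpart_nonneg parts_disjoint P(2) N(2) P(3) N(3)])
  have le: "m \<le> (LINT r|\<mu>. excess (s * pospart h r)) + (LINT r|\<mu>. excess (t * negpart h r))"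
    using min[OF st(7)] st(8) by simp
  note sP = excess_integral_scale[OF profiles_parts(1)[OF hp] st(1,2)]
  note sN = excess_integral_scale[OF profiles_parts(2)[OF hp] st(3,4)]
  \<comment> \<open>The infimum m is the unscaled sum; it is at most the scaled sum, whose terms are
    each no larger than the unscaled ones. So both inequalities are equalities, and strict
    monotonicity of the excess forces s = t = 1.\<close>
  have eq: "a' = a \<and> b' = b" if "a + b \<le> a' + b'" "a' \<le> a" "b' \<le> b" for a a' b b' :: real
    using that by linarith
  note eq = eq[OF le[unfolded m] sP(1) sN(1)]
  have "s = 1" by (rule sP(2)[OF P(3) conjunct1[OF eq]])
  moreover have "t = 1" by (rule sN(2)[OF N(3) conjunct2[OF eq]])
  ultimately have ne: "nehari (pospart h) = 0" "nehari (negpart h) = 0" using st(5,6) by auto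
  then have hn: "h \<in> nodal" unfolding nodal_def using hp P(3) N(3) by simp
  have "act h = m" using act_nodal[OF hn] m by simp
  moreover have "(\<lambda>n. qform d (\<lambda>r. g (\<rho> n) r - h r)) \<longlonglongrightarrow> 0"
  proof (rule qform_tendsto_strong[OF G(1) hp _ lim_h])
    \<comment> \<open>On the Nehari set the energy equals the nonlinear term, both along the
      sequence and for h; convergence of the latter is therefore convergence of norms.\<close>
    have "(\<lambda>n. qform d (pospart (g (\<rho> n))) + qform d (negpart (g (\<rho> n)))) \<longlonglongrightarrow> nl (pospart h) + nl (negpart h)"
      by (rule tendsto_add[OF P(4) N(4)])
    then show "(\<lambda>n. qform d (g (\<rho> n))) \<longlonglongrightarrow> qform d h"
      using ne by (simp add: qform_parts[OF G(1)] qform_parts[OF hp] nehari_def)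
  qed
  ultimately show ?thesis by (rule that[OF \<rho> hn])
qed

end

section \<open>The Euler--Lagrange equation\<close>

context nonlinearity
begin

text \<open>Dominated convergence. The formula for the derivative of a positive part is
  discontinuous across the zero set of k, but there the limit derivative c vanishes almost
  everywhere.\<close>

lemma pospart_continuity:
  assumes h: "\<And>n. profile d (h n) (e n)" and k: "profile d k c"
    and limh: "\<And>r. 0 < r \<Longrightarrow> (\<lambda>n. h n r) \<longlonglongrightarrow> k r" and lime: "\<And>r. 0 < r \<Longrightarrow> (\<lambda>n. e n r) \<longlonglongrightarrow> c r"
    and v: "integrable \<mu> (\<lambda>r. (v r)^2)" "\<And>n r. \<bar>h n r\<bar> \<le> v r"
    and w: "integrable \<mu> (\<lambda>r. (w r)^2)" "\<And>n r. \<bar>e n r\<bar> \<le> w r"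
  shows "(\<lambda>n. qform d (pospart (h n))) \<longlonglongrightarrow> qform d (pospart k)"
    and "(\<lambda>n. nehari (pospart (h n))) \<longlonglongrightarrow> nehari (pospart k)"
proof -
  note P = profile_pospart[OF h] and R = profile_pospart[OF k]
  note [measurable] = profileD(1,2)[OF h] profileD(1,2)[OF k]
  have sq: "x\<^sup>2 \<le> y\<^sup>2" if "\<bar>x\<bar> \<le> y" for x y :: real
    using that by (rule abs_le_square_iff[THEN iffD1, OF order_trans]) simp
  have sv: "(h n r)^2 \<le> (v r)^2" "(e n r)^2 \<le> (w r)^2" for n r using sq v(2) w(2) by blast+
  have 1: "(\<lambda>n. LINT r|\<mu>. (pospart (h n) r)^2) \<longlonglongrightarrow> (LINT r|\<mu>. (pospart k r)^2)"
  proof (rule integral_dominated_convergence[OF _ _ v(1)])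
    show "(\<lambda>r. (pospart k r)^2) \<in> borel_measurable \<mu>" "(\<lambda>r. (pospart (h n) r)^2) \<in> borel_measurable \<mu>" for n
      using profileD(1)[OF R] profileD(1)[OF P] by auto
    show "AE r in \<mu>. (\<lambda>n. (pospart (h n) r)^2) \<longlonglongrightarrow> (pospart k r)^2"
      by (rule AE_radialI) (intro tendsto_intros parts_tendsto limh)
    show "AE r in \<mu>. norm ((pospart (h n) r)^2) \<le> (v r)^2" for n
      using sv(1)[of n] by (auto simp: pospart_def max_def intro!: AE_I2)
  qed
  have 2: "(\<lambda>n. LINT r|\<mu>. (if 0 < h n r then e n r else 0)^2) \<longlonglongrightarrow> (LINT r|\<mu>. (if 0 < k r then c r else 0)^2)"
  proof (rule integral_dominated_convergence[OF _ _ w(1)])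
    show "(\<lambda>r. (if 0 < k r then c r else 0)^2) \<in> borel_measurable \<mu>"
      "(\<lambda>r. (if 0 < h n r then e n r else 0)^2) \<in> borel_measurable \<mu>" for n by auto
    have "AE r in \<mu>. 0 < r" by (rule AE_radialI)
    with profile_deriv_zero_on_zero_set[OF k]
    show "AE r in \<mu>. (\<lambda>n. (if 0 < h n r then e n r else 0)^2) \<longlonglongrightarrow> (if 0 < k r then c r else 0)^2"
    proof eventually_elim
      case (elim r)
      consider "0 < k r" | "k r < 0" | "k r = 0" by linarith
      then show ?case
      proof cases
        case 1
        have "\<forall>\<^sub>F n in sequentially. 0 < h n r" by (rule order_tendstoD(1)[OF limh]) (use elim 1 in auto)
        then have "\<forall>\<^sub>F n in sequentially. (e n r)^2 = (if 0 < h n r then e n r else 0)^2" by eventually_elim simp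
        moreover have "(\<lambda>n. (e n r)^2) \<longlonglongrightarrow> (c r)^2" by (intro tendsto_intros lime) (use elim in auto)
        ultimately show ?thesis using 1 by (simp add: tendsto_cong)
      next
        case 2
        have "\<forall>\<^sub>F n in sequentially. h n r < 0" by (rule order_tendstoD(2)[OF limh]) (use elim 2 in auto)
        then have "\<forall>\<^sub>F n in sequentially. (if 0 < h n r then e n r else 0)^2 = 0" by eventually_elim simp
        then show ?thesis using 2 by (simp add: tendsto_eventually)
      next
        case 3
        \<comment> \<open>The condition 0 < h n r may oscillate here, but it only selects among 0
          and derivatives that tend to c r = 0.\<close>
        then have c: "c r = 0" using elim by simp
        have "(\<lambda>n. (e n r)^2) \<longlonglongrightarrow> (c r)^2" by (intro tendsto_intros lime) (use elim in auto)
        then have l: "(\<lambda>n. (e n r)^2) \<longlonglongrightarrow> 0" using c by simp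
        have "(\<lambda>n. (if 0 < h n r then e n r else 0)^2) \<longlonglongrightarrow> 0"
          by (rule tendsto_sandwich[OF _ _ tendsto_const l]) auto
        then show ?thesis using 3 by simp
      qed
    qed
    show "AE r in \<mu>. norm ((if 0 < h n r then e n r else 0)^2) \<le> (w r)^2" for n
      using sv(2)[of n] by (auto intro!: AE_I2)
  qed
  show Q: "(\<lambda>n. qform d (pospart (h n))) \<longlonglongrightarrow> qform d (pospart k)"
    unfolding qform_eq[OF P] qform_eq[OF R] by (rule tendsto_add[OF 2 1])
  have "(\<lambda>n. nl (pospart (h n))) \<longlonglongrightarrow> nl (pospart k)"
  proof (rule nl_tendsto)
    fix n
    have "qform d (pospart (h n)) \<le> qform d (h n)"
      using qform_parts[OF profilesI[OF h]] qform_nonneg[of d "negpart (h n)"] by simp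
    also have "\<dots> = energy d (h n) (e n)" by (rule qform_eq[OF h])
    also have "\<dots> \<le> (LINT r|\<mu>. (w r)^2) + (LINT r|\<mu>. (v r)^2)"
      by (intro add_mono Bochner_Integration.integral_mono profileD(3,4)[OF h] v(1) w(1) sv)
    finally show "qform d (pospart (h n)) \<le> (LINT r|\<mu>. (w r)^2) + (LINT r|\<mu>. (v r)^2)" .
  qed (auto intro!: parts_tendsto limh profilesI[OF P] profileD(1)[OF R])
  then show "(\<lambda>n. nehari (pospart (h n))) \<longlonglongrightarrow> nehari (pospart k)"
    unfolding nehari_def by (rule tendsto_diff[OF Q])
qed

section \<open>Functionals along the rays through a Nehari function\<close>

lemma integral_pos_strict:
  assumes g: "g \<in> profiles d" "0 < qform d g" and k: "integrable \<mu> k"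
    and "\<And>r. g r \<noteq> 0 \<Longrightarrow> 0 < k r" "\<And>r. g r = 0 \<Longrightarrow> k r = (0::real)"
  shows "0 < integral\<^sup>L \<mu> k"
proof -
  have nn: "0 \<le> k r" for r using assms(4)[of r] assms(5)[of r] by (cases "g r = 0") auto
  have "integral\<^sup>L \<mu> k \<noteq> 0"
  proof
    assume "integral\<^sup>L \<mu> k = 0"
    then have "AE r in \<mu>. k r = 0" using integral_nonneg_eq_0_iff_AE[OF k] nn by simp
    then have "AE r in \<mu>. g r = 0" by eventually_elim (use assms(4) in force)
    then show False using qform_eq_zero_AE[OF g(1)] g(2) by simp
  qed
  moreover have "0 \<le> integral\<^sup>L \<mu> k" by (rule integral_nonneg) (rule nn)
  ultimately show ?thesis by simp
qed

lemma f_scale_less: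
  assumes "0 < s" "s < 1" "w \<noteq> 0"
  shows "f (s * w) * (s * w) < s\<^sup>2 * (f w * w)"
proof -
  define a where "a = \<bar>w\<bar>"
  have a: "0 < a" using assms by (simp add: a_def)
  have "f (s * a) / (s * a) < f a / a" using a assms by (intro ratio_less) auto
  then have "f (s * a) / (s * a) * (s * a)^2 < f a / a * (s * a)^2"
    using a assms by (intro mult_strict_right_mono) auto
  then have "f (s * a) * (s * a) < s\<^sup>2 * (f a * a)"
    using a assms by (simp add: power2_eq_square field_simps)
  moreover have "f (s * a) * (s * a) = f (s * w) * (s * w)"
  proof -
    have "s * a = \<bar>s * w\<bar>" using assms by (simp add: a_def abs_mult)
    then show ?thesis by (simp only: f_mult_abs)
  qed
  moreover have "f a * a = f w * w" unfolding a_def by (rule f_mult_abs)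
  ultimately show ?thesis by simp
qed

text \<open>Using I(g) = 0, the energy in I(s g) is replaced by the nonlinear term; the remaining
  integrand s^2 f(g) g - f(s g) s g has a fixed sign on each side of s = 1 because f(s)/s increases.
  This provides the boundary signs for the Poincare-Miranda argument.\<close>

lemma nehari_scale_sign:
  assumes g: "g \<in> profiles d" "0 < qform d g" and n: "nehari g = 0"
  shows "0 < s \<Longrightarrow> s < 1 \<Longrightarrow> 0 < nehari (\<lambda>r. s * g r)" "1 < s \<Longrightarrow> nehari (\<lambda>r. s * g r) < 0"
proof -
  note i = admissible_f_integrable[OF profile_admissible'[OF g(1)]]
  note is' = admissible_f_integrable[OF profile_admissible'[OF qform_scale(2)[OF g(1)]]]
  have e: "nehari (\<lambda>r. s * g r) = (LINT r|\<mu>. s\<^sup>2 * (f (g r) * g r) - f (s * g r) * (s * g r))" for s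
    using n i is'[of s] unfolding nehari_def nl_def qform_scale(1)[OF g(1)] by simp
  have ii: "integrable \<mu> (\<lambda>r. s\<^sup>2 * (f (g r) * g r) - f (s * g r) * (s * g r))" for s
    using i is'[of s] by simp
  show "0 < nehari (\<lambda>r. s * g r)" if "0 < s" "s < 1"
    unfolding e by (rule integral_pos_strict[OF g ii]) (use f_scale_less that in auto)
  show "nehari (\<lambda>r. s * g r) < 0" if s: "1 < s"
  proof -
    have "0 < (LINT r|\<mu>. - (s\<^sup>2 * (f (g r) * g r) - f (s * g r) * (s * g r)))"
    proof (rule integral_pos_strict[OF g])
      fix r assume "g r \<noteq> 0"
      then have "f (1/s * (s * g r)) * (1/s * (s * g r)) < (1/s)^2 * (f (s * g r) * (s * g r))"
        using s by (intro f_scale_less) auto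
      then have "f (g r) * g r < (1/s)^2 * (f (s * g r) * (s * g r))" using s by simp
      then have "s\<^sup>2 * (f (g r) * g r) < s\<^sup>2 * ((1/s)^2 * (f (s * g r) * (s * g r)))"
        using s by (intro mult_strict_left_mono) auto
      also have "\<dots> = f (s * g r) * (s * g r)" using s by (simp add: power_divide)
      finally show "0 < - (s\<^sup>2 * (f (g r) * g r) - f (s * g r) * (s * g r))" by simp
    qed (use i is'[of s] in auto)
    then show ?thesis unfolding e using i is'[of s] by simp
  qed
qed

text \<open>With I(g) = 0 the action of s g becomes an integral without gradient, and the inequality
  holds pointwise by \<open>F_diff_bound\<close> applied to |g r| and s |g r|.\<close>

lemma act_scale_le:
  assumes g: "g \<in> profiles d" and n: "nehari g = 0" and s: "0 < s"
  shows "act (\<lambda>r. s * g r) \<le> act g"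
proof -
  note a = profile_admissible'[OF g] and as = profile_admissible'[OF qform_scale(2)[OF g, of s]]
  have "act (\<lambda>r. s * g r) = (LINT r|\<mu>. 1/2 * s\<^sup>2 * (f (g r) * g r) - F (s * g r))"
    using n admissible_f_integrable[OF a] admissible_integrable[OF as cont_F F_le_f]
    unfolding act_def nehari_def nl_def qform_scale(1)[OF g] by simp
  also have "\<dots> \<le> (LINT r|\<mu>. excess (g r))"
  proof (rule Bochner_Integration.integral_mono)
    show "integrable \<mu> (\<lambda>r. 1/2 * s\<^sup>2 * (f (g r) * g r) - F (s * g r))"
      using admissible_f_integrable[OF a] admissible_integrable[OF as cont_F F_le_f] by simp
    show "integrable \<mu> (\<lambda>r. excess (g r))" by (rule admissible_integrable[OF a cont_excess excess_bound])
    fix r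
    show "1/2 * s\<^sup>2 * (f (g r) * g r) - F (s * g r) \<le> excess (g r)"
    proof (cases "g r = 0")
      case False
      define x where "x = \<bar>g r\<bar>"
      have x: "0 < x" using False by (simp add: x_def)
      have "F x - F (s * x) \<le> f x / x * (x\<^sup>2 - (s * x)^2) / 2" using x s by (intro F_diff_bound) auto
      also have "\<dots> = 1/2 * (f x * x) - 1/2 * s\<^sup>2 * (f x * x)" using x by (simp add: power2_eq_square field_simps)
      finally have "1/2 * s\<^sup>2 * (f x * x) - F (s * x) \<le> 1/2 * (f x * x) - F x" by simp
      moreover have "F (s * x) = F (s * g r)" using F_abs[of "s * g r"] s by (simp add: x_def abs_mult)
      ultimately show ?thesis using f_mult_abs[of "g r"] F_abs[of "g r"] unfolding x_def excess_def by simp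
    qed simp
  qed
  also have "\<dots> = act g" using act_eq_excess[OF g n] by simp
  finally show ?thesis .
qed

section \<open>Perturbations of the minimizer\<close>

lemma F_mean_value: "\<exists>\<xi>. \<bar>\<xi> - y\<bar> \<le> \<bar>z\<bar> \<and> F (y + z) - F y = f \<xi> * z"
proof -
  consider "z = 0" | "0 < z" | "z < 0" by linarith
  then show ?thesis
  proof cases
    case 2
    then obtain \<xi> where "y < \<xi>" "\<xi> < y + z" "F (y + z) - F y = (y + z - y) * f \<xi>"
      using MVT2[of y "y + z" F f] F_deriv by auto
    then show ?thesis by (intro exI[of _ \<xi>]) auto
  next
    case 3
    then obtain \<xi> where "y + z < \<xi>" "\<xi> < y" "F y - F (y + z) = (y - (y + z)) * f \<xi>"
      using MVT2[of "y + z" y F f] F_deriv by auto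
    then show ?thesis by (intro exI[of _ \<xi>]) (auto simp: algebra_simps)
  qed (auto intro: exI[of _ y])
qed

text \<open>The base point moves together with the step, so differentiability of F at l is not
  enough; the mean value theorem moves the question to continuity of f at l.\<close>

lemma F_quotient_tendsto:
  assumes y: "y \<longlonglongrightarrow> l" and \<epsilon>: "\<epsilon> \<longlonglongrightarrow> 0" "\<And>n. \<epsilon> n \<noteq> 0"
  shows "(\<lambda>n. (F (y n + \<epsilon> n * z) - F (y n)) / \<epsilon> n) \<longlonglongrightarrow> f l * z"
proof -
  have "\<forall>n. \<exists>\<xi>. \<bar>\<xi> - y n\<bar> \<le> \<bar>\<epsilon> n * z\<bar> \<and> F (y n + \<epsilon> n * z) - F (y n) = f \<xi> * (\<epsilon> n * z)"
    using F_mean_value by blast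
  from choice[OF this] obtain \<xi> where \<xi>: "\<And>n. \<bar>\<xi> n - y n\<bar> \<le> \<bar>\<epsilon> n * z\<bar>"
    "\<And>n. F (y n + \<epsilon> n * z) - F (y n) = f (\<xi> n) * (\<epsilon> n * z)" by blast
  have "(\<lambda>n. \<epsilon> n * z) \<longlonglongrightarrow> 0 * z" by (intro tendsto_intros \<epsilon>)
  then have "(\<lambda>n. \<bar>\<epsilon> n * z\<bar>) \<longlonglongrightarrow> 0" by (simp add: tendsto_rabs_zero_iff)
  then have "(\<lambda>n. \<bar>\<xi> n - y n\<bar>) \<longlonglongrightarrow> 0"
  proof (rule tendsto_sandwich[of "\<lambda>_. 0" _ _ "\<lambda>n. \<bar>\<epsilon> n * z\<bar>", rotated -1])
  qed (use \<xi>(1) in auto)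
  then have "(\<lambda>n. (\<xi> n - y n) + y n) \<longlonglongrightarrow> 0 + l" by (intro tendsto_intros y) (simp add: tendsto_rabs_zero_iff)
  then have "\<xi> \<longlonglongrightarrow> l" by simp
  moreover have "isCont f l" using cont_f by (simp add: continuous_on_eq_continuous_at)
  ultimately have "(\<lambda>n. f (\<xi> n)) \<longlonglongrightarrow> f l" by (rule isCont_tendsto_compose[rotated])
  then have "(\<lambda>n. f (\<xi> n) * z) \<longlonglongrightarrow> f l * z" by (rule tendsto_mult_right)
  moreover have "f (\<xi> n) * z = (F (y n + \<epsilon> n * z) - F (y n)) / \<epsilon> n" for n using \<xi>(2)[of n] \<epsilon>(2)[of n] by simp
  ultimately show ?thesis by simp
qed

lemma admissible_add_abs:
  assumes g: "admissible K g" and h: "admissible L h"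
  shows "admissible (8 * K + 2 * L) (\<lambda>r. 2 * \<bar>g r\<bar> + \<bar>h r\<bar>)"
proof -
  note [measurable] = admissibleD(1)[OF g] admissibleD(1)[OF h]
  have sq: "(2 * \<bar>x\<bar> + \<bar>y\<bar>)^2 \<le> 8 * x\<^sup>2 + 2 * y\<^sup>2" for x y :: real
    using square_add_bound[of "2 * \<bar>x\<bar> + \<bar>y\<bar>" "2 * \<bar>x\<bar>"] by (simp add: power_mult_distrib)
  have i: "integrable \<mu> (\<lambda>r. 8 * (g r)^2 + 2 * (h r)^2)" using admissibleD(3)[OF g] admissibleD(3)[OF h] by simp
  have i2: "integrable \<mu> (\<lambda>r. (2 * \<bar>g r\<bar> + \<bar>h r\<bar>)^2)"
    by (rule integrable_bound[OF i]) (use sq in \<open>auto intro!: AE_I2\<close>)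
  show ?thesis unfolding admissible_def
  proof (intro conjI allI impI i2)
    show "(2 * \<bar>g r\<bar> + \<bar>h r\<bar>)^2 \<le> (8 * K + 2 * L) * majorant d \<kappa> r" if "0 < r" for r
      using sq[of "g r" "h r"] admissibleD(2)[OF g that] admissibleD(2)[OF h that] by (simp add: algebra_simps)
    have "(LINT r|\<mu>. (2 * \<bar>g r\<bar> + \<bar>h r\<bar>)^2) \<le> (LINT r|\<mu>. 8 * (g r)^2 + 2 * (h r)^2)"
      by (rule Bochner_Integration.integral_mono[OF i2 i]) (rule sq)
    also have "\<dots> \<le> 8 * K + 2 * L" using admissibleD(3,4)[OF g] admissibleD(3,4)[OF h] by simp
    finally show "(LINT r|\<mu>. (2 * \<bar>g r\<bar> + \<bar>h r\<bar>)^2) \<le> 8 * K + 2 * L" .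
  qed measurable
qed

lemma clamp_fixed_point:
  fixes x y lo hi :: real
  assumes "max lo (min hi (x + y)) = x" "lo < hi" "x = lo \<Longrightarrow> 0 < y" "x = hi \<Longrightarrow> y < 0"
  shows "y = 0"
  using assms by (auto simp: max_def min_def split: if_splits)

text \<open>Brouwer's theorem for the displacement (A, B) clamped to the square. At a fixed point
  the strict signs on the edges rule out that the clamp is active, so the displacement
  vanishes.\<close>

lemma Poincare_Miranda_square:
  fixes A B :: "real \<Rightarrow> real \<Rightarrow> real"
  assumes lh: "lo < hi"
    and A: "continuous_on ({lo..hi} \<times> {lo..hi}) (\<lambda>x. A (fst x) (snd x))"
    and B: "continuous_on ({lo..hi} \<times> {lo..hi}) (\<lambda>x. B (fst x) (snd x))"
    and "\<And>t. t \<in> {lo..hi} \<Longrightarrow> 0 < A lo t" "\<And>t. t \<in> {lo..hi} \<Longrightarrow> A hi t < 0"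
    and "\<And>s. s \<in> {lo..hi} \<Longrightarrow> 0 < B s lo" "\<And>s. s \<in> {lo..hi} \<Longrightarrow> B s hi < 0"
  obtains s t where "s \<in> {lo..hi}" "t \<in> {lo..hi}" "A s t = 0" "B s t = 0"
proof -
  let ?S = "{lo..hi} \<times> {lo..hi}"
  define T where "T x = (max lo (min hi (fst x + A (fst x) (snd x))), max lo (min hi (snd x + B (fst x) (snd x))))" for x
  obtain x where x: "x \<in> ?S" "T x = x"
  proof (rule brouwer[of ?S T])
    show "compact ?S" "convex ?S" by (auto intro: compact_Times convex_Times)
    show "?S \<noteq> {}" using lh by auto
    show "continuous_on ?S T" unfolding T_def by (intro continuous_intros A B)
    show "T \<in> ?S \<rightarrow> ?S" unfolding T_def using lh by auto
  qed
  obtain s t where st: "x = (s, t)" by (cases x)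
  have "A s t = 0" by (rule clamp_fixed_point[of lo hi s]) (use x st assms in \<open>auto simp: T_def\<close>)
  moreover have "B s t = 0" by (rule clamp_fixed_point[of lo hi t]) (use x st assms in \<open>auto simp: T_def\<close>)
  ultimately show ?thesis using that x st by auto
qed

text \<open>The perturbation \<sigma> \<phi> leaves two constraints to be restored, whence two
  independent scalings of the signed parts. The case s = t = 1, \<sigma> = 0 is g itself.\<close>

definition tent :: "(real \<Rightarrow> real) \<Rightarrow> (real \<Rightarrow> real) \<Rightarrow> real \<Rightarrow> real \<Rightarrow> real \<Rightarrow> real \<Rightarrow> real" where
  "tent g \<phi> s t \<sigma> = (\<lambda>r. (s * pospart g r - t * negpart g r) + \<sigma> * \<phi> r)"

lemma tent_profile:
  assumes p: "profile d g c" and q: "profile d \<phi> e"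
  shows "profile d (tent g \<phi> s t \<sigma>)
    (\<lambda>r. (s * (if 0 < g r then c r else 0) - t * (if g r < 0 then - c r else 0)) + \<sigma> * e r)"
  using profile_lincomb[OF profile_lincomb[OF profile_pospart[OF p] profile_negpart[OF p], of s "- t"] q, of 1 \<sigma>]
  unfolding tent_def by simp

lemma tent_continuity:
  assumes p: "profile d g c" and q: "profile d \<phi> e"
    and s: "s \<longlonglongrightarrow> s'" and t: "t \<longlonglongrightarrow> t'" and \<sigma>: "\<sigma> \<longlonglongrightarrow> \<sigma>'"
  shows "(\<lambda>n. qform d (pospart (tent g \<phi> (s n) (t n) (\<sigma> n)))) \<longlonglongrightarrow> qform d (pospart (tent g \<phi> s' t' \<sigma>'))"
    and "(\<lambda>n. nehari (pospart (tent g \<phi> (s n) (t n) (\<sigma> n)))) \<longlonglongrightarrow> nehari (pospart (tent g \<phi> s' t' \<sigma>'))"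
proof -
  have "Bseq s" "Bseq t" "Bseq \<sigma>" using s t \<sigma> by (auto intro!: convergent_imp_Bseq simp: convergent_def)
  then obtain B1 B2 B3 where B': "\<And>n. \<bar>s n\<bar> \<le> B1" "\<And>n. \<bar>t n\<bar> \<le> B2" "\<And>n. \<bar>\<sigma> n\<bar> \<le> B3"
    unfolding Bseq_def real_norm_def by metis
  define B where "B = max B1 (max B2 B3)"
  have B: "\<bar>s n\<bar> \<le> B" "\<bar>t n\<bar> \<le> B" "\<bar>\<sigma> n\<bar> \<le> B" for n using B'[of n] unfolding B_def by auto
  have B0: "0 \<le> B" using B(1)[of 0] by linarith
  define v where "v r = B * \<bar>g r\<bar> + B * \<bar>\<phi> r\<bar>" for r
  define w where "w r = B * \<bar>c r\<bar> + B * \<bar>e r\<bar>" for r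
  note [measurable] = profileD(1,2)[OF p] profileD(1,2)[OF q]
  have vi: "integrable \<mu> (\<lambda>r. (v r)^2)" unfolding v_def
    by (rule integrable_square_lincomb(1)) (use profileD(3)[OF p] profileD(3)[OF q] in auto)
  have wi: "integrable \<mu> (\<lambda>r. (w r)^2)" unfolding w_def
    by (rule integrable_square_lincomb(1)) (use profileD(4)[OF p] profileD(4)[OF q] in auto)
  have tri: "\<bar>(x * a - y * b) + z * k\<bar> \<le> B * u + B * \<bar>k\<bar>"
    if "\<bar>x\<bar> \<le> B" "\<bar>y\<bar> \<le> B" "\<bar>z\<bar> \<le> B" "\<bar>a\<bar> + \<bar>b\<bar> \<le> u" for x y z a b k u :: real
  proof -
    have "\<bar>(x * a - y * b) + z * k\<bar> \<le> \<bar>x\<bar> * \<bar>a\<bar> + \<bar>y\<bar> * \<bar>b\<bar> + \<bar>z\<bar> * \<bar>k\<bar>"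
      unfolding abs_mult[symmetric] by linarith
    also have "\<dots> \<le> B * \<bar>a\<bar> + B * \<bar>b\<bar> + B * \<bar>k\<bar>" using that by (intro add_mono mult_right_mono) auto
    also have "\<dots> = B * (\<bar>a\<bar> + \<bar>b\<bar>) + B * \<bar>k\<bar>" by (simp add: distrib_left)
    also have "\<dots> \<le> B * u + B * \<bar>k\<bar>" using that B0 by (intro add_right_mono mult_left_mono) auto
    finally show ?thesis .
  qed
  note C = pospart_continuity[OF tent_profile[OF p q] tent_profile[OF p q] _ _ vi _ wi]
  have l1: "(\<lambda>n. tent g \<phi> (s n) (t n) (\<sigma> n) r) \<longlonglongrightarrow> tent g \<phi> s' t' \<sigma>' r" for r
    unfolding tent_def by (intro tendsto_intros s t \<sigma>)
  have l2: "(\<lambda>n. (s n * (if 0 < g r then c r else 0) - t n * (if g r < 0 then - c r else 0)) + \<sigma> n * e r)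
    \<longlonglongrightarrow> (s' * (if 0 < g r then c r else 0) - t' * (if g r < 0 then - c r else 0)) + \<sigma>' * e r" for r
    by (intro tendsto_intros s t \<sigma>)
  have b1: "\<bar>tent g \<phi> (s n) (t n) (\<sigma> n) r\<bar> \<le> v r" for n r
    unfolding tent_def v_def by (rule tri[OF B]) (auto simp: pospart_def negpart_def)
  have b2: "\<bar>(s n * (if 0 < g r then c r else 0) - t n * (if g r < 0 then - c r else 0)) + \<sigma> n * e r\<bar> \<le> w r" for n r
    unfolding w_def by (rule tri[OF B]) auto
  show "(\<lambda>n. qform d (pospart (tent g \<phi> (s n) (t n) (\<sigma> n)))) \<longlonglongrightarrow> qform d (pospart (tent g \<phi> s' t' \<sigma>'))"
    "(\<lambda>n. nehari (pospart (tent g \<phi> (s n) (t n) (\<sigma> n)))) \<longlonglongrightarrow> nehari (pospart (tent g \<phi> s' t' \<sigma>'))"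
    by (rule C[OF l1 l2 b1 b2])+
qed

text \<open>Turns every continuity statement about negative parts into the one for positive parts,
  applied to -g with the roles of s and t exchanged.\<close>

lemma negpart_tent: "negpart (tent g \<phi> s t \<sigma>) = pospart (tent (\<lambda>r. - g r) \<phi> t s (- \<sigma>))"
  by (simp add: negpart_def pospart_def tent_def algebra_simps max.commute)

text \<open>The sequences express uniformity in \<open>(s, t)\<close> near \<open>(1, 1)\<close>.\<close>
lemma act_tent_quotient:
  assumes p: "profile d g c" and q: "profile d \<phi> e"
    and s: "s \<longlonglongrightarrow> 1" and t: "t \<longlonglongrightarrow> 1" and \<epsilon>: "\<epsilon> \<longlonglongrightarrow> 0"
    and st: "\<And>n. 0 \<le> s n" "\<And>n. s n \<le> 2" "\<And>n. 0 \<le> t n" "\<And>n. t n \<le> 2" "\<And>n. 0 < \<epsilon> n" "\<And>n. \<epsilon> n \<le> 1"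
  shows "(\<lambda>n. (act (tent g \<phi> (s n) (t n) (\<epsilon> n)) - act (tent g \<phi> (s n) (t n) 0)) / \<epsilon> n)
    \<longlonglongrightarrow> (LINT r|\<mu>. c r * e r) + (LINT r|\<mu>. g r * \<phi> r) - (LINT r|\<mu>. f (g r) * \<phi> r)"
proof -
  note P = profile_pospart[OF p] and N = profile_negpart[OF p]
  let ?cp = "\<lambda>r. if 0 < g r then c r else 0" and ?cn = "\<lambda>r. if g r < 0 then - c r else 0"
  note [measurable] = profileD(1,2)[OF p] profileD(1,2)[OF q] profileD(1,2)[OF P] profileD(1,2)[OF N]
    borel_measurable_continuous_onI[OF cont_f] borel_measurable_continuous_onI[OF cont_F]
  define b where "b k l = (LINT r|\<mu>. l r * e r) + (LINT r|\<mu>. k r * \<phi> r)" for k l :: "real \<Rightarrow> real"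
  have prod: "integrable \<mu> (\<lambda>r. k r * \<phi> r)" "integrable \<mu> (\<lambda>r. l r * e r)" if "profile d k l" for k l
    using integrable_mult_squares[OF _ _ profileD(3)[OF that] profileD(3)[OF q]]
      integrable_mult_squares[OF _ _ profileD(4)[OF that] profileD(4)[OF q]] profileD(1,2)[OF that] by auto
  have b0: "b (tent g \<phi> x y 0) (\<lambda>r. x * ?cp r - y * ?cn r) = x * b (pospart g) ?cp - y * b (negpart g) ?cn" for x y
  proof -
    have 1: "(\<lambda>r. tent g \<phi> x y 0 r * \<phi> r) = (\<lambda>r. x * (pospart g r * \<phi> r) - y * (negpart g r * \<phi> r))"
      by (auto simp: tent_def algebra_simps)
    have 2: "(\<lambda>r. (x * ?cp r - y * ?cn r) * e r) = (\<lambda>r. x * (?cp r * e r) - y * (?cn r * e r))"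
      by (auto simp: algebra_simps)
    show ?thesis unfolding b_def 1 2 using prod[OF P] prod[OF N]
      by (simp add: distrib_left right_diff_distrib)
  qed
  have bg: "b (pospart g) ?cp - b (negpart g) ?cn = (LINT r|\<mu>. c r * e r) + (LINT r|\<mu>. g r * \<phi> r)"
  proof -
    have "(LINT r|\<mu>. c r * e r) = (LINT r|\<mu>. ?cp r * e r - ?cn r * e r)"
      by (rule integral_cong_AE, simp, simp)
         (use profile_deriv_zero_on_zero_set[OF p] in eventually_elim, auto)
    moreover have "(LINT r|\<mu>. g r * \<phi> r) = (LINT r|\<mu>. pospart g r * \<phi> r - negpart g r * \<phi> r)"
      by (rule integral_cong) (auto simp: pospart_def negpart_def max_def)
    ultimately show ?thesis unfolding b_def using prod[OF P] prod[OF N] by simp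
  qed
  \<comment> \<open>The energy is exactly quadratic in the perturbation parameter, so only the term
    with F needs a limit argument.\<close>
  have E: "qform d (tent g \<phi> x y z) = qform d (tent g \<phi> x y 0)
      + 2 * z * (x * b (pospart g) ?cp - y * b (negpart g) ?cn) + z\<^sup>2 * energy d \<phi> e" for x y z
  proof -
    note T = tent_profile[OF p q, of x y 0]
    have T0: "profile d (tent g \<phi> x y 0) (\<lambda>r. x * ?cp r - y * ?cn r)" using T by simp
    have eq: "tent g \<phi> x y z = (\<lambda>r. 1 * tent g \<phi> x y 0 r + z * \<phi> r)" by (auto simp: tent_def)
    show ?thesis
      unfolding eq b0[symmetric] qform_eq[OF profile_lincomb[OF T0 q, of 1 z]] qform_eq[OF T0]
        energy_lincomb[OF T0 q] by (simp add: b_def)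
  qed
  have gp: "g \<in> profiles d" and \<phi>p: "\<phi> \<in> profiles d" using p q by (auto intro: profilesI)
  have tp: "tent g \<phi> x y z \<in> profiles d" for x y z using tent_profile[OF p q] by (rule profilesI)
  note tm[measurable] = profiles_borel[OF tp]
  have Fi: "integrable \<mu> (\<lambda>r. F (tent g \<phi> x y z r))" for x y z
    by (rule admissible_integrable[OF profile_admissible'[OF tp] cont_F F_le_f])
  \<comment> \<open>Since s and t are at most 2 and \<epsilon> at most 1, all intermediate points
    from the mean value theorem lie below A in absolute value, and |\<phi>| does too; f (A r) * A r
    then dominates the difference quotients.\<close>
  define A where "A r = 2 * \<bar>g r\<bar> + \<bar>\<phi> r\<bar>" for r
  have adA: "admissible (8 * qform d g + 2 * qform d \<phi>) A"
    unfolding A_def by (rule admissible_add_abs[OF profile_admissible'[OF gp] profile_admissible'[OF \<phi>p]])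
  have tent0: "tent g \<phi> x y z = (\<lambda>r. tent g \<phi> x y 0 r + z * \<phi> r)" for x y z by (auto simp: tent_def)
  have "(\<lambda>n. LINT r|\<mu>. (F (tent g \<phi> (s n) (t n) (\<epsilon> n) r) - F (tent g \<phi> (s n) (t n) 0 r)) / \<epsilon> n)
    \<longlonglongrightarrow> (LINT r|\<mu>. f (g r) * \<phi> r)"
  proof (rule integral_dominated_convergence[where w = "\<lambda>r. f (A r) * A r"])
    show "integrable \<mu> (\<lambda>r. f (A r) * A r)" by (rule admissible_f_integrable[OF adA])
    show "AE r in \<mu>. (\<lambda>n. (F (tent g \<phi> (s n) (t n) (\<epsilon> n) r) - F (tent g \<phi> (s n) (t n) 0 r)) / \<epsilon> n) \<longlonglongrightarrow> f (g r) * \<phi> r"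
    proof (rule AE_I2)
      fix r
      have "(\<lambda>n. tent g \<phi> (s n) (t n) 0 r) \<longlonglongrightarrow> (1 * pospart g r - 1 * negpart g r) + 0 * \<phi> r"
        unfolding tent_def by (intro tendsto_intros s t)
      also have "(1 * pospart g r - 1 * negpart g r) + 0 * \<phi> r = g r" by (simp add: pospart_def negpart_def)
      finally have l: "(\<lambda>n. tent g \<phi> (s n) (t n) 0 r) \<longlonglongrightarrow> g r" .
      show "(\<lambda>n. (F (tent g \<phi> (s n) (t n) (\<epsilon> n) r) - F (tent g \<phi> (s n) (t n) 0 r)) / \<epsilon> n) \<longlonglongrightarrow> f (g r) * \<phi> r"
        using F_quotient_tendsto[OF l \<epsilon>, of "\<phi> r"] st(5) unfolding tent0[of _ _ "\<epsilon> _"] by (metis less_irrefl)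
    qed
    show "AE r in \<mu>. norm ((F (tent g \<phi> (s n) (t n) (\<epsilon> n) r) - F (tent g \<phi> (s n) (t n) 0 r)) / \<epsilon> n) \<le> f (A r) * A r" for n
    proof (rule AE_I2)
      fix r
      let ?y = "tent g \<phi> (s n) (t n) 0 r"
      obtain \<xi> where \<xi>: "\<bar>\<xi> - ?y\<bar> \<le> \<bar>\<epsilon> n * \<phi> r\<bar>" "F (?y + \<epsilon> n * \<phi> r) - F ?y = f \<xi> * (\<epsilon> n * \<phi> r)"
        using F_mean_value by blast
      have y: "\<bar>?y\<bar> \<le> 2 * \<bar>g r\<bar>"
        using st[of n] mult_right_mono[of "s n" 2 "\<bar>g r\<bar>"] mult_right_mono[of "t n" 2 "\<bar>g r\<bar>"]
        by (auto simp: tent_def pospart_def negpart_def max_def abs_mult mult_nonneg_nonneg)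
      have "\<bar>\<epsilon> n * \<phi> r\<bar> \<le> 1 * \<bar>\<phi> r\<bar>" unfolding abs_mult using st(5,6)[of n] by (intro mult_right_mono) auto
      then have "\<bar>\<xi>\<bar> \<le> A r" using \<xi>(1) y unfolding A_def by linarith
      then have "\<bar>f \<xi>\<bar> \<le> f (A r)" unfolding f_abs by (intro f_mono) auto
      moreover have "\<bar>\<phi> r\<bar> \<le> A r" unfolding A_def by simp
      ultimately have "\<bar>f \<xi>\<bar> * \<bar>\<phi> r\<bar> \<le> f (A r) * A r" by (intro mult_mono) auto
      moreover have "(F (tent g \<phi> (s n) (t n) (\<epsilon> n) r) - F ?y) / \<epsilon> n = f \<xi> * \<phi> r"
        using \<xi>(2) st(5)[of n] unfolding tent0[of _ _ "\<epsilon> n"] by simp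
      ultimately show "norm ((F (tent g \<phi> (s n) (t n) (\<epsilon> n) r) - F ?y) / \<epsilon> n) \<le> f (A r) * A r"
        by (simp add: abs_mult)
    qed
  qed measurable
  moreover have "(\<lambda>n. (s n * b (pospart g) ?cp - t n * b (negpart g) ?cn) + \<epsilon> n / 2 * energy d \<phi> e)
     \<longlonglongrightarrow> (1 * b (pospart g) ?cp - 1 * b (negpart g) ?cn) + 0 / 2 * energy d \<phi> e"
    by (intro tendsto_intros s t \<epsilon>) simp
  ultimately have "(\<lambda>n. ((s n * b (pospart g) ?cp - t n * b (negpart g) ?cn) + \<epsilon> n / 2 * energy d \<phi> e)
      - (LINT r|\<mu>. (F (tent g \<phi> (s n) (t n) (\<epsilon> n) r) - F (tent g \<phi> (s n) (t n) 0 r)) / \<epsilon> n))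
    \<longlonglongrightarrow> ((1 * b (pospart g) ?cp - 1 * b (negpart g) ?cn) + 0 / 2 * energy d \<phi> e) - (LINT r|\<mu>. f (g r) * \<phi> r)"
    by (intro tendsto_diff)
  moreover have "((s n * b (pospart g) ?cp - t n * b (negpart g) ?cn) + \<epsilon> n / 2 * energy d \<phi> e)
      - (LINT r|\<mu>. (F (tent g \<phi> (s n) (t n) (\<epsilon> n) r) - F (tent g \<phi> (s n) (t n) 0 r)) / \<epsilon> n)
    = (act (tent g \<phi> (s n) (t n) (\<epsilon> n)) - act (tent g \<phi> (s n) (t n) 0)) / \<epsilon> n" for n
  proof -
    have "(LINT r|\<mu>. (F (tent g \<phi> (s n) (t n) (\<epsilon> n) r) - F (tent g \<phi> (s n) (t n) 0 r)) / \<epsilon> n)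
      = ((LINT r|\<mu>. F (tent g \<phi> (s n) (t n) (\<epsilon> n) r)) - (LINT r|\<mu>. F (tent g \<phi> (s n) (t n) 0 r))) / \<epsilon> n"
      using Fi by simp
    moreover have "((B + \<epsilon> n / 2 * E') - (U - V) / \<epsilon> n) = ((1/2 * (q0 + 2 * \<epsilon> n * B + (\<epsilon> n)^2 * E') - U) - (1/2 * q0 - V)) / \<epsilon> n"
      for B E' U V q0 using st(5)[of n] by (simp add: field_simps power2_eq_square)
    ultimately show ?thesis unfolding act_def E[of "s n" "t n" "\<epsilon> n"] by simp
  qed
  ultimately show ?thesis using bg by simp
qed

text \<open>Were the derivative negative, Poincare-Miranda would give a nodal function of smaller action among the
  perturbations of \<open>s g\<^sup>+ - t g\<^sup>-\<close> with \<open>s, t\<close> near \<open>1\<close>.\<close>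
lemma minimizer_directional_derivative_nonneg:
  assumes g: "g \<in> nodal" and min: "\<And>h. h \<in> nodal \<Longrightarrow> act g \<le> act h"
    and p: "profile d g c" and q: "profile d \<phi> e"
  shows "0 \<le> (LINT r|\<mu>. c r * e r) + (LINT r|\<mu>. g r * \<phi> r) - (LINT r|\<mu>. f (g r) * \<phi> r)"
proof (rule ccontr)
  define a where "a = (LINT r|\<mu>. c r * e r) + (LINT r|\<mu>. g r * \<phi> r) - (LINT r|\<mu>. f (g r) * \<phi> r)"
  assume "\<not> ?thesis"
  then have a: "a < 0" unfolding a_def by linarith
  note G = nodalD[OF g]
  note gp = profiles_parts[OF G(1)]
  let ?h = "\<lambda>n::nat. 1 / (real n + 2)"
  \<comment> \<open>A negative derivative at g alone does not suffice: the decrease must hold for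
    all s and t near 1, as the fixed-point argument will choose them. Failure at every scale gives
    sequences tending to (1, 1, 0) with nonnegative quotients, against the limit a < 0.\<close>
  have "\<exists>\<delta>>0. \<delta> \<le> 1/2 \<and> (\<forall>s t \<epsilon>. \<bar>s - 1\<bar> \<le> \<delta> \<longrightarrow> \<bar>t - 1\<bar> \<le> \<delta> \<longrightarrow> 0 < \<epsilon> \<longrightarrow> \<epsilon> \<le> \<delta> \<longrightarrow>
      act (tent g \<phi> s t \<epsilon>) < act (tent g \<phi> s t 0))"
  proof (rule ccontr)
    assume neg: "\<not> ?thesis"
    have "\<exists>x. \<bar>fst x - 1\<bar> \<le> ?h n \<and> \<bar>fst (snd x) - 1\<bar> \<le> ?h n \<and> 0 < snd (snd x) \<and> snd (snd x) \<le> ?h n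
      \<and> act (tent g \<phi> (fst x) (fst (snd x)) 0) \<le> act (tent g \<phi> (fst x) (fst (snd x)) (snd (snd x)))" for n :: nat
    proof (rule ccontr)
      assume neg2: "\<not> ?thesis"
      have "0 < ?h n \<and> ?h n \<le> 1/2 \<and> (\<forall>s t \<epsilon>. \<bar>s - 1\<bar> \<le> ?h n \<longrightarrow> \<bar>t - 1\<bar> \<le> ?h n \<longrightarrow> 0 < \<epsilon> \<longrightarrow> \<epsilon> \<le> ?h n \<longrightarrow>
        act (tent g \<phi> s t \<epsilon>) < act (tent g \<phi> s t 0))"
      proof (intro conjI allI impI)
        fix s t \<epsilon> assume "\<bar>s - 1\<bar> \<le> ?h n" "\<bar>t - 1\<bar> \<le> ?h n" "0 < \<epsilon>" "\<epsilon> \<le> ?h n"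
        then show "act (tent g \<phi> s t \<epsilon>) < act (tent g \<phi> s t 0)"
          using neg2[unfolded not_ex, rule_format, of "(s, t, \<epsilon>)"] by (simp add: not_le)
      qed (auto simp: field_simps)
      then show False using neg by blast
    qed
    then obtain x where x: "\<And>n. \<bar>fst (x n) - 1\<bar> \<le> ?h n" "\<And>n. \<bar>fst (snd (x n)) - 1\<bar> \<le> ?h n"
      "\<And>n. 0 < snd (snd (x n))" "\<And>n. snd (snd (x n)) \<le> ?h n"
      "\<And>n. act (tent g \<phi> (fst (x n)) (fst (snd (x n))) 0) \<le> act (tent g \<phi> (fst (x n)) (fst (snd (x n))) (snd (snd (x n))))" for n :: nat
      by metis
    have z: "(\<lambda>n. ?h n) \<longlonglongrightarrow> 0"
      using LIMSEQ_ignore_initial_segment[OF lim_1_over_n, of 2] by (simp add: add.commute)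
    have near: "y \<longlonglongrightarrow> l" if "\<And>n. \<bar>y n - l\<bar> \<le> ?h n" for y :: "nat \<Rightarrow> real" and l
    proof -
      have "(\<lambda>n. \<bar>y n - l\<bar>) \<longlonglongrightarrow> 0"
        by (rule tendsto_sandwich[of "\<lambda>_. 0" _ _ "?h"]) (use that z in auto)
      then show ?thesis by (simp add: tendsto_rabs_zero_iff LIM_zero_iff)
    qed
    have le1: "?h n \<le> 1" for n by (simp add: field_simps)
    have D: "(\<lambda>n. (act (tent g \<phi> (fst (x n)) (fst (snd (x n))) (snd (snd (x n)))) - act (tent g \<phi> (fst (x n)) (fst (snd (x n))) 0)) / snd (snd (x n))) \<longlonglongrightarrow> a"
      unfolding a_def
    proof (rule act_tent_quotient[OF p q near near near])
      fix n
      show "\<bar>snd (snd (x n)) - 0\<bar> \<le> ?h n" using x(3,4)[of n] by simp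
      show "0 \<le> fst (x n)" "fst (x n) \<le> 2" "0 \<le> fst (snd (x n))" "fst (snd (x n)) \<le> 2" "snd (snd (x n)) \<le> 1"
        using x(1,2,4)[of n] le1[of n] by linarith+
    qed (use x in auto)
    have "0 \<le> a"
      by (rule LIMSEQ_le_const[OF D]) (use x(3,5) in \<open>auto intro!: exI[of _ 0] divide_nonneg_pos\<close>)
    then show False using a by simp
  qed
  then obtain \<delta> where \<delta>: "0 < \<delta>" "\<delta> \<le> 1/2"
    and dec: "\<And>s t \<epsilon>. \<bar>s - 1\<bar> \<le> \<delta> \<Longrightarrow> \<bar>t - 1\<bar> \<le> \<delta> \<Longrightarrow> 0 < \<epsilon> \<Longrightarrow> \<epsilon> \<le> \<delta> \<Longrightarrow> act (tent g \<phi> s t \<epsilon>) < act (tent g \<phi> s t 0)"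
    by blast
  have t0: "tent g \<phi> s t 0 = (\<lambda>r. s * pospart g r - t * negpart g r)" for s t by (simp add: tent_def)
  have parts0: "pospart (tent g \<phi> s t 0) = (\<lambda>r. s * pospart g r)" "negpart (tent g \<phi> s t 0) = (\<lambda>r. t * negpart g r)"
    if "0 < s" "0 < t" for s t
    unfolding t0 by (rule parts_of_combination[where a = "pospart g" and b = "negpart g", OF that pospart_nonneg negpart_nonneg parts_disjoint])+
  define T where "T x = tent g \<phi> (fst x) (fst (snd x)) (snd (snd x))" for x
  note pm = profile_uminus[OF p]
  have cont: "continuous_on UNIV (\<lambda>x. nehari (pospart (T x)))" "continuous_on UNIV (\<lambda>x. nehari (negpart (T x)))"
    "continuous_on UNIV (\<lambda>x. qform d (pospart (T x)))" "continuous_on UNIV (\<lambda>x. qform d (negpart (T x)))"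
    unfolding T_def negpart_tent
    by (rule continuous_on_sequentiallyI, intro tent_continuity[OF p q] tent_continuity[OF pm q] tendsto_intros, assumption+)+
  let ?I = "{1 - \<delta>..1 + \<delta>}"
  \<comment> \<open>One \<epsilon> has to serve all (s, t) in the square, so uniform continuity on a
    compact set is used.\<close>
  have unif: "\<exists>\<eta>>0. \<forall>s\<in>?I. \<forall>t\<in>?I. \<forall>\<epsilon>\<in>{0..1}. \<epsilon> < \<eta> \<longrightarrow> \<bar>\<Phi> (s, t, \<epsilon>) - \<Phi> (s, t, 0)\<bar> < v"
    if \<Phi>: "continuous_on UNIV \<Phi>" and v: "0 < v" for \<Phi> :: "real \<times> real \<times> real \<Rightarrow> real" and v
  proof -
    have "uniformly_continuous_on (?I \<times> ?I \<times> {0..1}) \<Phi>"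
      by (intro compact_uniformly_continuous continuous_on_subset[OF \<Phi>] compact_Times) auto
    then obtain \<eta> where \<eta>: "0 < \<eta>" "\<And>x y. x \<in> ?I \<times> ?I \<times> {0..1} \<Longrightarrow> y \<in> ?I \<times> ?I \<times> {0..1} \<Longrightarrow> dist y x < \<eta> \<Longrightarrow> dist (\<Phi> y) (\<Phi> x) < v"
      using v unfolding uniformly_continuous_on_def by metis
    show ?thesis
    proof (intro exI[of _ \<eta>] conjI ballI impI \<eta>(1))
      fix s t \<epsilon> assume "s \<in> ?I" "t \<in> ?I" "\<epsilon> \<in> {0..1}" "\<epsilon> < \<eta>"
      then show "\<bar>\<Phi> (s, t, \<epsilon>) - \<Phi> (s, t, 0)\<bar> < v"
        using \<eta>(2)[of "(s, t, 0)" "(s, t, \<epsilon>)"] by (auto simp: dist_Pair_Pair dist_real_def)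
    qed
  qed
  note signP = nehari_scale_sign[OF gp(1) G(4) G(2)] and signN = nehari_scale_sign[OF gp(2) G(5) G(3)]
  \<comment> \<open>The margin: the distance from 0 of both Nehari functionals on the edges of the
    unperturbed square, and a lower bound for the energies of the scaled signed parts. A change
    smaller than v preserves the edge signs and keeps both parts nonzero.\<close>
  define v where "v = Min {nehari (\<lambda>r. (1 - \<delta>) * pospart g r), - nehari (\<lambda>r. (1 + \<delta>) * pospart g r),
     nehari (\<lambda>r. (1 - \<delta>) * negpart g r), - nehari (\<lambda>r. (1 + \<delta>) * negpart g r),
     (1 - \<delta>)^2 * qform d (pospart g), (1 - \<delta>)^2 * qform d (negpart g)}"
  have v0: "0 < v" unfolding v_def
    using signP(1)[of "1 - \<delta>"] signP(2)[of "1 + \<delta>"] signN(1)[of "1 - \<delta>"] signN(2)[of "1 + \<delta>"] \<delta> G(4,5) by simp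
  have vle: "v \<le> nehari (\<lambda>r. (1 - \<delta>) * pospart g r)" "v \<le> - nehari (\<lambda>r. (1 + \<delta>) * pospart g r)"
     "v \<le> nehari (\<lambda>r. (1 - \<delta>) * negpart g r)" "v \<le> - nehari (\<lambda>r. (1 + \<delta>) * negpart g r)"
     "v \<le> (1 - \<delta>)^2 * qform d (pospart g)" "v \<le> (1 - \<delta>)^2 * qform d (negpart g)"
    unfolding v_def by (rule Min_le; simp)+
  obtain \<eta>1 \<eta>2 \<eta>3 \<eta>4 where \<eta>: "0 < \<eta>1" "0 < \<eta>2" "0 < \<eta>3" "0 < \<eta>4"
    and u1: "\<forall>s\<in>?I. \<forall>t\<in>?I. \<forall>\<epsilon>\<in>{0..1}. \<epsilon> < \<eta>1 \<longrightarrow> \<bar>nehari (pospart (T (s, t, \<epsilon>))) - nehari (pospart (T (s, t, 0)))\<bar> < v"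
    and u2: "\<forall>s\<in>?I. \<forall>t\<in>?I. \<forall>\<epsilon>\<in>{0..1}. \<epsilon> < \<eta>2 \<longrightarrow> \<bar>nehari (negpart (T (s, t, \<epsilon>))) - nehari (negpart (T (s, t, 0)))\<bar> < v"
    and u3: "\<forall>s\<in>?I. \<forall>t\<in>?I. \<forall>\<epsilon>\<in>{0..1}. \<epsilon> < \<eta>3 \<longrightarrow> \<bar>qform d (pospart (T (s, t, \<epsilon>))) - qform d (pospart (T (s, t, 0)))\<bar> < v"
    and u4: "\<forall>s\<in>?I. \<forall>t\<in>?I. \<forall>\<epsilon>\<in>{0..1}. \<epsilon> < \<eta>4 \<longrightarrow> \<bar>qform d (negpart (T (s, t, \<epsilon>))) - qform d (negpart (T (s, t, 0)))\<bar> < v"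
    using unif[OF cont(1) v0] unif[OF cont(2) v0] unif[OF cont(3) v0] unif[OF cont(4) v0] by (elim exE conjE) (rule that)
  define \<epsilon> where "\<epsilon> = Min {\<delta>, \<eta>1 / 2, \<eta>2 / 2, \<eta>3 / 2, \<eta>4 / 2}"
  have \<epsilon>: "0 < \<epsilon>" "\<epsilon> \<le> \<delta>" "\<epsilon> < \<eta>1" "\<epsilon> < \<eta>2" "\<epsilon> < \<eta>3" "\<epsilon> < \<eta>4" "\<epsilon> \<in> {0..1}"
  proof -
    show e0: "0 < \<epsilon>" unfolding \<epsilon>_def using \<delta> \<eta> by simp
    have "\<epsilon> \<le> \<delta>" "\<epsilon> \<le> \<eta>1 / 2" "\<epsilon> \<le> \<eta>2 / 2" "\<epsilon> \<le> \<eta>3 / 2" "\<epsilon> \<le> \<eta>4 / 2"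
      unfolding \<epsilon>_def by (rule Min_le; simp)+
    then show "\<epsilon> \<le> \<delta>" "\<epsilon> < \<eta>1" "\<epsilon> < \<eta>2" "\<epsilon> < \<eta>3" "\<epsilon> < \<eta>4" "\<epsilon> \<in> {0..1}" using e0 \<delta> \<eta> by auto
  qed
  have T0: "pospart (T (s, t, 0)) = (\<lambda>r. s * pospart g r)" "negpart (T (s, t, 0)) = (\<lambda>r. t * negpart g r)"
    if "s \<in> ?I" "t \<in> ?I" for s t
    unfolding T_def using parts0[of s t] that \<delta> by auto
  have I: "1 - \<delta> \<in> ?I" "1 + \<delta> \<in> ?I" using \<delta> by auto
  have edgeP: "0 < nehari (pospart (T (1 - \<delta>, t, \<epsilon>)))" "nehari (pospart (T (1 + \<delta>, t, \<epsilon>))) < 0" if t: "t \<in> ?I" for t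
    using u1[rule_format, OF I(1) t \<epsilon>(7) \<epsilon>(3)] u1[rule_format, OF I(2) t \<epsilon>(7) \<epsilon>(3)] vle(1,2)
    unfolding T0(1)[OF I(1) t] T0(1)[OF I(2) t] by linarith+
  have edgeN: "0 < nehari (negpart (T (s, 1 - \<delta>, \<epsilon>)))" "nehari (negpart (T (s, 1 + \<delta>, \<epsilon>))) < 0" if s: "s \<in> ?I" for s
    using u2[rule_format, OF s I(1) \<epsilon>(7) \<epsilon>(4)] u2[rule_format, OF s I(2) \<epsilon>(7) \<epsilon>(4)] vle(3,4)
    unfolding T0(2)[OF s I(1)] T0(2)[OF s I(2)] by linarith+
  have contA: "continuous_on (?I \<times> ?I) (\<lambda>x. nehari (pospart (T (fst x, snd x, \<epsilon>))))"
    "continuous_on (?I \<times> ?I) (\<lambda>x. nehari (negpart (T (fst x, snd x, \<epsilon>))))"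
    by (rule continuous_on_compose2[OF cont(1)], intro continuous_intros, simp)
       (rule continuous_on_compose2[OF cont(2)], intro continuous_intros, simp)
  obtain s t where st: "s \<in> ?I" "t \<in> ?I" and z: "nehari (pospart (T (s, t, \<epsilon>))) = 0" "nehari (negpart (T (s, t, \<epsilon>))) = 0"
    by (rule Poincare_Miranda_square[where A = "\<lambda>s t. nehari (pospart (T (s, t, \<epsilon>)))" and B = "\<lambda>s t. nehari (negpart (T (s, t, \<epsilon>)))"
          and lo = "1 - \<delta>" and hi = "1 + \<delta>"]) (use edgeP edgeN contA \<delta> in auto)
  have s0: "0 < s" "0 < t" "1 - \<delta> \<le> s" "1 - \<delta> \<le> t" using st \<delta> by auto
  have "(1 - \<delta>)^2 \<le> s\<^sup>2" "(1 - \<delta>)^2 \<le> t\<^sup>2" using s0 \<delta> by (auto intro!: power_mono)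
  then have "(1 - \<delta>)^2 * qform d (pospart g) \<le> s\<^sup>2 * qform d (pospart g)" "(1 - \<delta>)^2 * qform d (negpart g) \<le> t\<^sup>2 * qform d (negpart g)"
    using G(4,5) by (auto intro!: mult_right_mono)
  then have Q: "0 < qform d (pospart (T (s, t, \<epsilon>)))" "0 < qform d (negpart (T (s, t, \<epsilon>)))"
    using u3[rule_format, OF st \<epsilon>(7) \<epsilon>(5)] u4[rule_format, OF st \<epsilon>(7) \<epsilon>(6)] vle(5,6)
    unfolding T0[OF st] qform_scale(1)[OF gp(1)] qform_scale(1)[OF gp(2)] by linarith+
  have "T (s, t, \<epsilon>) \<in> nodal"
    unfolding nodal_def using z Q profilesI[OF tent_profile[OF p q]] by (simp add: T_def)
  then have "act g \<le> act (tent g \<phi> s t \<epsilon>)" using min by (simp add: T_def)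
  also have "\<dots> < act (tent g \<phi> s t 0)" by (rule dec) (use st \<epsilon> in auto)
  \<comment> \<open>The unperturbed function has action at most act g, since s = t = 1 maximizes the
    action along the rays through the signed parts.\<close>
  also have "\<dots> = act (\<lambda>r. s * pospart g r) + act (\<lambda>r. t * negpart g r)"
    using act_parts[OF profilesI[OF tent_profile[OF p q]], of s t 0] parts0[OF s0(1,2)] by simp
  also have "\<dots> \<le> act (pospart g) + act (negpart g)"
    by (intro add_mono act_scale_le gp G s0)
  also have "\<dots> = act g" using act_parts[OF G(1)] by simp
  finally show False by simp
qed

theorem Euler_Lagrange_radial:
  assumes g: "g \<in> nodal" and min: "\<And>h. h \<in> nodal \<Longrightarrow> act g \<le> act h"
    and p: "profile d g c" and q: "profile d \<phi> e"
  shows "(LINT r|\<mu>. c r * e r) + (LINT r|\<mu>. g r * \<phi> r) = (LINT r|\<mu>. f (g r) * \<phi> r)"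
  using minimizer_directional_derivative_nonneg[OF g min p q]
    minimizer_directional_derivative_nonneg[OF g min p profile_uminus[OF q]] by simp

end

section \<open>Shape of the minimizer\<close>

lemma has_integral_powr_lborel:
  assumes q: "0 < q" and b: "0 < (b::real)"
  shows "integrable lborel (\<lambda>r. indicator {0<..b} r * r powr (q - 1))"
    and "(LINT r|lborel. indicator {0<..b} r * r powr (q - 1)) = b powr q / q"
proof -
  have hi: "((\<lambda>r. r powr (q - 1)) has_integral (b powr q / q)) {0..b}"
    using has_integral_powr_from_0[of "q - 1" b] q b by simp
  have "((\<lambda>r. indicator {0..b} r * r powr (q - 1)) has_integral (b powr q / q)) UNIV"
  proof -
    have "(\<lambda>r. indicator {0..b} r * r powr (q - 1)) = (\<lambda>r. if r \<in> {0..b} then r powr (q - 1) else 0)" by auto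
    then show ?thesis using hi by (simp only: has_integral_restrict_UNIV)
  qed
  moreover have "(\<lambda>r. indicator {0..b} r * r powr (q - 1)) = (\<lambda>r. indicator {0<..b} r * r powr (q - 1))"
  proof (rule ext)
    fix r :: real
    show "indicator {0..b} r * r powr (q - 1) = indicator {0<..b} r * r powr (q - 1)"
      by (cases "r = 0") (auto simp: indicator_def)
  qed
  ultimately have h: "((\<lambda>r. indicator {0<..b} r * r powr (q - 1)) has_integral (b powr q / q)) UNIV" by simp
  have n: "(\<integral>\<^sup>+r. ennreal (indicator {0<..b} r * r powr (q - 1)) \<partial>lborel) = ennreal (b powr q / q)"
    by (rule nn_integral_has_integral_lborel[OF _ _ h]) auto
  show i: "integrable lborel (\<lambda>r. indicator {0<..b} r * r powr (q - 1))"
    by (rule integrableI_nonneg) (use n in auto)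
  have "ennreal (LINT r|lborel. indicator {0<..b} r * r powr (q - 1)) = ennreal (b powr q / q)"
    using nn_integral_eq_integral[OF i] n by simp
  then show "(LINT r|lborel. indicator {0<..b} r * r powr (q - 1)) = b powr q / q"
    using q b by (subst (asm) ennreal_inj) (auto intro!: integral_nonneg)
qed

context nonlinearity
begin

lemma nodal_uminus:
  assumes "g \<in> nodal"
  shows "(\<lambda>r. - g r) \<in> nodal" "act (\<lambda>r. - g r) = act g"
proof -
  note G = nodalD[OF assms]
  have e: "pospart (\<lambda>r. - g r) = negpart g" "negpart (\<lambda>r. - g r) = pospart g"
    by (auto simp: pospart_def negpart_def)
  have p: "(\<lambda>r. - g r) \<in> profiles d" using profiles_lincomb[OF G(1) G(1), of "-1" 0] by simp
  show "(\<lambda>r. - g r) \<in> nodal" using p G by (simp add: nodal_def e)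
  show "act (\<lambda>r. - g r) = act g" using act_parts[OF p] act_parts[OF G(1)] unfolding e by simp
qed

text \<open>Dropping the bump b from the positive part and scaling back into the nodal set does not
  raise the excess of what is kept, whereas the discarded bump had strictly positive excess. The
  resulting function would beat the minimum.\<close>

lemma minimizer_piece:
  assumes g: "g \<in> nodal" and min: "\<And>h. h \<in> nodal \<Longrightarrow> act g \<le> act h"
    and a: "a \<in> profiles d" "b \<in> profiles d" "\<And>r. 0 \<le> a r" "\<And>r. 0 \<le> b r" "\<And>r. a r = 0 \<or> b r = 0"
      "\<And>r. pospart g r = a r + b r"
    and n: "nehari a \<le> 0" and Q: "0 < qform d a" "0 < qform d b"
  shows False
proof -
  note G = nodalD[OF g]
  have disj: "a r = 0 \<or> negpart g r = 0" for r
    using parts_disjoint[of g r] a(3,4,6)[of r] by linarith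
  obtain s t where st: "0 < s" "s \<le> 1" "0 < t" "t \<le> 1" "(\<lambda>r. s * a r - t * negpart g r) \<in> nodal"
    "act (\<lambda>r. s * a r - t * negpart g r) = (LINT r|\<mu>. excess (s * a r)) + (LINT r|\<mu>. excess (t * negpart g r))"
    by (rule nodal_by_scaling[where a = a and b = "negpart g",
          OF a(1) profiles_parts(2)[OF G(1)] a(3) negpart_nonneg disj n _ Q(1) G(5)]) (use G(3) in auto)
  have "act g \<le> (LINT r|\<mu>. excess (s * a r)) + (LINT r|\<mu>. excess (t * negpart g r))"
    using min[OF st(5)] st(6) by simp
  also have "\<dots> \<le> (LINT r|\<mu>. excess (a r)) + (LINT r|\<mu>. excess (negpart g r))"
    by (intro add_mono excess_integral_scale(1) a(1) profiles_parts(2)[OF G(1)] st)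
  also have "(LINT r|\<mu>. excess (a r)) < (LINT r|\<mu>. excess (pospart g r))"
  proof -
    have ia: "integrable \<mu> (\<lambda>r. excess (a r))" and ib: "integrable \<mu> (\<lambda>r. excess (b r))"
      by (rule admissible_integrable[OF profile_admissible'[OF a(1)] cont_excess excess_bound],
          rule admissible_integrable[OF profile_admissible'[OF a(2)] cont_excess excess_bound])
    have "0 < (LINT r|\<mu>. excess (b r))"
      by (rule integral_pos_strict[OF a(2) Q(2) ib]) (auto intro: excess_pos)
    moreover have "(LINT r|\<mu>. excess (pospart g r)) = (LINT r|\<mu>. excess (a r) + excess (b r))"
      by (rule integral_cong) (use a(5,6) in \<open>metis add_0 add_0_right excess_zero\<close>)+
    ultimately show ?thesis using ia ib by simp
  qed
  finally show False using act_nodal[OF g] by simp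
qed

text \<open>If \<open>g\<^sup>+\<close> had two bumps, one of them would lie below its Nehari set, and the other could be discarded.\<close>
lemma positive_set_connected:
  assumes g: "g \<in> nodal" and min: "\<And>h. h \<in> nodal \<Longrightarrow> act g \<le> act h"
    and xyz: "0 < x" "x < y" "y < z" "0 < g x" "0 < g z"
  shows "0 < g y"
proof (rule ccontr)
  assume "\<not> 0 < g y"
  \<comment> \<open>The point y is a zero of the positive part, so the part may be cut there into
    two profiles.\<close>
  then have y: "0 < y" "pospart g y = 0" using xyz by (auto simp: pospart_def)
  note G = nodalD[OF g]
  obtain c where p: "profile d (pospart g) c" using profiles_parts(1)[OF G(1)] by (rule profilesE)
  define a where "a r = (if r < y then pospart g r else 0)" for r
  define b where "b r = (if r < y then 0 else pospart g r)" for r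
  define ca where "ca r = (if r < y then c r else 0)" for r
  define cb where "cb r = (if r < y then 0 else c r)" for r
  have pa: "profile d a ca" unfolding a_def[abs_def] ca_def[abs_def] by (rule profile_cut[OF p y])
  have "profile d (\<lambda>r. 1 * pospart g r + (-1) * a r) (\<lambda>r. 1 * c r + (-1) * ca r)"
    by (rule profile_lincomb[OF p pa])
  moreover have "(\<lambda>r. 1 * pospart g r + (-1) * a r) = b" "(\<lambda>r. 1 * c r + (-1) * ca r) = cb"
    by (auto simp: a_def b_def ca_def cb_def)
  ultimately have pb: "profile d b cb" by simp
  note ap = profilesI[OF pa] and bp = profilesI[OF pb]
  have nn: "0 \<le> a r" "0 \<le> b r" "a r = 0 \<or> b r = 0" "pospart g r = a r + b r" for r
    using pospart_nonneg[of g r] by (auto simp: a_def b_def)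
  have Qa: "0 < qform d a"
    using qform_zero_imp[OF ap _ xyz(1)] xyz qform_nonneg[of d a] by (auto simp: a_def pospart_def less_le)
  have Qb: "0 < qform d b"
    using qform_zero_imp[OF bp _ , of z] xyz qform_nonneg[of d b] by (auto simp: b_def pospart_def less_le)
  have "qform d (pospart g) = energy d (\<lambda>r. 1 * a r + 1 * b r) (\<lambda>r. 1 * ca r + 1 * cb r)"
  proof -
    have e: "1 * a r + 1 * b r = pospart g r" "1 * ca r + 1 * cb r = c r" for r
      by (auto simp: a_def b_def ca_def cb_def)
    show ?thesis by (simp only: qform_eq[OF p] e)
  qed
  also have "\<dots> = qform d a + qform d b"
  proof -
    have "(\<lambda>r. ca r * cb r) = (\<lambda>_. 0)" "(\<lambda>r. a r * b r) = (\<lambda>_. 0)" by (auto simp: a_def b_def ca_def cb_def)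
    then show ?thesis unfolding energy_lincomb[OF pa pb] qform_eq[OF pa] qform_eq[OF pb] by simp
  qed
  finally have Q: "qform d (pospart g) = qform d a + qform d b" .
  have "nl (pospart g) = (LINT r|\<mu>. f (a r) * a r + f (b r) * b r)"
    unfolding nl_def by (rule integral_cong) (auto simp: a_def b_def)
  also have "\<dots> = nl a + nl b"
    unfolding nl_def
    by (rule Bochner_Integration.integral_add[OF admissible_f_integrable[OF profile_admissible'[OF ap]]
          admissible_f_integrable[OF profile_admissible'[OF bp]]])
  \<comment> \<open>Disjoint supports make energy and nonlinear term additive; as the two values of
    I sum to 0, one of the pieces has I \<le> 0 and can be kept alone.\<close>
  finally have "nehari a + nehari b = 0" using Q G(2) unfolding nehari_def by simp
  then consider "nehari a \<le> 0" | "nehari b \<le> 0" by linarith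
  then show False
  proof cases
    case 1
    show False by (rule minimizer_piece[OF g min ap bp nn 1 Qa Qb])
  next
    case 2
    have "b r = 0 \<or> a r = 0" "pospart g r = b r + a r" for r using nn(3,4)[of r] by auto
    from minimizer_piece[OF g min bp ap nn(2) nn(1) this 2 Qb Qa] show False .
  qed
qed

lemma negative_set_connected:
  assumes g: "g \<in> nodal" and min: "\<And>h. h \<in> nodal \<Longrightarrow> act g \<le> act h"
    and xyz: "0 < x" "x < y" "y < z" "g x < 0" "g z < 0"
  shows "g y < 0"
  using positive_set_connected[OF nodal_uminus(1)[OF g] _ xyz(1-3)] min xyz nodal_uminus(2)[OF g] by simp

text \<open>The fundamental solution of the radial Laplacian, truncated to the shell between a and
  b: constant inside, zero outside. Its derivative -W cancels the weight r^(d-1), so that testing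
  against it produces the increment of a profile.\<close>

lemma profile_log_kernel:
  assumes ab: "0 < a" "a \<le> b"
  defines "W \<equiv> \<lambda>s::real. indicator {a..b} s * (1/s) ^ (d - 1)"
  defines "\<phi> \<equiv> \<lambda>r. LINT s|lborel. indicator {r..} s * W s"
  shows "profile d \<phi> (\<lambda>r. - W r)" "0 \<le> \<phi> r" "b < r \<Longrightarrow> \<phi> r = 0"
    "b \<le> 1 \<Longrightarrow> \<phi> r \<le> max r a powr (- \<kappa>) / \<kappa>"
proof -
  have [measurable]: "W \<in> borel_measurable borel" unfolding W_def by measurable
  have W0: "0 \<le> W s" for s using ab by (auto simp: W_def indicator_def)
  have Wi: "integrable lborel W"
    using set_integrable_inverse_power[OF ab(1), of b "d - 1"] unfolding W_def set_integrable_def by simp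
  have Wr: "integrable lborel (\<lambda>s. indicator {r..} s * W s)" for r
    using integrable_mult_indicator[OF _ Wi, of "{r..}"] by simp
  show nn: "0 \<le> \<phi> r" for r unfolding \<phi>_def using W0 by (intro integral_nonneg) simp
  show zero: "\<phi> r = 0" if "b < r" for r
  proof -
    have "(\<lambda>s. indicator {r..} s * W s) = (\<lambda>_. 0)" using that by (auto simp: W_def indicator_def)
    then show ?thesis unfolding \<phi>_def by simp
  qed
  have anti: "\<phi> y \<le> \<phi> x" if "x \<le> y" for x y
    unfolding \<phi>_def by (rule Bochner_Integration.integral_mono[OF Wr Wr]) (use that W0 in \<open>auto simp: indicator_def\<close>)
  then have "mono (\<lambda>r. - \<phi> r)" by (intro monoI) simp
  from borel_measurable_mono[OF this] have \<phi>m[measurable]: "\<phi> \<in> borel_measurable borel" by simp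
  have W1: "W s \<le> (1/a) ^ (d - 1) * indicator {a..b} s" for s
    using ab by (auto simp: W_def indicator_def intro!: power_mono divide_left_mono)
  have bi: "integrable \<mu> (indicator {0<..b} :: real \<Rightarrow> real)"
  proof (subst integrable_radial, measurable)
    show "integrable lborel (\<lambda>r. indicator {0<..} r * r ^ (d - 1) * indicator {0<..b} r)"
    proof (rule integrable_bound)
      show "integrable lborel (\<lambda>r. b ^ (d - 1) * indicator {0<..b} r)"
        by (intro integrable_mult_right integrable_real_indicator) (use ab in auto)
      show "AE r in lborel. norm (indicator {0<..} r * r ^ (d - 1) * indicator {0<..b} r) \<le> norm (b ^ (d - 1) * indicator {0<..b} r)"
        by (auto simp: indicator_def intro!: AE_I2 power_mono)
    qed measurable
  qed
  have pos: "AE r in \<mu>. 0 < r" by (rule AE_radialI)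
  show "profile d \<phi> (\<lambda>r. - W r)"
    unfolding profile_def
  proof (intro conjI allI impI)
    show "\<phi> \<in> borel_measurable borel" "(\<lambda>r. - W r) \<in> borel_measurable borel" by measurable
    show "integrable \<mu> (\<lambda>r. (\<phi> r)^2)"
    proof (rule integrable_bound[OF integrable_mult_right[OF bi, of "(\<phi> 0)^2"]])
      show "AE r in \<mu>. norm ((\<phi> r)^2) \<le> norm ((\<phi> 0)^2 * indicator {0<..b} r)"
        using pos
      proof eventually_elim
        case (elim r)
        then show ?case using zero[of r] anti[of 0 r] nn[of r]
          by (cases "r \<le> b") (auto simp: indicator_def intro!: power_mono)
      qed
    qed simp
    show "integrable \<mu> (\<lambda>r. (- W r)^2)"
    proof (rule integrable_bound[OF integrable_mult_right[OF bi, of "((1/a) ^ (d - 1))^2"]])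
      show "AE r in \<mu>. norm ((- W r)^2) \<le> norm (((1/a) ^ (d - 1))^2 * indicator {0<..b} r)"
      proof (rule AE_I2)
        fix r
        have "(W r)^2 \<le> ((1/a) ^ (d - 1) * indicator {a..b} r)^2" using W0 W1 by (intro power_mono)
        also have "\<dots> \<le> ((1/a) ^ (d - 1))^2 * indicator {0<..b} r" using ab by (auto simp: indicator_def)
        finally show "norm ((- W r)^2) \<le> norm (((1/a) ^ (d - 1))^2 * indicator {0<..b} r)"
          using ab by (simp add: indicator_def)
      qed
    qed simp
    fix x y :: real assume xy: "0 < x" "x \<le> y"
    have "\<phi> x - \<phi> y = (LINT s|lborel. indicator {x..} s * W s - indicator {y..} s * W s)"
      unfolding \<phi>_def using Wr by simp
    also have "\<dots> = (LINT s|lborel. indicator {x..y} s *\<^sub>R W s)"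
      by (rule integral_cong_AE, measurable)
         (use AE_lborel_singleton[of y] in eventually_elim, use xy in \<open>auto simp: indicator_def\<close>)
    finally show "\<phi> y - \<phi> x = (LBINT r:{x..y}. - W r)"
      by (simp add: set_lebesgue_integral_def)
  qed
  show "\<phi> r \<le> max r a powr (- \<kappa>) / \<kappa>" if b1: "b \<le> 1"
  proof (cases "max r a \<le> 1")
    case True
    define m where "m = max r a"
    have m: "0 < m" "m \<le> 1" using ab True by (auto simp: m_def)
    have "\<phi> r \<le> (LBINT s:{m..1}. s powr (- \<kappa> - 1))"
      unfolding \<phi>_def set_lebesgue_integral_def
    proof (rule Bochner_Integration.integral_mono[OF Wr])
      show "integrable lborel (\<lambda>s. indicator {m..1} s *\<^sub>R s powr (- \<kappa> - 1))"
        using LBINT_powr_bound(1)[OF m \<kappa>(1)] unfolding set_integrable_def .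
      fix s :: real
      show "indicator {r..} s * W s \<le> indicator {m..1} s *\<^sub>R s powr (- \<kappa> - 1)"
      proof (cases "r \<le> s \<and> a \<le> s \<and> s \<le> b")
        case True
        then have "(1/s) ^ (d - 1) = s powr (- real (d - 1))"
          using ab by (simp add: powr_minus powr_realpow power_one_over inverse_eq_divide)
        also have "\<dots> \<le> s powr (- \<kappa> - 1)"
          using True ab b1 \<kappa> d2 by (intro powr_mono') (auto simp: of_nat_diff)
        finally show ?thesis using True b1 by (simp add: W_def m_def)
      qed (auto simp: W_def indicator_def)
    qed
    also have "\<dots> \<le> m powr (- \<kappa>) / \<kappa>" by (rule LBINT_powr_bound(2)[OF m \<kappa>(1)])
    finally show ?thesis unfolding m_def .
  next
    case False
    then have "b < r" using b1 ab by auto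
    then show ?thesis using zero \<kappa>(1) by simp
  qed
qed

lemma f_upper:
  obtains C where "1 \<le> C" "\<And>s. \<bar>s - f s\<bar> \<le> C * (1 + \<bar>s\<bar> powr p)"
proof -
  obtain C where C: "0 \<le> C" "\<And>s. f s * s \<le> 1 * s\<^sup>2 + C * \<bar>s\<bar> powr (p + 1)" using f_growth[of 1] by auto
  have sp: "\<bar>s\<bar> \<le> 1 + \<bar>s\<bar> powr p" for s :: real
  proof (cases "\<bar>s\<bar> \<le> 1")
    case True
    then show ?thesis using powr_ge_zero[of "\<bar>s\<bar>" p] by linarith
  next
    case False
    then have "\<bar>s\<bar> powr 1 \<le> \<bar>s\<bar> powr p" using p1 by (intro powr_mono) auto
    then show ?thesis using False by simp
  qed
  have "\<bar>s - f s\<bar> \<le> (2 + C) * (1 + \<bar>s\<bar> powr p)" for s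
  proof (cases "s = 0")
    case False
    have "\<bar>f s\<bar> * \<bar>s\<bar> = f s * s" using f_mult_abs[of s] by (simp add: f_abs)
    also have "\<dots> \<le> 1 * s\<^sup>2 + C * \<bar>s\<bar> powr (p + 1)" by (rule C(2))
    also have "\<dots> = (\<bar>s\<bar> + C * \<bar>s\<bar> powr p) * \<bar>s\<bar>"
      using False by (simp add: powr_add power2_eq_square algebra_simps)
    finally have "\<bar>f s\<bar> \<le> \<bar>s\<bar> + C * \<bar>s\<bar> powr p" using False by simp
    then have "\<bar>s - f s\<bar> \<le> 2 * \<bar>s\<bar> + C * \<bar>s\<bar> powr p" by linarith
    also have "\<dots> \<le> 2 * (1 + \<bar>s\<bar> powr p) + C * \<bar>s\<bar> powr p"
      using sp[of s] by (intro add_right_mono mult_left_mono) auto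
    also have "\<dots> \<le> (2 + C) * (1 + \<bar>s\<bar> powr p)" using C(1) by (simp add: algebra_simps)
    finally show ?thesis .
  qed (use C(1) in simp)
  then show ?thesis using that[of "2 + C"] C(1) by simp
qed

text \<open>Testing the Euler-Lagrange equation with the truncated kernel gives g b - g a as the
  integral of (g - f g) \<phi>. The bound on g makes the first factor O(r^(-p \<alpha>)), the kernel
  is O(max r a ^ (-\<kappa>)), and integration with weight r^(d-1) over (0, b] yields the exponent.
  The parameter \<beta> shifts part of the kernel singularity from r to a, to make the integral
  converge when it otherwise would not.\<close>

lemma minimizer_increment:
  assumes g: "g \<in> nodal" and min: "\<And>h. h \<in> nodal \<Longrightarrow> act g \<le> act h"
    and \<alpha>: "0 \<le> \<alpha>" "\<alpha> \<le> \<kappa> / 2" and M: "\<And>r. 0 < r \<Longrightarrow> r \<le> 1 \<Longrightarrow> \<bar>g r\<bar> \<le> M * r powr (- \<alpha>)"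
    and \<beta>: "0 \<le> \<beta>" "\<beta> \<le> \<kappa>" "0 < d - p * \<alpha> - \<kappa> + \<beta>"
  shows "\<exists>C. \<forall>a b. 0 < a \<longrightarrow> a \<le> b \<longrightarrow> b \<le> 1 \<longrightarrow> \<bar>g b - g a\<bar> \<le> C * a powr (- \<beta>) * b powr (d - p * \<alpha> - \<kappa> + \<beta>)"
proof -
  define q where "q = d - p * \<alpha> - \<kappa> + \<beta>"
  have q: "0 < q" using \<beta>(3) by (simp add: q_def)
  have M0: "0 \<le> M" using M[of 1] by simp
  obtain C1 where C1: "1 \<le> C1" "\<And>s. \<bar>s - f s\<bar> \<le> C1 * (1 + \<bar>s\<bar> powr p)" using f_upper by blast
  define C2 where "C2 = C1 * (1 + M powr p)"
  have C2: "0 \<le> C2" unfolding C2_def using C1(1) by simp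
  have nlb: "\<bar>g r - f (g r)\<bar> \<le> C2 * r powr (- (p * \<alpha>))" if r: "0 < r" "r \<le> 1" for r
  proof -
    have "\<bar>g r\<bar> powr p \<le> (M * r powr (- \<alpha>)) powr p" using M[OF r] p1 by (intro powr_mono2) auto
    also have "\<dots> = M powr p * r powr (- (p * \<alpha>))" using M0 r by (simp add: powr_mult powr_powr mult.commute)
    finally have 1: "\<bar>g r\<bar> powr p \<le> M powr p * r powr (- (p * \<alpha>))" .
    have 2: "1 \<le> r powr (- (p * \<alpha>))" using powr_mono'[of "- (p * \<alpha>)" 0 r] r p1 \<alpha> by simp
    have "\<bar>g r - f (g r)\<bar> \<le> C1 * (1 + \<bar>g r\<bar> powr p)" by (rule C1(2))
    also have "\<dots> \<le> C1 * (r powr (- (p * \<alpha>)) + M powr p * r powr (- (p * \<alpha>)))"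
      using 1 2 C1(1) by (intro mult_left_mono add_mono) auto
    also have "\<dots> = C2 * r powr (- (p * \<alpha>))" by (simp add: C2_def algebra_simps)
    finally show ?thesis .
  qed
  note G = nodalD[OF g]
  obtain c where p: "profile d g c" using G(1) by (rule profilesE)
  note [measurable] = profileD(1,2)[OF p] borel_measurable_continuous_onI[OF cont_f]
  have main: "\<bar>g b - g a\<bar> \<le> C2 / \<kappa> / q * a powr (- \<beta>) * b powr q" if ab: "0 < a" "a \<le> b" "b \<le> 1" for a b
  proof -
    define W where "W s = indicator {a..b} s * (1/s) ^ (d - 1)" for s :: real
    define \<phi> where "\<phi> r = (LINT s|lborel. indicator {r..} s * W s)" for r
    note \<phi> = profile_log_kernel[OF ab(1,2), folded W_def, folded \<phi>_def]
    have \<phi>p: "profile d \<phi> (\<lambda>r. - W r)"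
      using \<phi>(1) unfolding W_def[abs_def] \<phi>_def[abs_def] .
    note [measurable] = profileD(1,2)[OF \<phi>p]
    have "(LINT r|\<mu>. c r * - W r) = - (g b - g a)"
    proof -
      have eqp: "indicator {0<..} r * r ^ (d - 1) * (c r * - W r) = - (indicator {a..b} r *\<^sub>R c r)" for r
        using ab by (auto simp: W_def indicator_def power_divide)
      have "(LINT r|\<mu>. c r * - W r) = (LINT r|lborel. - (indicator {a..b} r *\<^sub>R c r))"
        by (subst integral_radial, measurable) (simp only: eqp)
      then show ?thesis using profileD(5)[OF p ab(1,2)] by (simp add: set_lebesgue_integral_def)
    qed
    moreover have i1: "integrable \<mu> (\<lambda>r. g r * \<phi> r)"
      by (rule integrable_mult_squares) (use profileD(3)[OF p] profileD(3)[OF \<phi>p] in auto)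
    moreover have EL: "(LINT r|\<mu>. c r * - W r) + (LINT r|\<mu>. g r * \<phi> r) = (LINT r|\<mu>. f (g r) * \<phi> r)"
      by (rule Euler_Lagrange_radial[OF g min p \<phi>p])
    moreover have i2: "integrable \<mu> (\<lambda>r. f (g r) * \<phi> r)"
    proof -
      have adA: "admissible (8 * qform d g + 2 * qform d \<phi>) (\<lambda>r. 2 * \<bar>g r\<bar> + \<bar>\<phi> r\<bar>)"
        by (rule admissible_add_abs[OF profile_admissible'[OF G(1)] profile_admissible'[OF profilesI[OF \<phi>p]]])
      show ?thesis
      proof (rule integrable_bound[OF admissible_f_integrable[OF adA]])
        show "AE r in \<mu>. norm (f (g r) * \<phi> r) \<le> norm (f (2 * \<bar>g r\<bar> + \<bar>\<phi> r\<bar>) * (2 * \<bar>g r\<bar> + \<bar>\<phi> r\<bar>))"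
        proof (rule AE_I2)
          fix r
          have "\<bar>f (g r)\<bar> * \<bar>\<phi> r\<bar> \<le> f (2 * \<bar>g r\<bar> + \<bar>\<phi> r\<bar>) * (2 * \<bar>g r\<bar> + \<bar>\<phi> r\<bar>)"
            unfolding f_abs by (intro mult_mono f_mono) (use f_mono[of 0 "2 * \<bar>g r\<bar> + \<bar>\<phi> r\<bar>"] in auto)
          also have "\<dots> \<le> \<bar>f (2 * \<bar>g r\<bar> + \<bar>\<phi> r\<bar>)\<bar> * \<bar>2 * \<bar>g r\<bar> + \<bar>\<phi> r\<bar>\<bar>"
            by (intro mult_mono) auto
          finally show "norm (f (g r) * \<phi> r) \<le> norm (f (2 * \<bar>g r\<bar> + \<bar>\<phi> r\<bar>) * (2 * \<bar>g r\<bar> + \<bar>\<phi> r\<bar>))"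
            by (simp only: real_norm_def abs_mult)
        qed
      qed measurable
    qed
    ultimately have eq: "g b - g a = (LINT r|\<mu>. (g r - f (g r)) * \<phi> r)"
      by (simp add: left_diff_distrib)
    have int: "integrable \<mu> (\<lambda>r. (g r - f (g r)) * \<phi> r)" using i1 i2 by (simp add: left_diff_distrib)
    have wi: "integrable lborel (\<lambda>r. C2 / \<kappa> * a powr (- \<beta>) * (indicator {0<..b} r * r powr (q - 1)))"
      using has_integral_powr_lborel(1)[OF q, of b] ab by simp
    have "\<bar>g b - g a\<bar> = \<bar>LINT r|lborel. indicator {0<..} r * r ^ (d - 1) * ((g r - f (g r)) * \<phi> r)\<bar>"
      unfolding eq by (subst integral_radial) auto
    also have "\<dots> \<le> (LINT r|lborel. C2 / \<kappa> * a powr (- \<beta>) * (indicator {0<..b} r * r powr (q - 1)))"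
    proof (rule integral_abs_bound_integral)
      show "integrable lborel (\<lambda>r. indicator {0<..} r * r ^ (d - 1) * ((g r - f (g r)) * \<phi> r))"
        using int by (subst (asm) integrable_radial) auto
      fix r :: real
      show "\<bar>indicator {0<..} r * r ^ (d - 1) * ((g r - f (g r)) * \<phi> r)\<bar> \<le> C2 / \<kappa> * a powr (- \<beta>) * (indicator {0<..b} r * r powr (q - 1))"
      proof (cases "0 < r \<and> r \<le> b")
        case True
        then have r: "0 < r" "r \<le> 1" using ab by auto
        define m where "m = max r a"
        have m: "0 < m" "r \<le> m" "a \<le> m" using r by (auto simp: m_def)
        \<comment> \<open>The exponent \<kappa> is split into \<kappa> - \<beta>, estimated with m
          \<ge> r, and \<beta>, estimated with m \<ge> a.\<close>
        have "m powr (- \<kappa>) = m powr (- (\<kappa> - \<beta>)) * m powr (- \<beta>)" by (simp add: powr_add[symmetric])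
        also have "\<dots> \<le> r powr (- (\<kappa> - \<beta>)) * a powr (- \<beta>)"
          using m r ab \<beta> by (intro mult_mono powr_mono2') auto
        finally have mk: "m powr (- \<kappa>) \<le> r powr (- (\<kappa> - \<beta>)) * a powr (- \<beta>)" .
        have "\<bar>indicator {0<..} r * r ^ (d - 1) * ((g r - f (g r)) * \<phi> r)\<bar> = r powr (real d - 1) * (\<bar>g r - f (g r)\<bar> * \<phi> r)"
          using r \<phi>(2)[of r] d2 by (simp add: abs_mult powr_realpow[symmetric] of_nat_diff)
        also have "\<dots> \<le> r powr (real d - 1) * ((C2 * r powr (- (p * \<alpha>))) * (r powr (- (\<kappa> - \<beta>)) * a powr (- \<beta>) / \<kappa>))"
        proof (intro mult_left_mono mult_mono nlb r)
          have "\<phi> r \<le> m powr (- \<kappa>) / \<kappa>" using \<phi>(4)[OF ab(3), of r] unfolding m_def .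
          also have "\<dots> \<le> r powr (- (\<kappa> - \<beta>)) * a powr (- \<beta>) / \<kappa>" using mk \<kappa>(1) by (intro divide_right_mono) auto
          finally show "\<phi> r \<le> r powr (- (\<kappa> - \<beta>)) * a powr (- \<beta>) / \<kappa>" .
        qed (use C2 \<phi>(2) in auto)
        also have "\<dots> = C2 / \<kappa> * a powr (- \<beta>) * (r powr (real d - 1) * r powr (- (p * \<alpha>)) * r powr (- (\<kappa> - \<beta>)))"
          by (simp add: algebra_simps)
        also have "r powr (real d - 1) * r powr (- (p * \<alpha>)) * r powr (- (\<kappa> - \<beta>)) = r powr (q - 1)"
          unfolding powr_add[symmetric] by (simp add: q_def algebra_simps)
        finally show ?thesis using True by simp
      next
        case False
        then show ?thesis using \<phi>(3)[of r] by (auto simp: indicator_def)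
      qed
    qed (rule wi)
    also have "\<dots> = C2 / \<kappa> * a powr (- \<beta>) * (b powr q / q)"
      using has_integral_powr_lborel[OF q, of b] ab by simp
    finally show ?thesis by (simp add: field_simps)
  qed
  then show ?thesis unfolding q_def by blast
qed

text \<open>Bootstrap: subcriticality makes each application of the Euler--Lagrange equation improve the blow-up rate
  at the origin by a fixed amount.\<close>
theorem minimizer_limit_at_origin:
  assumes g: "g \<in> nodal" and min: "\<And>h. h \<in> nodal \<Longrightarrow> act g \<le> act h"
  obtains l where "(g \<longlongrightarrow> l) (at_right 0)"
proof (rule ccontr)
  assume "\<not> thesis"
  then have nolim: "\<not> (\<exists>l. (g \<longlongrightarrow> l) (at_right 0))" using that by blast
  note G = nodalD[OF g]
  \<comment> \<open>The distance to criticality; half of it is gained in the exponent at each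
    round.\<close>
  define \<delta> where "\<delta> = d - (p + 1) / 2 * \<kappa>"
  have \<delta>: "0 < \<delta>" unfolding \<delta>_def using \<kappa>(3) by simp
  define B where "B \<alpha> \<longleftrightarrow> (\<exists>M. \<forall>r. 0 < r \<longrightarrow> r \<le> 1 \<longrightarrow> \<bar>g r\<bar> \<le> M * r powr (- \<alpha>))" for \<alpha>
  have "B (\<kappa> / 2)" unfolding B_def
  proof (intro exI allI impI)
    fix r :: real assume r: "0 < r" "r \<le> 1"
    define K where "K = qform d g * (8 + 2 / \<kappa>)"
    have "(g r)^2 \<le> K * r powr (- \<kappa>)"
      using admissibleD(2)[OF profile_admissible'[OF G(1)] r(1)] r by (simp add: majorant_def K_def mult.assoc)
    then have "sqrt ((g r)^2) \<le> sqrt (K * r powr (- \<kappa>))" by (rule real_sqrt_le_mono)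
    also have "\<dots> = sqrt K * r powr (- (\<kappa> / 2))"
      using r by (simp add: real_sqrt_mult powr_half_sqrt[symmetric] powr_powr)
    finally show "\<bar>g r\<bar> \<le> sqrt K * r powr (- (\<kappa> / 2))" by simp
  qed
  have step: "\<exists>\<alpha>'. 0 \<le> \<alpha>' \<and> \<alpha>' \<le> \<alpha> - \<delta> / 2 \<and> B \<alpha>'" if \<alpha>: "0 \<le> \<alpha>" "\<alpha> \<le> \<kappa> / 2" and "B \<alpha>" for \<alpha>
  proof -
    obtain M where M: "\<And>r. 0 < r \<Longrightarrow> r \<le> 1 \<Longrightarrow> \<bar>g r\<bar> \<le> M * r powr (- \<alpha>)" using \<open>B \<alpha>\<close> unfolding B_def by blast
    show ?thesis
    proof (cases "0 < d - p * \<alpha> - \<kappa>")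
      case True
      define q where "q = d - p * \<alpha> - \<kappa>"
      have q: "0 < q" using True by (simp add: q_def)
      \<comment> \<open>Here \<beta> = 0 is allowed, so increments are O(b^q) uniformly in a: the
        profile is Cauchy at the origin and the limit assumed absent exists.\<close>
      obtain C where C: "\<And>a b. 0 < a \<Longrightarrow> a \<le> b \<Longrightarrow> b \<le> 1 \<Longrightarrow> \<bar>g b - g a\<bar> \<le> C * b powr q"
        using minimizer_increment[OF g min \<alpha> M, of 0] True \<kappa>(1) unfolding q_def by auto
      define x where "x n = 1 / (real n + 1)" for n
      have x: "0 < x n" "x n \<le> 1" for n unfolding x_def by (auto simp: field_simps)
      have xz: "x \<longlonglongrightarrow> 0" unfolding x_def using LIMSEQ_inverse_real_of_nat by (simp add: inverse_eq_divide add.commute)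
      have "\<bar>g (x n)\<bar> \<le> \<bar>g 1\<bar> + C" for n using C[of "x n" 1] x[of n] by auto
      then have "bounded (range (\<lambda>n. g (x n)))" by (intro boundedI[of _ "\<bar>g 1\<bar> + C"]) auto
      then obtain l \<rho> where \<rho>: "strict_mono \<rho>" "((\<lambda>n. g (x n)) \<circ> \<rho>) \<longlonglongrightarrow> l"
        using bounded_imp_convergent_subsequence by blast
      have xr: "(\<lambda>n. x (\<rho> n)) \<longlonglongrightarrow> 0" using LIMSEQ_subseq_LIMSEQ[OF xz \<rho>(1)] by (simp add: o_def)
      have gr: "\<bar>g r - l\<bar> \<le> C * r powr q" if r: "0 < r" "r \<le> 1" for r
      proof (rule tendsto_upperbound)
        show "(\<lambda>n. \<bar>g r - g (x (\<rho> n))\<bar>) \<longlonglongrightarrow> \<bar>g r - l\<bar>"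
          using \<rho>(2) by (intro tendsto_intros) (simp add: o_def)
        have "\<forall>\<^sub>F n in sequentially. x (\<rho> n) < r" by (rule order_tendstoD(2)[OF xr r(1)])
        then show "\<forall>\<^sub>F n in sequentially. \<bar>g r - g (x (\<rho> n))\<bar> \<le> C * r powr q"
          by eventually_elim (use C x r in auto)
      qed simp
      have "((\<lambda>r. g r - l) \<longlongrightarrow> 0) (at_right 0)"
      proof (rule Lim_null_comparison)
        show "\<forall>\<^sub>F r in at_right 0. norm (g r - l) \<le> C * r powr q"
          by (rule eventually_at_rightI[of 0 1]) (use gr in auto)
        have "((\<lambda>r::real. r powr q) \<longlongrightarrow> 0) (at_right 0)"
          by (rule tendsto_zero_powrI[OF tendsto_ident_at tendsto_const _ q])
             (rule eventually_at_rightI[of 0 1], auto)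
        from tendsto_mult_left[OF this, of C] show "((\<lambda>r. C * r powr q) \<longlongrightarrow> 0) (at_right 0)" by simp
      qed
      then have "\<exists>l. (g \<longlongrightarrow> l) (at_right 0)" by (auto simp: LIM_zero_iff)
      then show ?thesis using nolim by simp
    next
      case False
      \<comment> \<open>The least admissible \<beta> plus \<delta>/2, so that the exponent of b
        equals \<delta>/2. The bound \<alpha> \<le> \<kappa>/2 turns the choice of \<delta> into
        \<alpha>' \<le> \<alpha> - \<delta>/2.\<close>
      define \<alpha>' where "\<alpha>' = p * \<alpha> + \<kappa> - d + \<delta> / 2"
      have "(p - 1) * \<alpha> \<le> (p - 1) * (\<kappa> / 2)" using \<alpha> p1 by (intro mult_left_mono) auto
      then have le: "\<alpha>' \<le> \<alpha> - \<delta> / 2" unfolding \<alpha>'_def \<delta>_def by (simp add: field_simps)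
      have \<alpha>'0: "0 \<le> \<alpha>'" using False \<delta> unfolding \<alpha>'_def by simp
      have "\<alpha>' \<le> \<kappa>" using le \<delta> \<alpha> \<kappa>(1) by linarith
      then obtain C where C: "\<And>a b. 0 < a \<Longrightarrow> a \<le> b \<Longrightarrow> b \<le> 1 \<Longrightarrow>
          \<bar>g b - g a\<bar> \<le> C * a powr (- \<alpha>') * b powr (d - p * \<alpha> - \<kappa> + \<alpha>')"
        using minimizer_increment[OF g min \<alpha> M \<alpha>'0] \<delta> unfolding \<alpha>'_def by fastforce
      have "B \<alpha>'" unfolding B_def
      proof (intro exI allI impI)
        fix r :: real assume r: "0 < r" "r \<le> 1"
        have 1: "1 \<le> r powr (- \<alpha>')" using powr_mono'[of "- \<alpha>'" 0 r] r \<alpha>'0 by simp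
        have "\<bar>g 1\<bar> * 1 \<le> \<bar>g 1\<bar> * r powr (- \<alpha>')" using 1 by (intro mult_left_mono) auto
        then show "\<bar>g r\<bar> \<le> (\<bar>g 1\<bar> + C) * r powr (- \<alpha>')"
          using C[of r 1] r by (simp add: algebra_simps)
      qed
      then show ?thesis using le \<alpha>'0 by blast
    qed
  qed
  have "\<exists>\<alpha>. 0 \<le> \<alpha> \<and> \<alpha> \<le> \<kappa> / 2 - n * (\<delta> / 2) \<and> B \<alpha>" for n :: nat
  proof (induction n)
    case 0
    show ?case using \<open>B (\<kappa> / 2)\<close> \<kappa>(1) by (intro exI[of _ "\<kappa> / 2"]) simp
  next
    case (Suc n)
    then obtain \<alpha> where \<alpha>: "0 \<le> \<alpha>" "\<alpha> \<le> \<kappa> / 2 - n * (\<delta> / 2)" "B \<alpha>" by blast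
    moreover have "0 \<le> real n * (\<delta> / 2)" using \<delta> by simp
    ultimately obtain \<alpha>' where \<alpha>': "0 \<le> \<alpha>'" "\<alpha>' \<le> \<alpha> - \<delta> / 2" "B \<alpha>'" using step[of \<alpha>] by auto
    have "real (Suc n) * (\<delta> / 2) = real n * (\<delta> / 2) + \<delta> / 2" by (simp add: distrib_right add_divide_distrib)
    then have "\<alpha>' \<le> \<kappa> / 2 - real (Suc n) * (\<delta> / 2)" using \<alpha>(2) \<alpha>'(2) by linarith
    then show ?case using \<alpha>' by blast
  qed
  \<comment> \<open>After finitely many rounds the nonnegative exponent would have to lie below a
    negative number, so the limit must exist at some round.\<close>
  moreover obtain n :: nat where "\<kappa> / 2 / (\<delta> / 2) < n" using reals_Archimedean2 by blast
  then have "\<kappa> / 2 - n * (\<delta> / 2) < 0" using \<delta> by (simp add: field_simps)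
  ultimately show False by (meson leD order_trans)
qed

end

section \<open>Smooth functions\<close>

text \<open>Closure of the coinductive smoothness predicate under ring operations and composition, by coinduction
  up to these operations.\<close>
inductive smooth_closure :: "('a::euclidean_space \<Rightarrow> real) \<Rightarrow> bool" where
  base: "smooth_fun \<phi> \<Longrightarrow> smooth_closure \<phi>"
| const: "smooth_closure (\<lambda>_. c)"
| linear: "smooth_closure (\<lambda>x. x \<bullet> v)"
| add: "smooth_closure \<phi> \<Longrightarrow> smooth_closure \<psi> \<Longrightarrow> smooth_closure (\<lambda>x. \<phi> x + \<psi> x)"
| mult: "smooth_closure \<phi> \<Longrightarrow> smooth_closure \<psi> \<Longrightarrow> smooth_closure (\<lambda>x. \<phi> x * \<psi> x)"
| comp: "smooth_fun \<zeta> \<Longrightarrow> smooth_closure \<phi> \<Longrightarrow> smooth_closure (\<lambda>x. \<zeta> (\<phi> x :: real))"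

abbreviation has_gradient :: "('a::euclidean_space \<Rightarrow> real) \<Rightarrow> 'a \<Rightarrow> 'a \<Rightarrow> bool" where
  "has_gradient \<phi> v x \<equiv> (\<phi> has_derivative (\<lambda>h. v \<bullet> h)) (at x)"

lemma smooth_fun_gradient:
  assumes "smooth_fun \<phi>"
  obtains G where "\<And>x. has_gradient \<phi> (G x) x" "\<And>i. i \<in> Basis \<Longrightarrow> smooth_fun (\<lambda>x. G x \<bullet> i)"
  using assms by (cases rule: smooth_fun.cases) auto

text \<open>Product and chain rule express partial derivatives through sums, products and
  compositions of members, so the class is stable under differentiation and serves as the
  coinduction invariant.\<close>

lemma smooth_closure_gradient:
  assumes "smooth_closure \<phi>"
  shows "\<exists>G. (\<forall>x. has_gradient \<phi> (G x) x) \<and> (\<forall>i\<in>Basis. smooth_closure (\<lambda>x. G x \<bullet> i))"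
  using assms
proof (induction rule: smooth_closure.induct)
  case (base \<phi>)
  then show ?case by (elim smooth_fun_gradient) (auto intro: smooth_closure.base)
next
  case (const c)
  show ?case by (intro exI[of _ "\<lambda>_. 0"]) (auto intro: smooth_closure.const)
next
  case (linear v)
  show ?case
    by (intro exI[of _ "\<lambda>_. v"]) (auto intro!: smooth_closure.const derivative_eq_intros simp: inner_commute)
next
  case (add \<phi> \<psi>)
  then obtain G H where "\<And>x. has_gradient \<phi> (G x) x" "\<And>i. i \<in> Basis \<Longrightarrow> smooth_closure (\<lambda>x. G x \<bullet> i)"
    "\<And>x. (\<psi> has_derivative (\<lambda>h. H x \<bullet> h)) (at x)" "\<And>i. i \<in> Basis \<Longrightarrow> smooth_closure (\<lambda>x. H x \<bullet> i)" by blast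
  then show ?case
    by (intro exI[of _ "\<lambda>x. G x + H x"])
       (auto intro!: has_derivative_add smooth_closure.add simp: inner_add_left)
next
  case (mult \<phi> \<psi>)
  then obtain G H where GH: "\<And>x. has_gradient \<phi> (G x) x" "\<And>i. i \<in> Basis \<Longrightarrow> smooth_closure (\<lambda>x. G x \<bullet> i)"
    "\<And>x. (\<psi> has_derivative (\<lambda>h. H x \<bullet> h)) (at x)" "\<And>i. i \<in> Basis \<Longrightarrow> smooth_closure (\<lambda>x. H x \<bullet> i)" by blast
  show ?case
  proof (intro exI[of _ "\<lambda>x. \<phi> x *\<^sub>R H x + \<psi> x *\<^sub>R G x"] conjI allI ballI)
    fix x
    show "((\<lambda>x. \<phi> x * \<psi> x) has_derivative (\<lambda>h. (\<phi> x *\<^sub>R H x + \<psi> x *\<^sub>R G x) \<bullet> h)) (at x)"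
      by (rule has_derivative_eq_rhs[OF has_derivative_mult[OF GH(1) GH(3)]]) (auto simp: inner_add_left algebra_simps)
  next
    fix i :: 'a assume "i \<in> Basis"
    then show "smooth_closure (\<lambda>x. (\<phi> x *\<^sub>R H x + \<psi> x *\<^sub>R G x) \<bullet> i)"
      unfolding inner_add_left inner_scaleR_left
      by (intro smooth_closure.add smooth_closure.mult mult.hyps GH)
  qed
next
  case (comp \<zeta> \<phi>)
  then obtain G where G: "\<And>x. has_gradient \<phi> (G x) x" "\<And>i. i \<in> Basis \<Longrightarrow> smooth_closure (\<lambda>x. G x \<bullet> i)" by blast
  obtain Z where Z: "\<And>y. (\<zeta> has_derivative (\<lambda>h. Z y \<bullet> h)) (at y)" "smooth_fun (\<lambda>y. Z y \<bullet> 1)"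
    using comp.hyps(1) by (elim smooth_fun_gradient) auto
  show ?case
  proof (intro exI[of _ "\<lambda>x. Z (\<phi> x) *\<^sub>R G x"] conjI allI ballI)
    fix x
    show "((\<lambda>x. \<zeta> (\<phi> x)) has_derivative (\<lambda>h. (Z (\<phi> x) *\<^sub>R G x) \<bullet> h)) (at x)"
      by (rule has_derivative_eq_rhs[OF has_derivative_compose[OF G(1) Z(1)]]) auto
  next
    fix i :: 'a assume "i \<in> Basis"
    then show "smooth_closure (\<lambda>x. (Z (\<phi> x) *\<^sub>R G x) \<bullet> i)"
      using smooth_closure.mult[OF smooth_closure.comp[OF Z(2) comp.hyps(2)] G(2)] by simp
  qed
qed

lemma smooth_closure_imp_smooth: "smooth_closure \<phi> \<Longrightarrow> smooth_fun \<phi>"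
proof (coinduction arbitrary: \<phi> rule: smooth_fun.coinduct)
  case (smooth_fun \<phi>)
  then show ?case using smooth_closure_gradient by blast
qed

lemma smooth_fun_const: "smooth_fun (\<lambda>_. c)"
  by (rule smooth_closure_imp_smooth[OF smooth_closure.const])

lemma smooth_fun_linear: "smooth_fun (\<lambda>x. x \<bullet> v)"
  by (rule smooth_closure_imp_smooth[OF smooth_closure.linear])

lemma smooth_fun_add: "smooth_fun \<phi> \<Longrightarrow> smooth_fun \<psi> \<Longrightarrow> smooth_fun (\<lambda>x. \<phi> x + \<psi> x)"
  by (rule smooth_closure_imp_smooth[OF smooth_closure.add[OF smooth_closure.base smooth_closure.base]])

lemma smooth_fun_mult: "smooth_fun \<phi> \<Longrightarrow> smooth_fun \<psi> \<Longrightarrow> smooth_fun (\<lambda>x. \<phi> x * \<psi> x)"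
  by (rule smooth_closure_imp_smooth[OF smooth_closure.mult[OF smooth_closure.base smooth_closure.base]])

lemma smooth_fun_compose: "smooth_fun \<zeta> \<Longrightarrow> smooth_fun \<phi> \<Longrightarrow> smooth_fun (\<lambda>x. \<zeta> (\<phi> x :: real))"
  by (rule smooth_closure_imp_smooth[OF smooth_closure.comp[OF _ smooth_closure.base]])

lemma smooth_fun_id: "smooth_fun (\<lambda>x::real. x)"
  using smooth_fun_linear[of "1::real"] by simp

lemma smooth_fun_sum: "finite I \<Longrightarrow> (\<And>i. i \<in> I \<Longrightarrow> smooth_fun (\<phi> i)) \<Longrightarrow> smooth_fun (\<lambda>x. \<Sum>i\<in>I. \<phi> i x)"
  by (induction rule: finite_induct) (auto intro: smooth_fun_const smooth_fun_add)

lemma smooth_fun_prod: "finite I \<Longrightarrow> (\<And>i. i \<in> I \<Longrightarrow> smooth_fun (\<phi> i)) \<Longrightarrow> smooth_fun (\<lambda>x. \<Prod>i\<in>I. \<phi> i x)"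
  by (induction rule: finite_induct) (auto intro: smooth_fun_const smooth_fun_mult)

lemma smooth_fun_square_norm: "smooth_fun (\<lambda>x::'a::euclidean_space. x \<bullet> x)"
proof -
  have "smooth_fun (\<lambda>x::'a. \<Sum>i\<in>Basis. (x \<bullet> i) * (x \<bullet> i))"
    by (intro smooth_fun_sum smooth_fun_mult smooth_fun_linear) auto
  moreover have "(\<lambda>x::'a. \<Sum>i\<in>Basis. (x \<bullet> i) * (x \<bullet> i)) = (\<lambda>x. x \<bullet> x)"
    using euclidean_inner[symmetric] by (intro ext) blast
  ultimately show ?thesis by simp
qed

lemma smooth_fun_real_cases:
  fixes \<phi> :: "real \<Rightarrow> real"
  assumes "smooth_fun \<phi>"
  obtains \<phi>' where "\<And>x. (\<phi> has_real_derivative \<phi>' x) (at x)" "smooth_fun \<phi>'"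
proof -
  obtain G where G: "\<And>x. has_gradient \<phi> (G x) x" "smooth_fun (\<lambda>x. G x \<bullet> 1)"
    using assms by (elim smooth_fun_gradient) auto
  have "(\<phi> has_real_derivative G x) (at x)" for x
    using G(1)[of x] by (simp add: has_field_derivative_def)
  then show ?thesis by (rule that) (use G(2) in simp)
qed

text \<open>In one variable gradient and derivative coincide, so a class stable under
  differentiation is a valid coinduction invariant.\<close>

lemma smooth_fun_realI:
  fixes X :: "(real \<Rightarrow> real) \<Rightarrow> bool"
  assumes "X \<phi>" "\<And>\<phi>. X \<phi> \<Longrightarrow> \<exists>\<phi>'. (\<forall>x. (\<phi> has_real_derivative \<phi>' x) (at x)) \<and> X \<phi>'"
  shows "smooth_fun \<phi>"
  using assms(1)
proof (coinduction arbitrary: \<phi> rule: smooth_fun.coinduct)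
  case (smooth_fun \<phi>)
  then obtain \<phi>' where "\<And>x. (\<phi> has_real_derivative \<phi>' x) (at x)" "X \<phi>'" using assms(2) by blast
  then show ?case
    by (intro exI[of _ \<phi>] exI[of _ \<phi>']) (auto simp: has_field_derivative_def)
qed

lemma smooth_fun_antiderivative:
  fixes \<phi> :: "real \<Rightarrow> real"
  assumes "smooth_fun \<phi>'" "\<And>x. (\<phi> has_real_derivative \<phi>' x) (at x)"
  shows "smooth_fun \<phi>"
  by (rule smooth_fun_realI[of "\<lambda>\<psi>. \<psi> = \<phi> \<or> smooth_fun \<psi>"]) (use assms smooth_fun_real_cases in blast)+

section \<open>Smooth cutoffs on the line\<close>

lemma poly_exp_tendsto_zero: "((\<lambda>y::real. poly P y * exp (- y)) \<longlongrightarrow> 0) at_top"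
proof -
  have "((\<lambda>y::real. \<Sum>i\<le>degree P. coeff P i * (y ^ i / exp y)) \<longlongrightarrow> (\<Sum>i\<le>degree P. coeff P i * 0)) at_top"
    by (intro tendsto_intros tendsto_power_div_exp_0)
  then show ?thesis by (simp add: poly_altdef sum_distrib_right exp_minus divide_inverse mult.assoc)
qed

text \<open>Carrying a polynomial in 1/x along makes the family closed under differentiation: for x
  > 0 the derivative replaces P by X^2 (P - P').\<close>

definition flat :: "real poly \<Rightarrow> real \<Rightarrow> real" where
  "flat P x = (if x \<le> 0 then 0 else poly P (1 / x) * exp (- (1 / x)))"

lemma flat_deriv: "(flat P has_real_derivative flat (monom 1 2 * (P - pderiv P)) x) (at x)"
proof -
  consider "x < 0" | "0 < x" | "x = 0" by linarith
  then show ?thesis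
  proof cases
    case 1
    have "\<forall>\<^sub>F y in nhds x. flat P y = 0"
      using eventually_nhds_in_open[of "{..<0}" x] 1 by (auto elim!: eventually_mono simp: flat_def)
    then show ?thesis using 1 by (subst DERIV_cong_ev[OF refl _ refl]) (auto simp: flat_def)
  next
    case 2
    have ev: "\<forall>\<^sub>F y in nhds x. flat P y = poly P (1 / y) * exp (- (1 / y))"
      using eventually_nhds_in_open[of "{0<..}" x] 2 by (auto elim!: eventually_mono simp: flat_def)
    have i: "((\<lambda>y. 1 / y) has_real_derivative - (1 / x\<^sup>2)) (at x)"
      using 2 by (auto intro!: derivative_eq_intros simp: power2_eq_square)
    have 1: "((\<lambda>y. poly P (1 / y)) has_real_derivative poly (pderiv P) (1 / x) * - (1 / x\<^sup>2)) (at x)"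
      by (rule DERIV_chain2[OF poly_DERIV i])
    have 2: "((\<lambda>y. exp (- (1 / y))) has_real_derivative exp (- (1 / x)) * (1 / x\<^sup>2)) (at x)"
      by (rule DERIV_cong[OF DERIV_chain2[OF DERIV_exp DERIV_minus[OF i]]]) simp
    have "((\<lambda>y. poly P (1 / y) * exp (- (1 / y))) has_real_derivative flat (monom 1 2 * (P - pderiv P)) x) (at x)"
      by (rule DERIV_cong[OF DERIV_mult[OF 1 2]])
         (use \<open>0 < x\<close> in \<open>simp add: flat_def poly_monom power_divide algebra_simps diff_divide_distrib\<close>)
    then show ?thesis by (subst DERIV_cong_ev[OF refl ev refl])
  next
    case 3
    \<comment> \<open>Division by y is absorbed into the polynomial, as X P evaluated at 1/y;
      exponential decay beats every polynomial.\<close>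
    have "((\<lambda>y. flat P y / y) \<longlongrightarrow> 0) (at_right 0)"
    proof -
      have "((\<lambda>y. poly (pCons 0 P) (inverse y) * exp (- inverse y)) \<longlongrightarrow> 0) (at_right (0::real))"
        by (rule filterlim_compose[OF poly_exp_tendsto_zero filterlim_inverse_at_top_right])
      moreover have "\<forall>\<^sub>F y in at_right 0. poly (pCons 0 P) (inverse y) * exp (- inverse y) = flat P y / y"
        by (rule eventually_at_rightI[of 0 1]) (auto simp: flat_def field_simps)
      ultimately show ?thesis by (rule Lim_transform_eventually)
    qed
    moreover have "((\<lambda>y. flat P y / y) \<longlongrightarrow> 0) (at_left 0)"
    proof (rule tendsto_eventually)
      show "\<forall>\<^sub>F y in at_left 0. flat P y / y = 0"
        by (rule eventually_at_leftI[of "-1"]) (auto simp: flat_def)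
    qed
    ultimately have "((\<lambda>y. flat P y / y) \<longlongrightarrow> 0) (at 0)" by (simp add: filterlim_split_at)
    then show ?thesis using 3 by (simp add: DERIV_def flat_def)
  qed
qed

text \<open>The function exp(-1/x) on the positive axis. Its values stay in [0, 1] and it tends to 1
  at infinity, so mere rescaling of the argument approximates the indicator of the positive
  axis.\<close>

definition ramp :: "real \<Rightarrow> real" where
  "ramp = flat 1"

lemma ramp_eq: "ramp x = (if x \<le> 0 then 0 else exp (- (1 / x)))"
  by (simp add: ramp_def flat_def)

lemma smooth_ramp: "smooth_fun ramp"
  by (rule smooth_fun_realI[of "\<lambda>\<phi>. \<exists>P. \<phi> = flat P"]) (use flat_deriv in \<open>auto simp: ramp_def\<close>)

lemma ramp_bounds: "0 \<le> ramp x" "ramp x \<le> 1"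
  by (auto simp: ramp_eq)

lemma ramp_scaled_tendsto: "(\<lambda>n. ramp (real n * x)) \<longlonglongrightarrow> indicator {0<..} x"
proof (cases "0 < x")
  case True
  have "(\<lambda>n. exp (- (1 / real n * (1 / x)))) \<longlonglongrightarrow> exp (- (0 * (1 / x)))"
    by (intro tendsto_intros lim_1_over_n)
  moreover have "\<forall>\<^sub>F n in sequentially. exp (- (1 / real n * (1 / x))) = ramp (real n * x)"
    using eventually_gt_at_top[of 0]
  proof eventually_elim
    case (elim n)
    then have "0 < real n * x" using True by simp
    then show ?case by (simp add: ramp_eq)
  qed
  ultimately show ?thesis using True by (simp add: Lim_transform_eventually)
next
  case False
  then have "ramp (real n * x) = 0" for n by (simp add: ramp_eq mult_nonneg_nonpos)
  then show ?thesis using False by simp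
qed

text \<open>A power may be singular at 0, but \<phi> vanishes up to \<epsilon>. Functions of this
  form are closed under differentiation, with \<phi> replaced by a \<phi> + x \<phi>' and the power
  lowered by one.\<close>

lemma smooth_fun_powr_mult:
  assumes "smooth_fun \<phi>" "0 < \<epsilon>" "\<And>x. x \<le> \<epsilon> \<Longrightarrow> \<phi> x = 0"
  shows "smooth_fun (\<lambda>x::real. x powr a * \<phi> x)"
proof (rule smooth_fun_realI[of "\<lambda>\<psi>. \<exists>a \<phi> \<epsilon>. 0 < \<epsilon> \<and> smooth_fun \<phi> \<and> (\<forall>x\<le>\<epsilon>. \<phi> x = 0) \<and> \<psi> = (\<lambda>x. x powr a * \<phi> x)"])
  show "\<exists>a' \<phi>' \<epsilon>. 0 < \<epsilon> \<and> smooth_fun \<phi>' \<and> (\<forall>x\<le>\<epsilon>. \<phi>' x = 0) \<and> (\<lambda>x. x powr a * \<phi> x) = (\<lambda>x. x powr a' * \<phi>' x)"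
    using assms by blast
  fix \<psi> assume "\<exists>a \<phi> \<epsilon>. 0 < \<epsilon> \<and> smooth_fun \<phi> \<and> (\<forall>x\<le>\<epsilon>. \<phi> x = 0) \<and> \<psi> = (\<lambda>x::real. x powr a * \<phi> x)"
  then obtain a \<phi> \<epsilon> where e: "0 < \<epsilon>" and s: "smooth_fun \<phi>" and z: "\<And>x. x \<le> \<epsilon> \<Longrightarrow> \<phi> x = 0"
    and \<psi>: "\<psi> = (\<lambda>x. x powr a * \<phi> x)" by blast
  obtain \<phi>' where d: "\<And>x. (\<phi> has_real_derivative \<phi>' x) (at x)" and s': "smooth_fun \<phi>'"
    using s by (rule smooth_fun_real_cases) blast
  have z': "\<phi>' x = 0" if "x < \<epsilon>" for x
  proof -
    have ev: "\<forall>\<^sub>F y in nhds x. \<phi> y = 0"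
      using eventually_nhds_in_open[of "{..<\<epsilon>}" x] that by (auto elim!: eventually_mono simp: z)
    have "(\<phi> has_real_derivative 0) (at x)" by (subst DERIV_cong_ev[OF refl ev refl]) simp
    then show ?thesis using d DERIV_unique by blast
  qed
  define \<omega> where "\<omega> x = a * \<phi> x + x * \<phi>' x" for x
  have "(\<psi> has_real_derivative x powr (a - 1) * \<omega> x) (at x)" for x
  proof (cases "x < \<epsilon>")
    case True
    have ev: "\<forall>\<^sub>F y in nhds x. \<psi> y = 0"
      using eventually_nhds_in_open[of "{..<\<epsilon>}" x] True by (auto elim!: eventually_mono simp: z \<psi>)
    have "(\<psi> has_real_derivative 0) (at x)" by (subst DERIV_cong_ev[OF refl ev refl]) simp
    then show ?thesis using z'[OF True] z[of x] True by (simp add: \<omega>_def)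
  next
    case False
    then have x: "0 < x" using e by simp
    have "(\<psi> has_real_derivative a * x powr (a - 1) * \<phi> x + \<phi>' x * x powr a) (at x)"
      unfolding \<psi> by (rule DERIV_mult[OF has_real_derivative_powr[OF x] d])
    moreover have "x powr a = x powr (a - 1) * x" using x by (simp add: powr_diff)
    ultimately show ?thesis by (simp add: \<omega>_def algebra_simps)
  qed
  moreover have "smooth_fun \<omega>" unfolding \<omega>_def
    by (intro smooth_fun_add smooth_fun_mult smooth_fun_const smooth_fun_id s s')
  \<comment> \<open>The derivative \<phi>' has been shown to vanish strictly below \<epsilon> only,
    hence the smaller radius.\<close>
  moreover have "\<forall>x\<le>\<epsilon>/2. \<omega> x = 0" using z z' e by (simp add: \<omega>_def)
  ultimately show "\<exists>\<psi>'. (\<forall>x. (\<psi> has_real_derivative \<psi>' x) (at x)) \<and>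
      (\<exists>a \<phi> \<epsilon>. 0 < \<epsilon> \<and> smooth_fun \<phi> \<and> (\<forall>x\<le>\<epsilon>. \<phi> x = 0) \<and> \<psi>' = (\<lambda>x. x powr a * \<phi> x))"
    using e by (intro exI[of _ "\<lambda>x. x powr (a - 1) * \<omega> x"] conjI exI[of _ "a - 1"] exI[of _ \<omega>] exI[of _ "\<epsilon>/2"]) auto
qed

section \<open>Test functions and integration by parts\<close>

lemma smooth_fun_continuous:
  assumes "smooth_fun \<phi>"
  shows "continuous_on UNIV \<phi>"
  using assms by (elim smooth_fun_gradient) (auto intro!: continuous_at_imp_continuous_on has_derivative_continuous)

lemma smooth_fun_gradient_unique:
  assumes "smooth_fun \<phi>" and D: "\<And>x. has_gradient \<phi> (D x) x"
  shows "i \<in> Basis \<Longrightarrow> smooth_fun (\<lambda>x. D x \<bullet> i)" "continuous_on UNIV D"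
proof -
  obtain G where G: "\<And>x. has_gradient \<phi> (G x) x" "\<And>i. i \<in> Basis \<Longrightarrow> smooth_fun (\<lambda>x. G x \<bullet> i)"
    using assms(1) by (rule smooth_fun_gradient) blast
  have "G x = D x" for x
  proof -
    have "(\<lambda>h. G x \<bullet> h) = (\<lambda>h. D x \<bullet> h)" by (rule has_derivative_unique[OF G(1) D])
    then have "\<forall>h. G x \<bullet> h = D x \<bullet> h" by (blast dest: fun_cong)
    then show ?thesis by (rule vector_eq_rdot[THEN iffD1])
  qed
  then have GD: "G = D" by auto
  show s: "smooth_fun (\<lambda>x. D x \<bullet> i)" if "i \<in> Basis" for i using G(2)[OF that] GD by simp
  show "continuous_on UNIV D"
    by (subst continuous_on_componentwise) (auto intro: smooth_fun_continuous s)
qed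

lemma test_fun_bounds:
  fixes \<phi> :: "'a::euclidean_space \<Rightarrow> real"
  assumes t: "test_fun \<phi>" and D: "\<And>x. has_gradient \<phi> (D x) x"
  obtains R B where "0 < R" "0 < B" "\<And>x. R \<le> norm x \<Longrightarrow> \<phi> x = 0" "\<And>x. R \<le> norm x \<Longrightarrow> D x = 0"
    "\<And>x. \<bar>\<phi> x\<bar> \<le> B" "\<And>x. norm (D x) \<le> B" "\<And>x y. \<bar>\<phi> x - \<phi> y\<bar> \<le> B * norm (x - y)"
proof -
  have s: "smooth_fun \<phi>" and c: "compact (closure {x. \<phi> x \<noteq> 0})" using t unfolding test_fun_def by auto
  obtain R where R: "0 < R" "\<And>x. x \<in> closure {x. \<phi> x \<noteq> 0} \<Longrightarrow> norm x \<le> R"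
    using compact_imp_bounded[OF c] bounded_pos by blast
  have z: "\<phi> x = 0" if "R + 1 \<le> norm x" for x
    using R(2)[of x] that closure_subset[of "{x. \<phi> x \<noteq> 0}"] by fastforce
  have zD: "D x = 0" if "R + 1 \<le> norm x" for x
  proof -
    have "open (- cball (0::'a) R)" by (intro open_Compl) auto
    moreover have "x \<in> - cball 0 R" using that by auto
    ultimately have ev: "\<forall>\<^sub>F y in at x. \<phi> y = 0"
      using eventually_at_in_open'[of "- cball 0 R" x] R(2) closure_subset[of "{x. \<phi> x \<noteq> 0}"]
      by (auto elim!: eventually_mono)
    have "((\<lambda>_. 0) has_derivative (\<lambda>h. D x \<bullet> h)) (at x)"
      by (rule has_derivative_transform_eventually[OF D ev]) (use z that in auto)
    then have "(\<lambda>h. D x \<bullet> h) = (\<lambda>_. 0)" by (rule has_derivative_unique) simp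
    then show ?thesis by (metis inner_eq_zero_iff)
  qed
  have cD: "continuous_on UNIV D" by (rule smooth_fun_gradient_unique(2)[OF s D])
  have "compact (cball (0::'a) (R + 1))" by simp
  then have "bounded (\<phi> ` cball 0 (R + 1))" "bounded (D ` cball 0 (R + 1))"
    by (auto intro!: compact_imp_bounded compact_continuous_image continuous_on_subset[OF smooth_fun_continuous[OF s]]
        continuous_on_subset[OF cD])
  then obtain B1 B2 where B12: "0 < B1" "\<And>x. x \<in> cball 0 (R + 1) \<Longrightarrow> norm (\<phi> x) \<le> B1" "0 < B2" "\<And>x. x \<in> cball 0 (R + 1) \<Longrightarrow> norm (D x) \<le> B2"
    unfolding bounded_pos by (metis imageI)
  define B where "B = max B1 B2"
  have B: "0 < B" "\<bar>\<phi> x\<bar> \<le> B" "norm (D x) \<le> B" for x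
  proof -
    show "0 < B" using B12 by (simp add: B_def)
    show "\<bar>\<phi> x\<bar> \<le> B" "norm (D x) \<le> B"
      using B12(2)[of x] B12(4)[of x] z[of x] zD[of x] B12(1,3) by (cases "norm x \<le> R + 1"; simp add: B_def)+
  qed
  have lip: "\<bar>\<phi> x - \<phi> y\<bar> \<le> B * norm (x - y)" for x y
  proof -
    have "norm (\<phi> x - \<phi> y) \<le> B * norm (x - y)"
    proof (rule differentiable_bound[of UNIV \<phi> "\<lambda>x h. D x \<bullet> h"])
      show "onorm (\<lambda>h. D x \<bullet> h) \<le> B" for x
      proof (rule onorm_bound)
        fix h
        have "norm (D x \<bullet> h) \<le> norm (D x) * norm h" by (simp add: Cauchy_Schwarz_ineq2)
        also have "\<dots> \<le> B * norm h" using B(3) by (intro mult_right_mono) auto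
        finally show "norm (D x \<bullet> h) \<le> B * norm h" .
      qed (use B(1) in simp)
    qed (use D in auto)
    then show ?thesis by simp
  qed
  show ?thesis by (rule that[of "R + 1" B]) (use R B z zD lip in auto)
qed

lemma lborel_integral_translation:
  fixes h :: "'a::euclidean_space \<Rightarrow> real"
  assumes "h \<in> borel_measurable borel"
  shows "(LINT x|lborel. h (v + x)) = (LINT x|lborel. h x)"
    and "integrable lborel h \<Longrightarrow> integrable lborel (\<lambda>x. h (v + x))"
proof -
  have "(LINT x|lborel. h x) = (LINT x|distr lborel borel ((+) v). h x)" by (simp add: lborel_distr_plus)
  also have "\<dots> = (LINT x|lborel. h (v + x))" by (rule integral_distr) (use assms in auto)
  finally show "(LINT x|lborel. h (v + x)) = (LINT x|lborel. h x)" by simp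
  assume "integrable lborel h"
  then have "integrable (distr lborel borel ((+) v)) h" by (simp add: lborel_distr_plus)
  then show "integrable lborel (\<lambda>x. h (v + x))" by (subst (asm) integrable_distr_eq) (use assms in auto)
qed

text \<open>Integration by parts without Fubini: translation invariance kills the integrals of difference quotients.\<close>
lemma integral_directional_derivative_zero:
  fixes \<psi> D :: "'a::euclidean_space \<Rightarrow> real"
  assumes lip: "\<And>x y. \<bar>\<psi> x - \<psi> y\<bar> \<le> L * norm (x - y)" and supp: "\<And>x. R \<le> norm x \<Longrightarrow> \<psi> x = 0"
    and D: "D \<in> borel_measurable borel"
    and lim: "AE x in lborel. (\<lambda>n. (\<psi> (x + (1 / real (Suc n)) *\<^sub>R v) - \<psi> x) * real (Suc n)) \<longlonglongrightarrow> D x"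
  shows "(LINT x|lborel. D x) = 0"
proof -
  have L0: "0 \<le> L"
  proof -
    have "0 \<le> \<bar>\<psi> One - \<psi> 0\<bar>" by simp
    also have "\<dots> \<le> L * norm (One - 0 :: 'a)" by (rule lip)
    finally show ?thesis by (simp add: zero_le_mult_iff)
  qed
  have "continuous_on UNIV \<psi>"
  proof (rule continuous_onI)
    fix x :: 'a and e :: real assume "0 < e"
    have "dist (\<psi> y) (\<psi> x) \<le> e" if "dist y x < e / (L + 1)" for y
    proof -
      have "\<bar>\<psi> y - \<psi> x\<bar> \<le> L * norm (y - x)" by (rule lip)
      also have "\<dots> \<le> (L + 1) * (e / (L + 1))" using that L0 by (intro mult_mono) (auto simp: dist_norm)
      also have "\<dots> = e" using L0 by simp
      finally show ?thesis by (simp add: dist_real_def)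
    qed
    then show "\<exists>d>0. \<forall>x'\<in>UNIV. dist x' x < d \<longrightarrow> dist (\<psi> x') (\<psi> x) \<le> e"
      using \<open>0 < e\<close> L0 by (intro exI[of _ "e / (L + 1)"]) auto
  qed
  then have m[measurable]: "\<psi> \<in> borel_measurable borel" by (rule borel_measurable_continuous_onI)
  define R' where "R' = \<bar>R\<bar>"
  have supp': "\<psi> x = 0" if "R' \<le> norm x" for x using supp[of x] that by (simp add: R'_def)
  have ci: "integrable lborel (indicator (cball (0::'a) r) :: 'a \<Rightarrow> real)" for r
    using emeasure_bounded_finite[OF bounded_cball[of "0::'a" r]] by (intro integrable_real_indicator) auto
  have bd: "\<bar>\<psi> x\<bar> \<le> L * (2 * R') * indicator (cball 0 R') x" for x
  proof (cases "norm x \<le> R'")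
    case True
    \<comment> \<open>A reference point of norm R', where \<psi> vanishes; the Lipschitz bound
      between x and y becomes a uniform bound for \<psi>.\<close>
    define y :: 'a where "y = R' *\<^sub>R (SOME i. i \<in> Basis)"
    have y: "norm y = R'" using some_in_eq[of "Basis :: 'a set"] by (simp add: y_def R'_def)
    have "\<bar>\<psi> x - \<psi> y\<bar> \<le> L * norm (x - y)" by (rule lip)
    also have "\<dots> \<le> L * (2 * R')" using norm_triangle_ineq4[of x y] True y L0 by (intro mult_left_mono) auto
    finally show ?thesis using supp'[of y] y True by simp
  qed (use supp' in simp)
  have i: "integrable lborel \<psi>"
    by (rule integrable_bound[OF integrable_mult_right[OF ci, of "L * (2 * R')" R']])
       (use bd L0 in \<open>auto simp: R'_def intro!: AE_I2\<close>)
  define q where "q n x = (\<psi> (x + (1 / real (Suc n)) *\<^sub>R v) - \<psi> x) * real (Suc n)" for n x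
  have "(\<lambda>n. LINT x|lborel. q n x) \<longlonglongrightarrow> (LINT x|lborel. D x)"
  proof (rule integral_dominated_convergence[where w = "\<lambda>x. L * norm v * indicator (cball 0 (R' + norm v)) x"])
    show "AE x in lborel. (\<lambda>n. q n x) \<longlonglongrightarrow> D x" using lim unfolding q_def .
    show "AE x in lborel. norm (q n x) \<le> L * norm v * indicator (cball 0 (R' + norm v)) x" for n
    proof (rule AE_I2)
      fix x
      define w where "w = (1 / real (Suc n)) *\<^sub>R v"
      have w: "norm w \<le> norm v" "norm w * real (Suc n) = norm v"
        using mult_right_mono[of "1 / real (Suc n)" 1 "norm v"] by (auto simp: w_def)
      show "norm (q n x) \<le> L * norm v * indicator (cball 0 (R' + norm v)) x"
      proof (cases "norm x \<le> R' + norm v")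
        case True
        have "\<bar>\<psi> (x + w) - \<psi> x\<bar> \<le> L * norm w" using lip[of "x + w" x] by simp
        then have "\<bar>\<psi> (x + w) - \<psi> x\<bar> * real (Suc n) \<le> L * norm w * real (Suc n)" by (intro mult_right_mono) auto
        then show ?thesis using True w(2) by (simp add: q_def w_def[symmetric] abs_mult mult.assoc del: of_nat_Suc)
      next
        case False
        have "norm x \<le> norm (x + w) + norm w" using norm_triangle_ineq4[of "x + w" w] by simp
        then have "R' \<le> norm x" "R' \<le> norm (x + w)"
          using False w(1) norm_ge_zero[of v] by linarith+
        then show ?thesis using False by (simp add: q_def w_def[symmetric] supp' del: of_nat_Suc)
      qed
    qed
    show "q n \<in> borel_measurable lborel" for n unfolding q_def by measurable
  qed (use D ci in auto)
  moreover have "(LINT x|lborel. q n x) = 0" for n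
    using lborel_integral_translation[OF m, of "(1 / real (Suc n)) *\<^sub>R v"] i unfolding q_def
    by (simp add: add.commute)
  ultimately have "(\<lambda>n::nat. 0) \<longlonglongrightarrow> (LINT x|lborel. D x)" by simp
  then show ?thesis by (simp add: LIMSEQ_const_iff)
qed

lemma difference_quotient_tendsto:
  fixes \<psi> :: "'a::euclidean_space \<Rightarrow> real"
  assumes "(\<psi> has_derivative \<psi>') (at x)"
  shows "(\<lambda>n. (\<psi> (x + (1 / real (Suc n)) *\<^sub>R v) - \<psi> x) * real (Suc n)) \<longlonglongrightarrow> \<psi>' v"
proof -
  have "((\<lambda>t. \<psi> (x + t *\<^sub>R v)) has_derivative (\<lambda>t. \<psi>' (t *\<^sub>R v))) (at 0)"
    by (rule has_derivative_compose[of "\<lambda>t. x + t *\<^sub>R v" "\<lambda>t. t *\<^sub>R v" 0 UNIV \<psi> \<psi>'])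
       (use assms in \<open>auto intro!: derivative_eq_intros\<close>)
  moreover have "(\<lambda>t. \<psi>' (t *\<^sub>R v)) = (*) (\<psi>' v)"
    using has_derivative_linear[OF assms] by (auto simp: linear_cmul)
  ultimately have "((\<lambda>t. \<psi> (x + t *\<^sub>R v)) has_real_derivative \<psi>' v) (at 0)" by (simp add: has_field_derivative_def)
  then have "((\<lambda>t. (\<psi> (x + t *\<^sub>R v) - \<psi> x) / t) \<longlongrightarrow> \<psi>' v) (at 0)" by (simp add: DERIV_def)
  moreover have "filterlim (\<lambda>n. 1 / real (Suc n)) (at 0) sequentially"
    using LIMSEQ_inverse_real_of_nat by (simp add: filterlim_at inverse_eq_divide)
  ultimately have "(\<lambda>n. (\<psi> (x + (1 / real (Suc n)) *\<^sub>R v) - \<psi> x) / (1 / real (Suc n))) \<longlonglongrightarrow> \<psi>' v"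
    by (rule filterlim_compose)
  then show ?thesis by simp
qed

section \<open>Spherical averages\<close>

definition box_bump :: "nat \<Rightarrow> 'a::euclidean_space \<Rightarrow> 'a \<Rightarrow> 'a \<Rightarrow> real" where
  "box_bump n a b x = (\<Prod>i\<in>Basis. ramp (real n * (x \<bullet> i - a \<bullet> i)) * ramp (real n * (b \<bullet> i - x \<bullet> i)))"

lemma smooth_fun_affine: "smooth_fun (\<lambda>x::'a::euclidean_space. s * (x \<bullet> v) + c)"
  by (intro smooth_fun_add smooth_fun_mult smooth_fun_const smooth_fun_linear)

lemma box_bump_bounds: "0 \<le> box_bump n a b x" "box_bump n a b x \<le> indicator (box a b) x"
proof -
  show "0 \<le> box_bump n a b x" unfolding box_bump_def by (intro prod_nonneg) (simp add: ramp_bounds)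
  show "box_bump n a b x \<le> indicator (box a b) x"
  proof (cases "x \<in> box a b")
    case True
    have "box_bump n a b x \<le> (\<Prod>i\<in>(Basis::'a set). 1)"
      unfolding box_bump_def by (intro prod_mono) (auto simp: ramp_bounds intro!: mult_le_one)
    then show ?thesis using True by simp
  next
    case False
    then obtain i where i: "i \<in> Basis" "x \<bullet> i \<le> a \<bullet> i \<or> b \<bullet> i \<le> x \<bullet> i" by (auto simp: mem_box not_less)
    then have "ramp (real n * (x \<bullet> i - a \<bullet> i)) * ramp (real n * (b \<bullet> i - x \<bullet> i)) = 0"
      by (auto simp: ramp_eq mult_nonneg_nonpos)
    then have "box_bump n a b x = 0" unfolding box_bump_def using i(1) by (intro prod_zero) auto
    then show ?thesis using False by simp
  qed
qed

lemma box_bump_tendsto: "(\<lambda>n. box_bump n a b x) \<longlonglongrightarrow> indicator (box a b) x"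
proof -
  have "(\<lambda>n. box_bump n a b x) \<longlonglongrightarrow> (\<Prod>i\<in>Basis. indicator {0<..} (x \<bullet> i - a \<bullet> i) * indicator {0<..} (b \<bullet> i - x \<bullet> i))"
    unfolding box_bump_def by (intro tendsto_intros ramp_scaled_tendsto)
  also have "(\<Prod>i\<in>Basis. indicator {0<..} (x \<bullet> i - a \<bullet> i) * indicator {0<..} (b \<bullet> i - x \<bullet> i)) = (indicator (box a b) x :: real)"
  proof (cases "x \<in> box a b")
    case True
    then show ?thesis by (auto simp: mem_box intro!: prod.neutral)
  next
    case False
    then obtain i where i: "i \<in> Basis" "x \<bullet> i \<le> a \<bullet> i \<or> b \<bullet> i \<le> x \<bullet> i" by (auto simp: mem_box not_less)
    then have "(\<Prod>i\<in>Basis. indicator {0<..} (x \<bullet> i - a \<bullet> i) * indicator {0<..} (b \<bullet> i - x \<bullet> i)) = (0::real)"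
      by (intro prod_zero bexI[of _ i]) auto
    then show ?thesis using False by simp
  qed
  finally show ?thesis .
qed

lemma test_fun_box_bump: "test_fun (box_bump n a b)"
proof -
  have "smooth_fun (box_bump n a b)"
    unfolding box_bump_def
  proof (rule smooth_fun_prod)
    fix i :: 'a assume "i \<in> Basis"
    have "(\<lambda>x. real n * (x \<bullet> i - a \<bullet> i)) = (\<lambda>x. real n * (x \<bullet> i) + - real n * (a \<bullet> i))"
      "(\<lambda>x. real n * (b \<bullet> i - x \<bullet> i)) = (\<lambda>x. - real n * (x \<bullet> i) + real n * (b \<bullet> i))" by (auto simp: algebra_simps)
    then have "smooth_fun (\<lambda>x. real n * (x \<bullet> i - a \<bullet> i))" "smooth_fun (\<lambda>x. real n * (b \<bullet> i - x \<bullet> i))"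
      by (simp_all only: smooth_fun_affine)
    then show "smooth_fun (\<lambda>x. ramp (real n * (x \<bullet> i - a \<bullet> i)) * ramp (real n * (b \<bullet> i - x \<bullet> i)))"
      by (rule smooth_fun_mult[OF smooth_fun_compose[OF smooth_ramp] smooth_fun_compose[OF smooth_ramp]])
  qed simp
  moreover have sub: "{x. box_bump n a b x \<noteq> 0} \<subseteq> box a b"
  proof
    fix x assume "x \<in> {x. box_bump n a b x \<noteq> 0}"
    then have "(indicator (box a b) x :: real) \<noteq> 0" using box_bump_bounds[of n a b x] by auto
    then show "x \<in> box a b" by (simp add: indicator_def split: if_splits)
  qed
  have "bounded {x. box_bump n a b x \<noteq> 0}" by (rule bounded_subset[OF bounded_box sub])
  ultimately show ?thesis by (simp add: test_fun_def)
qed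

abbreviation origin_box :: "nat \<Rightarrow> 'a::euclidean_space set" where
  "origin_box N \<equiv> box (- (real N *\<^sub>R One)) (real N *\<^sub>R One)"

text \<open>Indicators of boxes are bounded pointwise limits of test functions, which reduces the
  claim to the box criterion. Boxes around the origin localize, as h need not be globally
  integrable.\<close>

lemma test_functions_separate:
  fixes h :: "'a::euclidean_space \<Rightarrow> real"
  assumes [measurable]: "h \<in> borel_measurable borel"
    and int: "\<And>N. integrable lborel (\<lambda>x. indicator (origin_box N) x * h x)"
    and z: "\<And>\<phi>. test_fun \<phi> \<Longrightarrow> (LINT x|lborel. h x * \<phi> x) = 0"
  shows "AE x in lborel. h x = 0"
proof -
  have "AE x in lborel. indicator (origin_box N) x * h x = 0" for N
  proof (rule AE_zero_if_box_integrals_zero[OF int])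
    fix a b :: 'a
    obtain a' b' :: 'a where ab: "box a b \<inter> origin_box N = box a' b'"
      using box_Int_box by blast
    have [measurable]: "box_bump n a' b' \<in> borel_measurable borel" for n
      using test_fun_box_bump[of n a' b'] smooth_fun_continuous
      by (auto simp: test_fun_def intro: borel_measurable_continuous_onI)
    have "(\<lambda>n. LINT x|lborel. h x * box_bump n a' b' x) \<longlonglongrightarrow> (LINT x|lborel. h x * indicator (box a' b') x)"
    proof (rule integral_dominated_convergence)
      show "integrable lborel (\<lambda>x. norm (indicator (origin_box N) x * h x))" using int by (rule integrable_norm)
      show "AE x in lborel. (\<lambda>n. h x * box_bump n a' b' x) \<longlonglongrightarrow> h x * indicator (box a' b') x"
        by (intro AE_I2 tendsto_intros box_bump_tendsto)
      show "AE x in lborel. norm (h x * box_bump n a' b' x) \<le> norm (indicator (origin_box N) x * h x)" for n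
      proof (rule AE_I2)
        fix x
        have "box_bump n a' b' x \<le> indicator (box a' b') x" by (rule box_bump_bounds)
        also have "\<dots> \<le> (indicator (origin_box N) x :: real)" using ab by (auto simp: indicator_def)
        finally have "\<bar>h x\<bar> * box_bump n a' b' x \<le> \<bar>h x\<bar> * indicator (origin_box N) x" by (intro mult_left_mono) auto
        then show "norm (h x * box_bump n a' b' x) \<le> norm (indicator (origin_box N) x * h x)"
          using box_bump_bounds(1)[of n a' b' x] by (simp add: abs_mult mult.commute)
      qed
    qed measurable
    then have "(LINT x|lborel. h x * indicator (box a' b') x) = 0"
      using z[OF test_fun_box_bump] by (simp add: LIMSEQ_const_iff)
    moreover have "h x * indicator (box a' b') x = indicator (box a b) x * (indicator (origin_box N) x * h x)" for x
      unfolding ab[symmetric] by (auto simp: indicator_def)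
    ultimately show "(LINT x|lborel. indicator (box a b) x * (indicator (origin_box N) x * h x)) = 0" by simp
  qed
  then have "AE x in lborel. \<forall>N. indicator (origin_box N) x * h x = 0" by (simp only: AE_all_countable) auto
  then show ?thesis
  proof eventually_elim
    case (elim x)
    have "x \<in> (\<Union>N::nat. origin_box N)" using UN_box_eq_UNIV[where 'a='a] by auto
    then obtain N :: nat where "x \<in> origin_box N" by blast
    then show ?case using elim[rule_format, of N] by simp
  qed
qed

lemma box_L2_integrable:
  fixes h :: "'a::euclidean_space \<Rightarrow> real"
  assumes "h \<in> borel_measurable borel" "integrable lborel (\<lambda>x. (h x)^2)"
  shows "integrable lborel (\<lambda>x. indicator (origin_box N) x * h x)"
proof -
  have "integrable lborel (indicator (origin_box N) :: 'a \<Rightarrow> real)"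
    using emeasure_bounded_finite[OF bounded_box] by (intro integrable_real_indicator) auto
  moreover have "(\<lambda>x. (indicator (origin_box N) x)^2) = (indicator (origin_box N) :: 'a \<Rightarrow> real)"
    by (auto simp: indicator_def)
  ultimately show ?thesis using assms by (intro integrable_mult_squares) auto
qed

section \<open>Borel versions and polar coordinates\<close>

lemma borel_version:
  fixes h :: "'a::euclidean_space \<Rightarrow> real"
  assumes "h \<in> borel_measurable lebesgue"
  obtains h' where "h' \<in> borel_measurable borel" "AE x in lebesgue. h x = h' x"
  using completion_ex_borel_measurable_real[of h lborel] assms by (auto simp: AE_completion_iff)

lemma borel_version_vector:
  fixes G :: "'a::euclidean_space \<Rightarrow> 'a"
  assumes G: "G \<in> borel_measurable lebesgue"
  obtains G' where "G' \<in> borel_measurable borel" "AE x in lebesgue. G x = G' x"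
proof -
  have "\<exists>h. h \<in> borel_measurable borel \<and> (AE x in lebesgue. G x \<bullet> i = h x)" for i
  proof -
    have "(\<lambda>x. G x \<bullet> i) \<in> borel_measurable lebesgue" using G by measurable
    then show ?thesis by (elim borel_version) blast
  qed
  then obtain H where H: "\<And>i. H i \<in> borel_measurable borel" "\<And>i. AE x in lebesgue. G x \<bullet> i = H i x" by metis
  define G' where "G' x = (\<Sum>i\<in>Basis. H i x *\<^sub>R i)" for x
  note [measurable] = H(1)
  have "G' \<in> borel_measurable borel" unfolding G'_def by measurable
  moreover have "AE x in lebesgue. \<forall>i\<in>Basis. G x \<bullet> i = H i x" by (rule AE_finite_allI) (use H(2) in auto)
  then have "AE x in lebesgue. G x = G' x"
  proof eventually_elim
    case (elim x)
    have "G x = (\<Sum>i\<in>Basis. (G x \<bullet> i) *\<^sub>R i)" by (simp add: euclidean_representation)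
    also have "\<dots> = G' x" unfolding G'_def using elim by (intro sum.cong) auto
    finally show ?case .
  qed
  ultimately show ?thesis by (rule that)
qed

text \<open>The bridge between the definitions, which integrate over \<open>lebesgue\<close>, and
  the calculus of images, densities and products, which is carried out over
  \<open>lborel\<close>.\<close>

lemma integral_lebesgue_borel:
  fixes h h' :: "'a::euclidean_space \<Rightarrow> real"
  assumes "h' \<in> borel_measurable borel" "AE x in lebesgue. h x = h' x"
  shows "h \<in> borel_measurable lebesgue" "(LINT x|lebesgue. h x) = (LINT x|lborel. h' x)" "integrable lebesgue h \<longleftrightarrow> integrable lborel h'"
proof -
  have m': "h' \<in> borel_measurable lebesgue" using assms(1) by (simp add: measurable_completion)
  show m: "h \<in> borel_measurable lebesgue"
  proof (rule measurableI)
    fix A :: "real set" assume "A \<in> sets borel"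
    then have "h' -` A \<in> sets lebesgue" using measurable_sets[OF m'] by simp
    then show "h -` A \<inter> space lebesgue \<in> sets lebesgue"
      by (rule completion.in_sets_AE[rotated]) (use assms(2) in \<open>auto elim!: eventually_mono\<close>)
  qed simp
  have "(LINT x|lebesgue. h x) = (LINT x|lebesgue. h' x)" by (rule integral_cong_AE[OF m m' assms(2)])
  also have "\<dots> = (LINT x|lborel. h' x)" by (rule integral_completion) (use assms(1) in simp)
  finally show "(LINT x|lebesgue. h x) = (LINT x|lborel. h' x)" .
  have "integrable lebesgue h \<longleftrightarrow> integrable lebesgue h'" by (rule integrable_cong_AE[OF m m' assms(2)])
  also have "\<dots> \<longleftrightarrow> integrable lborel h'" by (rule integrable_completion) (use assms(1) in simp)
  finally show "integrable lebesgue h \<longleftrightarrow> integrable lborel h'" .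
qed

definition sphere_area :: "'a::euclidean_space itself \<Rightarrow> real" where
  "sphere_area _ = DIM('a) * unit_ball_vol (DIM('a))"

lemma sphere_area_pos: "0 < sphere_area TYPE('a::euclidean_space)"
  by (simp add: sphere_area_def)

text \<open>Polar coordinates for functions of the norm. It suffices to compare the measures of the
  half lines {..r}, where both sides are the volume of the ball of radius r.\<close>

lemma distr_norm_lborel:
  "distr (lborel :: 'a::euclidean_space measure) borel norm =
    density lborel (\<lambda>r. ennreal (sphere_area TYPE('a) * (indicator {0<..} r * r ^ (DIM('a) - 1))))" (is "?M = ?N")
proof (rule measure_eqI_generator_eq[of "range atMost" UNIV])
  show "Int_stable (range (atMost :: real \<Rightarrow> real set))" by (auto simp: Int_stable_def)
  show "sets ?M = sigma_sets UNIV (range atMost)" "sets ?N = sigma_sets UNIV (range atMost)"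
    by (auto simp: borel_eq_atMost)
  show "range (\<lambda>n::nat. {..real n}) \<subseteq> range atMost" by auto
  show "(\<Union>n::nat. {..real n}) = UNIV" using real_arch_simple by auto
  have M: "emeasure ?M {..r} = emeasure lborel (cball (0::'a) r)" for r
    by (subst emeasure_distr) (auto intro!: arg_cong[where f = "emeasure lborel"])
  show "emeasure ?M {..real n} \<noteq> \<infinity>" for n :: nat
    unfolding M by (simp add: emeasure_cball)
  fix X assume "X \<in> range (atMost :: real \<Rightarrow> real set)"
  then obtain r where X: "X = {..r}" by auto
  have N: "emeasure ?N {..r} = (\<integral>\<^sup>+s. ennreal (sphere_area TYPE('a) * (indicator {0<..r} s * s powr (real DIM('a) - 1))) \<partial>lborel)"
  proof -
    have "emeasure ?N {..r} = (\<integral>\<^sup>+s. ennreal (sphere_area TYPE('a) * (indicator {0<..} s * s ^ (DIM('a) - 1))) * indicator {..r} s \<partial>lborel)"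
      by (subst emeasure_density) auto
    also have "\<dots> = (\<integral>\<^sup>+s. ennreal (sphere_area TYPE('a) * (indicator {0<..r} s * s powr (real DIM('a) - 1))) \<partial>lborel)"
      by (intro nn_integral_cong)
         (auto simp: indicator_def powr_realpow[symmetric] of_nat_diff DIM_positive Suc_leI)
    finally show ?thesis .
  qed
  show "emeasure ?M X = emeasure ?N X"
  proof (cases "0 < r")
    case True
    note I = has_integral_powr_lborel[of "real DIM('a)" r, OF _ True]
    have "emeasure ?N {..r} = ennreal (LINT s|lborel. sphere_area TYPE('a) * (indicator {0<..r} s * s powr (real DIM('a) - 1)))"
      unfolding N
      by (rule nn_integral_eq_integral) (use I sphere_area_pos[where 'a='a] in \<open>auto simp: DIM_positive intro!: AE_I2\<close>)
    also have "\<dots> = ennreal (unit_ball_vol (DIM('a)) * r ^ DIM('a))"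
      using I(2) True by (simp add: sphere_area_def DIM_positive powr_realpow)
    also have "\<dots> = emeasure ?M {..r}" unfolding M using True by (simp add: emeasure_cball)
    finally show ?thesis using X by simp
  next
    case False
    then have "{0<..r} = {}" by auto
    then have "emeasure ?N {..r} = 0" unfolding N by simp
    moreover have "emeasure ?M {..r} = 0"
    proof (cases "r = 0")
      case True
      then show ?thesis unfolding M by (simp add: emeasure_cball DIM_positive)
    next
      case False
      then show ?thesis unfolding M using \<open>\<not> 0 < r\<close> by simp
    qed
    ultimately show ?thesis using X by simp
  qed
qed auto

lemma integral_norm_radial:
  fixes h :: "real \<Rightarrow> real"
  assumes h[measurable]: "h \<in> borel_measurable borel"
  shows "integrable lborel (\<lambda>x::'a::euclidean_space. h (norm x)) \<longleftrightarrow> integrable (radial DIM('a)) h"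
    and "(LINT x|lborel. h (norm (x::'a))) = sphere_area TYPE('a) * (LINT r|radial DIM('a). h r)"
proof -
  let ?w = "\<lambda>r. indicator {0<..} r * r ^ (DIM('a) - 1)" and ?\<omega> = "sphere_area TYPE('a)"
  have nn: "0 \<le> ?\<omega> * ?w r" for r :: real using sphere_area_pos[where 'a='a] radial_weight_nonneg[of r "DIM('a) - 1"] by simp
  have "integrable lborel (\<lambda>x::'a. h (norm x)) \<longleftrightarrow> integrable (distr (lborel :: 'a measure) borel norm) h"
    by (subst integrable_distr_eq) auto
  also have "\<dots> \<longleftrightarrow> integrable lborel (\<lambda>r. (?\<omega> * ?w r) * h r)"
    unfolding distr_norm_lborel by (subst integrable_density) (use nn in auto)
  also have "\<dots> \<longleftrightarrow> integrable lborel (\<lambda>r. ?w r * h r)"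
    using sphere_area_pos[where 'a='a] by (simp add: mult.assoc)
  also have "\<dots> \<longleftrightarrow> integrable (radial DIM('a)) h" by (subst integrable_radial) auto
  finally show "integrable lborel (\<lambda>x::'a. h (norm x)) \<longleftrightarrow> integrable (radial DIM('a)) h" .
  have "(LINT x|lborel. h (norm (x::'a))) = (LINT r|distr (lborel :: 'a measure) borel norm. h r)"
    by (subst integral_distr) auto
  also have "\<dots> = (LINT r|lborel. (?\<omega> * ?w r) * h r)"
    unfolding distr_norm_lborel by (subst integral_density) (use nn in auto)
  also have "\<dots> = ?\<omega> * (LINT r|lborel. ?w r * h r)" by (simp add: mult.assoc)
  also have "(LINT r|lborel. ?w r * h r) = (LINT r|radial DIM('a). h r)" by (subst integral_radial) auto
  finally show "(LINT x|lborel. h (norm (x::'a))) = ?\<omega> * (LINT r|radial DIM('a). h r)" .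
qed

lemma AE_norm_radial:
  assumes "AE r in radial DIM('a). P r"
  shows "AE x in lborel. P (norm (x::'a::euclidean_space))"
proof -
  have "AE r in distr (lborel :: 'a measure) borel norm. P r"
    unfolding distr_norm_lborel
    using assms sphere_area_pos[where 'a='a]
    by (subst AE_density) (auto simp: AE_radial indicator_def ennreal_mult elim!: eventually_mono split: if_splits)
  then show ?thesis by (rule AE_distrD[rotated]) simp
qed

text \<open>A Lebesgue measurable set that is a union of spheres is one up to a null set with Borel set of radii: inner
  approximation by closed sets, whose sets of radii are \<open>F\<^sub>\<sigma>\<close>.\<close>
lemma radial_set_inner_approximation:
  fixes T :: "real set"
  assumes E: "norm -` T \<in> sets (lebesgue :: 'a::euclidean_space measure)"
  obtains S where "S \<in> sets borel" "S \<subseteq> T" "(norm -` T - norm -` S :: 'a set) \<in> null_sets lebesgue"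
proof -
  have "\<forall>n. \<exists>C. closed C \<and> C \<subseteq> norm -` T \<and> emeasure lebesgue ((norm -` T :: 'a set) - C) < ennreal (1 / real (Suc n))"
  proof
    fix n
    obtain C :: "'a set" where "closed C" "C \<subseteq> norm -` T" "emeasure lebesgue (norm -` T - C) < ennreal (1 / real (Suc n))"
      by (rule sets_lebesgue_inner_closed[OF E, of "1 / real (Suc n)"]) auto
    then show "\<exists>C. closed C \<and> C \<subseteq> norm -` T \<and> emeasure lebesgue ((norm -` T :: 'a set) - C) < ennreal (1 / real (Suc n))"
      by (intro exI[of _ C] conjI)
  qed
  from choice[OF this] obtain C :: "nat \<Rightarrow> 'a set" where C': "\<forall>n. closed (C n) \<and> C n \<subseteq> norm -` T \<and>
    emeasure lebesgue (norm -` T - C n) < ennreal (1 / real (Suc n))" by (elim exE)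
  then have C: "closed (C n)" "C n \<subseteq> norm -` T" "emeasure lebesgue (norm -` T - C n) < ennreal (1 / real (Suc n))" for n
    by (simp_all only:)
  define S where "S = (\<Union>n. \<Union>k::nat. norm ` (C n \<inter> cball 0 (real k)))"
  have "closed (norm ` (C n \<inter> cball 0 (real k)))" for n and k :: nat
    by (intro compact_imp_closed compact_continuous_image closed_Int_compact C continuous_intros) auto
  then have S: "S \<in> sets borel" unfolding S_def by (intro sets.countable_UN borel_closed) auto
  have ST: "S \<subseteq> T" unfolding S_def using C(2) by auto
  have CS: "C n \<subseteq> norm -` S" for n
  proof
    fix x assume "x \<in> C n"
    moreover obtain k :: nat where "norm x \<le> real k" using real_arch_simple by blast
    ultimately have "norm x \<in> norm ` (C n \<inter> cball 0 (real k))" by auto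
    then show "x \<in> norm -` S" unfolding S_def by blast
  qed
  have m: "(norm -` T - norm -` S :: 'a set) \<in> sets lebesgue"
  proof -
    have "(norm -` S :: 'a set) \<in> sets borel" using measurable_sets[of norm borel borel S] S by simp
    then show ?thesis using E by auto
  qed
  have "emeasure lebesgue (norm -` T - norm -` S :: 'a set) \<le> ennreal (1 / real (Suc n))" for n
  proof -
    have "emeasure lebesgue (norm -` T - norm -` S :: 'a set) \<le> emeasure lebesgue (norm -` T - C n)"
      using CS[of n] E C(1)[of n] by (intro emeasure_mono) auto
    then show ?thesis using C(3)[of n] by simp
  qed
  moreover have "(\<lambda>n. ennreal (1 / real (Suc n))) \<longlonglongrightarrow> ennreal 0"
    by (intro tendsto_ennrealI) (use LIMSEQ_inverse_real_of_nat in \<open>simp add: inverse_eq_divide\<close>)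
  ultimately have "emeasure lebesgue (norm -` T - norm -` S :: 'a set) \<le> ennreal 0"
    by (intro LIMSEQ_le_const) auto
  then have "(norm -` T - norm -` S :: 'a set) \<in> null_sets lebesgue" using m by (auto simp: null_sets_def)
  then show ?thesis by (rule that[OF S ST])
qed

text \<open>\<open>H1rad\<close> supplies an arbitrary function of the norm. Its superlevel sets T
  pull back to Lebesgue sets; approximating T and its complement from inside by Borel sets of radii
  leaves a Borel gap that is null for the image measure. So g is measurable for the completion of
  that measure and has a Borel version.\<close>

lemma radial_borel_version:
  fixes u :: "'a::euclidean_space \<Rightarrow> real"
  assumes u: "u \<in> borel_measurable lebesgue" and g: "AE x in lebesgue. u x = g (norm x)"
  obtains g' where "g' \<in> borel_measurable borel" "AE x in lebesgue. u x = g' (norm x)"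
proof -
  let ?N = "distr (lborel :: 'a measure) borel norm"
  have "g \<in> borel_measurable (completion ?N)"
  proof (subst borel_measurable_iff_greater, intro allI)
    fix c
    define T where "T = {r. c < g r}"
    have "{x. c < u x} \<in> sets lebesgue" using borel_measurable_iff_greater[THEN iffD1, OF u] by simp
    then have E: "(norm -` T :: 'a set) \<in> sets lebesgue"
    proof (rule completion.in_sets_AE[rotated])
      show "AE x in lebesgue. (x \<in> {x. c < u x}) = (x \<in> norm -` T)" using g by eventually_elim (simp add: T_def)
    qed simp
    then have E': "(norm -` (- T) :: 'a set) \<in> sets lebesgue" unfolding vimage_Compl using Compl_in_sets_lebesgue[of "norm -` T"] E by blast
    obtain S1 where S1: "S1 \<in> sets borel" "S1 \<subseteq> T" "(norm -` T - norm -` S1 :: 'a set) \<in> null_sets lebesgue"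
      by (rule radial_set_inner_approximation[OF E])
    obtain S2 where S2: "S2 \<in> sets borel" "S2 \<subseteq> - T" "(norm -` (- T) - norm -` S2 :: 'a set) \<in> null_sets lebesgue"
      by (rule radial_set_inner_approximation[OF E'])
    have eq: "norm -` (- S2 - S1) = (norm -` T - norm -` S1) \<union> (norm -` (- T) - norm -` S2 :: 'a set)"
      using S1(2) S2(2) by auto
    have "(norm -` (- S2 - S1) :: 'a set) \<in> null_sets lebesgue" unfolding eq using S1(3) S2(3) by (rule null_sets.Un)
    moreover have "(norm -` (- S2 - S1) :: 'a set) \<in> sets borel"
      using measurable_sets[of norm borel borel "- S2 - S1"] S1(1) S2(1) by auto
    ultimately have "(norm -` (- S2 - S1) :: 'a set) \<in> null_sets lborel" by (auto simp: null_sets_def)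
    then have N: "- S2 - S1 \<in> null_sets ?N"
      using S1(1) S2(1) by (auto simp: null_sets_def emeasure_distr)
    have "T \<in> sets (completion ?N)"
      by (rule sets_completionI[OF _ _ N, of T S1 "T - S1"]) (use S1 S2 in auto)
    then show "{r \<in> space (completion ?N). c < g r} \<in> sets (completion ?N)" by (simp add: T_def)
  qed
  then obtain g' where g': "g' \<in> borel_measurable borel" "AE r in ?N. g r = g' r"
    using completion_ex_borel_measurable_real[of g ?N] by auto
  have "AE x in lborel. g (norm (x::'a)) = g' (norm x)" using AE_distrD[OF _ g'(2)] by simp
  then have "AE x in lebesgue. u x = g' (norm x)"
    using g by (auto dest: AE_completion elim: eventually_elim2)
  then show ?thesis by (rule that[OF g'(1)])
qed

text \<open>Conditional expectation with respect to the norm.\<close>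
lemma spherical_average:
  fixes h :: "'a::euclidean_space \<Rightarrow> real"
  assumes h[measurable]: "h \<in> borel_measurable borel" and i: "integrable lborel (\<lambda>x. (h x)^2)"
  obtains m where "m \<in> borel_measurable borel" "integrable lborel (\<lambda>x::'a. (m (norm x))^2)"
    "\<And>k. k \<in> borel_measurable borel \<Longrightarrow> integrable lborel (\<lambda>x::'a. (k (norm x))^2) \<Longrightarrow>
      (LINT x|lborel. h x * k (norm x)) = (LINT x|lborel. m (norm (x::'a)) * k (norm x))"
proof -
  define F :: "'a measure" where "F = vimage_algebra UNIV norm borel"
  have F: "sets F = {norm -` A | A. A \<in> sets borel}" unfolding F_def by (subst sets_vimage_algebra2) auto
  have sF: "space F = UNIV" by (simp add: F_def)
  have sub: "subalgebra lborel F"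
    unfolding subalgebra_def F using measurable_sets[of norm borel borel] by (auto simp: sF)
  interpret sigma_finite_subalgebra lborel F
  proof (rule sigma_finite_subalgebra.intro)
    show "subalgebra lborel F" by (rule sub)
    show "sigma_finite_measure (restr_to_subalg lborel F)"
    proof (rule sigma_finite_measure.intro, intro exI conjI ballI)
      let ?A = "range (\<lambda>n::nat. norm -` {..real n} :: 'a set)"
      show "countable ?A" by simp
      have A: "norm -` {..real n} \<in> sets F" for n :: nat unfolding F by (intro CollectI exI[of _ "{..real n}"]) auto
      show "?A \<subseteq> sets (restr_to_subalg lborel F)" unfolding sets_restr_to_subalg[OF sub] using A by auto
      show "\<Union> ?A = space (restr_to_subalg lborel F)" using real_arch_simple by (auto simp: space_restr_to_subalg)
      fix a assume "a \<in> ?A"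
      then obtain n :: nat where a: "a = norm -` {..real n}" by auto
      then have "a \<in> sets F" using A by simp
      moreover have "a = cball 0 (real n)" using a by auto
      ultimately show "emeasure (restr_to_subalg lborel F) a \<noteq> \<infinity>"
        by (subst emeasure_restr_to_subalg[OF sub]) (auto simp: emeasure_cball)
    qed
  qed
  define c where "c = real_cond_exp lborel F h"
  have cF: "c \<in> borel_measurable F" unfolding c_def by simp
  have cb[measurable]: "c \<in> borel_measurable borel" using measurable_from_subalg[OF sub cF] by simp
  define e :: 'a where "e = (SOME i. i \<in> Basis)"
  have e: "norm e = 1" using some_in_eq[of "Basis :: 'a set"] by (simp add: e_def)
  \<comment> \<open>Functions measurable with respect to the norm are constant on spheres, so they
    can be read off along the ray through the unit vector e.\<close>
  define m where "m r = c (r *\<^sub>R e)" for r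
  have mb[measurable]: "m \<in> borel_measurable borel" unfolding m_def by measurable
  have cm: "c x = m (norm x)" for x
  proof -
    have "c -` {c x} \<in> sets F" using measurable_sets[OF cF, of "{c x}"] by (simp add: sF)
    then obtain A where A: "c -` {c x} = norm -` A" unfolding F by auto
    have "x \<in> norm -` A" unfolding A[symmetric] by simp
    then have "norm x *\<^sub>R e \<in> norm -` A" using e by simp
    then show ?thesis unfolding A[symmetric] m_def by simp
  qed
  have nF: "norm \<in> measurable F borel" unfolding F_def by (rule measurable_vimage_algebra1) simp
  have key: "(LINT x|lborel. k (norm x) * c x) = (LINT x|lborel. k (norm x) * h x)"
    if k: "k \<in> borel_measurable borel" "integrable lborel (\<lambda>x::'a. (k (norm x))^2)" for k
    unfolding c_def
  proof (rule real_cond_exp_intg(2))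
    show "integrable lborel (\<lambda>x. k (norm x) * h x)" by (rule integrable_mult_squares) (use k i in auto)
    show "(\<lambda>x. k (norm x)) \<in> borel_measurable F" using measurable_compose[OF nF k(1)] .
  qed simp
  \<comment> \<open>Square integrability of the conditional expectation is not known yet. Truncation
    in height and radius gives square integrable functions that may be paired with h.\<close>
  define fN where "fN N r = (if \<bar>m r\<bar> \<le> real N \<and> \<bar>r\<bar> \<le> real N then m r else 0)" for N r
  have [measurable]: "fN N \<in> borel_measurable borel" for N unfolding fN_def by measurable
  have fNi: "integrable lborel (\<lambda>x::'a. (fN N (norm x))^2)" for N
  proof (rule integrable_bound)
    show "integrable lborel (\<lambda>x::'a. (real N)^2 * indicator (cball 0 (real N)) x)"
      using emeasure_bounded_finite[OF bounded_cball] by (intro integrable_mult_right integrable_real_indicator) auto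
    show "AE x in lborel. norm ((fN N (norm (x::'a)))^2) \<le> norm ((real N)^2 * indicator (cball 0 (real N)) x)"
      by (auto simp: fN_def indicator_def abs_le_square_iff[symmetric] intro!: AE_I2)
  qed measurable
  \<comment> \<open>Pairing a truncation with the conditional expectation gives its own squared norm
    a, and Cauchy-Schwarz with h bounds a^2 by a times the squared norm of h. The bound is uniform
    in N, so Fatou applies.\<close>
  have bound: "(LINT x|lborel. (fN N (norm (x::'a)))^2) \<le> (LINT x|lborel. (h x)^2)" for N
  proof -
    define a where "a = (LINT x|lborel. (fN N (norm (x::'a)))^2)"
    have a0: "0 \<le> a" unfolding a_def by (rule integral_nonneg) simp
    have "(LINT x|lborel. fN N (norm x) * c x) = a"
      unfolding a_def cm by (rule integral_cong) (auto simp: fN_def power2_eq_square)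
    then have "a = (LINT x|lborel. fN N (norm x) * h x)" using key[OF _ fNi, of N] by simp
    then have "a\<^sup>2 \<le> a * (LINT x|lborel. (h x)^2)"
      using Cauchy_Schwarz_integral[of "\<lambda>x. fN N (norm x)" lborel h] fNi i unfolding a_def by simp
    then show ?thesis unfolding a_def[symmetric]
      using a0 by (cases "a = 0") (auto simp: power2_eq_square intro!: integral_nonneg)
  qed
  have conv: "AE x in lborel. (\<lambda>N. (fN N (norm (x::'a)))^2) \<longlonglongrightarrow> (m (norm x))^2"
  proof (rule AE_I2, rule tendsto_eventually)
    fix x :: 'a
    obtain N0 :: nat where "max \<bar>m (norm x)\<bar> (norm x) \<le> real N0" using real_arch_simple by blast
    then show "\<forall>\<^sub>F N in sequentially. (fN N (norm x))^2 = (m (norm x))^2"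
      by (intro eventually_sequentiallyI[of N0]) (auto simp: fN_def)
  qed
  have mi: "integrable lborel (\<lambda>x::'a. (m (norm x))^2)"
    by (rule integral_Fatou_bound(1)[OF fNi _ _ conv always_eventually]) (use bound in auto)
  show ?thesis
  proof (rule that[OF mb mi])
    fix k :: "real \<Rightarrow> real" assume "k \<in> borel_measurable borel" "integrable lborel (\<lambda>x::'a. (k (norm x))^2)"
    from key[OF this] show "(LINT x|lborel. h x * k (norm x)) = (LINT x|lborel. m (norm (x::'a)) * k (norm x))"
      unfolding cm by (simp add: mult.commute)
  qed
qed

section \<open>Averages of weak gradients\<close>

lemma continuous_compact_support_square_integrable:
  fixes v :: "'a::euclidean_space \<Rightarrow> real"
  assumes v: "continuous_on UNIV v" and R: "\<And>x. R \<le> norm x \<Longrightarrow> v x = 0"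
  shows "integrable lborel (\<lambda>x. (v x)^2)" "v \<in> borel_measurable borel" "integrable lborel v"
proof -
  have "integrable lborel (\<lambda>x. indicator (cball 0 R) x *\<^sub>R (v x)^2)" "integrable lborel (\<lambda>x. indicator (cball 0 R) x *\<^sub>R v x)"
    by (intro borel_integrable_compact continuous_intros continuous_on_subset[OF v]; simp)+
  moreover have "(\<lambda>x. indicator (cball 0 R) x *\<^sub>R (v x)^2) = (\<lambda>x. (v x)^2)" "(\<lambda>x. indicator (cball 0 R) x *\<^sub>R v x) = v"
    using R by (auto simp: indicator_def fun_eq_iff)
  ultimately show "integrable lborel (\<lambda>x. (v x)^2)" "integrable lborel v" by simp_all
  show "v \<in> borel_measurable borel" by (rule borel_measurable_continuous_onI[OF v])
qed

lemma component_square_integrable: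
  fixes H :: "'a::euclidean_space \<Rightarrow> 'a"
  assumes [measurable]: "H \<in> borel_measurable borel" and "integrable lborel (\<lambda>x. (norm (H x))^2)" and i: "i \<in> Basis"
  shows "integrable lborel (\<lambda>x. (H x \<bullet> i)^2)"
proof (rule integrable_bound[OF assms(2)])
  show "AE x in lborel. norm ((H x \<bullet> i)^2) \<le> norm ((norm (H x))^2)"
    using Basis_le_norm[OF i] by (auto intro!: AE_I2 simp: abs_le_square_iff[symmetric])
qed measurable

lemma radial_component_square_integrable:
  fixes H :: "'a::euclidean_space \<Rightarrow> 'a"
  assumes [measurable]: "H \<in> borel_measurable borel" and "integrable lborel (\<lambda>x. (norm (H x))^2)"
  shows "integrable lborel (\<lambda>x. (H x \<bullet> x / norm x)^2)"
proof (rule integrable_bound[OF assms(2)])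
  have "\<bar>H x \<bullet> x / norm x\<bar> \<le> norm (H x)" for x
    using Cauchy_Schwarz_ineq2[of "H x" x] by (cases "x = 0") (auto simp: abs_divide divide_le_eq)
  then show "AE x in lborel. norm ((H x \<bullet> x / norm x)^2) \<le> norm ((norm (H x))^2)"
    unfolding real_norm_def abs_power2 abs_le_square_iff[symmetric] by simp
qed measurable

text \<open>\<open>g\<close> and \<open>c\<close> are the spherical averages of \<open>U\<close> and of the radial component of its weak gradient \<open>G\<close>.\<close>
locale averaged_weak_gradient =
  fixes U :: "'a::euclidean_space \<Rightarrow> real" and G :: "'a \<Rightarrow> 'a" and g c :: "real \<Rightarrow> real"
  assumes U: "U \<in> borel_measurable borel" "integrable lborel (\<lambda>x. (U x)^2)"
    and G: "G \<in> borel_measurable borel" "integrable lborel (\<lambda>x. (norm (G x))^2)"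
    and weak: "\<And>\<phi> D i. test_fun \<phi> \<Longrightarrow> (\<And>x. has_gradient \<phi> (D x) x) \<Longrightarrow> i \<in> Basis \<Longrightarrow>
      (LINT x|lborel. U x * (D x \<bullet> i)) = - (LINT x|lborel. (G x \<bullet> i) * \<phi> x)"
    and g: "g \<in> borel_measurable borel" "integrable lborel (\<lambda>x::'a. (g (norm x))^2)"
      "\<And>k. k \<in> borel_measurable borel \<Longrightarrow> integrable lborel (\<lambda>x::'a. (k (norm x))^2) \<Longrightarrow>
        (LINT x|lborel. U x * k (norm x)) = (LINT x|lborel. g (norm (x::'a)) * k (norm x))"
    and c: "c \<in> borel_measurable borel" "integrable lborel (\<lambda>x::'a. (c (norm x))^2)"
      "\<And>k. k \<in> borel_measurable borel \<Longrightarrow> integrable lborel (\<lambda>x::'a. (k (norm x))^2) \<Longrightarrow>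
        (LINT x|lborel. (G x \<bullet> x / norm x) * k (norm x)) = (LINT x|lborel. c (norm (x::'a)) * k (norm x))"
begin

text \<open>The weak gradient is tested with the components of the field \<zeta>(|x|^2) x, smooth at
  the origin because it uses the squared norm. Its divergence is radial, and only the radial
  component of G enters, so both sides may be averaged over spheres.\<close>

lemma weak_identity_radial_field:
  fixes \<zeta> \<zeta>' :: "real \<Rightarrow> real"
  assumes \<zeta>: "smooth_fun \<zeta>" "\<And>\<rho>. (\<zeta> has_real_derivative \<zeta>' \<rho>) (at \<rho>)" "smooth_fun \<zeta>'"
    and M: "0 < M" "\<And>\<rho>. M\<^sup>2 \<le> \<rho> \<Longrightarrow> \<zeta> \<rho> = 0" "\<And>\<rho>. M\<^sup>2 \<le> \<rho> \<Longrightarrow> \<zeta>' \<rho> = 0"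
  shows "(LINT r|radial DIM('a). g r * (DIM('a) * \<zeta> (r\<^sup>2) + 2 * r\<^sup>2 * \<zeta>' (r\<^sup>2))) =
    - (LINT r|radial DIM('a). c r * (r * \<zeta> (r\<^sup>2)))"
proof -
  note [measurable] = U(1) G(1) g(1) c(1) borel_measurable_continuous_onI[OF smooth_fun_continuous[OF \<zeta>(1)]]
    borel_measurable_continuous_onI[OF smooth_fun_continuous[OF \<zeta>(3)]]
  define \<phi> where "\<phi> i x = \<zeta> (x \<bullet> x) * (x \<bullet> i)" for i x :: 'a
  define D where "D i x = \<zeta> (x \<bullet> x) *\<^sub>R i + (2 * \<zeta>' (x \<bullet> x) * (x \<bullet> i)) *\<^sub>R x" for i x :: 'a
  have far: "M\<^sup>2 \<le> x \<bullet> x" if "M \<le> norm x" for x :: 'a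
    using that M(1) by (simp add: power2_norm_eq_inner[symmetric])
  have der: "(\<phi> i has_derivative (\<lambda>h. D i x \<bullet> h)) (at x)" for i x
  proof -
    have 1: "((\<lambda>x::'a. x \<bullet> x) has_derivative (\<lambda>h. 2 * (x \<bullet> h))) (at x)"
      by (auto intro!: derivative_eq_intros simp: inner_commute)
    have 2: "((\<lambda>x::'a. \<zeta> (x \<bullet> x)) has_derivative (\<lambda>h. \<zeta>' (x \<bullet> x) * (2 * (x \<bullet> h)))) (at x)"
      using has_derivative_compose[OF 1 \<zeta>(2)[unfolded has_field_derivative_def]] by simp
    have 3: "((\<lambda>x::'a. x \<bullet> i) has_derivative (\<lambda>h. h \<bullet> i)) (at x)" by (auto intro!: derivative_eq_intros)
    show ?thesis unfolding \<phi>_def D_def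
      by (rule has_derivative_eq_rhs[OF has_derivative_mult[OF 2 3]])
         (auto simp: inner_add_left inner_commute algebra_simps)
  qed
  have sm: "smooth_fun (\<phi> i)" for i
    unfolding \<phi>_def by (intro smooth_fun_mult smooth_fun_linear smooth_fun_compose[OF \<zeta>(1)] smooth_fun_square_norm)
  have test: "test_fun (\<phi> i)" for i
  proof -
    have "{x. \<phi> i x \<noteq> 0} \<subseteq> cball 0 M"
    proof
      fix x assume "x \<in> {x. \<phi> i x \<noteq> 0}"
      then have "\<not> M \<le> norm x" using M(2)[OF far[of x]] by (auto simp: \<phi>_def)
      then show "x \<in> cball 0 M" by simp
    qed
    then have "bounded {x. \<phi> i x \<noteq> 0}" by (rule bounded_subset[OF bounded_cball])
    then show ?thesis using sm by (simp add: test_fun_def)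
  qed
  have cD: "continuous_on UNIV (\<lambda>x. D i x \<bullet> i)" for i
    unfolding D_def by (intro continuous_intros continuous_on_compose2[OF smooth_fun_continuous[OF \<zeta>(1)]]
        continuous_on_compose2[OF smooth_fun_continuous[OF \<zeta>(3)]]) auto
  note sD = continuous_compact_support_square_integrable[OF cD, of M]
  note s\<phi> = continuous_compact_support_square_integrable[OF smooth_fun_continuous[OF sm], of M]
  have zD: "D i x \<bullet> i = 0" "\<phi> i x = 0" if "M \<le> norm x" for i x
    using M(2,3)[OF far[OF that]] by (auto simp: D_def \<phi>_def)
  have i1: "integrable lborel (\<lambda>x. U x * (D i x \<bullet> i))" for i
    by (rule integrable_mult_squares) (use U sD(1,2)[of i] zD in auto)
  note Gi = component_square_integrable[OF G]
  have i2: "integrable lborel (\<lambda>x. (G x \<bullet> i) * \<phi> i x)" if "i \<in> Basis" for i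
    by (rule integrable_mult_squares) (use Gi[OF that] s\<phi>(1,2)[of i] zD in auto)
  have sumD: "(\<Sum>i\<in>Basis. D i x \<bullet> i) = DIM('a) * \<zeta> (x \<bullet> x) + 2 * (x \<bullet> x) * \<zeta>' (x \<bullet> x)" for x :: 'a
  proof -
    have "(\<Sum>i\<in>Basis. D i x \<bullet> i) = (\<Sum>i\<in>Basis. \<zeta> (x \<bullet> x) + 2 * \<zeta>' (x \<bullet> x) * ((x \<bullet> i) * (x \<bullet> i)))"
      by (rule sum.cong) (auto simp: D_def inner_add_left inner_Basis)
    also have "\<dots> = DIM('a) * \<zeta> (x \<bullet> x) + 2 * \<zeta>' (x \<bullet> x) * (\<Sum>i\<in>Basis. (x \<bullet> i) * (x \<bullet> i))"
      by (simp add: sum.distrib sum_distrib_left)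
    also have "(\<Sum>i\<in>Basis. (x \<bullet> i) * (x \<bullet> i)) = x \<bullet> x" by (rule euclidean_inner[symmetric])
    finally show ?thesis by simp
  qed
  have sumG: "(\<Sum>i\<in>Basis. (G x \<bullet> i) * \<phi> i x) = (G x \<bullet> x / norm x) * (norm x * \<zeta> ((norm x)^2))" for x
  proof -
    have "(\<Sum>i\<in>Basis. (G x \<bullet> i) * \<phi> i x) = \<zeta> (x \<bullet> x) * (\<Sum>i\<in>Basis. (G x \<bullet> i) * (x \<bullet> i))"
      by (simp add: \<phi>_def sum_distrib_left mult_ac)
    also have "(\<Sum>i\<in>Basis. (G x \<bullet> i) * (x \<bullet> i)) = G x \<bullet> x" by (rule euclidean_inner[symmetric])
    finally show ?thesis by (cases "x = 0") (auto simp: power2_norm_eq_inner)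
  qed
  define k1 where "k1 r = DIM('a) * \<zeta> (r\<^sup>2) + 2 * r\<^sup>2 * \<zeta>' (r\<^sup>2)" for r :: real
  define k2 where "k2 r = r * \<zeta> (r\<^sup>2)" for r :: real
  have k1c: "continuous_on UNIV k1"
    unfolding k1_def by (intro continuous_intros continuous_on_compose2[OF smooth_fun_continuous[OF \<zeta>(1)]]
        continuous_on_compose2[OF smooth_fun_continuous[OF \<zeta>(3)]]) auto
  have k2c: "continuous_on UNIV k2"
    unfolding k2_def by (intro continuous_intros continuous_on_compose2[OF smooth_fun_continuous[OF \<zeta>(1)]]) auto
  have kc: "continuous_on UNIV (\<lambda>x::'a. k1 (norm x))" "continuous_on UNIV (\<lambda>x::'a. k2 (norm x))"
    by (intro continuous_on_compose2[OF k1c] continuous_on_compose2[OF k2c] continuous_intros; simp)+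
  have kz: "k1 (norm x) = 0" "k2 (norm x) = 0" if "M \<le> norm x" for x :: 'a
    using M(2,3)[of "(norm x)^2"] that M(1) by (auto simp: k1_def k2_def)
  have k1i: "integrable lborel (\<lambda>x::'a. (k1 (norm x))^2)" and k2i: "integrable lborel (\<lambda>x::'a. (k2 (norm x))^2)"
    using continuous_compact_support_square_integrable(1)[OF kc(1), of M] continuous_compact_support_square_integrable(1)[OF kc(2), of M] kz by auto
  have km: "k1 \<in> borel_measurable borel" "k2 \<in> borel_measurable borel"
    using k1c k2c by (auto intro: borel_measurable_continuous_onI)
  have "(LINT x|lborel. U x * k1 (norm x)) = (LINT x|lborel. (\<Sum>i\<in>Basis. U x * (D i x \<bullet> i)))"
    by (rule integral_cong)
       (auto simp: k1_def sumD sum_distrib_left[symmetric] power2_norm_eq_inner)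
  also have "\<dots> = (\<Sum>i\<in>Basis. LINT x|lborel. U x * (D i x \<bullet> i))" using i1 by (simp add: Bochner_Integration.integral_sum)
  also have "\<dots> = (\<Sum>i\<in>Basis. - (LINT x|lborel. (G x \<bullet> i) * \<phi> i x))"
    by (intro sum.cong refl weak test der)
  also have "\<dots> = - (LINT x|lborel. (\<Sum>i\<in>Basis. (G x \<bullet> i) * \<phi> i x))"
    using i2 by (simp add: Bochner_Integration.integral_sum sum_negf)
  also have "\<dots> = - (LINT x|lborel. (G x \<bullet> x / norm x) * k2 (norm x))" unfolding sumG k2_def ..
  finally have "(LINT x|lborel. g (norm (x::'a)) * k1 (norm x)) = - (LINT x|lborel. c (norm (x::'a)) * k2 (norm x))"
    unfolding g(3)[OF km(1) k1i] c(3)[OF km(2) k2i] .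
  moreover have "(LINT x|lborel. g (norm (x::'a)) * k1 (norm x)) = sphere_area TYPE('a) * (LINT r|radial DIM('a). g r * k1 r)"
    by (rule integral_norm_radial(2)[where h = "\<lambda>r. g r * k1 r"]) (use g(1) km in measurable)
  moreover have "(LINT x|lborel. c (norm (x::'a)) * k2 (norm x)) = sphere_area TYPE('a) * (LINT r|radial DIM('a). c r * k2 r)"
    by (rule integral_norm_radial(2)[where h = "\<lambda>r. c r * k2 r"]) (use c(1) km in measurable)
  ultimately have "sphere_area TYPE('a) * (LINT r|radial DIM('a). g r * k1 r) = sphere_area TYPE('a) * - (LINT r|radial DIM('a). c r * k2 r)"
    by simp
  then show ?thesis using sphere_area_pos[where 'a='a] unfolding k1_def k2_def by (simp only: mult_cancel_left) simp
qed

text \<open>The choice \<zeta>(\<rho>) = \<rho>^(-d/2) X(\<rho>) cancels the dimension: the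
  divergence times r^(d-1) becomes the derivative of X(r^2), and the identity says that c is the
  one-dimensional weak derivative of g.\<close>

lemma weak_derivative_radial:
  assumes X: "smooth_fun X" "\<And>\<rho>. (X has_real_derivative X' \<rho>) (at \<rho>)"
    and A: "0 < A" "\<And>\<rho>. \<rho> \<le> A \<Longrightarrow> X \<rho> = 0" and M: "0 < M" "\<And>\<rho>. M\<^sup>2 \<le> \<rho> \<Longrightarrow> X \<rho> = 0"
  shows "(LINT r|lborel. indicator {0<..} r * (g r * (2 * r * X' (r\<^sup>2)))) = - (LINT r|lborel. indicator {0<..} r * (c r * X (r\<^sup>2)))"
proof -
  let ?d = "DIM('a)"
  define \<zeta> where "\<zeta> \<rho> = \<rho> powr (- real ?d / 2) * X \<rho>" for \<rho>
  have s\<zeta>: "smooth_fun \<zeta>" unfolding \<zeta>_def by (rule smooth_fun_powr_mult[OF X(1) A])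
  obtain \<zeta>' where \<zeta>': "\<And>\<rho>. (\<zeta> has_real_derivative \<zeta>' \<rho>) (at \<rho>)" "smooth_fun \<zeta>'"
    using s\<zeta> by (rule smooth_fun_real_cases) blast
  have z': "\<zeta>' \<rho> = 0" if "(M + 1)^2 \<le> \<rho>" for \<rho>
  proof -
    have "M\<^sup>2 < (M + 1)^2" using M(1) by (intro power_strict_mono) auto
    then have \<rho>: "M\<^sup>2 < \<rho>" using that by linarith
    have ev: "\<forall>\<^sub>F y in nhds \<rho>. \<zeta> y = 0"
      using eventually_nhds_in_open[of "{M\<^sup>2<..}" \<rho>] \<rho> by (auto elim!: eventually_mono simp: \<zeta>_def M(2))
    have "(\<zeta> has_real_derivative 0) (at \<rho>)" by (subst DERIV_cong_ev[OF refl ev refl]) simp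
    then show ?thesis using \<zeta>'(1) DERIV_unique by blast
  qed
  have eq: "?d * \<zeta> (r\<^sup>2) + 2 * r\<^sup>2 * \<zeta>' (r\<^sup>2) = 2 * r\<^sup>2 * X' (r\<^sup>2) / r ^ ?d" "\<zeta> (r\<^sup>2) = X (r\<^sup>2) / r ^ ?d" if r: "0 < r" for r :: real
  proof -
    define q where "q = r\<^sup>2"
    have q: "0 < q" using r by (simp add: q_def)
    have "(\<zeta> has_real_derivative (- real ?d / 2) * q powr (- real ?d / 2 - 1) * X q + X' q * q powr (- real ?d / 2)) (at q)"
      unfolding \<zeta>_def by (rule DERIV_mult[OF has_real_derivative_powr[OF q] X(2)])
    then have d: "\<zeta>' q = (- real ?d / 2) * q powr (- real ?d / 2 - 1) * X q + X' q * q powr (- real ?d / 2)"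
      using \<zeta>'(1) DERIV_unique by blast
    have "q = r powr 2" using r by (simp add: q_def)
    then have "q powr (- real ?d / 2) = r powr (- real ?d)" by (simp add: powr_powr)
    also have "\<dots> = 1 / r ^ ?d" unfolding powr_minus_divide powr_realpow[OF r] ..
    finally have P: "q powr (- real ?d / 2) = 1 / r ^ ?d" .
    have E: "q powr (- real ?d / 2 - 1) * q = q powr (- real ?d / 2)" using q powr_add[of q "- real ?d / 2 - 1" 1] by simp
    have "?d * \<zeta> q + 2 * q * \<zeta>' q = 2 * q * X' q * q powr (- real ?d / 2)"
      unfolding d \<zeta>_def E[symmetric] by (simp add: algebra_simps)
    then show "?d * \<zeta> (r\<^sup>2) + 2 * r\<^sup>2 * \<zeta>' (r\<^sup>2) = 2 * r\<^sup>2 * X' (r\<^sup>2) / r ^ ?d" unfolding P by (simp add: q_def)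
    show "\<zeta> (r\<^sup>2) = X (r\<^sup>2) / r ^ ?d" using P by (simp add: \<zeta>_def q_def)
  qed
  note [measurable] = g(1) c(1) borel_measurable_continuous_onI[OF smooth_fun_continuous[OF s\<zeta>]]
    borel_measurable_continuous_onI[OF smooth_fun_continuous[OF \<zeta>'(2)]]
  have mm: "M\<^sup>2 \<le> (M + 1)^2" using M(1) by (intro power_mono) auto
  have I: "(LINT r|radial ?d. g r * (?d * \<zeta> (r\<^sup>2) + 2 * r\<^sup>2 * \<zeta>' (r\<^sup>2))) = - (LINT r|radial ?d. c r * (r * \<zeta> (r\<^sup>2)))"
    by (intro weak_identity_radial_field[OF s\<zeta> \<zeta>', of "M + 1"]) (use M(1) M(2)[OF order_trans[OF mm]] z' in \<open>auto simp: \<zeta>_def\<close>)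
  have dpow: "r ^ (?d - 1) * r = r ^ ?d" for r :: real using DIM_positive[where 'a='a] by (cases "?d") auto
  have e1: "indicator {0<..} r * r ^ (?d - 1) * (g r * (?d * \<zeta> (r\<^sup>2) + 2 * r\<^sup>2 * \<zeta>' (r\<^sup>2))) = indicator {0<..} r * (g r * (2 * r * X' (r\<^sup>2)))" for r
  proof (cases "0 < r")
    case True
    have "r ^ (?d - 1) * (2 * r\<^sup>2 * X' (r\<^sup>2) / r ^ ?d) = 2 * r * X' (r\<^sup>2)"
      using True unfolding dpow[symmetric] by (simp add: power2_eq_square field_simps)
    then have "r ^ (?d - 1) * (g r * (2 * r\<^sup>2 * X' (r\<^sup>2) / r ^ ?d)) = g r * (2 * r * X' (r\<^sup>2))"
      by (simp only: mult.left_commute[of "r ^ (?d - 1)" "g r"])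
    then show ?thesis by (simp only: eq(1)[OF True] mult.assoc[of "indicator {0<..} r"])
  qed simp
  have e2: "indicator {0<..} r * r ^ (?d - 1) * (c r * (r * \<zeta> (r\<^sup>2))) = indicator {0<..} r * (c r * X (r\<^sup>2))" for r
  proof (cases "0 < r")
    case True
    have "r ^ (?d - 1) * (r * (X (r\<^sup>2) / r ^ ?d)) = X (r\<^sup>2)"
      using True unfolding dpow[symmetric] by (simp add: field_simps)
    then have "r ^ (?d - 1) * (c r * (r * (X (r\<^sup>2) / r ^ ?d))) = c r * X (r\<^sup>2)"
      by (simp only: mult.left_commute[of "r ^ (?d - 1)" "c r"])
    then show ?thesis by (simp only: eq(2)[OF True] mult.assoc[of "indicator {0<..} r"])
  qed simp
  have "(LINT r|radial ?d. g r * (?d * \<zeta> (r\<^sup>2) + 2 * r\<^sup>2 * \<zeta>' (r\<^sup>2))) = (LINT r|lborel. indicator {0<..} r * (g r * (2 * r * X' (r\<^sup>2))))"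
    by (subst integral_radial, measurable) (simp only: e1)
  moreover have "(LINT r|radial ?d. c r * (r * \<zeta> (r\<^sup>2))) = (LINT r|lborel. indicator {0<..} r * (c r * X (r\<^sup>2)))"
    by (subst integral_radial, measurable) (simp only: e2)
  ultimately show ?thesis using I by simp
qed

text \<open>The base point is 1 since c need not be integrable down to the origin.\<close>

definition primitive :: "real \<Rightarrow> real" where
  "primitive r = (if 1 \<le> r then LBINT s:{1..r}. c s else - (LBINT s:{r..1}. c s))"

lemma c_radial_L2: "integrable (radial DIM('a)) (\<lambda>r. (c r)^2)"
  using integral_norm_radial(1)[where 'a='a and h = "\<lambda>r. (c r)^2"] c(1,2) by simp

lemma g_radial_L2: "integrable (radial DIM('a)) (\<lambda>r. (g r)^2)"
  using integral_norm_radial(1)[where 'a='a and h = "\<lambda>r. (g r)^2"] g(1,2) by simp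

lemma c_interval: "0 < a \<Longrightarrow> set_integrable lborel {a..b} c"
  using radial_L2_interval(1)[OF c(1) c_radial_L2] .

lemma g_interval: "0 < a \<Longrightarrow> set_integrable lborel {a..b} g"
  using radial_L2_interval(1)[OF g(1) g_radial_L2] .

lemma primitive_diff:
  assumes ab: "0 < a" "a \<le> b"
  shows "primitive b - primitive a = (LBINT r:{a..b}. c r)"
proof -
  consider "1 \<le> a" | "a < 1" "1 \<le> b" | "b < 1" by linarith
  then show ?thesis
  proof cases
    case 1
    then show ?thesis using LBINT_interval_split[OF c_interval, of 1 a b] ab by (simp add: primitive_def)
  next
    case 2
    then show ?thesis using LBINT_interval_split[OF c_interval, of a 1 b] ab by (simp add: primitive_def)
  next
    case 3
    then show ?thesis using LBINT_interval_split[OF c_interval, of a b 1] ab by (simp add: primitive_def)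
  qed
qed

lemma primitive_continuous:
  assumes a: "0 < a"
  shows "continuous_on {a..b} primitive"
proof -
  note i = c_interval[OF a, of b]
  have "c integrable_on {a..b}" using set_borel_integral_eq_integral(1)[OF i] .
  then have "continuous_on {a..b} (\<lambda>x. primitive a + integral {a..x} c)"
    by (intro continuous_intros indefinite_integral_continuous_1)
  moreover have "primitive a + integral {a..x} c = primitive x" if "x \<in> {a..b}" for x
    using primitive_diff[OF a, of x] set_borel_integral_eq_integral(2)[OF c_interval[OF a, of x]] that by simp
  ultimately show ?thesis by (rule continuous_on_eq) blast
qed

lemma primitive_continuous': "continuous_on {0<..} primitive"
proof (rule continuous_at_imp_continuous_on, rule ballI)
  fix x :: real assume "x \<in> {0<..}"
  then show "isCont primitive x"
    using continuous_on_interior[OF primitive_continuous[of "x/2" "x + 1"], of x] by simp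
qed

text \<open>Integration by parts for an absolutely continuous factor, by polarization: the chain
  rule for the squares of primitive + y and primitive - y is subtracted, where y r = X (r^2)
  vanishes at both ends.\<close>

lemma primitive_by_parts:
  assumes X: "\<And>\<rho>. (X has_real_derivative X' \<rho>) (at \<rho>)" "continuous_on UNIV X'"
    and ab: "0 < a" "a \<le> b" "X (a\<^sup>2) = 0" "X (b\<^sup>2) = 0"
  shows "(LBINT r:{a..b}. primitive r * (2 * r * X' (r\<^sup>2)) + c r * X (r\<^sup>2)) = 0"
    and "set_integrable lborel {a..b} (\<lambda>r. primitive r * (2 * r * X' (r\<^sup>2)))"
    and "set_integrable lborel {a..b} (\<lambda>r. c r * X (r\<^sup>2))"
proof -
  define y where "y r = X (r\<^sup>2)" for r :: real
  define y' where "y' r = 2 * r * X' (r\<^sup>2)" for r :: real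
  have Xc: "continuous_on UNIV X" by (intro continuous_at_imp_continuous_on ballI DERIV_isCont[OF X(1)])
  have yd: "(y has_real_derivative y' r) (at r)" for r
  proof -
    have "((\<lambda>r::real. r\<^sup>2) has_real_derivative 2 * r) (at r)" by (auto intro!: derivative_eq_intros)
    from DERIV_chain2[where f = X and g = "\<lambda>r. r\<^sup>2" and x = r, OF X(1) this]
    show ?thesis unfolding y_def y'_def by (simp add: mult.commute)
  qed
  have y'c: "continuous_on UNIV y'" unfolding y'_def
    by (intro continuous_intros continuous_on_compose2[OF X(2)]) auto
  have yc: "continuous_on UNIV y" unfolding y_def by (intro continuous_on_compose2[OF Xc] continuous_intros) auto
  have set_i: "set_integrable lborel {a..b} h" if "continuous_on {a..b} h" for h :: "real \<Rightarrow> real"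
    using borel_integrable_compact[OF _ that] by (simp add: set_integrable_def)
  have y'i: "set_integrable lborel {u..v} y'" for u v
    using borel_integrable_compact[OF _ continuous_on_subset[OF y'c]] by (simp add: set_integrable_def)
  note ci = c_interval[OF ab(1), of b]
  have FTC: "y v - y u = (LBINT r:{u..v}. y' r)" if "u \<le> v" for u v
    using integral_FTC_Icc_real[OF that, of y y'] yd y'c
    by (simp add: set_lebesgue_integral_def mult.commute continuous_on_eq_continuous_at)
  have chain: "(primitive b + s * y b)^2 - (primitive a + s * y a)^2 = (LBINT r:{a..b}. 2 * (primitive r + s * y r) * (c r + s * y' r))" for s
  proof (rule integral_chain_rule[OF ab(2)])
    show "continuous_on {a..b} (\<lambda>r. primitive r + s * y r)"
      by (intro continuous_intros primitive_continuous ab continuous_on_subset[OF yc]) auto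
    show "set_integrable lborel {a..b} (\<lambda>r. c r + s * y' r)" using ci y'i by simp
    show "primitive v + s * y v - (primitive u + s * y u) = (LBINT r:{u..v}. c r + s * y' r)" if "a \<le> u" "u \<le> v" "v \<le> b" for u v
      using primitive_diff[of u v] FTC[of u v] c_interval[of u v] y'i[of u v] that ab by (simp add: distrib_left algebra_simps)
    show "((\<lambda>x. x\<^sup>2) has_real_derivative 2 * x) (at x)" for x :: real by (auto intro!: derivative_eq_intros)
    show "continuous_on UNIV (\<lambda>x::real. 2 * x)" by (intro continuous_intros)
  qed
  have py: "set_integrable lborel {a..b} (\<lambda>r. primitive r * y' r)" "set_integrable lborel {a..b} (\<lambda>r. y r * y' r)"
    by (rule set_i, intro continuous_intros primitive_continuous ab continuous_on_subset[OF y'c] continuous_on_subset[OF yc], auto)+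
  note bc = set_integrable_mult_continuous[OF ci]
  note pc = bc[OF primitive_continuous[OF ab(1)]] and yc' = bc[OF continuous_on_subset[OF yc subset_UNIV]]
  have expand: "(LBINT r:{a..b}. 2 * (primitive r + s * y r) * (c r + s * y' r)) =
      2 * (LBINT r:{a..b}. primitive r * c r) + 2 * s * (LBINT r:{a..b}. primitive r * y' r)
      + 2 * s * (LBINT r:{a..b}. y r * c r) + 2 * s * s * (LBINT r:{a..b}. y r * y' r)" for s
  proof -
    have "(\<lambda>r. 2 * (primitive r + s * y r) * (c r + s * y' r)) = (\<lambda>r. (2 * (primitive r * c r) + 2 * s * (primitive r * y' r))
      + (2 * s * (y r * c r) + 2 * s * s * (y r * y' r)))" by (auto simp: algebra_simps)
    then show ?thesis using py pc yc' by simp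
  qed
  have yab: "y a = 0" "y b = 0" using ab by (auto simp: y_def)
  have "(LBINT r:{a..b}. primitive r * y' r) + (LBINT r:{a..b}. y r * c r) = 0"
    using chain[of 1] chain[of "-1"] unfolding expand yab by simp
  then show "(LBINT r:{a..b}. primitive r * (2 * r * X' (r\<^sup>2)) + c r * X (r\<^sup>2)) = 0"
    using py(1) yc' unfolding y_def y'_def by (simp add: mult.commute[of "c _"])
  show "set_integrable lborel {a..b} (\<lambda>r. primitive r * (2 * r * X' (r\<^sup>2)))" using py(1) unfolding y'_def .
  show "set_integrable lborel {a..b} (\<lambda>r. c r * X (r\<^sup>2))" using yc' unfolding y_def by (simp add: mult.commute)
qed

text \<open>Both g and the primitive of c have weak derivative c, so their difference annihilates
  derivatives of test functions.\<close>

lemma defect_orthogonal: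
  assumes X: "smooth_fun X" "\<And>\<rho>. (X has_real_derivative X' \<rho>) (at \<rho>)" "continuous_on UNIV X'"
    and ab: "0 < a" "a < b" "\<And>\<rho>. \<rho> \<le> a\<^sup>2 \<Longrightarrow> X \<rho> = 0" "\<And>\<rho>. b\<^sup>2 \<le> \<rho> \<Longrightarrow> X \<rho> = 0"
    and X'0: "\<And>\<rho>. \<rho> \<le> a\<^sup>2 \<Longrightarrow> X' \<rho> = 0" "\<And>\<rho>. b\<^sup>2 \<le> \<rho> \<Longrightarrow> X' \<rho> = 0"
  shows "(LBINT r:{a..b}. (g r - primitive r) * (2 * r * X' (r\<^sup>2))) = 0"
    and "set_integrable lborel {a..b} (\<lambda>r. (g r - primitive r) * (2 * r * X' (r\<^sup>2)))"
proof -
  have ab': "a \<le> b" "X (a\<^sup>2) = 0" "X (b\<^sup>2) = 0" using ab by auto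
  note P = primitive_by_parts[OF X(2,3) ab(1) ab']
  have out: "r\<^sup>2 \<le> a\<^sup>2 \<or> b\<^sup>2 \<le> r\<^sup>2" if "0 < r" "r \<notin> {a..b}" for r
    using that ab by (auto simp: not_le intro!: power_mono)
  have e: "indicator {0<..} r * (g r * (2 * r * X' (r\<^sup>2))) = indicator {a..b} r *\<^sub>R (g r * (2 * r * X' (r\<^sup>2)))"
    "indicator {0<..} r * (c r * X (r\<^sup>2)) = indicator {a..b} r *\<^sub>R (c r * X (r\<^sup>2))" for r
    using out[of r] ab X'0 by (auto simp: indicator_def)
  have "(LINT r|lborel. indicator {0<..} r * (g r * (2 * r * X' (r\<^sup>2)))) = - (LINT r|lborel. indicator {0<..} r * (c r * X (r\<^sup>2)))"
    by (rule weak_derivative_radial[OF X(1,2), of "a\<^sup>2" b]) (use ab in auto)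
  then have G: "(LBINT r:{a..b}. g r * (2 * r * X' (r\<^sup>2))) = - (LBINT r:{a..b}. c r * X (r\<^sup>2))"
    unfolding set_lebesgue_integral_def e .
  have "continuous_on {a..b} (\<lambda>r. 2 * r * X' (r\<^sup>2))" by (intro continuous_intros continuous_on_compose2[OF X(3)]) auto
  from set_integrable_mult_continuous[OF g_interval[OF ab(1)] this]
  have gi: "set_integrable lborel {a..b} (\<lambda>r. g r * (2 * r * X' (r\<^sup>2)))" by (simp only: mult.commute)
  have "(LBINT r:{a..b}. primitive r * (2 * r * X' (r\<^sup>2))) = - (LBINT r:{a..b}. c r * X (r\<^sup>2))"
    using P by simp
  then show "(LBINT r:{a..b}. (g r - primitive r) * (2 * r * X' (r\<^sup>2))) = 0"
    using G gi P(2) by (simp add: left_diff_distrib)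
  show "set_integrable lborel {a..b} (\<lambda>r. (g r - primitive r) * (2 * r * X' (r\<^sup>2)))"
    using gi P(2) by (simp add: left_diff_distrib)
qed

text \<open>With \<rho> = r^2 the mass is the total integral of b in \<rho>, and the moment pairs b
  with the defect g - primitive. Constancy of the defect means that the moment is a fixed multiple
  of the mass.\<close>

abbreviation "mass a e b \<equiv> LBINT r:{a..e}. 2 * r * b (r\<^sup>2)"
abbreviation "moment a e b \<equiv> LBINT r:{a..e}. (g r - primitive r) * (2 * r * b (r\<^sup>2))"

text \<open>Du Bois-Reymond: two bumps, scaled to equal mass, differ by the derivative of a test function.\<close>
lemma bump_relation:
  fixes b b0 :: "real \<Rightarrow> real"
  assumes sm: "smooth_fun b" "smooth_fun b0" and ae: "0 < a" "a < e"
    and z: "\<And>\<rho>. \<rho> \<le> a\<^sup>2 \<or> e\<^sup>2 \<le> \<rho> \<Longrightarrow> b \<rho> = 0" "\<And>\<rho>. \<rho> \<le> a\<^sup>2 \<or> e\<^sup>2 \<le> \<rho> \<Longrightarrow> b0 \<rho> = 0"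
  shows "mass a e b0 * moment a e b =
    mass a e b * moment a e b0" (is "?P * ?K = ?N * ?Q")
proof -
  have N: "mass a e h = Fprim h (e\<^sup>2) - Fprim h (a\<^sup>2)" if "smooth_fun h" for h :: "real \<Rightarrow> real"
  proof -
    note hc = smooth_fun_continuous[OF that]
    have d: "((\<lambda>r. Fprim h (r\<^sup>2)) has_real_derivative 2 * r * h (r\<^sup>2)) (at r)" for r
    proof -
      have "((\<lambda>r::real. r\<^sup>2) has_real_derivative 2 * r) (at r)" by (auto intro!: derivative_eq_intros)
      from DERIV_chain2[where f = "Fprim h" and g = "\<lambda>r. r\<^sup>2" and x = r, OF Fprim_DERIV[OF hc] this]
      show ?thesis by (simp add: mult.commute)
    qed
    have "continuous_on UNIV (\<lambda>r. 2 * r * h (r\<^sup>2))" by (intro continuous_intros continuous_on_compose2[OF hc]) auto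
    then show ?thesis using integral_FTC_Icc_real[of a e "\<lambda>r. Fprim h (r\<^sup>2)" "\<lambda>r. 2 * r * h (r\<^sup>2)"] d ae
      by (simp add: set_lebesgue_integral_def mult.commute continuous_on_eq_continuous_at)
  qed
  \<comment> \<open>An antiderivative of the combination of b and b0 that has total mass 0; it
    vanishes at a^2 and therefore also at e^2, which makes it an admissible test function.\<close>
  define X where "X \<rho> = ?P * (Fprim b \<rho> + - Fprim b (a\<^sup>2)) + - ?N * (Fprim b0 \<rho> + - Fprim b0 (a\<^sup>2))" for \<rho>
  define X' where "X' \<rho> = ?P * b \<rho> - ?N * b0 \<rho>" for \<rho>
  note F = Fprim_DERIV[OF smooth_fun_continuous[OF sm(1)]] Fprim_DERIV[OF smooth_fun_continuous[OF sm(2)]]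
  have Xs: "smooth_fun X" unfolding X_def
    by (intro smooth_fun_add smooth_fun_mult smooth_fun_const smooth_fun_antiderivative[OF sm(1) F(1)] smooth_fun_antiderivative[OF sm(2) F(2)])
  have Xd: "(X has_real_derivative X' \<rho>) (at \<rho>)" for \<rho>
    unfolding X_def X'_def by (auto intro!: derivative_eq_intros F)
  have X'c: "continuous_on UNIV X'"
    unfolding X'_def by (intro continuous_intros smooth_fun_continuous sm)
  have flat: "X \<rho> = X \<rho>'" if S: "convex S" "\<rho> \<in> S" "\<rho>' \<in> S" "\<And>\<rho>. \<rho> \<in> S \<Longrightarrow> \<rho> \<le> a\<^sup>2 \<or> e\<^sup>2 \<le> \<rho>" for S \<rho> \<rho>'
  proof -
    have "(X has_field_derivative 0) (at \<rho> within S)" if "\<rho> \<in> S" for \<rho>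
      using has_field_derivative_at_within[OF Xd[of \<rho>]] z[OF S(4)[OF that]] by (simp add: X'_def)
    from has_field_derivative_zero_constant[OF S(1) this] show ?thesis using S(2,3) by auto
  qed
  have Xa: "X (a\<^sup>2) = 0" "X (e\<^sup>2) = 0" unfolding X_def N[OF sm(1)] N[OF sm(2)] by (auto simp: algebra_simps)
  have X0: "X \<rho> = 0" if "\<rho> \<le> a\<^sup>2" for \<rho> using flat[of "{..a\<^sup>2}" \<rho> "a\<^sup>2"] Xa that by simp
  have X1: "X \<rho> = 0" if "e\<^sup>2 \<le> \<rho>" for \<rho> using flat[of "{e\<^sup>2..}" \<rho> "e\<^sup>2"] Xa that by simp
  have i: "set_integrable lborel {a..e} (\<lambda>r. (g r - primitive r) * (2 * r * h (r\<^sup>2)))" if "smooth_fun h" for h :: "real \<Rightarrow> real"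
  proof -
    have hc: "continuous_on {a..e} (\<lambda>r. 2 * r * h (r\<^sup>2))"
      by (intro continuous_intros continuous_on_compose2[OF smooth_fun_continuous[OF that]]) auto
    have "set_integrable lborel {a..e} (\<lambda>r. primitive r * (2 * r * h (r\<^sup>2)))"
      unfolding set_integrable_def
      by (intro borel_integrable_compact continuous_intros hc primitive_continuous ae) auto
    moreover have "set_integrable lborel {a..e} (\<lambda>r. g r * (2 * r * h (r\<^sup>2)))"
      using set_integrable_mult_continuous[OF g_interval[OF ae(1)] hc] by (simp only: mult.commute)
    ultimately show ?thesis by (simp add: left_diff_distrib)
  qed
  have "(LBINT r:{a..e}. (g r - primitive r) * (2 * r * X' (r\<^sup>2))) = 0"
    by (rule defect_orthogonal(1)[OF Xs Xd X'c ae X0 X1]) (use z in \<open>auto simp: X'_def\<close>)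
  moreover have "(\<lambda>r. (g r - primitive r) * (2 * r * X' (r\<^sup>2))) =
      (\<lambda>r. ?P * ((g r - primitive r) * (2 * r * b (r\<^sup>2))) - ?N * ((g r - primitive r) * (2 * r * b0 (r\<^sup>2))))"
    by (auto simp: X'_def algebra_simps)
  ultimately have "(LBINT r:{a..e}. ?P * ((g r - primitive r) * (2 * r * b (r\<^sup>2))) - ?N * ((g r - primitive r) * (2 * r * b0 (r\<^sup>2)))) = 0" by simp
  then show ?thesis using i[OF sm(1)] i[OF sm(2)] by (subst (asm) set_integral_diff(2)) auto
qed

definition bump :: "real \<Rightarrow> real \<Rightarrow> nat \<Rightarrow> real \<Rightarrow> real" where
  "bump \<alpha> \<beta> n \<rho> = ramp (real n * (\<rho> - \<alpha>)) * ramp (real n * (\<beta> - \<rho>))"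

lemma bump_facts:
  "smooth_fun (bump \<alpha> \<beta> n)" "\<rho> \<le> \<alpha> \<or> \<beta> \<le> \<rho> \<Longrightarrow> bump \<alpha> \<beta> n \<rho> = 0" "0 \<le> bump \<alpha> \<beta> n \<rho>" "bump \<alpha> \<beta> n \<rho> \<le> 1"
  "(\<lambda>n. bump \<alpha> \<beta> n \<rho>) \<longlonglongrightarrow> indicator {\<alpha><..<\<beta>} \<rho>"
proof -
  have "(\<lambda>\<rho>. real n * (\<rho> - \<alpha>)) = (\<lambda>\<rho>. real n * \<rho> + - (real n * \<alpha>))" "(\<lambda>\<rho>. real n * (\<beta> - \<rho>)) = (\<lambda>\<rho>. - real n * \<rho> + real n * \<beta>)"
    by (auto simp: algebra_simps)
  then have "smooth_fun (\<lambda>\<rho>. real n * (\<rho> - \<alpha>))" "smooth_fun (\<lambda>\<rho>. real n * (\<beta> - \<rho>))"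
    by (simp_all only:) (intro smooth_fun_add smooth_fun_mult smooth_fun_const smooth_fun_id)+
  then show "smooth_fun (bump \<alpha> \<beta> n)"
    unfolding bump_def[abs_def] by (rule smooth_fun_mult[OF smooth_fun_compose[OF smooth_ramp] smooth_fun_compose[OF smooth_ramp]])
  show "\<rho> \<le> \<alpha> \<or> \<beta> \<le> \<rho> \<Longrightarrow> bump \<alpha> \<beta> n \<rho> = 0" by (auto simp: bump_def ramp_eq mult_nonneg_nonpos)
  show "0 \<le> bump \<alpha> \<beta> n \<rho>" "bump \<alpha> \<beta> n \<rho> \<le> 1" by (auto simp: bump_def ramp_bounds intro!: mult_le_one)
  have "(\<lambda>n. bump \<alpha> \<beta> n \<rho>) \<longlonglongrightarrow> indicator {0<..} (\<rho> - \<alpha>) * indicator {0<..} (\<beta> - \<rho>)"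
    unfolding bump_def by (intro tendsto_intros ramp_scaled_tendsto)
  moreover have "indicator {0<..} (\<rho> - \<alpha>) * indicator {0<..} (\<beta> - \<rho>) = (indicator {\<alpha><..<\<beta>} \<rho> :: real)" by (simp add: indicator_def)
  ultimately show "(\<lambda>n. bump \<alpha> \<beta> n \<rho>) \<longlonglongrightarrow> indicator {\<alpha><..<\<beta>} \<rho>" by simp
qed

lemma bump_mass_pos: "0 < mass 1 2 (bump 1 4 1)"
proof -
  have c: "continuous_on UNIV (\<lambda>r. 2 * r * bump 1 4 1 (r\<^sup>2))"
    by (intro continuous_intros continuous_on_compose2[OF smooth_fun_continuous[OF bump_facts(1)]]) auto
  have c': "continuous_on {1..2} (\<lambda>r. 2 * r * bump 1 4 1 (r\<^sup>2))" by (rule continuous_on_subset[OF c]) simp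
  have i: "set_integrable lborel {1..2::real} (\<lambda>r. 2 * r * bump 1 4 1 (r\<^sup>2))"
    unfolding set_integrable_def by (intro borel_integrable_compact c') simp
  have nn: "0 \<le> 2 * r * bump 1 4 1 (r\<^sup>2)" if "r \<in> {1..2}" for r :: real using that bump_facts(3) by simp
  have "integral {1..2} (\<lambda>r::real. 2 * r * bump 1 4 1 (r\<^sup>2)) \<noteq> 0"
  proof
    assume "integral {1..2} (\<lambda>r::real. 2 * r * bump 1 4 1 (r\<^sup>2)) = 0"
    moreover have "(\<lambda>r::real. 2 * r * bump 1 4 1 (r\<^sup>2)) integrable_on {1..2}" using set_borel_integral_eq_integral(1)[OF i] .
    ultimately have h: "((\<lambda>r::real. 2 * r * bump 1 4 1 (r\<^sup>2)) has_integral 0) (cbox 1 2)" by (simp add: has_integral_iff)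
    have "2 * (3/2) * bump 1 4 1 ((3/2)^2) = (0::real)"
      by (rule has_integral_0_cbox_imp_0[OF _ _ h]) (use c' nn in \<open>auto simp: box_real\<close>)
    then show False by (simp add: bump_def ramp_eq power2_eq_square)
  qed
  moreover have "0 \<le> integral {1..2} (\<lambda>r::real. 2 * r * bump 1 4 1 (r\<^sup>2))" by (rule Henstock_Kurzweil_Integration.integral_nonneg) (use set_borel_integral_eq_integral(1)[OF i] nn in auto)
  ultimately show ?thesis using set_borel_integral_eq_integral(2)[OF i] by simp
qed

text \<open>By the relation between moments and masses the defect g - primitive acts on all bumps as
  one constant; letting bumps tend to indicators of intervals identifies the defect with this
  constant almost everywhere.\<close>

theorem averages_form_profile: "\<exists>g0. profile DIM('a) g0 c \<and> (AE r in radial DIM('a). g r = g0 r)"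
proof -
  \<comment> \<open>The constant is read off from a reference bump supported in 1 \<le> r \<le>
    2.\<close>
  define C where "C = moment 1 2 (bump 1 4 1) / mass 1 2 (bump 1 4 1)"
  define h where "h r = g r - indicator {0<..} r *\<^sub>R primitive r" for r
  have hm[measurable]: "h \<in> borel_measurable borel"
    unfolding h_def using g(1) borel_measurable_continuous_on_indicator[OF _ primitive_continuous'] by (intro borel_measurable_diff) auto
  have hi: "set_integrable lborel {a..b} h" if "0 < a" for a b
  proof -
    have "set_integrable lborel {a..b} (\<lambda>r. g r - primitive r)"
      using g_interval[OF that, of b] borel_integrable_compact[OF _ primitive_continuous[OF that]]
      by (simp add: set_integrable_def right_diff_distrib)
    then show ?thesis by (rule set_integrable_cong[THEN iffD1, rotated 3]) (use that in \<open>auto simp: h_def\<close>)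
  qed
  \<comment> \<open>The interval [a, e] is chosen to contain both [s, t] and the support [1, 2] of
    the reference bump, since the relation compares bumps on one common interval.\<close>
  have rel: "(LBINT r:{a..e}. h r * (2 * r * bump (s\<^sup>2) (t\<^sup>2) n (r\<^sup>2))) = C * mass a e (bump (s\<^sup>2) (t\<^sup>2) n)"
    if "0 < s" "s \<le> t" "a = min s 1" "e = max t 2" for s t a e n
  proof -
    have ae: "0 < a" "a < e" "a \<le> s" "t \<le> e" "a \<le> 1" "2 \<le> e" using that by auto
    have sq: "a\<^sup>2 \<le> s\<^sup>2" "t\<^sup>2 \<le> e\<^sup>2" "a\<^sup>2 \<le> 1" "4 \<le> e\<^sup>2"
      using power_mono[OF ae(3), of 2] power_mono[OF ae(4), of 2] power_mono[OF ae(5), of 2] power_mono[OF ae(6), of 2] ae that by auto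
    have z0: "indicator {a..e} r *\<^sub>R (q * (2 * r * bump 1 4 1 (r\<^sup>2))) = indicator {1..2} r *\<^sub>R (q * (2 * r * bump 1 4 1 (r\<^sup>2)))" for r q :: real
    proof (cases "1 \<le> r \<and> r \<le> 2 \<or> r \<notin> {a..e}")
      case False
      then have "0 < r" "r < 1 \<or> 2 < r" using ae by auto
      then have "r\<^sup>2 \<le> 1 \<or> 4 \<le> r\<^sup>2" using power_mono[of r 1 2] power_mono[of 2 r 2] by auto
      then show ?thesis using bump_facts(2)[of "r\<^sup>2" 1 4 1] by simp
    qed (use ae in \<open>auto simp: indicator_def\<close>)
    have K0: "moment a e (bump 1 4 1) = moment 1 2 (bump 1 4 1)"
      "mass a e (bump 1 4 1) = mass 1 2 (bump 1 4 1)"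
      unfolding set_lebesgue_integral_def using z0[of _ 1] by (simp_all only: z0 mult_1)
    have "(LBINT r:{a..e}. h r * (2 * r * bump (s\<^sup>2) (t\<^sup>2) n (r\<^sup>2))) = moment a e (bump (s\<^sup>2) (t\<^sup>2) n)"
      by (rule set_lebesgue_integral_cong) (use ae in \<open>auto simp: h_def\<close>)
    moreover have "mass a e (bump 1 4 1) * moment a e (bump (s\<^sup>2) (t\<^sup>2) n) =
        mass a e (bump (s\<^sup>2) (t\<^sup>2) n) * moment a e (bump 1 4 1)"
      by (rule bump_relation[OF bump_facts(1) bump_facts(1) ae(1,2)]) (rule bump_facts(2); use sq in auto)+
    ultimately show ?thesis unfolding K0 C_def using bump_mass_pos by (simp add: field_simps)
  qed
  have ci: "set_integrable lborel {a..b} (\<lambda>r. 2 * r * (h r - C))" if "0 < a" for a b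
  proof (rule set_integrable_mult_continuous)
    have "set_integrable lborel {a..b} (\<lambda>_. C)" unfolding set_integrable_def by (intro borel_integrable_compact) auto
    then show "set_integrable lborel {a..b} (\<lambda>r. h r - C)" by (rule set_integral_diff(1)[OF hi[OF that]])
  qed (auto intro!: continuous_intros)
  have "AE r in radial DIM('a). 2 * r * (h r - C) = 0"
  proof (rule AE_radial_zero_if_interval_integrals_zero)
    fix s t :: real assume st: "0 < s" "s \<le> t"
    define a e where "a = min s 1" and "e = max t 2"
    have a: "0 < a" "a \<le> s" "t \<le> e" using st by (auto simp: a_def e_def)
    let ?b = "\<lambda>n r. bump (s\<^sup>2) (t\<^sup>2) n (r\<^sup>2)"
    have bm[measurable]: "(\<lambda>r. ?b n r) \<in> borel_measurable borel" for n
      by (intro borel_measurable_continuous_onI continuous_on_compose2[OF smooth_fun_continuous[OF bump_facts(1)]] continuous_intros) auto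
    have bi: "set_integrable lborel {a..e} (\<lambda>r. ?b n r * k r)" if "set_integrable lborel {a..e} k" for n k
      by (rule set_integrable_mult_continuous[OF that]) (intro continuous_on_compose2[OF smooth_fun_continuous[OF bump_facts(1)]] continuous_intros; simp)
    have "(\<lambda>n. LBINT r:{a..e}. 2 * r * (h r - C) * ?b n r) \<longlonglongrightarrow> (LBINT r:{a..e}. 2 * r * (h r - C) * indicator {s\<^sup>2<..<t\<^sup>2} (r\<^sup>2))"
      unfolding set_lebesgue_integral_def
    proof (rule integral_dominated_convergence)
      show "integrable lborel (\<lambda>r. norm (indicator {a..e} r *\<^sub>R (2 * r * (h r - C))))"
        using ci[OF a(1), of e] unfolding set_integrable_def by (rule integrable_norm)
      show "AE r in lborel. (\<lambda>n. indicator {a..e} r *\<^sub>R (2 * r * (h r - C) * ?b n r)) \<longlonglongrightarrow> indicator {a..e} r *\<^sub>R (2 * r * (h r - C) * indicator {s\<^sup>2<..<t\<^sup>2} (r\<^sup>2))"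
        by (intro AE_I2 tendsto_intros bump_facts(5))
      show "AE r in lborel. norm (indicator {a..e} r *\<^sub>R (2 * r * (h r - C) * ?b n r)) \<le> norm (indicator {a..e} r *\<^sub>R (2 * r * (h r - C)))" for n
      proof (rule AE_I2)
        fix r
        have "\<bar>indicator {a..e} r *\<^sub>R (2 * r * (h r - C))\<bar> * ?b n r \<le> \<bar>indicator {a..e} r *\<^sub>R (2 * r * (h r - C))\<bar> * 1"
          by (rule mult_left_mono) (auto simp: bump_facts)
        then show "norm (indicator {a..e} r *\<^sub>R (2 * r * (h r - C) * ?b n r)) \<le> norm (indicator {a..e} r *\<^sub>R (2 * r * (h r - C)))"
          using bump_facts(3)[of "s\<^sup>2" "t\<^sup>2" n "r\<^sup>2"] by (simp add: abs_mult)
      qed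
    qed measurable
    moreover have "(LBINT r:{a..e}. 2 * r * (h r - C) * ?b n r) = 0" for n
    proof -
      have "continuous_on {a..e} (\<lambda>r. 2 * r * C)" by (intro continuous_intros)
      then have "set_integrable lborel {a..e} (\<lambda>r. 2 * r * h r)" "set_integrable lborel {a..e} (\<lambda>r. 2 * r * C)"
        using set_integrable_mult_continuous[OF hi[OF a(1)], of e "\<lambda>r. 2 * r"] borel_integrable_compact[of "{a..e}" "\<lambda>r. 2 * r * C"]
        by (auto intro!: continuous_intros simp: set_integrable_def)
      then have "set_integrable lborel {a..e} (\<lambda>r. ?b n r * (2 * r * h r))" "set_integrable lborel {a..e} (\<lambda>r. ?b n r * (2 * r * C))"
        by (auto intro!: bi)
      then have I: "set_integrable lborel {a..e} (\<lambda>r. h r * (2 * r * ?b n r))" "set_integrable lborel {a..e} (\<lambda>r. C * (2 * r * ?b n r))"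
        by (simp_all only: mult_ac)
      have "(LBINT r:{a..e}. 2 * r * (h r - C) * ?b n r) = (LBINT r:{a..e}. h r * (2 * r * ?b n r) - C * (2 * r * ?b n r))"
        by (rule set_lebesgue_integral_cong) (auto simp: algebra_simps)
      also have "\<dots> = (LBINT r:{a..e}. h r * (2 * r * ?b n r)) - (LBINT r:{a..e}. C * (2 * r * ?b n r))"
        by (rule set_integral_diff(2)[OF I])
      also have "\<dots> = 0" using rel[OF st a_def e_def, of n] by simp
      finally show ?thesis .
    qed
    ultimately have "(LBINT r:{a..e}. 2 * r * (h r - C) * indicator {s\<^sup>2<..<t\<^sup>2} (r\<^sup>2)) = 0" by (simp add: LIMSEQ_const_iff)
    moreover have "(LBINT r:{s..t}. 2 * r * (h r - C)) = (LBINT r:{a..e}. 2 * r * (h r - C) * indicator {s\<^sup>2<..<t\<^sup>2} (r\<^sup>2))"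
      unfolding set_lebesgue_integral_def
    proof (rule integral_cong_AE)
      show "AE r in lborel. indicator {s..t} r *\<^sub>R (2 * r * (h r - C)) = indicator {a..e} r *\<^sub>R (2 * r * (h r - C) * indicator {s\<^sup>2<..<t\<^sup>2} (r\<^sup>2))"
        using AE_lborel_singleton[of s] AE_lborel_singleton[of t]
      proof eventually_elim
        case (elim r)
        show ?case
        proof (cases "r \<in> {a..e}")
          case True
          then have "s\<^sup>2 < r\<^sup>2 \<longleftrightarrow> s < r" "r\<^sup>2 < t\<^sup>2 \<longleftrightarrow> r < t" using a st power_mono_iff[of r s 2] power_mono_iff[of t r 2] by (auto simp: not_le[symmetric])
          then show ?thesis using elim True by (auto simp: indicator_def)
        qed (use a in \<open>auto simp: indicator_def\<close>)
      qed
    qed measurable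
    ultimately show "(LBINT r:{s..t}. 2 * r * (h r - C)) = 0" by simp
  qed (use ci in auto)
  then have AE: "AE r in radial DIM('a). g r = indicator {0<..} r *\<^sub>R primitive r + C"
    unfolding AE_radial by eventually_elim (auto simp: h_def)
  define g0 where "g0 r = indicator {0<..} r *\<^sub>R primitive r + C" for r
  have m: "g0 \<in> borel_measurable borel"
    unfolding g0_def using borel_measurable_continuous_on_indicator[OF _ primitive_continuous'] by (intro borel_measurable_add) auto
  have "integrable (radial DIM('a)) (\<lambda>r. (g0 r)^2)"
  proof (rule integrable_cong_AE_imp[OF g_radial_L2])
    show "(\<lambda>r. (g0 r)^2) \<in> borel_measurable (radial DIM('a))" using m by simp
    show "AE r in radial DIM('a). (g r)^2 = (g0 r)^2" using AE by eventually_elim (simp add: g0_def)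
  qed
  moreover have "g0 e - g0 a = (LBINT r:{a..e}. c r)" if "0 < a" "a \<le> e" for a e
    using primitive_diff[OF that] that by (simp add: g0_def)
  ultimately have "profile DIM('a) g0 c" using m c(1) c_radial_L2 by (simp add: profile_def)
  then show ?thesis using AE unfolding g0_def by blast
qed

end

section \<open>Weak gradients of radial functions\<close>

lemma integral_indicator_tail:
  fixes s t q :: real
  assumes "s \<le> t"
  shows "(LINT r|lborel. indicator {s..t} r * indicator {q<..} r) = t - max s (min t q)"
proof (cases "q < s")
  case True
  then have "(\<lambda>r. indicator {s..t} r * indicator {q<..} r) = (indicator {s..t} :: real \<Rightarrow> real)" by (auto simp: indicator_def fun_eq_iff)
  then show ?thesis using True assms by simp
next
  case False
  then have "(\<lambda>r. indicator {s..t} r * indicator {q<..} r) = (indicator {q<..t} :: real \<Rightarrow> real)" by (auto simp: indicator_def fun_eq_iff)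
  then show ?thesis using False assms by (cases "q \<le> t") auto
qed

lemma AE_norm_neq: "AE x in lborel. norm (x::'a::euclidean_space) \<noteq> s"
proof (rule AE_norm_radial)
  show "AE r in radial DIM('a). r \<noteq> s"
    unfolding AE_radial using AE_lborel_singleton[of s] by eventually_elim auto
qed

lemma has_derivative_nhds_cong:
  assumes "(h has_derivative h') (at x)" "\<forall>\<^sub>F y in nhds x. h y = k y"
  shows "(k has_derivative h') (at x)"
  by (rule has_derivative_transform_eventually[OF assms(1)])
     (use assms(2) in \<open>auto simp: eventually_at_filter elim: eventually_mono dest: eventually_nhds_x_imp_x\<close>)

context
  fixes \<phi> :: "'a::euclidean_space \<Rightarrow> real" and D :: "'a \<Rightarrow> 'a" and i :: 'a
  assumes test: "test_fun \<phi>" and der: "\<And>x. has_gradient \<phi> (D x) x" and i: "i \<in> Basis"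
begin

text \<open>The flux of \<open>\<phi> i\<close> through the sphere of radius \<open>r\<close>, written as a volume integral.\<close>
definition ball_flux :: "real \<Rightarrow> real" where
  "ball_flux r = (LINT x|lborel. indicator {norm x<..} r * (D x \<bullet> i))"

lemma direction_component_le: "\<bar>(x \<bullet> i) / norm x\<bar> \<le> 1"
  using Basis_le_norm[OF i, of x] by (cases "x = 0") (auto simp: abs_divide divide_le_eq)

text \<open>Controls the iterated absolute integral when Fubini is applied to
  \<open>ball_flux\<close>.\<close>

definition abs_flux :: "real \<Rightarrow> real" where
  "abs_flux r = (LINT x|lborel. indicator {norm x<..} r * \<bar>D x \<bullet> i\<bar>)"

lemma test_gradient_facts:
  obtains R B where "0 < R" "0 < B" "\<And>x. R \<le> norm x \<Longrightarrow> \<phi> x = 0" "\<And>x. R \<le> norm x \<Longrightarrow> D x = 0"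
    "\<And>x. \<bar>\<phi> x\<bar> \<le> B" "\<And>x. \<bar>D x \<bullet> i\<bar> \<le> B" "\<And>x y. \<bar>\<phi> x - \<phi> y\<bar> \<le> B * norm (x - y)"
proof -
  obtain R B where *: "0 < R" "0 < B" "\<And>x. R \<le> norm x \<Longrightarrow> \<phi> x = 0" "\<And>x. R \<le> norm x \<Longrightarrow> D x = 0"
    "\<And>x. \<bar>\<phi> x\<bar> \<le> B" "\<And>x. norm (D x) \<le> B" "\<And>x y. \<bar>\<phi> x - \<phi> y\<bar> \<le> B * norm (x - y)"
    using test_fun_bounds[OF test der] by blast
  have "\<bar>D x \<bullet> i\<bar> \<le> B" for x using Basis_le_norm[OF i, of "D x"] *(6)[of x] by linarith
  then show ?thesis using that[OF *(1-5) _ *(7)] by blast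
qed

lemma test_measurable [measurable]: "\<phi> \<in> borel_measurable borel" "D \<in> borel_measurable borel"
  using test smooth_fun_continuous smooth_fun_gradient_unique(2)[OF _ der] unfolding test_fun_def
  by (auto intro: borel_measurable_continuous_onI)

lemma test_snd_measurable [measurable]: "(\<lambda>p. D (snd p) \<bullet> i) \<in> borel_measurable (M \<Otimes>\<^sub>M lborel)"
  by (rule measurable_compose[OF measurable_snd]) simp

lemma test_component_integrable: "integrable lborel (\<lambda>x. D x \<bullet> i)" "integrable lborel (\<lambda>x. (\<phi> x)^2)" "integrable lborel (\<lambda>x. (D x \<bullet> i)^2)"
proof -
  obtain R B where b: "0 < R" "0 < B" "\<And>x. R \<le> norm x \<Longrightarrow> \<phi> x = 0" "\<And>x. R \<le> norm x \<Longrightarrow> D x = 0"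
    "\<And>x. \<bar>\<phi> x\<bar> \<le> B" "\<And>x. \<bar>D x \<bullet> i\<bar> \<le> B" "\<And>x y. \<bar>\<phi> x - \<phi> y\<bar> \<le> B * norm (x - y)" using test_gradient_facts by blast
  have s: "smooth_fun \<phi>" using test by (simp add: test_fun_def)
  have "continuous_on UNIV (\<lambda>x. D x \<bullet> i)" by (intro continuous_intros smooth_fun_gradient_unique(2)[OF s der])
  from continuous_compact_support_square_integrable[OF this, of R] continuous_compact_support_square_integrable[OF smooth_fun_continuous[OF s], of R]
  show "integrable lborel (\<lambda>x. D x \<bullet> i)" "integrable lborel (\<lambda>x. (\<phi> x)^2)" "integrable lborel (\<lambda>x. (D x \<bullet> i)^2)" using b(3,4) by auto
qed

lemma test_component_integral_zero: "(LINT x|lborel. D x \<bullet> i) = 0"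
proof -
  obtain R B where b: "0 < R" "0 < B" "\<And>x. R \<le> norm x \<Longrightarrow> \<phi> x = 0" "\<And>x. R \<le> norm x \<Longrightarrow> D x = 0"
    "\<And>x. \<bar>\<phi> x\<bar> \<le> B" "\<And>x. \<bar>D x \<bullet> i\<bar> \<le> B" "\<And>x y. \<bar>\<phi> x - \<phi> y\<bar> \<le> B * norm (x - y)" using test_gradient_facts by blast
  show ?thesis
  proof (rule integral_directional_derivative_zero[where R = R and v = i, OF b(7) b(3)])
    show "AE x in lborel. (\<lambda>n. (\<phi> (x + (1 / real (Suc n)) *\<^sub>R i) - \<phi> x) * real (Suc n)) \<longlonglongrightarrow> D x \<bullet> i"
      by (intro AE_I2 difference_quotient_tendsto[OF der])
  qed auto
qed

lemma flux_measurable [measurable]: "ball_flux \<in> borel_measurable borel" "abs_flux \<in> borel_measurable borel"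
  unfolding ball_flux_def abs_flux_def indicator_def greaterThan_iff by measurable

lemma ball_flux_Fubini:
  assumes w[measurable]: "w \<in> borel_measurable borel"
    and wi: "integrable lborel (\<lambda>r. w r * abs_flux r)"
  shows "(LINT r|lborel. w r * ball_flux r) = (LINT x|lborel. (D x \<bullet> i) * (LINT r|lborel. w r * indicator {norm x<..} r))"
    and "integrable lborel (\<lambda>x. (D x \<bullet> i) * (LINT r|lborel. w r * indicator {norm x<..} r))"
proof -
  define F where "F r x = w r * (indicator {norm x<..} r * (D x \<bullet> i))" for r x
  have [measurable]: "(\<lambda>p. F (fst p) (snd p)) \<in> borel_measurable (lborel \<Otimes>\<^sub>M lborel)"
    unfolding F_def indicator_def greaterThan_iff by measurable
  have m: "case_prod F \<in> borel_measurable (lborel \<Otimes>\<^sub>M lborel)" unfolding split_beta' by measurable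
  have ii: "integrable lborel (\<lambda>x. indicator {norm x<..} r * (D x \<bullet> i))" for r
    by (rule integrable_bound[OF test_component_integrable(1)]) (auto simp: indicator_def)
  have FI: "integrable (lborel \<Otimes>\<^sub>M lborel) (case_prod F)"
  proof (rule lborel_pair.Fubini_integrable[OF m])
    have "(LINT x|lborel. norm (case_prod F (r, x))) = \<bar>w r * abs_flux r\<bar>" for r
    proof -
      have "(LINT x|lborel. norm (case_prod F (r, x))) = (LINT x|lborel. \<bar>w r\<bar> * (indicator {norm (x::'a)<..} r * \<bar>D x \<bullet> i\<bar>))"
        by (rule integral_cong) (auto simp: F_def abs_mult)
      then show ?thesis by (simp add: abs_mult abs_flux_def)
    qed
    then show "integrable lborel (\<lambda>r. LINT x|lborel. norm (case_prod F (r, x)))" using wi by simp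
    show "AE r in lborel. integrable lborel (\<lambda>x. case_prod F (r, x))" using ii by (auto simp: F_def)
  qed
  have inner: "(LINT r|lborel. F r x) = (D x \<bullet> i) * (LINT r|lborel. w r * indicator {norm x<..} r)" for x
  proof -
    have "(\<lambda>r. F r x) = (\<lambda>r. (D x \<bullet> i) * (w r * indicator {norm x<..} r))" by (auto simp: F_def)
    then show ?thesis by simp
  qed
  show "(LINT r|lborel. w r * ball_flux r) = (LINT x|lborel. (D x \<bullet> i) * (LINT r|lborel. w r * indicator {norm x<..} r))"
    using lborel_pair.Fubini_integral[OF FI] unfolding inner by (simp add: F_def ball_flux_def)
  show "integrable lborel (\<lambda>x. (D x \<bullet> i) * (LINT r|lborel. w r * indicator {norm x<..} r))"
    using lborel_pair.integrable_snd[OF FI] unfolding inner .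
qed

text \<open>The bound by r^d matters near the origin: there c is controlled only with the weight
  r^(d-1), which the volume of the ball supplies. The constant bound serves on intervals away from
  0.\<close>

lemma ball_flux_abs_bound:
  obtains K where "\<And>r. 0 \<le> r \<Longrightarrow> \<bar>abs_flux r\<bar> \<le> K * r ^ DIM('a)"
    "\<And>r. \<bar>abs_flux r\<bar> \<le> K"
proof -
  obtain R B where b: "0 < R" "0 < B" "\<And>x. R \<le> norm x \<Longrightarrow> \<phi> x = 0" "\<And>x. R \<le> norm x \<Longrightarrow> D x = 0"
    "\<And>x. \<bar>\<phi> x\<bar> \<le> B" "\<And>x. \<bar>D x \<bullet> i\<bar> \<le> B" "\<And>x y. \<bar>\<phi> x - \<phi> y\<bar> \<le> B * norm (x - y)" using test_gradient_facts by blast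
  define K where "K = max (B * unit_ball_vol DIM('a)) (LINT x|lborel. \<bar>D x \<bullet> i\<bar>)"
  have nn: "0 \<le> abs_flux r" for r
    unfolding abs_flux_def by (rule integral_nonneg) simp
  have ai: "integrable lborel (\<lambda>x. \<bar>D x \<bullet> i\<bar>)" using test_component_integrable(1) by simp
  have ii: "integrable lborel (\<lambda>x. indicator {norm x<..} r * \<bar>D x \<bullet> i\<bar>)" for r
    by (rule integrable_bound[OF test_component_integrable(1)]) (auto simp: indicator_def)
  show ?thesis
  proof
    fix r :: real
    have "abs_flux r \<le> (LINT x|lborel. \<bar>D x \<bullet> i\<bar>)"
      unfolding abs_flux_def by (rule integral_mono[OF ii ai]) (auto simp: indicator_def)
    then show "\<bar>abs_flux r\<bar> \<le> K" using nn[of r] by (simp add: K_def)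
    assume r: "0 \<le> r"
    have "abs_flux r \<le> (LINT x|lborel. B * indicator (ball (0::'a) r) x)"
      using b(2,6) emeasure_bounded_finite[OF bounded_ball]
      unfolding abs_flux_def
      by (intro integral_mono[OF ii] integrable_mult_right integrable_real_indicator) (auto simp: indicator_def)
    also have "\<dots> = B * unit_ball_vol DIM('a) * r ^ DIM('a)" using r by (simp add: content_ball)
    also have "\<dots> \<le> K * r ^ DIM('a)" using r by (intro mult_right_mono) (auto simp: K_def)
    finally show "\<bar>abs_flux r\<bar> \<le> K * r ^ DIM('a)" using nn[of r] by simp
  qed
qed

text \<open>The divergence theorem on balls, integrated over the radius so that no surface measure
  is needed: \<phi> times a Lipschitz cutoff of the norm has directional derivatives of integral
  0.\<close>

lemma ball_flux_shell:
  assumes st: "0 < s" "s \<le> t"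
  shows "(LBINT r:{s..t}. ball_flux r) = (LINT x|lborel. \<phi> x * (x \<bullet> i) / norm x * indicator {s<..<t} (norm x))"
    and "set_integrable lborel {s..t} ball_flux"
proof -
  obtain K where K0: "\<And>r. 0 \<le> r \<Longrightarrow> \<bar>abs_flux r\<bar> \<le> K * r ^ DIM('a)"
    and K: "\<And>r. \<bar>abs_flux r\<bar> \<le> K"
    using ball_flux_abs_bound by blast
  have Ki: "integrable lborel (\<lambda>r. K * indicator {s..t} r)"
    by (intro integrable_mult_right integrable_real_indicator) (auto simp: emeasure_lborel_Icc_eq)
  have wi: "integrable lborel (\<lambda>r. indicator {s..t} r * abs_flux r)"
    by (rule integrable_bound[OF Ki]) (use order_trans[OF K abs_ge_self[of K]] in \<open>auto simp: indicator_def\<close>)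
  \<comment> \<open>The integral over r in [s, t] of the indicator of q < r. As a function of the
    norm it is constant inside the shell's inner sphere, falls with slope -1 across the shell and is
    0 outside, so its gradient is minus the radial unit field on the shell.\<close>
  define L where "L q = t - max s (min t q)" for q
  have FI: "(LINT r|lborel. indicator {s..t} r * ball_flux r) = (LINT x|lborel. (D x \<bullet> i) * L (norm x))"
    "integrable lborel (\<lambda>x. (D x \<bullet> i) * L (norm x))"
    using ball_flux_Fubini[OF _ wi] unfolding integral_indicator_tail[OF st(2)] L_def by auto
  obtain R B where b: "0 < R" "0 < B" "\<And>x. R \<le> norm x \<Longrightarrow> \<phi> x = 0" "\<And>x. R \<le> norm x \<Longrightarrow> D x = 0"
    "\<And>x. \<bar>\<phi> x\<bar> \<le> B" "\<And>x. \<bar>D x \<bullet> i\<bar> \<le> B" "\<And>x y. \<bar>\<phi> x - \<phi> y\<bar> \<le> B * norm (x - y)" using test_gradient_facts by blast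
  define Q where "Q x = \<phi> x * (x \<bullet> i) / norm x * indicator {s<..<t} (norm x)" for x
  have Lb: "0 \<le> L q" "L q \<le> t - s" "\<bar>L q - L q'\<bar> \<le> \<bar>q - q'\<bar>" for q q' using st by (auto simp: L_def)
  have "(LINT x|lborel. (D x \<bullet> i) * L (norm x) - Q x) = 0"
  proof (rule integral_directional_derivative_zero[where \<psi> = "\<lambda>x. \<phi> x * L (norm x)" and R = R and v = i and L = "B * (t - s) + B"])
    fix x y :: 'a
    have "\<bar>\<phi> x * L (norm x) - \<phi> y * L (norm y)\<bar> = \<bar>(\<phi> x - \<phi> y) * L (norm x) + \<phi> y * (L (norm x) - L (norm y))\<bar>" by (simp add: algebra_simps)
    also have "\<dots> \<le> \<bar>\<phi> x - \<phi> y\<bar> * L (norm x) + \<bar>\<phi> y\<bar> * \<bar>L (norm x) - L (norm y)\<bar>"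
      using Lb(1)[of "norm x"] by (metis abs_mult abs_of_nonneg abs_triangle_ineq)
    also have "\<dots> \<le> (B * norm (x - y)) * (t - s) + B * norm (x - y)"
    proof (intro add_mono mult_mono)
      show "\<bar>L (norm x) - L (norm y)\<bar> \<le> norm (x - y)"
        by (rule order_trans[OF Lb(3) norm_triangle_ineq3])
    qed (use b Lb in auto)
    finally show "\<bar>\<phi> x * L (norm x) - \<phi> y * L (norm y)\<bar> \<le> (B * (t - s) + B) * norm (x - y)" by (simp add: algebra_simps)
  next
    show "\<phi> x * L (norm x) = 0" if "R \<le> norm x" for x using b(3)[OF that] by simp
    show "(\<lambda>x. (D x \<bullet> i) * L (norm x) - Q x) \<in> borel_measurable borel"
      unfolding L_def Q_def by measurable
    show "AE x in lborel. (\<lambda>n. (\<phi> (x + (1 / real (Suc n)) *\<^sub>R i) * L (norm (x + (1 / real (Suc n)) *\<^sub>R i)) - \<phi> x * L (norm x)) * real (Suc n))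
        \<longlonglongrightarrow> (D x \<bullet> i) * L (norm x) - Q x"
      using AE_norm_neq[of s] AE_norm_neq[of t]
    proof eventually_elim
      case (elim x)
      have cn: "\<forall>\<^sub>F y in nhds x. norm y < q" if "norm x < q" for q
      proof -
        have "open {y::'a. norm y < q}" by (intro open_Collect_less continuous_intros)
        from eventually_nhds_in_open[OF this, of x] that show ?thesis by simp
      qed
      have cn': "\<forall>\<^sub>F y in nhds x. q < norm y" if "q < norm x" for q
      proof -
        have "open {y::'a. q < norm y}" by (intro open_Collect_less continuous_intros)
        from eventually_nhds_in_open[OF this, of x] that show ?thesis by simp
      qed
      consider "norm x < s" | "s < norm x" "norm x < t" | "t < norm x" using elim by linarith
      then have Ld: "((\<lambda>y. L (norm y)) has_derivative (\<lambda>h. - indicator {s<..<t} (norm x) * (x \<bullet> h) / norm x)) (at x)"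
      proof cases
        case 1
        have "\<forall>\<^sub>F y in nhds x. t - s = L (norm y)" using cn[OF 1] by eventually_elim (use st in \<open>auto simp: L_def\<close>)
        from has_derivative_nhds_cong[OF has_derivative_const this] show ?thesis using 1 by simp
      next
        case 2
        then have x: "x \<noteq> 0" using st by auto
        have "((\<lambda>y. t - norm y) has_derivative (\<lambda>h. 0 - h \<bullet> sgn x)) (at x)"
          by (intro has_derivative_diff has_derivative_const has_derivative_norm[OF x])
        moreover have "\<forall>\<^sub>F y in nhds x. t - norm y = L (norm y)" using cn[OF 2(2)] cn'[OF 2(1)] by eventually_elim (auto simp: L_def)
        ultimately have "((\<lambda>y. L (norm y)) has_derivative (\<lambda>h. 0 - h \<bullet> sgn x)) (at x)" by (rule has_derivative_nhds_cong)
        then show ?thesis using 2 by (simp add: sgn_div_norm divide_inverse mult.commute inner_commute)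
      next
        case 3
        have "\<forall>\<^sub>F y in nhds x. 0 = L (norm y)" using cn'[OF 3] by eventually_elim (use st in \<open>auto simp: L_def\<close>)
        from has_derivative_nhds_cong[OF has_derivative_const this] show ?thesis using 3 by simp
      qed
      have "(D x \<bullet> i) * L (norm x) - Q x = \<phi> x * (- indicator {s<..<t} (norm x) * (x \<bullet> i) / norm x) + (D x \<bullet> i) * L (norm x)"
        by (simp add: Q_def)
      then show ?case using difference_quotient_tendsto[OF has_derivative_mult[OF der Ld], of i] by simp
    qed
  qed
  moreover have Qi: "integrable lborel Q"
  proof (rule integrable_bound)
    show "integrable lborel (\<lambda>x::'a. B * indicator (cball 0 t) x)"
      using emeasure_bounded_finite[OF bounded_cball] by (intro integrable_mult_right integrable_real_indicator) auto
    show "Q \<in> borel_measurable lborel" unfolding Q_def by measurable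
    show "AE x in lborel. norm (Q x) \<le> norm (B * indicator (cball 0 t) x)"
    proof (rule AE_I2)
      fix x
      have "\<bar>\<phi> x\<bar> * \<bar>(x \<bullet> i) / norm x\<bar> \<le> B * 1" using b(5)[of x] by (intro mult_mono direction_component_le) auto
      then show "norm (Q x) \<le> norm (B * indicator (cball 0 t) x)" using b(2) by (auto simp: Q_def indicator_def abs_mult)
    qed
  qed
  ultimately have "(LINT x|lborel. (D x \<bullet> i) * L (norm x)) = (LINT x|lborel. Q x)" using FI(2) by simp
  then show "(LBINT r:{s..t}. ball_flux r) = (LINT x|lborel. \<phi> x * (x \<bullet> i) / norm x * indicator {s<..<t} (norm x))"
    using FI(1) by (simp add: set_lebesgue_integral_def Q_def)
  show "set_integrable lborel {s..t} ball_flux"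
    unfolding set_integrable_def
  proof (rule integrable_bound[OF wi])
    have "\<bar>ball_flux r\<bar> \<le> abs_flux r" for r
      unfolding ball_flux_def abs_flux_def by (rule order_trans[OF integral_abs_bound]) (simp add: abs_mult)
    then show "AE r in lborel. norm (indicator {s..t} r *\<^sub>R ball_flux r) \<le> norm (indicator {s..t} r * abs_flux r)"
      by (auto simp: indicator_def intro!: AE_I2 order_trans[OF _ abs_ge_self])
  qed measurable
qed

text \<open>Let b be the spherical average of \<phi> x_i / |x|. By the shell identity the flux and
  the sphere area times r^(d-1) b have equal integrals over all intervals, so they agree for almost
  every radius; pairing with c is then integration in polar coordinates.\<close>

lemma ball_flux_pairing:
  assumes c[measurable]: "c \<in> borel_measurable borel" and ci: "integrable (radial DIM('a)) (\<lambda>r. (c r)^2)"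
  shows "(LINT r|lborel. indicator {0<..} r * (c r * ball_flux r)) = (LINT x|lborel. c (norm x) * (\<phi> x * (x \<bullet> i) / norm x))"
proof -
  let ?\<psi> = "\<lambda>x. \<phi> x * (x \<bullet> i) / norm x" and ?\<omega> = "sphere_area TYPE('a)"
  have \<psi>i: "integrable lborel (\<lambda>x. (?\<psi> x)^2)"
  proof (rule integrable_bound[OF test_component_integrable(2)])
    show "AE x in lborel. norm ((?\<psi> x)^2) \<le> norm ((\<phi> x)^2)"
    proof (rule AE_I2)
      fix x
      have "\<bar>\<phi> x\<bar> * \<bar>(x \<bullet> i) / norm x\<bar> \<le> \<bar>\<phi> x\<bar> * 1" by (intro mult_left_mono direction_component_le) simp
      then have "\<bar>?\<psi> x\<bar> \<le> \<bar>\<phi> x\<bar>" by (simp add: abs_mult)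
      then show "norm ((?\<psi> x)^2) \<le> norm ((\<phi> x)^2)" unfolding abs_le_square_iff real_norm_def abs_power2 .
    qed
  qed measurable
  obtain b where b[measurable]: "b \<in> borel_measurable borel" and bi: "integrable lborel (\<lambda>x::'a. (b (norm x))^2)"
    and avg: "\<And>k. k \<in> borel_measurable borel \<Longrightarrow> integrable lborel (\<lambda>x::'a. (k (norm x))^2) \<Longrightarrow>
      (LINT x|lborel. ?\<psi> x * k (norm x)) = (LINT x|lborel. b (norm (x::'a)) * k (norm x))"
    by (rule spherical_average[OF _ \<psi>i]) auto
  have avg': "(LINT x|lborel. ?\<psi> x * k (norm x)) = ?\<omega> * (LINT r|lborel. indicator {0<..} r * r ^ (DIM('a) - 1) * (b r * k r))"
    if [measurable]: "k \<in> borel_measurable borel" and "integrable lborel (\<lambda>x::'a. (k (norm x))^2)" for k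
  proof -
    have "(LINT x|lborel. ?\<psi> x * k (norm x)) = ?\<omega> * (LINT r|radial DIM('a). b r * k r)"
      unfolding avg[OF that] by (subst integral_norm_radial(2)[where h = "\<lambda>r. b r * k r"]) auto
    then show ?thesis by (subst (asm) integral_radial) auto
  qed
  have bR: "integrable (radial DIM('a)) (\<lambda>r. (b r)^2)"
    using integral_norm_radial(1)[where 'a='a and h = "\<lambda>r. (b r)^2"] bi by simp
  have bI: "set_integrable lborel {s..t} (\<lambda>r. ?\<omega> * r ^ (DIM('a) - 1) * b r)" if "0 < s" for s t
    by (rule set_integrable_mult_continuous[OF radial_L2_interval(1)[OF b bR that]]) (intro continuous_intros)
  have "AE r in radial DIM('a). ball_flux r - ?\<omega> * r ^ (DIM('a) - 1) * b r = 0"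
  proof (rule AE_radial_zero_if_interval_integrals_zero)
    fix s t :: real assume st: "0 < s" "s \<le> t"
    note F = ball_flux_shell[OF st]
    show "set_integrable lborel {s..t} (\<lambda>r. ball_flux r - ?\<omega> * r ^ (DIM('a) - 1) * b r)"
      by (rule set_integral_diff(1)[OF F(2) bI[OF st(1)]])
    have k: "integrable lborel (\<lambda>x::'a. (indicator {s<..<t} (norm x) :: real)^2)"
    proof (rule integrable_bound)
      show "integrable lborel (indicator (cball 0 t) :: 'a \<Rightarrow> real)"
        using emeasure_bounded_finite[OF bounded_cball] by (intro integrable_real_indicator) auto
    qed (auto simp: indicator_def intro!: AE_I2)
    have "(LBINT r:{s..t}. ball_flux r) = ?\<omega> * (LINT r|lborel. indicator {0<..} r * r ^ (DIM('a) - 1) * (b r * indicator {s<..<t} r))"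
      unfolding F(1) by (rule avg'[OF _ k]) simp
    also have "\<dots> = (LINT r|lborel. ?\<omega> * (indicator {0<..} r * r ^ (DIM('a) - 1) * (b r * indicator {s<..<t} r)))" by simp
    also have "\<dots> = (LBINT r:{s..t}. ?\<omega> * r ^ (DIM('a) - 1) * b r)"
      unfolding set_lebesgue_integral_def
    proof (rule integral_cong_AE)
      show "AE r in lborel. ?\<omega> * (indicator {0<..} r * r ^ (DIM('a) - 1) * (b r * indicator {s<..<t} r)) = indicator {s..t} r *\<^sub>R (?\<omega> * r ^ (DIM('a) - 1) * b r)"
        using AE_lborel_singleton[of s] AE_lborel_singleton[of t] by eventually_elim (use st in \<open>auto simp: indicator_def\<close>)
    qed measurable
    finally show "(LBINT r:{s..t}. ball_flux r - ?\<omega> * r ^ (DIM('a) - 1) * b r) = 0"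
      by (subst set_integral_diff(2)[OF F(2) bI[OF st(1)]]) simp
  qed measurable
  then have AE: "AE r in lborel. 0 < r \<longrightarrow> ball_flux r = ?\<omega> * r ^ (DIM('a) - 1) * b r" by (simp add: AE_radial)
  have cN: "integrable lborel (\<lambda>x::'a. (c (norm x))^2)"
    using integral_norm_radial(1)[where 'a='a and h = "\<lambda>r. (c r)^2"] ci by simp
  have "(LINT r|lborel. indicator {0<..} r * (c r * ball_flux r)) = (LINT r|lborel. ?\<omega> * (indicator {0<..} r * r ^ (DIM('a) - 1) * (b r * c r)))"
    by (rule integral_cong_AE) (use AE in \<open>auto simp: indicator_def elim!: eventually_mono\<close>)
  also have "\<dots> = (LINT x|lborel. ?\<psi> x * c (norm x))" using avg'[OF c cN] by simp
  finally show ?thesis by (simp only: mult.commute)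
qed

text \<open>Let R be a radius beyond the support of \<phi>. There g(|x|) is written as g R minus the
  integral of c from |x| to R; the constant drops out because a directional derivative has integral
  0, and Fubini turns the rest into a pairing of c with the flux.\<close>

lemma radial_weak_identity:
  assumes p: "profile DIM('a) g c"
  shows "(LINT x|lborel. g (norm x) * (D x \<bullet> i)) = - (LINT x|lborel. c (norm x) * (\<phi> x * (x \<bullet> i) / norm x))"
proof -
  note [measurable] = profileD(1,2)[OF p]
  note cL = profileD(4)[OF p]
  obtain R B where b: "0 < R" "0 < B" "\<And>x. R \<le> norm x \<Longrightarrow> \<phi> x = 0" "\<And>x. R \<le> norm x \<Longrightarrow> D x = 0"
    "\<And>x. \<bar>\<phi> x\<bar> \<le> B" "\<And>x. \<bar>D x \<bullet> i\<bar> \<le> B" "\<And>x y. \<bar>\<phi> x - \<phi> y\<bar> \<le> B * norm (x - y)" using test_gradient_facts by blast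
  obtain K where K: "\<And>r. 0 \<le> r \<Longrightarrow> \<bar>abs_flux r\<bar> \<le> K * r ^ DIM('a)"
    and K1: "\<And>r. \<bar>abs_flux r\<bar> \<le> K"
    using ball_flux_abs_bound by blast
  define w where "w r = indicator {0<..R} r * c r" for r
  have [measurable]: "w \<in> borel_measurable borel" unfolding w_def by measurable
  have ind: "integrable (radial DIM('a)) (indicator {..R} :: real \<Rightarrow> real)"
  proof -
    have "integrable lborel (indicator (cball 0 R) :: 'a \<Rightarrow> real)"
      using emeasure_bounded_finite[OF bounded_cball] by (intro integrable_real_indicator) auto
    also have "(indicator (cball 0 R) :: 'a \<Rightarrow> real) = (\<lambda>x. indicator {..R} (norm x))" by (auto simp: indicator_def fun_eq_iff)
    finally show ?thesis by (subst (asm) integral_norm_radial(1)) auto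
  qed
  have "(\<lambda>r. (indicator {..R} r)^2) = (indicator {..R} :: real \<Rightarrow> real)" by (auto simp: indicator_def)
  then have "integrable (radial DIM('a)) (\<lambda>r. indicator {..R} r * c r)"
    by (intro integrable_mult_squares) (use ind cL in auto)
  then have ci: "integrable lborel (\<lambda>r. indicator {0<..} r * r ^ (DIM('a) - 1) * (indicator {..R} r * c r))"
    by (subst (asm) integrable_radial) auto
  have wi: "integrable lborel (\<lambda>r. w r * abs_flux r)"
  proof (rule integrable_bound)
    show "integrable lborel (\<lambda>r. K * R * (indicator {0<..} r * r ^ (DIM('a) - 1) * (indicator {..R} r * c r)))" using ci by (rule integrable_mult_right)
    show "AE r in lborel. norm (w r * abs_flux r) \<le> norm (K * R * (indicator {0<..} r * r ^ (DIM('a) - 1) * (indicator {..R} r * c r)))"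
    proof (rule AE_I2)
      fix r
      show "norm (w r * abs_flux r) \<le> norm (K * R * (indicator {0<..} r * r ^ (DIM('a) - 1) * (indicator {..R} r * c r)))"
      proof (cases "0 < r \<and> r \<le> R")
        case True
        have K0: "0 \<le> K" using order_trans[OF abs_ge_zero K[of 1]] by simp
        have "r ^ DIM('a) = r * r ^ (DIM('a) - 1)" using DIM_positive[where 'a='a] by (cases "DIM('a)") auto
        also have "\<dots> \<le> R * r ^ (DIM('a) - 1)" using True by (intro mult_right_mono) auto
        finally have "K * r ^ DIM('a) \<le> K * (R * r ^ (DIM('a) - 1))" using K0 by (rule mult_left_mono)
        then have "\<bar>abs_flux r\<bar> \<le> K * (R * r ^ (DIM('a) - 1))" using K[of r] True by linarith
        from mult_left_mono[OF this, of "\<bar>c r\<bar>"]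
        show ?thesis using True K0 b(1) by (simp add: w_def abs_mult mult_ac)
      qed (auto simp: w_def indicator_def)
    qed
  qed measurable
  note FI = ball_flux_Fubini[OF _ wi]
  have "(LINT x|lborel. g (norm x) * (D x \<bullet> i)) = (LINT x|lborel. g R * (D x \<bullet> i) - (D x \<bullet> i) * (LINT r|lborel. w r * indicator {norm x<..} r))"
  proof (rule integral_cong_AE)
    show "AE x in lborel. g (norm x) * (D x \<bullet> i) = g R * (D x \<bullet> i) - (D x \<bullet> i) * (LINT r|lborel. w r * indicator {norm x<..} r)"
      using AE_norm_neq[of 0]
    proof eventually_elim
      case (elim x)
      show ?case
      proof (cases "norm x < R")
        case True
        have "(LINT r|lborel. w r * indicator {norm x<..} r) = (LBINT r:{norm x..R}. c r)"
          unfolding set_lebesgue_integral_def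
        proof (rule integral_cong_AE)
          show "AE r in lborel. w r * indicator {norm x<..} r = indicator {norm x..R} r *\<^sub>R c r"
            using AE_lborel_singleton[of "norm x"]
          proof eventually_elim
            case (elim r)
            have "0 < r" if "norm x < r" using that norm_ge_zero[of x] by linarith
            then show ?case using elim unfolding w_def indicator_def by (auto simp: less_le)
          qed
        qed measurable
        also have "\<dots> = g R - g (norm x)" using profileD(5)[OF p, of "norm x" R] elim True by simp
        finally show ?thesis by (simp only:) (simp add: algebra_simps)
      qed (use b(4)[of x] in simp)
    qed
  qed (use FI(2) in auto)
  also have "\<dots> = g R * (LINT x|lborel. D x \<bullet> i) - (LINT x|lborel. (D x \<bullet> i) * (LINT r|lborel. w r * indicator {norm x<..} r))"
    using test_component_integrable(1) FI(2) by simp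
  also have "\<dots> = - (LINT r|lborel. w r * ball_flux r)" unfolding test_component_integral_zero using FI(1) by simp
  also have "(LINT r|lborel. w r * ball_flux r) = (LINT r|lborel. indicator {0<..} r * (indicator {..R} r * c r * ball_flux r))"
    by (rule integral_cong) (auto simp: w_def indicator_def)
  also have "\<dots> = (LINT x|lborel. indicator {..R} (norm x) * c (norm x) * (\<phi> x * (x \<bullet> i) / norm x))"
  proof (rule ball_flux_pairing)
    show "integrable (radial DIM('a)) (\<lambda>r. (indicator {..R} r * c r)^2)"
      by (rule integrable_bound[OF cL]) (auto simp: indicator_def)
  qed simp
  also have "\<dots> = (LINT x|lborel. c (norm x) * (\<phi> x * (x \<bullet> i) / norm x))"
    by (rule integral_cong) (use b(3) in \<open>auto simp: indicator_def not_le\<close>)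
  finally show ?thesis .
qed

end

declare test_measurable [measurable del] test_snd_measurable [measurable del] flux_measurable [measurable del]

section \<open>Profiles and radial Sobolev functions\<close>

definition radial_gradient :: "(real \<Rightarrow> real) \<Rightarrow> 'a::euclidean_space \<Rightarrow> 'a" where
  "radial_gradient c x = c (norm x) *\<^sub>R (x /\<^sub>R norm x)"

lemma radial_gradient_measurable [measurable]:
  assumes [measurable]: "c \<in> borel_measurable borel"
  shows "radial_gradient c \<in> borel_measurable borel"
  unfolding radial_gradient_def[abs_def] by measurable

lemma norm_radial_gradient: "x \<noteq> 0 \<Longrightarrow> norm (radial_gradient c x) = \<bar>c (norm x)\<bar>"
  by (simp add: radial_gradient_def abs_mult)

lemma integral_norm_radial_gradient:
  fixes c :: "real \<Rightarrow> real"
  assumes [measurable]: "c \<in> borel_measurable borel"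
  shows "integrable lborel (\<lambda>x::'a::euclidean_space. (norm (radial_gradient c x))^2) \<longleftrightarrow> integrable (radial DIM('a)) (\<lambda>r. (c r)^2)"
    and "(LINT x|lborel. (norm (radial_gradient c (x::'a)))^2) = sphere_area TYPE('a) * (LINT r|radial DIM('a). (c r)^2)"
proof -
  have AE: "AE x::'a in lborel. (norm (radial_gradient c x))^2 = (c (norm x))^2"
    using AE_norm_neq[of 0] by eventually_elim (simp add: norm_radial_gradient)
  have "integrable lborel (\<lambda>x::'a. (norm (radial_gradient c x))^2) \<longleftrightarrow> integrable lborel (\<lambda>x::'a. (c (norm x))^2)"
    by (rule integrable_cong_AE[OF _ _ AE]) auto
  then show "integrable lborel (\<lambda>x::'a. (norm (radial_gradient c x))^2) \<longleftrightarrow> integrable (radial DIM('a)) (\<lambda>r. (c r)^2)"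
    using integral_norm_radial(1)[where 'a='a and h = "\<lambda>r. (c r)^2"] by simp
  have "(LINT x::'a|lborel. (norm (radial_gradient c x))^2) = (LINT x::'a|lborel. (c (norm x))^2)"
    by (rule integral_cong_AE[OF _ _ AE]) auto
  then show "(LINT x|lborel. (norm (radial_gradient c (x::'a)))^2) = sphere_area TYPE('a) * (LINT r|radial DIM('a). (c r)^2)"
    using integral_norm_radial(2)[where 'a='a and h = "\<lambda>r. (c r)^2"] by simp
qed

lemma weak_grad_borel_iff:
  fixes u v :: "'a::euclidean_space \<Rightarrow> real"
  assumes v: "v \<in> borel_measurable borel" "AE x in lebesgue. u x = v x" and H: "H \<in> borel_measurable borel" "AE x in lebesgue. G x = H x"
    and G: "G \<in> borel_measurable lebesgue"
  shows "weak_grad u G \<longleftrightarrow> integrable lborel (\<lambda>x. (norm (H x))^2) \<and>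
    (\<forall>\<phi> D. test_fun \<phi> \<longrightarrow> (\<forall>x. has_gradient \<phi> (D x) x) \<longrightarrow>
        (\<forall>i\<in>Basis. (LINT x|lborel. v x * (D x \<bullet> i)) = - (LINT x|lborel. (H x \<bullet> i) * \<phi> x)))" (is "_ \<longleftrightarrow> ?R")
proof -
  note [measurable] = v(1) H(1)
  have A: "integrable lebesgue (\<lambda>x. (norm (G x))^2) \<longleftrightarrow> integrable lborel (\<lambda>x. (norm (H x))^2)"
    by (rule integral_lebesgue_borel(3)) (use H in \<open>auto elim!: eventually_mono\<close>)
  have "(LINT x|lebesgue. u x * (D x \<bullet> i)) = (LINT x|lborel. v x * (D x \<bullet> i))"
    "(LINT x|lebesgue. (G x \<bullet> i) * \<phi> x) = (LINT x|lborel. (H x \<bullet> i) * \<phi> x)"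
    if t: "test_fun \<phi>" and D: "\<And>x. has_gradient \<phi> (D x) x" for \<phi> D i
  proof -
    note [measurable] = test_measurable[OF t D SOME_Basis]
    show "(LINT x|lebesgue. u x * (D x \<bullet> i)) = (LINT x|lborel. v x * (D x \<bullet> i))"
      by (rule integral_lebesgue_borel(2)) (use v(2) in \<open>auto elim!: eventually_mono\<close>)
    show "(LINT x|lebesgue. (G x \<bullet> i) * \<phi> x) = (LINT x|lborel. (H x \<bullet> i) * \<phi> x)"
      by (rule integral_lebesgue_borel(2)) (use H(2) in \<open>auto elim!: eventually_mono\<close>)
  qed
  note B = this
  show ?thesis
  proof
    assume W: "weak_grad u G"
    have "(LINT x|lborel. v x * (D x \<bullet> i)) = - (LINT x|lborel. (H x \<bullet> i) * \<phi> x)"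
      if t: "test_fun \<phi>" and D: "\<forall>x. has_gradient \<phi> (D x) x" and i: "i \<in> Basis" for \<phi> D i
    proof -
      have "(LINT x|lebesgue. u x * (D x \<bullet> i)) = - (LINT x|lebesgue. (G x \<bullet> i) * \<phi> x)" using W t D i unfolding weak_grad_def by blast
      then show ?thesis unfolding B(1)[OF t D[rule_format]] B(2)[OF t D[rule_format]] .
    qed
    then show ?R
      using W A unfolding weak_grad_def by blast
  next
    assume W: ?R
    have "(LINT x|lebesgue. u x * (D x \<bullet> i)) = - (LINT x|lebesgue. (G x \<bullet> i) * \<phi> x)"
      if t: "test_fun \<phi>" and D: "\<forall>x. has_gradient \<phi> (D x) x" and i: "i \<in> Basis" for \<phi> D i
    proof -
      have "(LINT x|lborel. v x * (D x \<bullet> i)) = - (LINT x|lborel. (H x \<bullet> i) * \<phi> x)" using W t D i by blast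
      then show ?thesis unfolding B(1)[OF t D[rule_format]] B(2)[OF t D[rule_format]] .
    qed
    then show "weak_grad u G" using W A G unfolding weak_grad_def by blast
  qed
qed

lemma weak_grad_radial:
  fixes u :: "'a::euclidean_space \<Rightarrow> real"
  assumes p: "profile DIM('a) g c" and u: "AE x in lebesgue. u x = g (norm x)"
  shows "weak_grad u (radial_gradient c)"
proof -
  note [measurable] = profileD(1,2)[OF p]
  have gm: "(\<lambda>x::'a. g (norm x)) \<in> borel_measurable borel" by measurable
  have m: "radial_gradient c \<in> borel_measurable (lebesgue :: 'a measure)" by (intro measurable_completion) simp
  have e: "(radial_gradient c x \<bullet> i) * \<phi> x = c (norm x) * (\<phi> x * (x \<bullet> i) / norm x)" for x i :: 'a and \<phi> :: "'a \<Rightarrow> real"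
    by (simp add: radial_gradient_def divide_inverse mult_ac)
  show ?thesis
    unfolding weak_grad_borel_iff[OF gm u radial_gradient_measurable[OF profileD(2)[OF p]] AE_I2[OF refl] m] e
    using integral_norm_radial_gradient(1)[OF profileD(2)[OF p], where 'a='a] profileD(4)[OF p] radial_weak_identity[OF _ _ _ p] by blast
qed

text \<open>The difference of two weak gradients is orthogonal, component by component, to all test
  functions. This makes the choice in \<open>wgrad\<close> harmless.\<close>

lemma weak_grad_unique:
  fixes u :: "'a::euclidean_space \<Rightarrow> real"
  assumes u: "u \<in> borel_measurable lebesgue" and G: "weak_grad u G" and G': "weak_grad u G'"
  shows "AE x in lebesgue. G x = G' x"
proof -
  obtain v where v: "v \<in> borel_measurable borel" "AE x in lebesgue. u x = v x" using u by (rule borel_version)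
  have m: "G \<in> borel_measurable lebesgue" "G' \<in> borel_measurable lebesgue" using G G' by (auto simp: weak_grad_def)
  obtain H where H: "H \<in> borel_measurable borel" "AE x in lebesgue. G x = H x" using m(1) by (rule borel_version_vector)
  obtain H' where H': "H' \<in> borel_measurable borel" "AE x in lebesgue. G' x = H' x" using m(2) by (rule borel_version_vector)
  note W = G[unfolded weak_grad_borel_iff[OF v H m(1)]] and W' = G'[unfolded weak_grad_borel_iff[OF v H' m(2)]]
  note [measurable] = H(1) H'(1)
  have "AE x in lborel. (H x \<bullet> i) - (H' x \<bullet> i) = 0" if i: "i \<in> Basis" for i
  proof (rule test_functions_separate)
    note c = component_square_integrable[OF H(1) _ i] component_square_integrable[OF H'(1) _ i]
    have c: "integrable lborel (\<lambda>x. (H x \<bullet> i)^2)" "integrable lborel (\<lambda>x. (H' x \<bullet> i)^2)" using c W W' by auto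
    show "integrable lborel (\<lambda>x. indicator (origin_box N) x * ((H x \<bullet> i) - (H' x \<bullet> i)))" for N
      using box_L2_integrable[of "\<lambda>x. H x \<bullet> i" N] box_L2_integrable[of "\<lambda>x. H' x \<bullet> i" N] c by (simp add: right_diff_distrib)
    fix \<phi> :: "'a \<Rightarrow> real" assume t: "test_fun \<phi>"
    obtain D where D: "\<And>x. has_gradient \<phi> (D x) x" using t unfolding test_fun_def by (elim conjE smooth_fun_gradient) blast
    note [measurable] = test_measurable[OF t D SOME_Basis] and \<phi>2 = test_component_integrable(2)[OF t D i]
    have "integrable lborel (\<lambda>x. (H x \<bullet> i) * \<phi> x)" "integrable lborel (\<lambda>x. (H' x \<bullet> i) * \<phi> x)"
      by (rule integrable_mult_squares; use c \<phi>2 in simp)+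
    moreover have "(LINT x|lborel. (H x \<bullet> i) * \<phi> x) = (LINT x|lborel. (H' x \<bullet> i) * \<phi> x)"
      using W W' t D i by (metis (no_types, lifting) add.inverse_inverse)
    ultimately show "(LINT x|lborel. ((H x \<bullet> i) - (H' x \<bullet> i)) * \<phi> x) = 0" by (simp add: left_diff_distrib)
  qed measurable
  then have "AE x in lborel. \<forall>i\<in>Basis. H x \<bullet> i = H' x \<bullet> i" by (intro AE_finite_allI) auto
  then have "AE x in lebesgue. \<forall>i\<in>Basis. H x \<bullet> i = H' x \<bullet> i" by (rule AE_completion)
  then show ?thesis using H(2) H'(2) by eventually_elim (simp add: euclidean_eq_iff[where 'a='a])
qed

lemma H1_weak_grad: "u \<in> H1 \<Longrightarrow> weak_grad u (wgrad u)" "u \<in> H1 \<Longrightarrow> L2fun u"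
  using someI_ex[of "weak_grad u"] unfolding H1_def wgrad_def by auto

text \<open>A Borel version g of the radial function is its own spherical average, so the averaging
  argument applies with c the average of the radial component of the weak gradient; its output is
  the continuous representative of g.\<close>

theorem H1rad_profile:
  fixes u :: "'a::euclidean_space \<Rightarrow> real"
  assumes u: "u \<in> H1rad"
  obtains g c where "profile DIM('a) g c" "AE x in lebesgue. u x = g (norm x)"
proof -
  have u1: "u \<in> H1" and L2: "u \<in> borel_measurable lebesgue" "integrable lebesgue (\<lambda>x. (u x)^2)"
    using u H1_weak_grad(2)[of u] by (auto simp: H1rad_def L2fun_def)
  obtain g1 :: "real \<Rightarrow> real" where "AE x in lebesgue. u x = g1 (norm x)" using u by (auto simp: H1rad_def)
  then obtain g where g: "g \<in> borel_measurable borel" "AE x in lebesgue. u x = g (norm x)" by (rule radial_borel_version[OF L2(1)])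
  have gm: "(\<lambda>x::'a. g (norm x)) \<in> borel_measurable borel" using g(1) by measurable
  define G where "G = wgrad u"
  have W: "weak_grad u G" using H1_weak_grad(1)[OF u1] by (simp add: G_def)
  then have m: "G \<in> borel_measurable lebesgue" by (simp add: weak_grad_def)
  obtain H where H: "H \<in> borel_measurable borel" "AE x in lebesgue. G x = H x" using m by (rule borel_version_vector)
  note W' = W[unfolded weak_grad_borel_iff[OF gm g(2) H m]]
  note [measurable] = g(1) H(1)
  note ci = radial_component_square_integrable[OF H(1) conjunct1[OF W']]
  obtain c where c: "c \<in> borel_measurable borel" "integrable lborel (\<lambda>x::'a. (c (norm x))^2)"
    "\<And>k. k \<in> borel_measurable borel \<Longrightarrow> integrable lborel (\<lambda>x::'a. (k (norm x))^2) \<Longrightarrow>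
        (LINT x|lborel. (H x \<bullet> x / norm x) * k (norm x)) = (LINT x|lborel. c (norm (x::'a)) * k (norm x))"
    by (rule spherical_average[OF _ ci]) auto
  have g2: "integrable lborel (\<lambda>x::'a. (g (norm x))^2)"
  proof (subst integral_lebesgue_borel(3)[symmetric])
    show "AE x in lebesgue. (u x)^2 = (g (norm x))^2" using g(2) by eventually_elim simp
  qed (use L2(2) in simp_all)
  note u_eq = g(2)
  interpret averaged_weak_gradient "\<lambda>x::'a. g (norm x)" H g c
    by (rule averaged_weak_gradient.intro) (use g2 g(1) H(1) W' c in auto)
  obtain g0 where g0: "profile DIM('a) g0 c" "AE r in radial DIM('a). g r = g0 r" using averages_form_profile by blast
  have "AE x::'a in lebesgue. g (norm x) = g0 (norm x)" by (rule AE_completion[OF AE_norm_radial[OF g0(2)]])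
  then have "AE x in lebesgue. u x = g0 (norm x)" using u_eq by eventually_elim simp
  then show ?thesis using g0(1) by (rule that[rotated])
qed

lemma profile_H1rad:
  fixes u :: "'a::euclidean_space \<Rightarrow> real"
  assumes p: "profile DIM('a) g c" and u: "AE x in lebesgue. u x = g (norm x)"
  shows "u \<in> H1rad" "AE x in lebesgue. wgrad u x = radial_gradient c x"
proof -
  note [measurable] = profileD(1,2)[OF p]
  note B = integral_lebesgue_borel[of "\<lambda>x::'a. g (norm x)" u, OF _ u]
  have "integrable lborel (\<lambda>x::'a. (g (norm x))^2)"
    using integral_norm_radial(1)[where 'a='a and h = "\<lambda>r. (g r)^2"] profileD(3)[OF p] by simp
  then have "integrable lebesgue (\<lambda>x. (u x)^2)"
  proof (subst integral_lebesgue_borel(3))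
    show "AE x in lebesgue. (u x)^2 = (g (norm x))^2" using u by eventually_elim simp
  qed simp_all
  moreover have um: "u \<in> borel_measurable lebesgue" by (rule B(1)) simp
  ultimately have "L2fun u" by (simp add: L2fun_def)
  then have h: "u \<in> H1" using weak_grad_radial[OF p u] by (auto simp: H1_def)
  then show "u \<in> H1rad" using u by (auto simp: H1rad_def)
  show "AE x in lebesgue. wgrad u x = radial_gradient c x"
    by (rule weak_grad_unique[OF um H1_weak_grad(1)[OF h] weak_grad_radial[OF p u]])
qed

lemma test_fun_radial_derivative:
  fixes \<phi> :: "'a::euclidean_space \<Rightarrow> real"
  assumes t: "test_fun \<phi>" and D: "\<And>x. has_gradient \<phi> (D x) x"
  shows "integrable lborel (\<lambda>x. (norm (D x))^2)" "integrable lborel (\<lambda>x. (D x \<bullet> x / norm x)^2)"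
proof -
  note [measurable] = test_measurable[OF t D SOME_Basis]
  have "(norm (D x))^2 = (\<Sum>i\<in>Basis. (D x \<bullet> i)^2)" for x
    unfolding power2_norm_eq_inner unfolding power2_eq_square by (rule euclidean_inner)
  then show D2: "integrable lborel (\<lambda>x. (norm (D x))^2)" using test_component_integrable(3)[OF t D] by simp
  from radial_component_square_integrable[OF test_measurable(2)[OF t D SOME_Basis] this]
  show "integrable lborel (\<lambda>x. (D x \<bullet> x / norm x)^2)" .
qed

text \<open>A test function satisfies the weak identity by the product rule, so its spherical
  average is a profile whose derivative is the average of the radial derivative. This profile can be
  inserted in the radial Euler-Lagrange equation.\<close>

lemma test_fun_averages:
  fixes \<phi> :: "'a::euclidean_space \<Rightarrow> real"
  assumes t: "test_fun \<phi>" and D: "\<And>x. has_gradient \<phi> (D x) x"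
  obtains g c where "profile DIM('a) g c"
    "\<And>k. k \<in> borel_measurable borel \<Longrightarrow> integrable lborel (\<lambda>x::'a. (k (norm x))^2) \<Longrightarrow>
      (LINT x|lborel. \<phi> x * k (norm x)) = (LINT x|lborel. g (norm (x::'a)) * k (norm x))"
    "\<And>k. k \<in> borel_measurable borel \<Longrightarrow> integrable lborel (\<lambda>x::'a. (k (norm x))^2) \<Longrightarrow>
      (LINT x|lborel. (D x \<bullet> x / norm x) * k (norm x)) = (LINT x|lborel. c (norm (x::'a)) * k (norm x))"
proof -
  note [measurable] = test_measurable[OF t D SOME_Basis]
  have \<phi>2: "integrable lborel (\<lambda>x. (\<phi> x)^2)" using test_component_integrable(2)[OF t D SOME_Basis] .
  obtain g where g: "g \<in> borel_measurable borel" "integrable lborel (\<lambda>x::'a. (g (norm x))^2)"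
    "\<And>k. k \<in> borel_measurable borel \<Longrightarrow> integrable lborel (\<lambda>x::'a. (k (norm x))^2) \<Longrightarrow>
        (LINT x|lborel. \<phi> x * k (norm x)) = (LINT x|lborel. g (norm (x::'a)) * k (norm x))"
    by (rule spherical_average[OF _ \<phi>2]) auto
  note D2 = test_fun_radial_derivative(1)[OF t D] and ci = test_fun_radial_derivative(2)[OF t D]
  obtain c where c: "c \<in> borel_measurable borel" "integrable lborel (\<lambda>x::'a. (c (norm x))^2)"
    "\<And>k. k \<in> borel_measurable borel \<Longrightarrow> integrable lborel (\<lambda>x::'a. (k (norm x))^2) \<Longrightarrow>
        (LINT x|lborel. (D x \<bullet> x / norm x) * k (norm x)) = (LINT x|lborel. c (norm (x::'a)) * k (norm x))"
    by (rule spherical_average[OF _ ci]) auto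
  have weak: "(LINT x|lborel. \<phi> x * (D' x \<bullet> i)) = - (LINT x|lborel. (D x \<bullet> i) * \<phi>' x)"
    if t': "test_fun \<phi>'" and D': "\<And>x. has_gradient \<phi>' (D' x) x" and i: "i \<in> Basis" for \<phi>' D' i
  proof -
    note [measurable] = test_measurable[OF t' D' SOME_Basis]
    obtain R B where b: "0 < R" "0 < B" "\<And>x. R \<le> norm x \<Longrightarrow> \<phi> x = 0" "\<And>x. R \<le> norm x \<Longrightarrow> D x = 0" "\<And>x. \<bar>\<phi> x\<bar> \<le> B"
      "\<And>x. norm (D x) \<le> B" "\<And>x y. \<bar>\<phi> x - \<phi> y\<bar> \<le> B * norm (x - y)" using test_fun_bounds[OF t D] by blast
    obtain R' B' where b': "0 < R'" "0 < B'" "\<And>x. R' \<le> norm x \<Longrightarrow> \<phi>' x = 0" "\<And>x. R' \<le> norm x \<Longrightarrow> D' x = 0" "\<And>x. \<bar>\<phi>' x\<bar> \<le> B'"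
      "\<And>x. norm (D' x) \<le> B'" "\<And>x y. \<bar>\<phi>' x - \<phi>' y\<bar> \<le> B' * norm (x - y)" using test_fun_bounds[OF t' D'] by blast
    have "(LINT x|lborel. \<phi> x * (D' x \<bullet> i) + (D x \<bullet> i) * \<phi>' x) = 0"
    proof (rule integral_directional_derivative_zero[where \<psi> = "\<lambda>x. \<phi> x * \<phi>' x" and R = R and v = i and L = "B * B' + B * B'"])
      fix x y
      have "\<bar>\<phi> x * \<phi>' x - \<phi> y * \<phi>' y\<bar> = \<bar>(\<phi> x - \<phi> y) * \<phi>' x + \<phi> y * (\<phi>' x - \<phi>' y)\<bar>" by (simp add: algebra_simps)
      also have "\<dots> \<le> \<bar>\<phi> x - \<phi> y\<bar> * \<bar>\<phi>' x\<bar> + \<bar>\<phi> y\<bar> * \<bar>\<phi>' x - \<phi>' y\<bar>" by (metis abs_mult abs_triangle_ineq)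
      also have "\<dots> \<le> (B * norm (x - y)) * B' + B * (B' * norm (x - y))"
        by (intro add_mono mult_mono b b') (use b(2) b'(2) in auto)
      finally show "\<bar>\<phi> x * \<phi>' x - \<phi> y * \<phi>' y\<bar> \<le> (B * B' + B * B') * norm (x - y)" by (simp add: algebra_simps)
    next
      show "AE x in lborel. (\<lambda>n. (\<phi> (x + (1 / real (Suc n)) *\<^sub>R i) * \<phi>' (x + (1 / real (Suc n)) *\<^sub>R i) - \<phi> x * \<phi>' x) * real (Suc n))
        \<longlonglongrightarrow> \<phi> x * (D' x \<bullet> i) + (D x \<bullet> i) * \<phi>' x"
        by (intro AE_I2 difference_quotient_tendsto[OF has_derivative_mult[OF D D']])
    qed (use b in auto)
    moreover have "integrable lborel (\<lambda>x. \<phi> x * (D' x \<bullet> i))" "integrable lborel (\<lambda>x. (D x \<bullet> i) * \<phi>' x)"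
      using test_component_integrable[OF t D i] test_component_integrable[OF t' D' i] by (auto intro!: integrable_mult_squares)
    ultimately show ?thesis by simp
  qed
  interpret averaged_weak_gradient \<phi> D g c
    by (rule averaged_weak_gradient.intro) (use \<phi>2 D2 weak g c in auto)
  obtain g0 where g0: "profile DIM('a) g0 c" "AE r in radial DIM('a). g r = g0 r" using averages_form_profile by blast
  note [measurable] = g(1) profileD(1)[OF g0(1)]
  have AE: "AE x::'a in lborel. g (norm x) = g0 (norm x)" by (rule AE_norm_radial[OF g0(2)])
  show ?thesis
  proof (rule that[OF g0(1)])
    fix k :: "real \<Rightarrow> real" assume k: "k \<in> borel_measurable borel" "integrable lborel (\<lambda>x::'a. (k (norm x))^2)"
    note [measurable] = k(1)
    have "(LINT x::'a|lborel. g (norm x) * k (norm x)) = (LINT x::'a|lborel. g0 (norm x) * k (norm x))"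
      by (rule integral_cong_AE) (use AE in \<open>auto elim!: eventually_mono\<close>)
    then show "(LINT x|lborel. \<phi> x * k (norm x)) = (LINT x|lborel. g0 (norm (x::'a)) * k (norm x))" using g(3)[OF k] by simp
  qed (rule c(3))
qed

section \<open>Minimizers on Euclidean space\<close>

text \<open>Off the origin the set is the image of an interval times the unit sphere, connected in
  dimension at least 2. If the origin belongs to the set, openness places it in the closure of that
  image, which preserves connectedness.\<close>

lemma radial_superlevel_connected:
  fixes H :: "real \<Rightarrow> real"
  assumes dim: "2 \<le> DIM('a::euclidean_space)" and H: "continuous_on UNIV H"
    and mid: "\<And>x y z. 0 < x \<Longrightarrow> x < y \<Longrightarrow> y < z \<Longrightarrow> 0 < H x \<Longrightarrow> 0 < H z \<Longrightarrow> 0 < H y"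
  shows "connected {x::'a. 0 < H (norm x)}"
proof -
  define S where "S = {r. 0 < r \<and> 0 < H r}"
  define Q where "Q = (\<lambda>p. fst p *\<^sub>R snd p) ` (S \<times> sphere (0::'a) 1)"
  have "is_interval S"
    unfolding is_interval_1 S_def using mid by (auto simp: le_less)
  then have "connected (S \<times> sphere (0::'a) 1)"
    by (intro connected_Times connected_sphere dim) (simp add: is_interval_connected_1)
  then have Q: "connected Q"
    unfolding Q_def by (intro connected_continuous_image continuous_intros)
  have Qeq: "Q = {x. x \<noteq> 0 \<and> 0 < H (norm x)}"
  proof (intro set_eqI iffI)
    fix x :: 'a assume "x \<in> {x. x \<noteq> 0 \<and> 0 < H (norm x)}"
    then have "(norm x, x /\<^sub>R norm x) \<in> S \<times> sphere (0::'a) 1" "x = fst (norm x, x /\<^sub>R norm x) *\<^sub>R snd (norm x, x /\<^sub>R norm x)"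
      by (auto simp: S_def)
    then show "x \<in> Q" unfolding Q_def by blast
  qed (auto simp: Q_def S_def)
  have op: "open {x::'a. 0 < H (norm x)}"
    by (intro open_Collect_less continuous_intros continuous_on_compose2[OF H]) auto
  have "{x::'a. 0 < H (norm x)} \<subseteq> closure Q"
  proof
    fix x :: 'a assume x: "x \<in> {x. 0 < H (norm x)}"
    show "x \<in> closure Q"
    proof (cases "x = 0")
      case True
      show ?thesis unfolding closure_approachable
      proof (intro allI impI)
        fix e :: real assume e: "0 < e"
        obtain e' where e': "0 < e'" "ball x e' \<subseteq> {x. 0 < H (norm x)}" using op x by (auto simp: open_contains_ball)
        obtain b :: 'a where b: "b \<in> Basis" using nonempty_Basis by blast
        define y where "y = (min e e' / 2) *\<^sub>R b"
        have n: "norm y = min e e' / 2" using e e'(1) b by (simp add: y_def)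
        then have "y \<in> ball x e'" "y \<noteq> 0" "dist y x < e" using True e e'(1) by (auto simp: dist_norm)
        then show "\<exists>y\<in>Q. dist y x < e" using e'(2) unfolding Qeq by blast
      qed
    next
      case False
      then have "x \<in> Q" using x by (simp add: Qeq)
      then show ?thesis using closure_subset by blast
    qed
  qed
  moreover have "Q \<subseteq> {x::'a. 0 < H (norm x)}" by (auto simp: Qeq)
  ultimately show ?thesis using connected_intermediate_closure[OF Q] by blast
qed

lemma integral_radial_compose:
  fixes u :: "'a::euclidean_space \<Rightarrow> real"
  assumes g[measurable]: "g \<in> borel_measurable borel" and u: "AE x in lebesgue. u x = g (norm x)"
    and \<Psi>[measurable]: "\<Psi> \<in> borel_measurable borel"
  shows "(LINT x|lebesgue. \<Psi> (u x)) = sphere_area TYPE('a) * (LINT r|radial DIM('a). \<Psi> (g r))"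
proof -
  have "(LINT x|lebesgue. \<Psi> (u x)) = (LINT x::'a|lborel. \<Psi> (g (norm x)))"
  proof (rule integral_lebesgue_borel(2))
    show "AE x in lebesgue. \<Psi> (u x) = \<Psi> (g (norm x))" using u by eventually_elim simp
  qed measurable
  also have "\<dots> = sphere_area TYPE('a) * (LINT r|radial DIM('a). \<Psi> (g r))"
    by (rule integral_norm_radial(2)[where h = "\<lambda>r. \<Psi> (g r)"]) measurable
  finally show ?thesis .
qed

context
  fixes u :: "'a::euclidean_space \<Rightarrow> real" and g :: "real \<Rightarrow> real"
  assumes g: "g \<in> profiles DIM('a)" and u: "AE x in lebesgue. u x = g (norm x)"
begin

lemma wgrad_energy:
  "(LINT x|lebesgue. (norm (wgrad u x))^2) + (LINT x|lebesgue. (u x)^2) = sphere_area TYPE('a) * qform DIM('a) g"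
proof -
  obtain c where p: "profile DIM('a) g c" using g by (rule profilesE)
  note [measurable] = profileD(1,2)[OF p]
  have "(LINT x|lebesgue. (norm (wgrad u x))^2) = (LINT x|lborel. (norm (radial_gradient c (x::'a)))^2)"
  proof (rule integral_lebesgue_borel(2))
    show "AE x in lebesgue. (norm (wgrad u x))^2 = (norm (radial_gradient c x))^2"
      using profile_H1rad(2)[OF p u] by eventually_elim simp
  qed measurable
  then show ?thesis
    using integral_norm_radial_gradient(2)[OF profileD(2)[OF p], where 'a='a] integral_radial_compose[OF _ u, of "\<lambda>s. s\<^sup>2"]
    by (simp add: qform_eq[OF p] distrib_left)
qed

lemma radial_H1_norm: "H1_norm u = sqrt (sphere_area TYPE('a) * qform DIM('a) g)"
  by (simp add: H1_norm_def wgrad_energy)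

lemma AE_radial_parts:
  "AE x in lebesgue. pospart u x = pospart g (norm x)" "AE x in lebesgue. negpart u x = negpart g (norm x)"
  using u by (auto simp: pospart_def negpart_def elim!: eventually_mono)

end

context nonlinearity
begin

context
  fixes u :: "'a::euclidean_space \<Rightarrow> real" and g :: "real \<Rightarrow> real"
  assumes d: "d = DIM('a)" and g: "g \<in> profiles d" and u: "AE x in lebesgue. u x = g (norm x)"
begin

lemma radial_act: "actS f u = sphere_area TYPE('a) * act g"
proof -
  have "(LINT x|lebesgue. F (u x)) = sphere_area TYPE('a) * (LINT r|\<mu>. F (g r))"
    unfolding d by (rule integral_radial_compose[OF profiles_borel[OF g] u borel_measurable_continuous_onI[OF cont_F]])
  then show ?thesis
    using wgrad_energy[OF g[unfolded d] u] unfolding actS_def act_def unfolding d by (simp add: algebra_simps)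
qed

lemma radial_nehari: "nehI f u = sphere_area TYPE('a) * nehari g"
proof -
  have "(LINT x|lebesgue. f (u x) * u x) = sphere_area TYPE('a) * nl g"
    unfolding nl_def unfolding d by (rule integral_radial_compose[OF profiles_borel[OF g] u, of "\<lambda>s. f s * s"])
      (intro borel_measurable_continuous_onI continuous_intros cont_f)
  then show ?thesis
    using wgrad_energy[OF g[unfolded d] u] unfolding nehI_def nehari_def unfolding d by (simp add: algebra_simps)
qed

lemma radial_nonzero: "nonzero_fun u \<longleftrightarrow> 0 < qform d g"
proof
  assume n: "nonzero_fun u"
  show "0 < qform d g"
  proof (rule ccontr)
    assume "\<not> 0 < qform d g"
    then have z: "qform d g = 0" using qform_nonneg[of d g] by simp
    have "AE x::'a in lborel. g (norm x) = 0"
      using AE_norm_neq[where 'a='a, of 0] by eventually_elim (simp add: qform_zero_imp[OF g z])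
    then have "AE x::'a in lebesgue. g (norm x) = 0" by (rule AE_completion)
    then have "AE x in lebesgue. u x = 0" using u by eventually_elim simp
    then show False using n by (simp add: nonzero_fun_def)
  qed
next
  assume q: "0 < qform d g"
  obtain c where p: "profile d g c" using g by (rule profilesE)
  show "nonzero_fun u" unfolding nonzero_fun_def
  proof
    assume z: "AE x in lebesgue. u x = 0"
    have "sphere_area TYPE('a) * (LINT r|\<mu>. (g r)^2) = (LINT x|lebesgue. (u x)^2)"
      unfolding d by (rule integral_radial_compose[OF profiles_borel[OF g] u, symmetric]) simp
    also have "\<dots> = 0"
      by (rule integral_eq_zero_AE) (use z in \<open>auto elim!: eventually_mono\<close>)
    finally have "(LINT r|\<mu>. (g r)^2) = 0" using sphere_area_pos[where 'a='a] by simp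
    then have "AE r in \<mu>. (g r)^2 = 0" using integral_nonneg_eq_0_iff_AE[OF profileD(3)[OF p]] by simp
    then have "AE r in \<mu>. g r = 0" by simp
    from qform_eq_zero_AE[OF g this] show False using q by simp
  qed
qed

end

lemma radial_nodal:
  fixes u :: "'a::euclidean_space \<Rightarrow> real"
  assumes d: "d = DIM('a)" and g: "g \<in> profiles d" and u: "AE x in lebesgue. u x = g (norm x)"
  shows "u \<in> Nnodrad f \<longleftrightarrow> g \<in> nodal"
proof -
  note P = profiles_parts[OF g] and A = AE_radial_parts[OF g[unfolded d] u]
  obtain c where "profile d g c" using g by (rule profilesE)
  then have "u \<in> H1rad" using profile_H1rad(1)[of g c u] u d by simp
  then show ?thesis
    using g sphere_area_pos[where 'a='a] unfolding Nnodrad_def nodal_def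
    by (simp add: radial_nehari[OF d P(1) A(1)] radial_nehari[OF d P(2) A(2)] radial_nonzero[OF d P(1) A(1)] radial_nonzero[OF d P(2) A(2)])
qed

section \<open>The minimizer as a function on Euclidean space\<close>

context
  fixes g :: "real \<Rightarrow> real"
  assumes g: "g \<in> nodal" and min: "\<And>h. h \<in> nodal \<Longrightarrow> act g \<le> act h"
begin

lemma minimizer_bounded:
  obtains M where "0 < M" "\<And>r. 0 < r \<Longrightarrow> \<bar>g r\<bar> \<le> M"
proof -
  obtain c where p: "profile d g c" using nodalD(1)[OF g] by (rule profilesE)
  obtain l where l: "(g \<longlongrightarrow> l) (at_right 0)" using minimizer_limit_at_origin[OF g min] .
  have "\<forall>\<^sub>F r in at_right 0. dist (g r) l < 1" using tendstoD[OF l, of 1] by simp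
  then obtain b where b: "0 < b" "\<And>r. 0 < r \<Longrightarrow> r < b \<Longrightarrow> dist (g r) l < 1" unfolding eventually_at_right_field by blast
  have "compact (g ` {b..1})"
    by (intro compact_continuous_image continuous_on_subset[OF profile_continuous[OF p]]) (use b in auto)
  then obtain B where B: "\<And>r. r \<in> {b..1} \<Longrightarrow> \<bar>g r\<bar> \<le> B"
    using compact_imp_bounded bounded_real by (metis (no_types, lifting) imageI)
  define E where "E = sqrt (energy d g c * 4)"
  have E0: "0 \<le> energy d g c" by (intro add_nonneg_nonneg integral_nonneg) auto
  have far: "\<bar>g r\<bar> \<le> E" if "1 < r" for r
  proof -
    have "(g r)^2 \<le> energy d g c * majorant d \<kappa> r" using that by (intro profile_le_majorant[OF p d2 _ \<kappa>(1,2)]) simp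
    also have "\<dots> \<le> energy d g c * 4"
      using that by (intro mult_left_mono E0) (auto simp: majorant_def power_le_one divide_le_eq)
    finally have "sqrt ((g r)^2) \<le> E" unfolding E_def by (rule real_sqrt_le_mono)
    then show ?thesis by simp
  qed
  have "\<bar>g r\<bar> \<le> \<bar>l\<bar> + 1 + \<bar>B\<bar> + \<bar>E\<bar>" if "0 < r" for r
  proof -
    consider "r < b" | "r \<in> {b..1}" | "1 < r" by fastforce
    then show ?thesis using b(2)[OF that] B[of r] far[of r] by cases (auto simp: dist_real_def)
  qed
  moreover have "0 < \<bar>l\<bar> + 1 + \<bar>B\<bar> + \<bar>E\<bar>" by linarith
  ultimately show ?thesis using that by blast
qed

text \<open>The averaging identity pairs test functions only with square integrable functions of the
  norm. As g is bounded by M and f(s)/s increases, |f(g)| is at most (f M / M) |g|.\<close>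

lemma minimizer_f_square_integrable: "integrable \<mu> (\<lambda>r. (f (g r))^2)"
proof -
  obtain M where M: "0 < M" "\<And>r. 0 < r \<Longrightarrow> \<bar>g r\<bar> \<le> M" by (rule minimizer_bounded) blast
  note [measurable] = profiles_borel[OF nodalD(1)[OF g]] borel_measurable_continuous_onI[OF cont_f]
  obtain c where p: "profile d g c" using nodalD(1)[OF g] by (rule profilesE)
  have "integrable \<mu> (\<lambda>r. (f M / M)^2 * (g r)^2)" using profileD(3)[OF p] by simp
  then show ?thesis
  proof (rule integrable_bound)
    show "AE r in \<mu>. norm ((f (g r))^2) \<le> norm ((f M / M)^2 * (g r)^2)"
    proof (rule AE_radialI)
      fix r :: real assume r: "0 < r"
      have "\<bar>f (g r)\<bar> \<le> (f M / M) * \<bar>g r\<bar>"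
      proof (cases "g r = 0")
        case False
        have "f \<bar>g r\<bar> / \<bar>g r\<bar> \<le> f M / M"
          using ratio_less[of "\<bar>g r\<bar>" M] M(2)[OF r] False by (cases "\<bar>g r\<bar> = M") auto
        then show ?thesis using False by (simp add: f_abs pos_divide_le_eq)
      qed simp
      also have "\<dots> = \<bar>(f M / M) * g r\<bar>" using f_pos[OF M(1)] M(1) by (simp add: abs_mult)
      finally show "norm ((f (g r))^2) \<le> norm ((f M / M)^2 * (g r)^2)"
        unfolding abs_le_square_iff by (simp add: power_mult_distrib power_divide)
    qed
  qed simp
qed

text \<open>The gradient of w is radial, so each of the three terms pairs \<phi> or its radial
  derivative with a function of the norm. Replacing \<phi> by its average leaves the radial
  Euler-Lagrange equation.\<close>

lemma minimizer_weak_solution: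
  fixes w :: "'a::euclidean_space \<Rightarrow> real"
  assumes d: "d = DIM('a)" and w: "w = (\<lambda>x. g (norm x))"
  shows "weak_solution f w"
proof -
  obtain c where p: "profile d g c" using nodalD(1)[OF g] by (rule profilesE)
  have wg: "AE x in lebesgue. w x = g (norm x)" by (simp add: w)
  note W = profile_H1rad[OF p[unfolded d] wg]
  note [measurable] = profileD(1,2)[OF p] borel_measurable_continuous_onI[OF cont_f]
  have int: "integrable lborel (\<lambda>x::'a. (k (norm x))^2)" if [measurable]: "k \<in> borel_measurable borel" and "integrable \<mu> (\<lambda>r. (k r)^2)" for k :: "real \<Rightarrow> real"
    using integral_norm_radial(1)[where 'a='a and h = "\<lambda>r. (k r)^2"] that(2) d by simp
  have cm: "c \<in> borel_measurable borel" and gm: "g \<in> borel_measurable borel" and fm: "(\<lambda>r. f (g r)) \<in> borel_measurable borel" by measurable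
  note sq = int[OF cm profileD(4)[OF p]] int[OF gm profileD(3)[OF p]] int[OF fm minimizer_f_square_integrable]
  have "(LINT x|lebesgue. wgrad w x \<bullet> D x + w x * \<phi> x - f (w x) * \<phi> x) = 0"
    if t: "test_fun \<phi>" and D: "\<And>x. has_gradient \<phi> (D x) x" for \<phi> D
  proof -
    note [measurable] = test_measurable[OF t D SOME_Basis]
    obtain q e where q: "profile DIM('a) q e" and
      avg: "\<And>k. k \<in> borel_measurable borel \<Longrightarrow> integrable lborel (\<lambda>x::'a. (k (norm x))^2) \<Longrightarrow>
        (LINT x|lborel. \<phi> x * k (norm x)) = (LINT x|lborel. q (norm (x::'a)) * k (norm x))"
      "\<And>k. k \<in> borel_measurable borel \<Longrightarrow> integrable lborel (\<lambda>x::'a. (k (norm x))^2) \<Longrightarrow>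
        (LINT x|lborel. (D x \<bullet> x / norm x) * k (norm x)) = (LINT x|lborel. e (norm (x::'a)) * k (norm x))"
      by (rule test_fun_averages[OF t D]) auto
    note [measurable] = profileD(1,2)[OF q]
    have rad: "(LINT x|lborel. j (norm (x::'a)) * k (norm x)) = sphere_area TYPE('a) * (LINT r|\<mu>. k r * j r)"
      if [measurable]: "k \<in> borel_measurable borel" "j \<in> borel_measurable borel" for j k
      using integral_norm_radial(2)[where 'a='a and h = "\<lambda>r. j r * k r"] d by (simp add: mult.commute)
    have \<phi>2: "integrable lborel (\<lambda>x. (\<phi> x)^2)" by (rule test_component_integrable(2)[OF t D SOME_Basis])
    have i: "integrable lborel (\<lambda>x. (D x \<bullet> x / norm x) * c (norm x))" "integrable lborel (\<lambda>x. \<phi> x * g (norm x))"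
      "integrable lborel (\<lambda>x. \<phi> x * f (g (norm x)))"
      by (rule integrable_mult_squares; (use sq \<phi>2 test_fun_radial_derivative(2)[OF t D] in simp)?; measurable)+
    have "(LINT x|lebesgue. wgrad w x \<bullet> D x + w x * \<phi> x - f (w x) * \<phi> x) =
        (LINT x|lborel. (D x \<bullet> x / norm x) * c (norm x) + \<phi> x * g (norm x) - \<phi> x * f (g (norm x)))"
    proof (rule integral_lebesgue_borel(2))
      show "AE x in lebesgue. wgrad w x \<bullet> D x + w x * \<phi> x - f (w x) * \<phi> x = (D x \<bullet> x / norm x) * c (norm x) + \<phi> x * g (norm x) - \<phi> x * f (g (norm x))"
        using W(2) by eventually_elim (simp add: w radial_gradient_def inner_commute divide_inverse mult_ac)
    qed measurable
    also have "\<dots> = (LINT x|lborel. (D x \<bullet> x / norm x) * c (norm x)) + (LINT x|lborel. \<phi> x * g (norm x)) - (LINT x|lborel. \<phi> x * f (g (norm x)))"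
      using i by simp
    also have "\<dots> = sphere_area TYPE('a) * ((LINT r|\<mu>. c r * e r) + (LINT r|\<mu>. g r * q r) - (LINT r|\<mu>. f (g r) * q r))"
      unfolding avg(2)[OF cm sq(1)] avg(1)[OF gm sq(2)] avg(1)[OF fm sq(3)]
        rad[OF cm profileD(2)[OF q]] rad[OF gm profileD(1)[OF q]] rad[OF fm profileD(1)[OF q]]
      by (simp add: right_diff_distrib distrib_left)
    also have "\<dots> = 0" using Euler_Lagrange_radial[OF g min p q[folded d]] by simp
    finally show ?thesis .
  qed
  then show ?thesis using W(1) unfolding weak_solution_def H1rad_def by blast
qed

lemma minimizer_nodal_domains:
  assumes d: "d = DIM('a::euclidean_space)"
  obtains w' :: "'a::euclidean_space \<Rightarrow> real" where "continuous_on UNIV w'" "AE x in lebesgue. w' x = g (norm x)"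
    "\<exists>x. 0 < w' x" "\<exists>x. w' x < 0" "card (nodal_domains w') = 2"
proof -
  note G = nodalD[OF g]
  obtain c where p: "profile d g c" using G(1) by (rule profilesE)
  obtain l where l: "(g \<longlongrightarrow> l) (at_right 0)" using minimizer_limit_at_origin[OF g min] .
  \<comment> \<open>Extension by the limit at the origin gives a continuous function on the whole
    line, hence a continuous representative to which nodal domains refer.\<close>
  define H where "H r = (if r \<le> 0 then l else g r)" for r
  have "isCont H r" for r
  proof -
    consider "r < 0" | "r = 0" | "0 < r" by linarith
    then show ?thesis
    proof cases
      case 1
      then have "\<forall>\<^sub>F y in nhds r. H y = l" using eventually_nhds_in_open[of "{..<0}" r] by (auto simp: H_def elim!: eventually_mono)
      then show ?thesis by (subst isCont_cong) auto
    next
      case 2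
      have "(H \<longlongrightarrow> l) (at_left 0)" by (rule tendsto_eventually) (auto simp: H_def eventually_at_filter)
      moreover have "(H \<longlongrightarrow> l) (at_right 0)"
        by (rule Lim_transform_eventually[OF l]) (auto simp: H_def eventually_at_filter)
      ultimately show ?thesis using 2 unfolding isCont_def by (simp add: filterlim_split_at H_def)
    next
      case 3
      then have "\<forall>\<^sub>F y in nhds r. H y = g y" using eventually_nhds_in_open[of "{0<..}" r] by (auto simp: H_def elim!: eventually_mono)
      then show ?thesis using 3 profile_continuous[OF p] by (subst isCont_cong) (auto simp: continuous_on_eq_continuous_at)
    qed
  qed
  then have Hc: "continuous_on UNIV H" by (simp add: continuous_at_imp_continuous_on)
  define w' where "w' x = H (norm x)" for x :: 'a
  have pos: "\<exists>r>0. 0 < g r"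
  proof (rule ccontr)
    assume "\<not> ?thesis"
    then have "AE r in \<mu>. pospart g r = 0" by (intro AE_radialI) (force simp: pospart_def max_def)
    from qform_eq_zero_AE[OF profiles_parts(1)[OF G(1)] this] show False using G(4) by simp
  qed
  have neg: "\<exists>r>0. g r < 0"
  proof (rule ccontr)
    assume "\<not> ?thesis"
    then have "AE r in \<mu>. negpart g r = 0" by (intro AE_radialI) (force simp: negpart_def max_def)
    from qform_eq_zero_AE[OF profiles_parts(2)[OF G(1)] this] show False using G(5) by simp
  qed
  obtain b :: 'a where b: "b \<in> Basis" using nonempty_Basis by blast
  have wb: "w' (r *\<^sub>R b) = g r" if "0 < r" for r using that b by (simp add: w'_def H_def)
  have ex: "\<exists>x. 0 < w' x" "\<exists>x. w' x < 0" using pos neg wb by metis+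
  have dim: "2 \<le> DIM('a)" using d2 d by simp
  have cP: "connected {x. 0 < w' x}"
    unfolding w'_def by (rule radial_superlevel_connected[OF dim Hc])
      (use positive_set_connected[OF g min] in \<open>auto simp: H_def split: if_splits\<close>)
  have "connected {x::'a. 0 < - H (norm x)}"
    by (rule radial_superlevel_connected[OF dim, where H = "\<lambda>r. - H r"])
      (use Hc negative_set_connected[OF g min] in \<open>auto intro: continuous_intros simp: H_def split: if_splits\<close>)
  then have cN: "connected {x. w' x < 0}" by (simp add: w'_def)
  have wc: "continuous_on UNIV w'" unfolding w'_def by (intro continuous_on_compose2[OF Hc] continuous_intros) auto
  \<comment> \<open>The positive and the negative set are open, connected, nonempty, disjoint and
    exhaust the set where w' does not vanish, which characterizes its components.\<close>
  have "components {x. w' x \<noteq> 0} = {{x. 0 < w' x}, {x. w' x < 0}}"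
  proof (rule components_open_unique)
    show "pairwise disjnt {{x. 0 < w' x}, {x. w' x < 0}}" by (auto simp: pairwise_def disjnt_def)
    fix X assume "X \<in> {{x. 0 < w' x}, {x. w' x < 0}}"
    then show "open X \<and> connected X \<and> X \<noteq> {}"
      using cP cN ex open_Collect_less[OF continuous_on_const wc] open_Collect_less[OF wc continuous_on_const] by auto
  qed auto
  moreover have "{x. 0 < w' x} \<noteq> {x. w' x < 0}" using ex by fastforce
  ultimately have card: "card (nodal_domains w') = 2" unfolding nodal_domains_def by simp
  have "AE x in lborel. w' x = g (norm x)"
    using AE_norm_neq[where 'a='a, of 0] by eventually_elim (simp add: w'_def H_def)
  then show ?thesis using that[OF wc AE_completion ex card] by blast
qed

end

end

text \<open>For d \<ge> 3 the value d - 2 works, and the last condition is then exactly p < 2d/(d-2)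
  - 1. In the plane any small positive exponent does, and 1/(p + 1) makes the product equal to
  1/2.\<close>

lemma subcritical_exponent:
  assumes d: "2 \<le> d" and p: "1 < p" "3 \<le> d \<longrightarrow> p < 2 * real d / (real d - 2) - 1"
  obtains \<kappa> where "0 < \<kappa>" "real d - 2 \<le> \<kappa>" "(p + 1) / 2 * \<kappa> < d"
proof (cases "d = 2")
  case True
  have e: "(p + 1) / 2 * (1 / (p + 1)) = 1 / 2" using p by (simp add: field_simps)
  show ?thesis
  proof (rule that[of "1 / (p + 1)"])
    show "(p + 1) / 2 * (1 / (p + 1)) < real d" unfolding e using True by simp
  qed (use True p in auto)
next
  case False
  then have d3: "3 \<le> d" "0 < real d - 2" using d by auto
  then have "(p + 1) * (real d - 2) < 2 * real d" using p(2) by (simp add: less_diff_eq pos_less_divide_eq)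
  then show ?thesis using d3 by (intro that[of "real d - 2"]) auto
qed

theorem theorem2p6:
  fixes f :: "real \<Rightarrow> real"
    and u :: "nat \<Rightarrow> 'a::euclidean_space \<Rightarrow> real"
  assumes dim: "DIM('a) \<ge> 2"
    and H1: "continuous_on UNIV f" "\<And>s. f (- s) = - f s"
    and H2: "\<exists>p::real. 1 < p \<and>
               (DIM('a) \<ge> 3 \<longrightarrow> p < 2 * real DIM('a) / (real DIM('a) - 2) - 1) \<and>
               (\<exists>C R. \<forall>s. \<bar>s\<bar> \<ge> R \<longrightarrow> \<bar>f s\<bar> \<le> C * \<bar>s\<bar> powr p)"
    and H3: "((\<lambda>s. f s / s) \<longlongrightarrow> 0) (at 0)"
    and H4: "\<exists>\<xi>0>0. Fprim f \<xi>0 > \<xi>0\<^sup>2 / 2"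
    and H5: "strict_mono_on {0<..} (\<lambda>s. f s / s)"
    and H6: "\<exists>\<theta>>2. \<forall>s>0. \<theta> * Fprim f s < s * f s"
    and seq: "\<And>n. u n \<in> Nnodrad f"
    and lim: "(\<lambda>n. actS f (u n)) \<longlonglongrightarrow> mNnodrad f TYPE('a)"
  shows "\<exists>w \<in> Nnodrad f.
           (\<exists>r. strict_mono r \<and> (\<lambda>n. H1_norm (\<lambda>x. u (r n) x - w x)) \<longlonglongrightarrow> 0) \<and>
           weak_solution f w \<and> nonzero_fun w \<and>
           (\<exists>w'. continuous_on UNIV w' \<and> (AE x in lebesgue. w' x = w x) \<and>
                 (\<exists>x. w' x > 0) \<and> (\<exists>y. w' y < 0) \<and>
                 card (nodal_domains w') = 2)"
proof -
  obtain p C R where p: "1 < p" "DIM('a) \<ge> 3 \<longrightarrow> p < 2 * real DIM('a) / (real DIM('a) - 2) - 1"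
    and growth: "\<And>s. R \<le> \<bar>s\<bar> \<Longrightarrow> \<bar>f s\<bar> \<le> C * \<bar>s\<bar> powr p" using H2 by blast
  obtain \<theta> where \<theta>: "2 < \<theta>" "\<And>s. 0 < s \<Longrightarrow> \<theta> * Fprim f s < s * f s" using H6 by blast
  obtain \<kappa> where \<kappa>: "0 < \<kappa>" "real DIM('a) - 2 \<le> \<kappa>" "(p + 1) / 2 * \<kappa> < DIM('a)" by (rule subcritical_exponent[OF dim p])
  interpret nonlinearity "DIM('a)" f p C R \<theta> \<kappa>
    by (rule nonlinearity.intro) (use dim H1 p(1) growth H3 H5 \<theta> \<kappa> in auto)
  let ?\<omega> = "sphere_area TYPE('a)"
  note \<omega> = sphere_area_pos[where 'a='a]
  have rad: "\<exists>g. g \<in> profiles DIM('a) \<and> (AE x in lebesgue. v x = g (norm x))" if "v \<in> Nnodrad f" for v :: "'a \<Rightarrow> real"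
  proof -
    have "v \<in> H1rad" using that by (simp add: Nnodrad_def)
    then obtain g c where "profile DIM('a) g c" "AE x in lebesgue. v x = g (norm x)" by (rule H1rad_profile)
    then show ?thesis using profilesI by blast
  qed
  have "\<forall>n. \<exists>g. g \<in> profiles DIM('a) \<and> (AE x in lebesgue. u n x = g (norm x))" using rad[OF seq] by blast
  from choice[OF this] obtain g where g: "\<And>n. g n \<in> profiles DIM('a)" "\<And>n. AE x in lebesgue. u n x = g n (norm x)" by blast
  have nod: "g n \<in> nodal" for n using radial_nodal[OF refl g(1) g(2), of n] seq[of n] by simp
  \<comment> \<open>Needed for \<open>Inf\<close> to be a genuine lower bound; coercivity on the
    Nehari set supplies the bound 0.\<close>
  have "bdd_below (actS f ` (Nnodrad f :: ('a \<Rightarrow> real) set))"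
  proof (rule bdd_belowI2[of _ 0])
    fix v :: "'a \<Rightarrow> real" assume v: "v \<in> Nnodrad f"
    obtain k where k: "k \<in> profiles DIM('a)" "AE x in lebesgue. v x = k (norm x)" using rad[OF v] by blast
    then have "k \<in> nodal" using radial_nodal[OF refl k] v by simp
    then have "nehari k = 0" using nodalD(2,3)[of k] nehari_parts[OF k(1)] by simp
    note act_coercive[OF k(1) this]
    moreover have "0 \<le> (1/2 - 1/\<theta>) * qform DIM('a) k"
      using \<theta>(1) by (intro mult_nonneg_nonneg qform_nonneg) (simp add: field_simps)
    ultimately have "0 \<le> act k" by linarith
    then show "0 \<le> actS f v" using radial_act[OF refl k] \<omega> by simp
  qed
  then have mN: "mNnodrad f TYPE('a) \<le> actS f v" if "v \<in> Nnodrad f" for v :: "'a \<Rightarrow> real"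
    unfolding mNnodrad_def using that by (intro cInf_lower) auto
  \<comment> \<open>Functionals on Euclidean space and on profiles differ by the area of the sphere,
    so the infimum is rescaled accordingly.\<close>
  have "(\<lambda>n. actS f (u n) / ?\<omega>) \<longlonglongrightarrow> mNnodrad f TYPE('a) / ?\<omega>" using \<omega> by (intro tendsto_intros lim) simp
  moreover have "actS f (u n) / ?\<omega> = act (g n)" for n using radial_act[OF refl g] \<omega> by simp
  ultimately have lim': "(\<lambda>n. act (g n)) \<longlonglongrightarrow> mNnodrad f TYPE('a) / ?\<omega>" by simp
  have low: "mNnodrad f TYPE('a) / ?\<omega> \<le> act h" if "h \<in> nodal" for h
  proof -
    have 1: "h \<in> profiles DIM('a)" and 2: "AE x::'a in lebesgue. h (norm x) = h (norm x)" using nodalD(1)[OF that] by auto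
    have "(\<lambda>x::'a. h (norm x)) \<in> Nnodrad f" using radial_nodal[OF refl 1 2] that by simp
    from mN[OF this] show ?thesis unfolding radial_act[OF refl 1 2] using \<omega> by (simp add: pos_divide_le_eq mult.commute)
  qed
  obtain \<rho> h where \<rho>: "strict_mono \<rho>" and h: "h \<in> nodal" "act h = mNnodrad f TYPE('a) / ?\<omega>"
    and conv: "(\<lambda>n. qform DIM('a) (\<lambda>r. g (\<rho> n) r - h r)) \<longlonglongrightarrow> 0"
    by (rule nodal_minimizing_sequence[OF nod lim' low]) auto
  have min: "act h \<le> act k" if "k \<in> nodal" for k using low[OF that] h(2) by simp
  define w where "w x = h (norm x)" for x :: 'a
  have hp: "h \<in> profiles DIM('a)" by (rule nodalD(1)[OF h(1)])
  have wh: "AE x in lebesgue. w x = h (norm x)" by (simp add: w_def)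
  have wN: "w \<in> Nnodrad f" using radial_nodal[OF refl hp wh] h(1) by simp
  have "H1_norm (\<lambda>x. u (\<rho> n) x - w x) = sqrt (?\<omega> * qform DIM('a) (\<lambda>r. g (\<rho> n) r - h r))" for n
  proof (rule radial_H1_norm)
    show "(\<lambda>r. g (\<rho> n) r - h r) \<in> profiles DIM('a)" using profiles_lincomb[OF g(1)[of "\<rho> n"] hp, of 1 "-1"] by simp
    show "AE x in lebesgue. u (\<rho> n) x - w x = g (\<rho> n) (norm x) - h (norm x)" using g(2)[of "\<rho> n"] by eventually_elim (simp add: w_def)
  qed
  moreover have "(\<lambda>n. sqrt (?\<omega> * qform DIM('a) (\<lambda>r. g (\<rho> n) r - h r))) \<longlonglongrightarrow> sqrt (?\<omega> * 0)"
    by (intro tendsto_intros conv)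
  ultimately have norm0: "(\<lambda>n. H1_norm (\<lambda>x. u (\<rho> n) x - w x)) \<longlonglongrightarrow> 0" by simp
  have "0 < qform DIM('a) h" using qform_parts[OF hp] nodalD(4,5)[OF h(1)] by simp
  then have nz: "nonzero_fun w" using radial_nonzero[OF refl hp wh] by simp
  have ws: "weak_solution f w" by (rule minimizer_weak_solution[OF h(1) min refl]) (auto simp: w_def)
  obtain w' :: "'a \<Rightarrow> real" where w': "continuous_on UNIV w'" "AE x in lebesgue. w' x = h (norm x)"
    "\<exists>x. 0 < w' x" "\<exists>x. w' x < 0" "card (nodal_domains w') = 2"
    by (rule minimizer_nodal_domains[OF h(1) min refl])
  have ae: "AE x in lebesgue. w' x = w x" using w'(2) by (simp add: w_def)
  show ?thesis
    by (intro bexI[OF _ wN] conjI exI[of _ \<rho>] exI[of _ w'] \<rho> norm0 ws nz ae w')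
qed

end
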